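(* Let $N\in\mathbb N$, $\phi\in L^2_0(\mathbb T^N)$, and $\vec\beta=(\beta_1,\dots,\beta_N)$ with $\beta_j\in\{0,1\}$. Then: (1) $\Pi^{(0,\dots,0)}_\phi=\Pi_\phi:\mathrm{BMO}^d(\mathbb T^N)\to\mathrm{BMO}^d(\mathbb T^N)$ is bounded if and only if $\phi\in\mathrm{LMO}^d(\mathbb T^N)$. Moreover, $\|\Pi_\phi\|_{\mathrm{BMO}^d\to\mathrm{BMO}^d}\approx\|\phi\|_{\mathrm{LMO}^d}$. (2) $\Pi^{(1,\dots,1)}_\phi=\Delta_\phi:\mathrm{BMO}^d(\mathbb T^N)\to\mathrm{BMO}^d(\mathbb T^N)$ is bounded if and only if $\phi\in\mathrm{BMO}^d(\mathbb T^N)$. Moreover, $\|\Delta_\phi\|_{\mathrm{BMO}^d\to\mathrm{BMO}^d}\approx\|\phi\|_{\mathrm{BMO}^d}$. (3) For $\vec\beta\ne(0,\dots,0),(1,\dots,1)$, $\Pi^{\vec\beta}_\phi:\mathrm{BMO}^d(\mathbb T^N)\to\mathrm{BMO}^d(\mathbb T^N)$ is bounded if $\phi\in\mathrm{LMO}^d_{\vec\beta}(\mathbb T^N)$. Moreover, $\|\Pi^{\vec\beta}_\phi\|_{\mathrm{BMO}^d(\mathbb T^N)\to\mathrm{BMO}^d(\mathbb T^N)}\lesssim\|\phi\|_{\mathrm{LMO}^d_{\vec\beta}}$.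
   Context: $\mathbb T$ is the unit circle identified with $[0,1)$; $\mathcal D$ is the set of all dyadic subintervals of $[0,1)$ (including $[0,1)$), and $\mathcal R=\{R=R_1\times\cdots\times R_N: R_j\in\mathcal D\}$. For $I\in\mathcal D$ put $h^0_I=h_I=|I|^{-1/2}(\chi_{I^+}-\chi_{I^-})$ ($I^+,I^-$ the right and left halves) and $h^1_I=|I|^{-1/2}|h_I|=\chi_I/|I|$. For $\vec\varepsilon\in\{0,1\}^N$ and $R=R_1\times\cdots\times R_N$, $h_R^{\vec\varepsilon}=h_{R_1}^{\varepsilon_1}\otimes\cdots\otimes h_{R_N}^{\varepsilon_N}$ and $h_R=h_R^{(0,\dots,0)}$, $f_R=\langle f,h_R\rangle$. $L^2_0(\mathbb T^N)$ is the closed span of $(h_R)_{R\in\mathcal R}$ in $L^2(\mathbb T^N)$ (functions with zero integral in each variable separately). $\mathrm{BMO}^d(\mathbb T^N)$ consists of the functions with $\|b\|^2_{\mathrm{BMO}^d}=\sup_{\Omega\subset\mathbb T^N\text{ open}}\frac1{|\Omega|}\sum_{R\in\mathcal R,R\subset\Omega}|b_R|^2<\infty$, where only the Haar coefficients $b_R$, $R\in\mathcal R$, matter (values of operators are taken modulo functions with vanishing Haar coefficients). For $\vec\delta\in\{0,1\}^N$, a function $\phi\in L^2(\mathbb T^N)$ is in $\mathrm{LMO}^d_{\vec\delta}(\mathbb T^N)$ if there is $C>0$ such that for each dyadic rectangle $R=R_1\times\cdots\times R_N\in\mathcal R$ and each nonempty open $\Omega\subseteq R$, $$\frac{\big(\log\frac4{|R_{\delta_1}|}\big)^2\cdots\big(\log\frac4{|R_{\delta_N}|}\big)^2}{|\Omega|}\sum_{Q\in\mathcal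 R,\,Q\subseteq\Omega}|\phi_Q|^2\le C,$$ where $R_{\delta_j}=R_j$ if $\delta_j=0$ and $R_{\delta_j}=\mathbb T$ (of measure $1$) if $\delta_j=1$; $\|\phi\|_{\mathrm{LMO}^d_{\vec\delta}}$ is the square root of the infimum of such $C$. $\mathrm{LMO}^d(\mathbb T^N)=\mathrm{LMO}^d_{(0,\dots,0)}(\mathbb T^N)$. Inclusions between open sets and dyadic rectangles are understood up to null sets. For $\vec\beta\in\{0,1\}^N$ let $\delta_j=1-\beta_j$. The paraproduct is $\Pi^{\vec\beta}_\phi f=\sum_{R\in\mathcal R}\phi_R\langle f,h_R^{\vec\delta}\rangle h_R^{\vec\beta}$; $\Pi_\phi=\Pi_\phi^{(0,\dots,0)}$, $\Delta_\phi=\Pi^{(1,\dots,1)}_\phi$. $A\lesssim B$ means $A\le CB$ with $C$ depending only on $N$; $A\approx B$ means $A\lesssim B\lesssim A$.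
   Formalization: In (1) and (2) the "only if" and the lower norm bounds are for φ with φ_R=0 whenever R has a full side R_j=[0,1); otherwise they fail: N=1, φ=h_[0,1) gives Π_φ=Δ_φ=0 modulo functions with vanishing Haar coefficients. BMO^d elements are represented in L²_0. *)

theory Defs
  imports "HOL-Analysis.Analysis"
begin

text \<open>
  Throughout, \<open>N = CARD('n)\<close>, functions are complex valued, and the torus is the cube
  \<open>[0,1)\<close> to the power \<open>N\<close> inside \<open>real ^ 'n\<close>.
\<close>

definition torus_set :: "(real ^ 'n::finite) set" where
  "torus_set = {x. \<forall>j. 0 \<le> x $ j \<and> x $ j < 1}"

abbreviation torus :: "(real ^ 'n::finite) measure" where
  "torus \<equiv> lebesgue_on torus_set"

text \<open>Openness in the (quotient) topology of the torus: the periodic extension is open.\<close>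

definition torus_open :: "(real ^ 'n::finite) set \<Rightarrow> bool" where
  "torus_open \<Omega> \<longleftrightarrow> \<Omega> \<subseteq> torus_set \<and> open {x. (\<chi> j. frac (x $ j)) \<in> \<Omega>}"

definition dyadic_intervals :: "real set set" where
  "dyadic_intervals = {{real k / 2 ^ n ..< (real k + 1) / 2 ^ n} | k n :: nat. k < 2 ^ n}"

text \<open>
  A dyadic rectangle is given by the family of its sides; \<open>rect R\<close> is the corresponding
  subset of the torus.
\<close>

definition dyadic_rects :: "('n::finite \<Rightarrow> real set) set" where
  "dyadic_rects = {R. \<forall>j. R j \<in> dyadic_intervals}"

definition rect :: "('n::finite \<Rightarrow> real set) \<Rightarrow> (real ^ 'n) set" where
  "rect R = {x. \<forall>j. x $ j \<in> R j}"

definition right_half :: "real set \<Rightarrow> real set" where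
  "right_half I = {x \<in> I. (Inf I + Sup I) / 2 \<le> x}"

definition left_half :: "real set \<Rightarrow> real set" where
  "left_half I = {x \<in> I. x < (Inf I + Sup I) / 2}"

definition haar :: "nat \<Rightarrow> real set \<Rightarrow> real \<Rightarrow> real" where
  "haar e I x =
     (if e = 0 then (indicator (right_half I) x - indicator (left_half I) x) / sqrt (measure lborel I)
      else indicator I x / measure lborel I)"

definition haar_rect :: "('n::finite \<Rightarrow> nat) \<Rightarrow> ('n \<Rightarrow> real set) \<Rightarrow> real ^ 'n \<Rightarrow> complex" where
  "haar_rect e R x = (\<Prod>j\<in>UNIV. complex_of_real (haar (e j) (R j) (x $ j)))"

definition inner_torus :: "(real ^ 'n::finite \<Rightarrow> complex) \<Rightarrow> (real ^ 'n \<Rightarrow> complex) \<Rightarrow> complex" where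
  "inner_torus f g = (LINT x|torus. f x * cnj (g x))"

definition haar_coeff :: "(real ^ 'n::finite \<Rightarrow> complex) \<Rightarrow> ('n \<Rightarrow> real set) \<Rightarrow> complex" where
  "haar_coeff f R = inner_torus f (haar_rect (\<lambda>_. 0) R)"

definition L2 :: "(real ^ 'n::finite \<Rightarrow> complex) set" where
  "L2 = {f. f \<in> borel_measurable torus \<and> integrable torus (\<lambda>x. (cmod (f x))\<^sup>2)}"

definition L2_norm_torus :: "(real ^ 'n::finite \<Rightarrow> complex) \<Rightarrow> real" where
  "L2_norm_torus f = sqrt (LINT x|torus. (cmod (f x))\<^sup>2)"

definition L2_0 :: "(real ^ 'n::finite \<Rightarrow> complex) set" where
  "L2_0 = {f \<in> L2. \<forall>\<epsilon>>0. \<exists>F c. finite F \<and> F \<subseteq> dyadic_rects \<and>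
             L2_norm_torus (\<lambda>x. f x - (\<Sum>R\<in>F. c R * haar_rect (\<lambda>_. 0) R x)) < \<epsilon>}"

text \<open>Inclusion up to null sets.\<close>

definition ae_subset :: "(real ^ 'n::finite) set \<Rightarrow> (real ^ 'n) set \<Rightarrow> bool" where
  "ae_subset A B \<longleftrightarrow> A - B \<in> null_sets lebesgue"

text \<open>The sum of \<open>\<bar>b\<^sub>R\<bar>\<^sup>2\<close> over the dyadic rectangles \<open>R \<subseteq> \<Omega>\<close>, divided by the measure of \<open>\<Omega>\<close>.\<close>

definition carleson_avg :: "(real ^ 'n::finite \<Rightarrow> complex) \<Rightarrow> (real ^ 'n) set \<Rightarrow> ennreal" where
  "carleson_avg b \<Omega> =
     (\<Sum>\<^sub>\<infinity>R\<in>{R \<in> dyadic_rects. ae_subset (rect R) \<Omega>}. ennreal ((cmod (haar_coeff b R))\<^sup>2))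
       / emeasure lebesgue \<Omega>"

definition bmo_norm_sq :: "(real ^ 'n::finite \<Rightarrow> complex) \<Rightarrow> ennreal" where
  "bmo_norm_sq b = (SUP \<Omega>\<in>{\<Omega>. torus_open \<Omega> \<and> \<Omega> \<noteq> {}}. carleson_avg b \<Omega>)"

text \<open>
  Only the Haar coefficients of an element of BMO matter, so each element is represented by the
  (almost everywhere unique) function in \<open>L2_0\<close> with these coefficients.
\<close>

definition BMO :: "(real ^ 'n::finite \<Rightarrow> complex) set" where
  "BMO = {b \<in> L2_0. bmo_norm_sq b < \<infinity>}"

definition bmo_norm :: "(real ^ 'n::finite \<Rightarrow> complex) \<Rightarrow> real" where
  "bmo_norm b = sqrt (enn2real (bmo_norm_sq b))"

text \<open>\<open>log_weight \<delta> R\<close> is the product of the squares of \<open>log (4 / \<bar>R\<^sub>\<delta>\<^sub>j\<bar>)\<close>; \<open>R\<^sub>\<delta>\<^sub>j\<close> is \<open>R j\<close> or \<open>[0,1)\<close>.\<close>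

definition log_weight :: "('n::finite \<Rightarrow> nat) \<Rightarrow> ('n \<Rightarrow> real set) \<Rightarrow> real" where
  "log_weight \<delta> R =
     (\<Prod>j\<in>UNIV. (ln (4 / measure lborel (if \<delta> j = 0 then R j else {0..<1})))\<^sup>2)"

definition lmo_bound :: "('n::finite \<Rightarrow> nat) \<Rightarrow> (real ^ 'n \<Rightarrow> complex) \<Rightarrow> real \<Rightarrow> bool" where
  "lmo_bound \<delta> \<phi> C \<longleftrightarrow>
     (\<forall>R\<in>dyadic_rects. \<forall>\<Omega>. torus_open \<Omega> \<and> \<Omega> \<noteq> {} \<and> ae_subset \<Omega> (rect R) \<longrightarrow>
        ennreal (log_weight \<delta> R) * carleson_avg \<phi> \<Omega> \<le> ennreal C)"

definition LMO :: "('n::finite \<Rightarrow> nat) \<Rightarrow> (real ^ 'n \<Rightarrow> complex) set" where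
  "LMO \<delta> = {\<phi> \<in> L2. \<exists>C>0. lmo_bound \<delta> \<phi> C}"

definition lmo_norm :: "('n::finite \<Rightarrow> nat) \<Rightarrow> (real ^ 'n \<Rightarrow> complex) \<Rightarrow> real" where
  "lmo_norm \<delta> \<phi> = sqrt (Inf {C. C > 0 \<and> lmo_bound \<delta> \<phi> C})"

text \<open>
  \<open>paraproduct \<beta> \<phi> f g\<close>: \<open>g\<close> is the value of the paraproduct with parameter \<open>\<beta>\<close> and symbol \<open>\<phi>\<close>
  at \<open>f\<close>. Values are taken modulo functions with vanishing Haar coefficients, so the series
  defining the paraproduct is summed after pairing with each Haar function. For \<open>\<phi>\<close> and \<open>f\<close> in
  \<open>L2_0\<close> these scalar series converge absolutely (Cauchy-Schwarz), and they determine
  \<open>g \<in> L2_0\<close> almost everywhere.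
\<close>

definition paraproduct ::
  "('n::finite \<Rightarrow> nat) \<Rightarrow> (real ^ 'n \<Rightarrow> complex) \<Rightarrow> (real ^ 'n \<Rightarrow> complex) \<Rightarrow> (real ^ 'n \<Rightarrow> complex) \<Rightarrow> bool"
  where
  "paraproduct \<beta> \<phi> f g \<longleftrightarrow> g \<in> L2_0 \<and>
     (\<forall>Q\<in>dyadic_rects.
        ((\<lambda>R. haar_coeff \<phi> R * inner_torus f (haar_rect (\<lambda>j. 1 - \<beta> j) R)
                * inner_torus (haar_rect \<beta> R) (haar_rect (\<lambda>_. 0) Q))
           has_sum haar_coeff g Q) dyadic_rects)"

definition paraproduct_bound :: "('n::finite \<Rightarrow> nat) \<Rightarrow> (real ^ 'n \<Rightarrow> complex) \<Rightarrow> real \<Rightarrow> bool" where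
  "paraproduct_bound \<beta> \<phi> K \<longleftrightarrow>
     (\<forall>f\<in>BMO. \<exists>g\<in>BMO. paraproduct \<beta> \<phi> f g \<and> bmo_norm g \<le> K * bmo_norm f)"

definition paraproduct_bounded :: "('n::finite \<Rightarrow> nat) \<Rightarrow> (real ^ 'n \<Rightarrow> complex) \<Rightarrow> bool" where
  "paraproduct_bounded \<beta> \<phi> \<longleftrightarrow> (\<exists>K\<ge>0. paraproduct_bound \<beta> \<phi> K)"

definition paraproduct_norm :: "('n::finite \<Rightarrow> nat) \<Rightarrow> (real ^ 'n \<Rightarrow> complex) \<Rightarrow> real" where
  "paraproduct_norm \<beta> \<phi> = Inf {K. K \<ge> 0 \<and> paraproduct_bound \<beta> \<phi> K}"

text \<open>
  \<open>\<phi>\<close> has no Haar coefficient at a rectangle having the whole circle as a side. Such coefficients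
  are invisible to the paraproducts with \<open>\<beta> = 0\<close> and \<open>\<beta> = 1\<close>: for \<open>\<beta> = 0\<close> the coefficient
  at \<open>R\<close> is multiplied by the mean of \<open>f\<close> over \<open>R\<close>, and for \<open>\<beta> = 1\<close> by the indicator of \<open>R\<close>; if
  \<open>R\<close> has a full side, the former vanishes for \<open>f \<in> L2_0\<close> and the latter has vanishing Haar
  coefficients. Hence boundedness of these paraproducts implies a condition on \<open>\<phi>\<close> only up to
  such coefficients. For instance, if \<open>N = 1\<close> and \<open>\<phi>\<close> is the Haar function of \<open>[0,1)\<close>, both
  operators vanish.
\<close>

definition no_full_side :: "(real ^ 'n::finite \<Rightarrow> complex) \<Rightarrow> bool" where
  "no_full_side \<phi> \<longleftrightarrow> (\<forall>R\<in>dyadic_rects. (\<exists>j. R j = {0..<1}) \<longrightarrow> haar_coeff \<phi> R = 0)"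

end

theory Submission
  imports Defs "HOL-Library.Discrete_Functions"
begin

text \<open>
  The proof is carried out on finite grids. At resolution \<open>2\<^sup>-\<^sup>L\<close> the torus becomes the set of integer points of a
  cube, dyadic rectangles become cells, and the Haar system up to scale \<open>L\<close> becomes an orthogonal system there.
  All estimates have constants independent of \<open>L\<close>, and only finitely many Haar coefficients enter at a time.

  \<^bold>\<open>Upper bounds.\<close> Let \<open>Z\<close> be the set of coordinates \<open>j\<close> with \<open>\<beta>\<^sub>j = 0\<close>. All choices of \<open>\<beta>\<close> are handled at once by
  bounding, for every \<open>W\<close> and every \<open>\<alpha>\<close> supported on rectangles inside \<open>W\<close>, the absolute sum over \<open>R\<close> of
  \<open>\<phi>\<^sub>R\<close> times the \<open>(1-\<beta>)\<close>-coefficient of \<open>f\<close> times the \<open>\<beta>\<close>-coefficient of \<open>\<Sum> \<alpha>\<^sub>Q h\<^sub>Q\<close> by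
  \<open>B * \<parallel>f\<parallel> * \<bar>W\<bar> to the 1/2 * \<parallel>\<alpha>\<parallel>\<close> (\<open>four_linear_estimate\<close>). Since the \<open>\<beta>\<close>-coefficient
  vanishes unless \<open>R\<close> lies in \<open>W\<close>, the mean over \<open>R\<close> of the indicator \<open>b\<close> of \<open>W\<close> may be inserted as a fourth factor.
  In each coordinate of \<open>Z\<close> the product of the means of \<open>f\<close> and \<open>b\<close> is telescoped over coarser scales \<open>k\<close>, so that
  either \<open>f\<close> or \<open>b\<close> or both are differenced at scale \<open>k\<close>; where \<open>f\<close> is differenced the BMO condition acts as a
  Carleson condition, and where only \<open>b\<close> is differenced the mean of \<open>f\<close> costs a factor \<open>k\<close>. This growth is exactly
  what the logarithms in the LMO norm pay for: grouping scales by the binary logarithm of \<open>k\<close> turns it into geometric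
  decay, and the groups are summed by a Schur test. Duality and the Riesz--Fischer theorem then produce the value
  of the operator in BMO.

  \<^bold>\<open>Lower bounds.\<close> For \<open>\<beta> = 0\<close> one tests on a sum of signed, suitably normalised Haar functions over all ancestors
  of a rectangle \<open>R\<close>. Its BMO norm is bounded because each ancestor contains a sibling of fixed proportion and these
  siblings are disjoint, while its mean over any rectangle in \<open>R\<close> without full sides is, up to sign, the number of
  ancestors, which is comparable to the product of the logarithms. For \<open>\<beta> = 1\<close> the Carleson sum of \<open>\<phi>\<close> over
  an extremal \<open>W\<close> is recovered by pairing \<open>\<Delta>\<^sub>\<phi> f\<close> with a function \<open>a\<close> whose Haar spectrum lives in a set of measure
  at most a constant times \<open>\<bar>W\<bar>\<close> and whose means over rectangles in \<open>W\<close> are at least \<open>1/2\<close> in absolute value,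
  except for rectangles inside a set of half the measure (\<open>localized_test_function\<close>); the exceptional part is
  absorbed because \<open>W\<close> is extremal.
\<close>

section \<open>Grids, scales and averaging kernels\<close>

text \<open>The integer point \<open>x\<close> stands for the half-open cube of side \<open>2\<^sup>-\<^sup>L\<close> with lower corner \<open>x / 2\<^sup>L\<close>.\<close>

definition grid :: "nat => ('n::finite => nat) set" where
 "grid L = {x. \<forall>j. x j < 2 ^ L}"

text \<open>A rectangle of scale \<open>k\<close> has sides of length \<open>2\<close> to the power \<open>- k j\<close>; strictness leaves room for its halves.\<close>

definition scales :: "nat => ('n::finite => nat) set" where
 "scales L = {k. \<forall>j. k j < L}"

definition same_cell :: "nat => nat => nat => nat => bool" where
 "same_cell L k s t \<longleftrightarrow> s div 2 ^ (L - k) = t div 2 ^ (L - k)"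

definition cell :: "nat => ('n::finite => nat) => ('n => nat) => ('n => nat) set" where
 "cell L k x = {y \<in> grid L. \<forall>j. same_cell L (k j) (x j) (y j)}"

text \<open>The sign of the Haar function of the interval of scale \<open>k\<close> around \<open>s\<close>, evaluated at \<open>s\<close>.\<close>

definition half_sign :: "nat => nat => nat => real" where
 "half_sign L k s = (if odd (s div 2 ^ (L - Suc k)) then 1 else - 1)"

text \<open>The kernels below act along one axis: \<open>mean_ker\<close> is conditional expectation on the intervals of scale \<open>k\<close>,
  \<open>diff_ker\<close> the martingale difference from scale \<open>k\<close> to \<open>k + 1\<close>, \<open>coeff_ker\<close> a normalised Haar coefficient, and
  \<open>osc_ker\<close> conditional expectation minus the global mean.\<close>

definition mean_ker :: "nat => nat => nat => nat => real" where
 "mean_ker L k s t = (if same_cell L k s t then 1 / 2 ^ (L - k) else 0)"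

definition diff_ker :: "nat => nat => nat => nat => real" where
 "diff_ker L k s t = half_sign L k s * mean_ker L k s t * half_sign L k t"

definition coeff_ker :: "nat => nat => nat => nat => real" where
 "coeff_ker L k s t = mean_ker L k s t * half_sign L k t"

definition osc_ker :: "nat => nat => nat => nat => real" where
 "osc_ker L k s t = (\<Sum>l<k. diff_ker L l s t)"

definition ker_op :: "nat => ('n::finite => nat => nat => real) => (('n => nat) => real) => ('n => nat) => real" where
 "ker_op L \<kappa> f x = (\<Sum>y\<in>grid L. (\<Prod>j\<in>UNIV. \<kappa> j (x j) (y j)) * f y)"

text \<open>Bilinear operators with product kernels: after telescoping, the kernels of \<open>f\<close> and \<open>b\<close> are coupled through
  their common scale.\<close>

definition ker_op2 :: "nat => ('n::finite => nat => nat => nat => real) => (('n => nat) => real) => (('n => nat) => real) => ('n => nat) => real" where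
 "ker_op2 L \<gamma> f b x = (\<Sum>y\<in>grid L. \<Sum>z\<in>grid L. (\<Prod>j\<in>UNIV. \<gamma> j (x j) (y j) (z j)) * (f y * b z))"

definition mean_op :: "nat => ('n::finite => nat) => (('n => nat) => real) => ('n => nat) => real" where
 "mean_op L k = ker_op L (%j. mean_ker L (k j))"

definition sq_norm :: "nat => (('n::finite => nat) => real) => real" where
 "sq_norm L f = (\<Sum>x\<in>grid L. (f x)^2)"

lemma grid_PiE: "grid L = PiE UNIV (%_. {..<2 ^ L})"
 by (auto simp: grid_def)

lemma finite_grid [simp]: "finite (grid L :: ('n::finite => nat) set)"
 unfolding grid_PiE by (intro finite_PiE) auto

lemma finite_scales [simp]: "finite (scales L :: ('n::finite => nat) set)"
proof -
 have "scales L = (PiE UNIV (%_. {..<L}) :: ('n => nat) set)" by (auto simp: scales_def)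
 then show ?thesis by (simp add: finite_PiE)
qed

lemma gridD: "x \<in> grid L ==> x j < 2 ^ L"
 by (simp add: grid_def)

lemma scalesD: "k \<in> scales L ==> k j < L"
 by (simp add: scales_def)

lemma sum_grid_prod:
 fixes g :: "'n::finite => nat => real"
 shows "(\<Sum>x\<in>grid L. \<Prod>j\<in>UNIV. g j (x j)) = (\<Prod>j\<in>UNIV. \<Sum>s<2 ^ L. g j s)"
 unfolding grid_PiE by (rule prod_sum_PiE[symmetric]) auto

lemma card_grid: "card (grid L :: ('n::finite => nat) set) = 2 ^ (L * CARD('n))"
 unfolding grid_PiE by (subst card_PiE) (auto simp: power_mult)

lemma sq_norm_nonneg [simp]: "0 <= sq_norm L f"
 by (simp add: sq_norm_def sum_nonneg)

lemma same_cell_refl [simp]: "same_cell L k s s"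
 and same_cell_sym: "same_cell L k s t \<longleftrightarrow> same_cell L k t s"
 by (auto simp: same_cell_def)

lemma same_cell_trans: "same_cell L k s t ==> same_cell L k t u ==> same_cell L k s u"
 by (auto simp: same_cell_def)

lemma same_cell_mono:
 assumes "same_cell L l s t" "k <= l"
 shows "same_cell L k s t"
proof -
 have e: "(2::nat) ^ (L - k) = 2 ^ (L - l) * 2 ^ ((L - k) - (L - l))"
  using assms(2) by (simp flip: power_add)
 show ?thesis using assms(1) unfolding same_cell_def e by (simp add: div_mult2_eq)
qed

lemma same_cell_top: "same_cell L L s t \<longleftrightarrow> s = t"
 by (simp add: same_cell_def)

lemma same_cell_0: "s < 2 ^ L ==> t < 2 ^ L ==> same_cell L 0 s t"
 by (simp add: same_cell_def)

lemma same_cell_Suc: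
 assumes "k < L" "same_cell L k s t"
 shows "same_cell L (Suc k) s t \<longleftrightarrow> half_sign L k s = half_sign L k t"
proof -
 have e: "(2::nat) ^ (L - k) = 2 ^ (L - Suc k) * 2"
  using assms(1) by (metis Suc_diff_Suc power_Suc2)
 define a b where "a = s div 2 ^ (L - Suc k)" and "b = t div 2 ^ (L - Suc k)"
 have "a div 2 = b div 2"
  using assms(2) unfolding same_cell_def e by (simp add: div_mult2_eq a_def b_def)
 then have "a = b \<longleftrightarrow> (odd a \<longleftrightarrow> odd b)" by presburger
 then show ?thesis unfolding same_cell_def half_sign_def a_def b_def by auto
qed

lemma half_sign_cases: "half_sign L k s = 1 \<or> half_sign L k s = - 1"
 by (simp add: half_sign_def)

lemma half_sign_sq [simp]: "half_sign L k s * half_sign L k s = 1" "(half_sign L k s)^2 = 1"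
 "\<bar>half_sign L k s\<bar> = 1"
 by (simp_all add: half_sign_def)

lemma half_sign_same_cell: "same_cell L (Suc k) s t ==> half_sign L k s = half_sign L k t"
 by (simp add: half_sign_def same_cell_def)

lemma mean_ker_sym: "mean_ker L k s t = mean_ker L k t s"
 by (simp add: mean_ker_def same_cell_sym)

lemma mean_ker_nonneg [simp]: "0 <= mean_ker L k s t"
 by (simp add: mean_ker_def)

lemma mean_ker_top: "mean_ker L L s t = (if s = t then 1 else 0)"
 by (simp add: mean_ker_def same_cell_top)

lemma mean_ker_0: "s < 2 ^ L ==> t < 2 ^ L ==> mean_ker L 0 s t = 1 / 2 ^ L"
 by (simp add: mean_ker_def same_cell_0)

lemma mean_ker_cell: "same_cell L k s s' ==> mean_ker L k s t = mean_ker L k s' t"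
 by (auto simp: mean_ker_def same_cell_def)

lemma card_same_cell:
 assumes "k <= L" "s < 2 ^ L"
 shows "card {t. t < 2 ^ L \<and> same_cell L k s t} = 2 ^ (L - k)"
proof -
 define D where "D = (2::nat) ^ (L - k)"
 define q where "q = s div D"
 have D0: "D > 0" by (simp add: D_def)
 have LD: "(2::nat) ^ L = D * 2 ^ k" using assms(1) by (simp add: D_def flip: power_add)
 have q: "q < 2 ^ k" unfolding q_def using assms(2) LD D0 by (simp add: less_mult_imp_div_less mult.commute)
 have "{t. t < 2 ^ L \<and> same_cell L k s t} = {q * D ..< q * D + D}"
 proof (intro set_eqI iffI)
  fix t assume "t \<in> {t. t < 2 ^ L \<and> same_cell L k s t}"
  then have "t div D = q" by (auto simp: same_cell_def D_def q_def)
  then show "t \<in> {q * D ..< q * D + D}" using D0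
   by (metis add.commute atLeastLessThan_iff div_times_less_eq_dividend dividend_less_times_div mult.commute)
 next
  fix t assume t: "t \<in> {q * D ..< q * D + D}"
  then have tq: "t div D = q" using D0
   by (metis add.commute atLeastLessThan_iff div_nat_eqI mult.commute mult_Suc_right)
  have "q * D + D <= 2 ^ L" unfolding LD using q
   by (metis Suc_leI mult.commute mult_Suc mult_le_mono1 add.commute)
  with t have "t < 2 ^ L" by simp
  then show "t \<in> {t. t < 2 ^ L \<and> same_cell L k s t}" using tq by (simp add: same_cell_def D_def q_def)
 qed
 then show ?thesis by (simp add: D_def)
qed

lemma sum_mean_ker:
 assumes "k <= L" "s < 2 ^ L"
 shows "(\<Sum>t<2 ^ L. mean_ker L k s t) = 1"
proof -
 have "(\<Sum>t<2 ^ L. mean_ker L k s t) = (\<Sum>t\<in>{t. t < 2 ^ L \<and> same_cell L k s t}. 1 / 2 ^ (L - k))"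
  unfolding mean_ker_def by (rule sum.mono_neutral_cong_right) auto
 also have "... = 1" using card_same_cell[OF assms] by simp
 finally show ?thesis .
qed

lemma diff_ker_eq:
 assumes "k < L"
 shows "diff_ker L k s t = mean_ker L (Suc k) s t - mean_ker L k s t"
proof (cases "same_cell L k s t")
 case True
 have e: "(2::real) ^ (L - k) = 2 ^ (L - Suc k) * 2"
  using assms by (metis Suc_diff_Suc power_Suc2)
 show ?thesis
  using same_cell_Suc[OF assms True] True half_sign_cases[of L k s] half_sign_cases[of L k t]
  by (auto simp: diff_ker_def mean_ker_def e field_simps)
next
 case False
 then have "\<not> same_cell L (Suc k) s t" using same_cell_mono[of L "Suc k" s t k] by auto
 with False show ?thesis by (simp add: diff_ker_def mean_ker_def)
qed

lemma osc_ker_eq: "k <= L ==> osc_ker L k s t = mean_ker L k s t - mean_ker L 0 s t"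
proof (induction k)
 case 0 then show ?case by (simp add: osc_ker_def)
next
 case (Suc k) then show ?case by (simp add: osc_ker_def diff_ker_eq)
qed

definition cell_const :: "nat => nat => (nat => real) => bool" where
 "cell_const L k u \<longleftrightarrow> (\<forall>s t. s < 2 ^ L --> t < 2 ^ L --> same_cell L k s t --> u s = u t)"

text \<open>Functions that on each interval of scale \<open>k\<close> are multiples of its Haar sign, up to a factor constant on the
  interval; they are orthogonal to everything constant at scale \<open>k\<close>.\<close>

definition haar_like :: "nat => nat => (nat => real) => bool" where
 "haar_like L k u \<longleftrightarrow> (\<exists>w. cell_const L k w \<and> u = (%s. half_sign L k s * w s))"

lemma cell_constD: "cell_const L k u ==> s < 2 ^ L ==> t < 2 ^ L ==> same_cell L k s t ==> u s = u t"
 unfolding cell_const_def by blast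

lemma cell_const_mono: "cell_const L k u ==> k <= l ==> cell_const L l u"
 unfolding cell_const_def using same_cell_mono by blast

lemma cell_const_mult: "cell_const L k u ==> cell_const L k v ==> cell_const L k (%s. u s * v s)"
 unfolding cell_const_def by (metis (no_types, lifting))

lemma cell_const_diff: "cell_const L k u ==> cell_const L k v ==> cell_const L k (%s. u s - v s)"
 unfolding cell_const_def by (metis (no_types, lifting))

lemma cell_const_const [simp]: "cell_const L k (%s. c)"
 by (simp add: cell_const_def)

lemma cell_const_mean_ker: "k <= l ==> cell_const L l (%s. mean_ker L k s t)"
 by (rule cell_const_mono[of L k]) (auto simp: cell_const_def intro: mean_ker_cell)

lemma cell_const_mean_ker': "k <= l ==> cell_const L l (mean_ker L k t)"
 using cell_const_mean_ker[of k l L t] ext[of "mean_ker L k t" "%s. mean_ker L k s t"] mean_ker_sym by metis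

lemma haar_likeI: "cell_const L k w ==> haar_like L k (%s. half_sign L k s * w s)"
 by (auto simp: haar_like_def)

lemma haar_like_cell_const: "haar_like L k u ==> k < l ==> cell_const L l u"
 unfolding haar_like_def
proof (elim exE conjE)
 fix w assume w: "cell_const L k w" "u = (%s. half_sign L k s * w s)" "k < l"
 have "cell_const L (Suc k) (half_sign L k)"
  by (auto simp: cell_const_def intro: half_sign_same_cell)
 then have "cell_const L l (half_sign L k)" using w(3) by (auto intro: cell_const_mono)
 then show "cell_const L l u" unfolding w(2)
  using w(1,3) by (auto intro!: cell_const_mult intro: cell_const_mono)
qed

lemma mean_of_cell_const:
 assumes "k <= l" "l <= L" "cell_const L k u" "s < 2 ^ L"
 shows "(\<Sum>t<2 ^ L. mean_ker L l s t * u t) = u s"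
proof -
 have "(\<Sum>t<2 ^ L. mean_ker L l s t * u t) = (\<Sum>t<2 ^ L. mean_ker L l s t * u s)"
 proof (rule sum.cong, simp)
  fix t assume t: "t \<in> {..<(2::nat) ^ L}"
  show "mean_ker L l s t * u t = mean_ker L l s t * u s"
  proof (cases "same_cell L l s t")
   case True
   then have "same_cell L k s t" using assms(1) by (rule same_cell_mono)
   from cell_constD[OF assms(3,4) _ this] have "u s = u t" using t by simp
   then show ?thesis by simp
  qed (simp add: mean_ker_def)
 qed
 also have "... = u s" using sum_mean_ker[OF assms(2,4)] by (simp flip: sum_distrib_right)
 finally show ?thesis .
qed

text \<open>Averaging over the cells does not change the constant factors, and the signs average to zero.\<close>

lemma sum_haar_like:
 assumes "k < L" "haar_like L k u" "cell_const L k v"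
 shows "(\<Sum>s<2 ^ L. u s * v s) = 0"
proof -
 obtain w where w: "cell_const L k w" "u = (%s. half_sign L k s * w s)"
  using assms(2) by (auto simp: haar_like_def)
 define g where "g = (%s. w s * v s)"
 have g: "cell_const L k g" unfolding g_def using w(1) assms(3) by (rule cell_const_mult)
 have z: "(\<Sum>s<2 ^ L. half_sign L k s * mean_ker L k s t) = 0" if t: "t < 2 ^ L" for t
 proof -
  have "(\<Sum>s<2 ^ L. diff_ker L k s t) = (\<Sum>s<2 ^ L. mean_ker L (Suc k) t s) - (\<Sum>s<2 ^ L. mean_ker L k t s)"
   using assms(1) by (simp add: diff_ker_eq sum_subtractf mean_ker_sym[of L _ t])
  also have "... = 0" using assms(1) t by (simp add: sum_mean_ker)
  finally have "half_sign L k t * (\<Sum>s<2 ^ L. half_sign L k s * mean_ker L k s t) = 0"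
   by (simp add: diff_ker_def sum_distrib_left mult_ac)
  then show ?thesis using half_sign_cases[of L k t] by auto
 qed
 have "(\<Sum>s<2 ^ L. u s * v s) = (\<Sum>s<2 ^ L. half_sign L k s * g s)"
  by (simp add: w(2) g_def mult_ac)
 also have "... = (\<Sum>s<2 ^ L. half_sign L k s * (\<Sum>t<2 ^ L. mean_ker L k s t * g t))"
  using assms(1) g by (intro sum.cong refl) (simp add: mean_of_cell_const[of k k L g])
 also have "... = (\<Sum>t<2 ^ L. g t * (\<Sum>s<2 ^ L. half_sign L k s * mean_ker L k s t))"
  unfolding sum_distrib_left by (subst sum.swap) (simp add: mult_ac)
 also have "... = 0" using z by (simp add: sum.neutral)
 finally show ?thesis .
qed

lemma mean_of_haar_like:
 assumes "l <= k" "k < L" "haar_like L k u"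
 shows "(\<Sum>t<2 ^ L. mean_ker L l s t * u t) = 0"
 using sum_haar_like[OF assms(2,3) cell_const_mean_ker'[OF assms(1), of L s]] by (simp add: mult.commute)

lemma haar_like_diff_ker: "haar_like L k (%s. diff_ker L k s t)"
proof -
 have e: "(%s. diff_ker L k s t) = (%s. half_sign L k s * (mean_ker L k s t * half_sign L k t))"
  by (auto simp: diff_ker_def)
 show ?thesis unfolding e
  by (rule haar_likeI, rule cell_const_mult, rule cell_const_mean_ker, simp, rule cell_const_const)
qed

lemma haar_like_mult: "haar_like L k u ==> cell_const L k v ==> haar_like L k (%s. u s * v s)"
 unfolding haar_like_def
proof (elim exE conjE)
 fix w assume w: "cell_const L k w" "u = (%s. half_sign L k s * w s)" "cell_const L k v"
 then show "\<exists>w. cell_const L k w \<and> (%s. u s * v s) = (%s. half_sign L k s * w s)"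
  by (intro exI[of _ "%s. w s * v s"]) (auto intro: cell_const_mult)
qed

lemma sum_haar_like_orth:
 assumes "haar_like L k u" "haar_like L l v" "k ~= l" "k < L" "l < L"
 shows "(\<Sum>s<2 ^ L. u s * v s) = 0"
proof (cases "k < l")
 case True
 have "cell_const L l u" using assms(1) True by (rule haar_like_cell_const)
 from sum_haar_like[OF assms(5,2) this] show ?thesis by (simp add: mult.commute)
next
 case False
 then have "cell_const L k v" using assms by (intro haar_like_cell_const) auto
 from sum_haar_like[OF assms(4,1) this] show ?thesis .
qed

section \<open>Product kernels\<close>

lemma ker_op_ker_op:
 "ker_op L \<tau> (ker_op L \<kappa> f) x = ker_op L (%j s t. \<Sum>u<2 ^ L. \<tau> j s u * \<kappa> j u t) f x"
proof -
 have "ker_op L \<tau> (ker_op L \<kappa> f) x =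
  (\<Sum>z\<in>grid L. \<Sum>y\<in>grid L. (\<Prod>j\<in>UNIV. \<tau> j (x j) (z j) * \<kappa> j (z j) (y j)) * f y)"
  unfolding ker_op_def by (simp add: sum_distrib_left prod.distrib mult_ac)
 also have "... = (\<Sum>y\<in>grid L. (\<Sum>z\<in>grid L. \<Prod>j\<in>UNIV. \<tau> j (x j) (z j) * \<kappa> j (z j) (y j)) * f y)"
  by (subst sum.swap) (simp add: sum_distrib_right)
 also have "... = ker_op L (%j s t. \<Sum>u<2 ^ L. \<tau> j s u * \<kappa> j u t) f x"
  unfolding ker_op_def using sum_grid_prod[of "%j u. \<tau> j (x j) u * \<kappa> j u (y j)" for y] by simp
 finally show ?thesis .
qed

lemma ker_op_ker_op2:
 "ker_op L \<tau> (ker_op2 L \<gamma> f b) x = ker_op2 L (%j s y z. \<Sum>u<2 ^ L. \<tau> j s u * \<gamma> j u y z) f b x"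
proof -
 have "ker_op L \<tau> (ker_op2 L \<gamma> f b) x =
  (\<Sum>w\<in>grid L. \<Sum>y\<in>grid L. \<Sum>z\<in>grid L. (\<Prod>j\<in>UNIV. \<tau> j (x j) (w j) * \<gamma> j (w j) (y j) (z j)) * (f y * b z))"
  unfolding ker_op_def ker_op2_def by (simp add: sum_distrib_left prod.distrib mult_ac)
 also have "... = (\<Sum>y\<in>grid L. \<Sum>z\<in>grid L. (\<Sum>w\<in>grid L. \<Prod>j\<in>UNIV. \<tau> j (x j) (w j) * \<gamma> j (w j) (y j) (z j)) * (f y * b z))"
  unfolding sum_distrib_right
  by (subst sum.swap, rule sum.cong[OF refl], subst sum.swap, rule refl)
 also have "... = ker_op2 L (%j s y z. \<Sum>u<2 ^ L. \<tau> j s u * \<gamma> j u y z) f b x"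
  unfolding ker_op2_def using sum_grid_prod[of "%j u. \<tau> j (x j) u * \<gamma> j u (y j) (z j)" for y z] by simp
 finally show ?thesis .
qed

lemma ker_op_cong:
 assumes "!!j t. t < 2 ^ L ==> \<kappa> j (x j) t = \<kappa>' j (x' j) t"
 shows "ker_op L \<kappa> f x = ker_op L \<kappa>' f x'"
 unfolding ker_op_def using assms by (intro sum.cong refl arg_cong2[of _ _ _ _ "(*)"] prod.cong) (auto dest: gridD)

lemma ker_op2_cong:
 assumes "!!j t u. t < 2 ^ L ==> u < 2 ^ L ==> \<gamma> j (x j) t u = \<gamma>' j (x' j) t u"
 shows "ker_op2 L \<gamma> f b x = ker_op2 L \<gamma>' f b x'"
 unfolding ker_op2_def using assms by (intro sum.cong refl arg_cong2[of _ _ _ _ "(*)"] prod.cong) (simp_all add: gridD)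

lemma ker_op_cong_fun: "(!!y. y \<in> grid L ==> f y = g y) ==> ker_op L \<kappa> f x = ker_op L \<kappa> g x"
 unfolding ker_op_def by (auto intro: sum.cong)

lemma ker_op_mono:
 assumes "!!j s t. 0 <= \<kappa> j s t" "!!y. y \<in> grid L ==> f y <= g y"
 shows "ker_op L \<kappa> f x <= ker_op L \<kappa> g x"
 unfolding ker_op_def using assms by (intro sum_mono mult_left_mono prod_nonneg) auto

lemma ker_op_abs_le:
 assumes "!!j s t. 0 <= \<kappa> j s t"
 shows "\<bar>ker_op L \<kappa> f x\<bar> <= ker_op L \<kappa> (%y. \<bar>f y\<bar>) x"
proof -
 have "\<bar>ker_op L \<kappa> f x\<bar> <= (\<Sum>y\<in>grid L. \<bar>(\<Prod>j\<in>UNIV. \<kappa> j (x j) (y j)) * f y\<bar>)"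
  unfolding ker_op_def by (rule sum_abs)
 also have "... = ker_op L \<kappa> (%y. \<bar>f y\<bar>) x"
  unfolding ker_op_def using assms by (simp add: abs_mult abs_prod)
 finally show ?thesis .
qed

lemma ker_op_nonneg:
 assumes "!!j s t. 0 <= \<kappa> j s t" "!!y. y \<in> grid L ==> 0 <= f y"
 shows "0 <= ker_op L \<kappa> f x"
 unfolding ker_op_def using assms by (intro sum_nonneg mult_nonneg_nonneg prod_nonneg) auto

lemma ker_op_add: "ker_op L \<kappa> (%x. f x + g x) x = ker_op L \<kappa> f x + ker_op L \<kappa> g x"
 by (simp add: ker_op_def distrib_left sum.distrib)

lemma ker_op_diff: "ker_op L \<kappa> (%x. f x - g x) x = ker_op L \<kappa> f x - ker_op L \<kappa> g x"
 by (simp add: ker_op_def right_diff_distrib sum_subtractf)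

lemma ker_op_cmult: "ker_op L \<kappa> (%x. c * f x) x = c * ker_op L \<kappa> f x"
 by (simp add: ker_op_def sum_distrib_left mult_ac)

lemma ker_op_sum: "ker_op L \<kappa> (%x. \<Sum>i\<in>I. f i x) x = (\<Sum>i\<in>I. ker_op L \<kappa> (f i) x)"
 unfolding ker_op_def sum_distrib_left by (rule sum.swap)

lemma ker_op_mult:
 "ker_op L \<kappa> f x * ker_op L \<kappa>' b x = ker_op2 L (%j s y z. \<kappa> j s y * \<kappa>' j s z) f b x"
 unfolding ker_op_def ker_op2_def sum_product by (simp add: prod.distrib mult_ac)

lemma ker_op_id:
 assumes "x \<in> grid L" "!!j t. t < 2 ^ L ==> \<kappa> j (x j) t = (if x j = t then 1 else 0)"
 shows "ker_op L \<kappa> f x = f x"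
proof -
 have "ker_op L \<kappa> f x = (\<Sum>y\<in>grid L. if x = y then f y else 0)"
  unfolding ker_op_def
 proof (intro sum.cong refl)
  fix y :: "'a => nat" assume y: "y \<in> grid L"
  have e: "(\<Prod>j\<in>UNIV. \<kappa> j (x j) (y j)) = (\<Prod>j\<in>UNIV. if x j = y j then 1 else 0)"
   using assms(2) gridD[OF y] by (intro prod.cong) auto
  show "(\<Prod>j\<in>UNIV. \<kappa> j (x j) (y j)) * f y = (if x = y then f y else 0)"
  proof (cases "x = y")
   case False
   then obtain j where "x j ~= y j" by auto
   then have "(\<Prod>j\<in>UNIV. if x j = y j then 1 else (0::real)) = 0" by (intro prod_zero) auto
   with False e show ?thesis by simp
  next
   case True
   then show ?thesis unfolding e by simp
  qed
 qed
 also have "... = f x" using assms(1) by (simp add: sum.delta)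
 finally show ?thesis .
qed

lemma ker_op_signs:
 assumes "!!j t. t < 2 ^ L ==> \<kappa> j (x j) t = \<sigma> j * \<kappa>' j (x j) t" "!!j. \<bar>\<sigma> j\<bar> = 1"
 shows "\<bar>ker_op L \<kappa> f x\<bar> = \<bar>ker_op L \<kappa>' f x\<bar>"
proof -
 have "ker_op L \<kappa> f x = ker_op L (%j s t. \<sigma> j * \<kappa>' j s t) f x"
  using assms(1) by (intro ker_op_cong) auto
 also have "... = (\<Prod>j\<in>UNIV. \<sigma> j) * ker_op L \<kappa>' f x"
  by (simp add: ker_op_def prod.distrib sum_distrib_left mult_ac)
 finally show ?thesis by (simp add: abs_mult abs_prod assms(2))
qed

lemma ker_op_adjoint:
 assumes "!!j s t. \<kappa> j s t = \<kappa> j t s"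
 shows "(\<Sum>x\<in>grid L. f x * ker_op L \<kappa> g x) = (\<Sum>x\<in>grid L. ker_op L \<kappa> f x * g x)"
proof -
 have "(\<Sum>x\<in>grid L. f x * ker_op L \<kappa> g x) = (\<Sum>x\<in>grid L. \<Sum>y\<in>grid L. (\<Prod>j\<in>UNIV. \<kappa> j (x j) (y j)) * f x * g y)"
  by (simp add: ker_op_def sum_distrib_left mult_ac)
 also have "... = (\<Sum>y\<in>grid L. \<Sum>x\<in>grid L. (\<Prod>j\<in>UNIV. \<kappa> j (y j) (x j)) * f x * g y)"
  by (subst sum.swap) (simp add: assms[of _ "_ _" "_ _"] cong: prod.cong sum.cong)
 also have "... = (\<Sum>x\<in>grid L. ker_op L \<kappa> f x * g x)"
  by (simp add: ker_op_def sum_distrib_right)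
 finally show ?thesis .
qed

lemma ker_op_sum_kernels:
 assumes "!!j. finite (I j)"
 shows "ker_op L (%j s t. \<Sum>l\<in>I j. \<kappa> j l s t) f x = (\<Sum>l\<in>PiE UNIV I. ker_op L (%j. \<kappa> j (l j)) f x)"
proof -
 have "ker_op L (%j s t. \<Sum>l\<in>I j. \<kappa> j l s t) f x =
  (\<Sum>y\<in>grid L. \<Sum>l\<in>PiE UNIV I. (\<Prod>j\<in>UNIV. \<kappa> j (l j) (x j) (y j)) * f y)"
  unfolding ker_op_def using assms by (subst prod_sum_PiE) (auto simp: sum_distrib_right)
 also have "... = (\<Sum>l\<in>PiE UNIV I. ker_op L (%j. \<kappa> j (l j)) f x)"
  unfolding ker_op_def by (rule sum.swap)
 finally show ?thesis .
qed

lemma ker_op2_sum_kernels: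
 assumes "!!j. finite (I j)"
 shows "ker_op2 L (%j s y z. \<Sum>l\<in>I j. \<gamma> j l s y z) f b x = (\<Sum>l\<in>PiE UNIV I. ker_op2 L (%j. \<gamma> j (l j)) f b x)"
proof -
 have "ker_op2 L (%j s y z. \<Sum>l\<in>I j. \<gamma> j l s y z) f b x =
  (\<Sum>y\<in>grid L. \<Sum>z\<in>grid L. \<Sum>l\<in>PiE UNIV I. (\<Prod>j\<in>UNIV. \<gamma> j (l j) (x j) (y j) (z j)) * (f y * b z))"
  unfolding ker_op2_def using assms by (subst prod_sum_PiE) (auto simp: sum_distrib_right)
 also have "... = (\<Sum>l\<in>PiE UNIV I. ker_op2 L (%j. \<gamma> j (l j)) f b x)"
  unfolding ker_op2_def by (simp only: sum.swap[of _ "grid L" "PiE UNIV I"])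
 finally show ?thesis .
qed

lemma ker_op_eq_0:
 assumes "!!t. t < 2 ^ L ==> \<kappa> i (x i) t = 0"
 shows "ker_op L \<kappa> f x = 0"
 unfolding ker_op_def
proof (intro sum.neutral ballI)
 fix y :: "'a => nat" assume "y \<in> grid L"
 then have "\<kappa> i (x i) (y i) = 0" using assms by (simp add: gridD)
 then have "(\<Prod>j\<in>UNIV. \<kappa> j (x j) (y j)) = 0" by (intro prod_zero) auto
 then show "(\<Prod>j\<in>UNIV. \<kappa> j (x j) (y j)) * f y = 0" by simp
qed

lemma ker_op2_eq_0:
 assumes "!!t u. t < 2 ^ L ==> u < 2 ^ L ==> \<gamma> i (x i) t u = 0"
 shows "ker_op2 L \<gamma> f b x = 0"
 unfolding ker_op2_def
proof (intro sum.neutral ballI)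
 fix y z :: "'a => nat" assume "y \<in> grid L" "z \<in> grid L"
 then have "\<gamma> i (x i) (y i) (z i) = 0" using assms by (simp add: gridD)
 then have "(\<Prod>j\<in>UNIV. \<gamma> j (x j) (y j) (z j)) = 0" by (intro prod_zero) auto
 then show "(\<Prod>j\<in>UNIV. \<gamma> j (x j) (y j) (z j)) * (f y * b z) = 0" by simp
qed

text \<open>Orthogonality in a single coordinate suffices, because the kernels are products.\<close>

lemma ker_op2_orth:
 assumes "!!y z y' z'. y < 2 ^ L ==> z < 2 ^ L ==> y' < 2 ^ L ==> z' < 2 ^ L ==>
   (\<Sum>s<2 ^ L. \<gamma> i s y z * \<gamma>' i s y' z') = 0"
 shows "(\<Sum>x\<in>grid L. ker_op2 L \<gamma> f b x * ker_op2 L \<gamma>' f b x) = 0"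
proof -
 have "(\<Sum>x\<in>grid L. ker_op2 L \<gamma> f b x * ker_op2 L \<gamma>' f b x) =
  (\<Sum>x\<in>grid L. \<Sum>y\<in>grid L. \<Sum>y'\<in>grid L. \<Sum>z\<in>grid L. \<Sum>z'\<in>grid L.
   (\<Prod>j\<in>UNIV. \<gamma> j (x j) (y j) (z j) * \<gamma>' j (x j) (y' j) (z' j)) * (f y * b z * f y' * b z'))"
  unfolding ker_op2_def sum_product by (simp add: prod.distrib mult_ac)
 also have "... = (\<Sum>y\<in>grid L. \<Sum>y'\<in>grid L. \<Sum>z\<in>grid L. \<Sum>z'\<in>grid L. \<Sum>x\<in>grid L.
   (\<Prod>j\<in>UNIV. \<gamma> j (x j) (y j) (z j) * \<gamma>' j (x j) (y' j) (z' j)) * (f y * b z * f y' * b z'))"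
  by (subst sum.swap, rule sum.cong[OF refl], subst sum.swap, rule sum.cong[OF refl],
    subst sum.swap, rule sum.cong[OF refl], rule sum.swap)
 also have "... = 0"
 proof (rule sum.neutral, rule ballI, rule sum.neutral, rule ballI, rule sum.neutral, rule ballI,
   rule sum.neutral, rule ballI)
  fix y z y' z' :: "'a => nat" assume g: "y \<in> grid L" "z \<in> grid L" "y' \<in> grid L" "z' \<in> grid L"
  have "(\<Sum>x\<in>grid L. \<Prod>j\<in>UNIV. \<gamma> j (x j) (y j) (z j) * \<gamma>' j (x j) (y' j) (z' j)) =
    (\<Prod>j\<in>UNIV. \<Sum>s<2 ^ L. \<gamma> j s (y j) (z j) * \<gamma>' j s (y' j) (z' j))"
   by (rule sum_grid_prod[of "%j s. \<gamma> j s (y j) (z j) * \<gamma>' j s (y' j) (z' j)"])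
  also have "... = 0"
   using assms[OF g(1)[THEN gridD, of i] g(2)[THEN gridD, of i] g(3)[THEN gridD, of i] g(4)[THEN gridD, of i]]
   by (intro prod_zero bexI[of _ i]) auto
  finally show "(\<Sum>x\<in>grid L. (\<Prod>j\<in>UNIV. \<gamma> j (x j) (y j) (z j) * \<gamma>' j (x j) (y' j) (z' j)) * (f y * b z * f y' * b z')) = 0"
   by (simp flip: sum_distrib_right)
 qed
 finally show ?thesis .
qed

section \<open>Averages over cells and the strong maximal function\<close>

lemma cell_subset_grid: "cell L n x \<subseteq> grid L"
 by (auto simp: cell_def)

lemma cell_refl: "x \<in> grid L ==> x \<in> cell L n x"
 by (auto simp: cell_def)

lemma cell_eq: "y \<in> cell L n x ==> cell L n y = cell L n x"
 unfolding cell_def using same_cell_trans same_cell_sym by blast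

lemma prod_mean_ker_neq_0:
 "y \<in> grid L ==> (\<Prod>j\<in>UNIV. mean_ker L (n j) (x j) (y j)) ~= 0 ==> y \<in> cell L n x"
 by (auto simp: cell_def mean_ker_def split: if_splits)

lemma sum_prod_mean_ker:
 assumes "x \<in> grid L" "!!j. n j <= L"
 shows "(\<Sum>y\<in>grid L. \<Prod>j\<in>UNIV. mean_ker L (n j) (x j) (y j)) = 1"
 using assms by (simp add: sum_grid_prod[of "%j. mean_ker L (n j) (x j)"] sum_mean_ker gridD)

lemma mean_op_fix:
 fixes x :: "'n::finite => nat"
 assumes "x \<in> grid L" "!!j. n j <= L" "!!y. y \<in> cell L n x ==> u y = u x"
 shows "mean_op L n u x = u x"
proof -
 have "mean_op L n u x = (\<Sum>y\<in>grid L. (\<Prod>j\<in>UNIV. mean_ker L (n j) (x j) (y j)) * u x)"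
  unfolding mean_op_def ker_op_def
 proof (rule sum.cong[OF refl])
  fix y :: "'n => nat" assume "y \<in> grid L"
  then show "(\<Prod>j\<in>UNIV. mean_ker L (n j) (x j) (y j)) * u y = (\<Prod>j\<in>UNIV. mean_ker L (n j) (x j) (y j)) * u x"
   using prod_mean_ker_neq_0[of y L n x] assms(3)[of y] by (cases "(\<Prod>j\<in>UNIV. mean_ker L (n j) (x j) (y j)) = 0") auto
 qed
 then show ?thesis using sum_prod_mean_ker[OF assms(1,2)] by (simp flip: sum_distrib_right)
qed

lemma mean_op_const: "x \<in> grid L ==> (!!j. n j <= L) ==> mean_op L n (%_. c) x = c"
 by (rule mean_op_fix) auto

lemma mean_op_top: "x \<in> grid L ==> mean_op L (%_. L) u x = u x"
proof (rule mean_op_fix)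
 fix y assume "y \<in> cell L (%_. L) x"
 then have "y = x" by (auto simp: cell_def same_cell_top)
 then show "u y = u x" by simp
qed auto

lemma mean_op_cell: "y \<in> cell L n x ==> mean_op L n u y = mean_op L n u x"
 unfolding mean_op_def by (rule ker_op_cong) (auto simp: cell_def same_cell_sym intro: mean_ker_cell)

lemma mean_op_mono_cell:
 fixes x :: "'n::finite => nat"
 assumes "!!y. y \<in> cell L n x ==> f y <= g y"
 shows "mean_op L n f x <= mean_op L n g x"
 unfolding mean_op_def ker_op_def
proof (rule sum_mono)
 fix y :: "'n => nat" assume y: "y \<in> grid L"
 define P where "P = (\<Prod>j\<in>UNIV. mean_ker L (n j) (x j) (y j))"
 have "0 <= P" unfolding P_def by (intro prod_nonneg) auto
 moreover have "P = 0 \<or> f y <= g y"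
  using prod_mean_ker_neq_0[OF y, where n = n and x = x] assms[of y] unfolding P_def by blast
 ultimately have "P * f y <= P * g y" by (auto intro: mult_left_mono)
 then show "(\<Prod>j\<in>UNIV. mean_ker L (n j) (x j) (y j)) * f y <= (\<Prod>j\<in>UNIV. mean_ker L (n j) (x j) (y j)) * g y"
  by (simp only: P_def)
qed

lemma mean_op_nonneg: "(!!y. y \<in> grid L ==> 0 <= f y) ==> 0 <= mean_op L n f x"
 unfolding mean_op_def by (rule ker_op_nonneg) auto

lemma mean_op_mono: "(!!y. y \<in> grid L ==> f y <= g y) ==> mean_op L n f x <= mean_op L n g x"
 unfolding mean_op_def by (rule ker_op_mono) auto

lemma mean_op_abs: "\<bar>mean_op L n f x\<bar> <= mean_op L n (%y. \<bar>f y\<bar>) x"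
 unfolding mean_op_def by (rule ker_op_abs_le) auto

lemma mean_op_pos:
 assumes "x \<in> grid L" "!!j. n j <= L" "!!y. y \<in> cell L n x ==> 0 < f y"
 shows "0 < mean_op L n f x"
proof -
 have fin: "finite (cell L n x)" by (rule finite_subset[OF cell_subset_grid]) simp
 define c where "c = Min (f ` cell L n x)"
 have "c \<in> f ` cell L n x" unfolding c_def using fin cell_refl[OF assms(1)] by (intro Min_in) auto
 then have c: "c > 0" using assms(3) by auto
 have "mean_op L n (%_. c) x <= mean_op L n f x"
  by (rule mean_op_mono_cell) (auto simp: c_def fin)
 with c show ?thesis using mean_op_const[where x = x and L = L and n = n and c = c] assms(1,2) by simp
qed

lemma mean_op_adjoint: "(\<Sum>x\<in>grid L. f x * mean_op L n g x) = (\<Sum>x\<in>grid L. mean_op L n f x * g x)"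
 unfolding mean_op_def by (rule ker_op_adjoint) (rule mean_ker_sym)

lemma sum_mean_op: "(!!j. n j <= L) ==> (\<Sum>x\<in>grid L. mean_op L n f x) = (\<Sum>x\<in>grid L. f x)"
 using mean_op_adjoint[where f = "%_. 1" and L = L and n = n and g = f] by (simp add: mean_op_const)

lemma mean_ker_comp:
 assumes "k <= L" "l <= L" "s < 2 ^ L" "t < 2 ^ L"
 shows "(\<Sum>u<2 ^ L. mean_ker L k s u * mean_ker L l u t) = mean_ker L (min k l) s t"
proof (cases "l <= k")
 case True
 have "cell_const L l (%u. mean_ker L l u t)" by (rule cell_const_mean_ker) simp
 from mean_of_cell_const[OF True assms(1) this assms(3)] True show ?thesis by (simp add: min_def)
next
 case False
 have "cell_const L k (%u. mean_ker L k u s)" by (rule cell_const_mean_ker) simp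
 from mean_of_cell_const[OF _ assms(2) this assms(4)] False
 have "(\<Sum>u<2 ^ L. mean_ker L l t u * mean_ker L k u s) = mean_ker L k t s" by simp
 then show ?thesis using False
  by (simp add: min_def mean_ker_sym[of L l _ t] mean_ker_sym[of L k s] mult.commute)
qed

lemma mean_op_comp:
 assumes "x \<in> grid L" "!!j. n j <= L" "!!j. m j <= L"
 shows "mean_op L n (mean_op L m f) x = mean_op L (%j. min (n j) (m j)) f x"
 unfolding mean_op_def ker_op_ker_op
 by (rule ker_op_cong) (use assms in \<open>auto simp: mean_ker_comp gridD\<close>)

definition axis_max :: "nat => 'n::finite => (('n => nat) => real) => nat => ('n => nat) => real" where
 "axis_max L j v k x = Max ((%l. mean_op L ((%_. L)(j := l)) v x) ` {..k})"

lemma axis_max_ge: "l <= k ==> mean_op L ((%_. L)(j := l)) v x <= axis_max L j v k x"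
 unfolding axis_max_def by (rule Max_ge) auto

lemma axis_max_Suc:
 "axis_max L j v (Suc k) x = max (mean_op L ((%_. L)(j := Suc k)) v x) (axis_max L j v k x)"
 unfolding axis_max_def atMost_Suc image_insert by (rule Max_insert) auto

text \<open>The core of Doob's inequality along one axis, by induction on the number of scales. The running maximum at scale \<open>k\<close> only increases where the new mean
  attains it, and its previous value is constant on the coarser cells.\<close>

lemma axis_max_le_cross:
 assumes "k <= L"
 shows "(\<Sum>x\<in>grid L. (axis_max L j v k x)^2)
  <= 2 * (\<Sum>x\<in>grid L. axis_max L j v k x * mean_op L ((%_. L)(j := k)) v x)"
 using assms
proof (induction k)
 case 0
 define e where "e = mean_op L ((%_. L)(j := 0)) v"
 have a: "axis_max L j v 0 = e" by (auto simp: axis_max_def e_def fun_eq_iff)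
 have "0 <= (\<Sum>x\<in>grid L. e x * e x)" by (simp add: sum_nonneg)
 then show ?case unfolding a e_def[symmetric] power2_eq_square by simp
next
 case (Suc k)
 define m where "m = axis_max L j v k"
 define m' where "m' = axis_max L j v (Suc k)"
 define E where "E = (%l. mean_op L ((%_. L)(j := l)) v)"
 have "k <= L" using Suc.prems by simp
 from Suc.IH[OF this] have IH: "(\<Sum>x\<in>grid L. (m x)^2) <= 2 * (\<Sum>x\<in>grid L. m x * E k x)"
  unfolding m_def E_def .
 have pt: "(m' x)^2 <= (m x)^2 + 2 * (m' x * E (Suc k) x) - 2 * (m x * E (Suc k) x)" for x
 proof (cases "E (Suc k) x <= m x")
  case True
  then have "m' x = m x" by (simp add: m'_def m_def E_def axis_max_Suc)
  then show ?thesis by simp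
 next
  case False
  then have "m' x = E (Suc k) x" by (simp add: m'_def m_def E_def axis_max_Suc)
  moreover have "0 <= (E (Suc k) x - m x)^2" by simp
  ultimately show ?thesis by (simp add: power2_diff power2_eq_square algebra_simps)
 qed
 have fixm: "mean_op L ((%_. L)(j := k)) m x = m x" if x: "x \<in> grid L" for x
 proof (rule mean_op_fix[OF x])
  fix i show "((%_. L)(j := k)) i <= L" using Suc.prems by simp
 next
  fix y assume y: "y \<in> cell L ((%_. L)(j := k)) x"
  have "mean_op L ((%_. L)(j := l)) v y = mean_op L ((%_. L)(j := l)) v x" if "l <= k" for l
  proof (rule mean_op_cell)
   show "y \<in> cell L ((%_. L)(j := l)) x"
    using y that unfolding cell_def by (auto intro: same_cell_mono split: if_splits)
  qed
  then show "m y = m x" unfolding m_def axis_max_def by (intro arg_cong[where f = Max] image_cong) auto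
 qed
 have "(\<Sum>x\<in>grid L. m x * E (Suc k) x) = (\<Sum>x\<in>grid L. mean_op L ((%_. L)(j := k)) m x * E (Suc k) x)"
  by (simp add: fixm)
 also have "... = (\<Sum>x\<in>grid L. m x * mean_op L ((%_. L)(j := k)) (E (Suc k)) x)"
  by (rule mean_op_adjoint[symmetric])
 also have "... = (\<Sum>x\<in>grid L. m x * E k x)"
 proof (intro sum.cong refl arg_cong2[of _ _ _ _ "(*)"])
  fix x :: "'a => nat" assume x: "x \<in> grid L"
  have "mean_op L ((%_. L)(j := k)) (E (Suc k)) x
   = mean_op L (%i. min (((%_. L)(j := k)) i) (((%_. L)(j := Suc k)) i)) v x"
   unfolding E_def using Suc.prems by (intro mean_op_comp x) auto
  also have "(%i. min (((%_. L)(j := k)) i) (((%_. L)(j := Suc k)) i)) = (%_. L)(j := k)"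
   using Suc.prems by auto
  finally show "mean_op L ((%_. L)(j := k)) (E (Suc k)) x = E k x" by (simp only: E_def)
 qed
 finally have eq: "(\<Sum>x\<in>grid L. m x * E (Suc k) x) = (\<Sum>x\<in>grid L. m x * E k x)" .
 have "(\<Sum>x\<in>grid L. (m' x)^2)
  <= (\<Sum>x\<in>grid L. (m x)^2 + 2 * (m' x * E (Suc k) x) - 2 * (m x * E (Suc k) x))"
  by (rule sum_mono) (rule pt)
 also have "... = (\<Sum>x\<in>grid L. (m x)^2) + 2 * (\<Sum>x\<in>grid L. m' x * E (Suc k) x)
   - 2 * (\<Sum>x\<in>grid L. m x * E (Suc k) x)"
  by (simp add: sum.distrib sum_subtractf sum_distrib_left)
 also have "... <= 2 * (\<Sum>x\<in>grid L. m' x * E (Suc k) x)" using IH eq by simp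
 finally show ?case by (simp only: m'_def E_def)
qed

lemma sq_norm_axis_max: "sq_norm L (axis_max L j v L) <= 4 * sq_norm L v"
proof -
 define m where "m = axis_max L j v L"
 have fe: "(%_. L)(j := L) = (%_. L)" by auto
 have "sq_norm L m <= 2 * (\<Sum>x\<in>grid L. m x * v x)"
  using axis_max_le_cross[of L L j v] by (simp add: sq_norm_def m_def fe mean_op_top)
 also have "... <= (\<Sum>x\<in>grid L. (m x)^2 / 2 + 2 * (v x)^2)"
  unfolding sum_distrib_left
 proof (rule sum_mono)
  fix x show "2 * (m x * v x) <= (m x)^2 / 2 + 2 * (v x)^2"
   using zero_le_power2[of "m x - 2 * v x"] by (simp add: power2_diff field_simps power2_eq_square)
 qed
 also have "... = sq_norm L m / 2 + 2 * sq_norm L v"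
  by (simp add: sum.distrib sq_norm_def sum_divide_distrib sum_distrib_left)
 finally show ?thesis by (simp add: m_def)
qed

definition strong_max :: "nat => (('n::finite => nat) => real) => ('n => nat) => real" where
 "strong_max L u x = Max ((%n. mean_op L n (%y. \<bar>u y\<bar>) x) ` {n. \<forall>j. n j <= L})"

lemma finite_scales_le: "finite {n :: 'n::finite => nat. \<forall>j. n j <= L}"
proof -
 have "{n :: 'n => nat. \<forall>j. n j <= L} = scales (Suc L)" by (auto simp: scales_def less_Suc_eq_le)
 then show ?thesis by simp
qed

lemma strong_max_ge: "(!!j. n j <= L) ==> mean_op L n (%y. \<bar>u y\<bar>) x <= strong_max L u x"
 unfolding strong_max_def by (rule Max_ge) (use finite_scales_le in auto)

lemma strong_max_ge_abs: "(!!j. n j <= L) ==> \<bar>mean_op L n u x\<bar> <= strong_max L u x"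
 using mean_op_abs strong_max_ge order_trans by blast

lemma strong_max_nonneg: "0 <= strong_max L u x"
 using strong_max_ge_abs[of "%_. L" L u x] by simp

text \<open>The strong maximal function is dominated by the iterated one-dimensional ones, one coordinate at a time.\<close>

lemma sq_norm_strong_max:
 fixes u :: "('n::finite => nat) => real"
 shows "sq_norm L (strong_max L u) <= 4 ^ CARD('n) * sq_norm L u"
proof -
 have "\<exists>w. (\<forall>x. 0 <= w x) \<and>
  (\<forall>n x. (\<forall>j. n j <= L) --> x \<in> grid L --> mean_op L (%j. if j \<in> S then n j else L) (%y. \<bar>u y\<bar>) x <= w x)
  \<and> sq_norm L w <= 4 ^ card S * sq_norm L u" if "finite S" for S :: "'n set"
  using that
 proof (induction S)
  case empty
  show ?case by (rule exI[of _ "%y. \<bar>u y\<bar>"]) (auto simp: mean_op_top sq_norm_def)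
 next
  case (insert j S)
  then obtain w where w: "!!x. 0 <= w x"
   "!!n x. (\<forall>j. n j <= L) ==> x \<in> grid L ==> mean_op L (%j. if j \<in> S then n j else L) (%y. \<bar>u y\<bar>) x <= w x"
   "sq_norm L w <= 4 ^ card S * sq_norm L u" by blast
  have "0 <= axis_max L j w L x" for x
   by (rule order_trans[OF _ axis_max_ge[of 0]]) (use w(1) in \<open>auto intro: mean_op_nonneg\<close>)
  moreover have "mean_op L (%i. if i \<in> insert j S then n i else L) (%y. \<bar>u y\<bar>) x <= axis_max L j w L x"
   if n: "\<forall>j. n j <= L" and x: "x \<in> grid L" for n x
  proof -
   have "(%i. if i \<in> insert j S then n i else L) =
     (%i. min (((%_. L)(j := n j)) i) (if i \<in> S then n i else L))"
    using n insert.hyps by auto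
   then have "mean_op L (%i. if i \<in> insert j S then n i else L) (%y. \<bar>u y\<bar>) x =
     mean_op L ((%_. L)(j := n j)) (mean_op L (%i. if i \<in> S then n i else L) (%y. \<bar>u y\<bar>)) x"
    using n x by (simp add: mean_op_comp)
   also have "... <= mean_op L ((%_. L)(j := n j)) w x"
    by (rule mean_op_mono) (use w(2) n in auto)
   also have "... <= axis_max L j w L x" by (rule axis_max_ge) (use n in auto)
   finally show ?thesis .
  qed
  moreover have "sq_norm L (axis_max L j w L) <= 4 ^ card (insert j S) * sq_norm L u"
   using sq_norm_axis_max[of L j w] w(3) insert.hyps by simp
  ultimately show ?case by blast
 qed
 from this[of UNIV] have "\<exists>w. (\<forall>x. 0 <= w x) \<and>
  (\<forall>n x. (\<forall>j. n j <= L) --> x \<in> grid L --> mean_op L n (%y. \<bar>u y\<bar>) x <= w x)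
  \<and> sq_norm L w <= 4 ^ CARD('n) * sq_norm L u" by simp
 then obtain w where w: "!!x. 0 <= w x"
  "!!n x. (\<forall>j. n j <= L) ==> x \<in> grid L ==> mean_op L n (%y. \<bar>u y\<bar>) x <= w x"
  "sq_norm L w <= 4 ^ CARD('n) * sq_norm L u" by blast
 have "strong_max L u x <= w x" if "x \<in> grid L" for x
  unfolding strong_max_def
 proof (rule Max.boundedI)
  show "finite ((%n. mean_op L n (%y. \<bar>u y\<bar>) x) ` {n. \<forall>j. n j <= L})" using finite_scales_le by blast
  show "(%n. mean_op L n (%y. \<bar>u y\<bar>) x) ` {n. \<forall>j. n j <= L} ~= {}" by auto
 qed (use w(2) that in auto)
 then have "sq_norm L (strong_max L u) <= sq_norm L w"
  unfolding sq_norm_def using strong_max_nonneg by (intro sum_mono power_mono) auto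
 with w(3) show ?thesis by linarith
qed

section \<open>Carleson embedding and the duality estimate\<close>

text \<open>Apply the Carleson condition to the superlevel sets of \<open>g\<close> and integrate over the levels: a set \<open>S i\<close> is contained in
  the superlevel set of every level below \<open>v i\<close>. Peeling off the smallest positive value of \<open>g\<close> makes this an
  induction.\<close>

lemma layer_cake:
 fixes w v :: "'i => real" and g :: "'x => real" and C :: real
 assumes "finite J" "finite X" "!!i. i \<in> J ==> 0 <= w i"
  and "!!i. i \<in> J ==> S i \<subseteq> X" "!!i. i \<in> J ==> S i ~= {}"
  and carl: "!!W. W \<subseteq> X ==> (\<Sum>i\<in>{i \<in> J. S i \<subseteq> W}. w i) <= C * card W"
  and "!!i y. i \<in> J ==> y \<in> S i ==> v i <= g y" "!!y. y \<in> X ==> 0 <= g y"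
 shows "(\<Sum>i\<in>J. w i * v i) <= C * (\<Sum>y\<in>X. g y)"
 using assms(7,8)
proof (induction "card {y \<in> X. 0 < g y}" arbitrary: g v rule: less_induct)
 case less
 define P where "P = {y \<in> X. 0 < g y}"
 have finP: "finite P" using assms(2) by (simp add: P_def)
 have v0: "v i <= 0" if i: "i \<in> J" "\<not> S i \<subseteq> P" for i
 proof -
  from i obtain z where z: "z \<in> S i" "z \<notin> P" by blast
  with assms(4)[OF i(1)] less.prems(2) have "g z = 0" by (force simp: P_def)
  with less.prems(1)[OF i(1) z(1)] show ?thesis by simp
 qed
 show ?case
 proof (cases "P = {}")
  case True
  have "(\<Sum>i\<in>J. w i * v i) <= 0"
   using v0 True assms(3,5) by (intro sum_nonpos mult_nonneg_nonpos) auto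
  moreover have "(\<Sum>y\<in>X. g y) = 0"
   using True less.prems(2) by (intro sum.neutral) (force simp: P_def)
  ultimately show ?thesis by simp
 next
  case False
  define m where "m = Min (g ` P)"
  define g' where "g' = (%y. if y \<in> P then g y - m else g y)"
  define v' where "v' = (%i. if S i \<subseteq> P then v i - m else v i)"
  have m: "m <= g y" if "y \<in> P" for y unfolding m_def using finP that by simp
  have "m \<in> g ` P" unfolding m_def using finP False by (intro Min_in) auto
  then obtain y0 where y0: "y0 \<in> P" "g y0 = m" by auto
  have gn: "0 <= g' y" if "y \<in> X" for y
   using m[of y] less.prems(2)[OF that] by (auto simp: g'_def)
  have vg: "v' i <= g' y" if i: "i \<in> J" "y \<in> S i" for i y
  proof (cases "S i \<subseteq> P")
   case True
   then show ?thesis using less.prems(1)[OF i] i by (auto simp: v'_def g'_def)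
  next
   case False
   then show ?thesis using v0[OF i(1) False] gn[of y] assms(4)[OF i(1)] i(2) by (auto simp: v'_def)
  qed
  have "{y \<in> X. 0 < g' y} \<subset> P" using y0 by (auto simp: g'_def P_def)
  then have "card {y \<in> X. 0 < g' y} < card {y \<in> X. 0 < g y}"
   using finP unfolding P_def by (rule psubset_card_mono[rotated])
  from less.hyps[OF this vg gn] have IH: "(\<Sum>i\<in>J. w i * v' i) <= C * (\<Sum>y\<in>X. g' y)" by simp
  have "(\<Sum>i\<in>J. w i * v i) = (\<Sum>i\<in>J. w i * v' i + (if S i \<subseteq> P then w i * m else 0))"
   by (intro sum.cong) (auto simp: v'_def algebra_simps)
  also have "... = (\<Sum>i\<in>J. w i * v' i) + m * (\<Sum>i\<in>{i \<in> J. S i \<subseteq> P}. w i)"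
   using assms(1) sum.inter_filter[of J "%i. w i * m" "%i. S i \<subseteq> P"]
   by (simp add: sum.distrib mult.commute flip: sum_distrib_left)
  also have "... <= C * (\<Sum>y\<in>X. g' y) + m * (C * card P)"
  proof (rule add_mono[OF IH mult_left_mono])
   show "(\<Sum>i\<in>{i \<in> J. S i \<subseteq> P}. w i) <= C * card P" by (rule carl) (auto simp: P_def)
   show "0 <= m" using y0 by (auto simp: P_def)
  qed
  also have "... = C * (\<Sum>y\<in>X. g y)"
  proof -
   have "(\<Sum>y\<in>X. g y) = (\<Sum>y\<in>X. g' y + (if y \<in> P then m else 0))"
    by (intro sum.cong) (auto simp: g'_def)
   also have "... = (\<Sum>y\<in>X. g' y) + m * card P"
   proof -
    have "X \<inter> P = P" by (auto simp: P_def)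
    then show ?thesis using assms(2) by (simp add: sum.distrib sum.If_cases mult.commute)
   qed
   finally show ?thesis by (simp add: algebra_simps)
  qed
  finally show ?thesis .
 qed
qed

text \<open>The discrete form of the condition defining product BMO, with the weights \<open>w n x\<close> in place of squared coefficients.\<close>

definition carleson :: "nat => ('n::finite => nat) set => (('n => nat) => ('n => nat) => real) => real => bool" where
 "carleson L K w C \<longleftrightarrow>
  (\<forall>W \<subseteq> grid L. (\<Sum>n\<in>K. \<Sum>x\<in>{x \<in> grid L. cell L n x \<subseteq> W}. w n x) <= C * card W)"

lemma carleson_layer_cake:
 fixes w :: "('n::finite => nat) => ('n => nat) => real"
 assumes "finite I" "inj_on \<nu> I" "\<nu> ` I \<subseteq> K" "finite K" "carleson L K w C"
  and w: "!!n x. 0 <= w n x"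
  and v: "!!i x y. i \<in> I ==> x \<in> grid L ==> y \<in> cell L (\<nu> i) x ==> v i x <= g y"
  and g: "!!y. y \<in> grid L ==> 0 <= g y"
 shows "(\<Sum>i\<in>I. \<Sum>x\<in>grid L. w (\<nu> i) x * v i x) <= C * (\<Sum>y\<in>grid L. g y)"
proof -
 have "(\<Sum>p\<in>I \<times> grid L. w (\<nu> (fst p)) (snd p) * v (fst p) (snd p)) <= C * (\<Sum>y\<in>grid L. g y)"
 proof (rule layer_cake[where S = "%p. cell L (\<nu> (fst p)) (snd p)" and X = "grid L" and g = g
    and w = "%p. w (\<nu> (fst p)) (snd p)" and v = "%p. v (fst p) (snd p)"])
  fix W :: "('n => nat) set" assume om: "W \<subseteq> grid L"
  have "{p \<in> I \<times> grid L. cell L (\<nu> (fst p)) (snd p) \<subseteq> W} = Sigma I (%i. {x \<in> grid L. cell L (\<nu> i) x \<subseteq> W})"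
   by auto
  then have "(\<Sum>p\<in>{p \<in> I \<times> grid L. cell L (\<nu> (fst p)) (snd p) \<subseteq> W}. w (\<nu> (fst p)) (snd p)) =
   (\<Sum>i\<in>I. \<Sum>x\<in>{x \<in> grid L. cell L (\<nu> i) x \<subseteq> W}. w (\<nu> i) x)"
   using assms(1) by (simp add: sum.Sigma case_prod_beta)
  also have "... = (\<Sum>n\<in>\<nu> ` I. \<Sum>x\<in>{x \<in> grid L. cell L n x \<subseteq> W}. w n x)"
   using assms(2) by (simp add: sum.reindex)
  also have "... <= (\<Sum>n\<in>K. \<Sum>x\<in>{x \<in> grid L. cell L n x \<subseteq> W}. w n x)"
   using assms(3,4) w by (intro sum_mono2) (auto intro: sum_nonneg)
  also have "... <= C * card W" using assms(5) om by (simp add: carleson_def)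
  finally show "(\<Sum>p\<in>{p \<in> I \<times> grid L. cell L (\<nu> (fst p)) (snd p) \<subseteq> W}. w (\<nu> (fst p)) (snd p)) <= C * card W" .
 next
  fix p assume p: "p \<in> I \<times> (grid L :: ('n => nat) set)"
  show "cell L (\<nu> (fst p)) (snd p) \<subseteq> grid L" by (rule cell_subset_grid)
  show "cell L (\<nu> (fst p)) (snd p) ~= {}" using cell_refl[of "snd p" L "\<nu> (fst p)"] p by (metis SigmaE empty_iff snd_conv)
  show "v (fst p) (snd p) <= g y" if "y \<in> cell L (\<nu> (fst p)) (snd p)" for y
   using v[OF _ _ that] p by auto
 qed (use assms(1) w g in auto)
 then show ?thesis by (simp add: sum.cartesian_product case_prod_beta)
qed

text \<open>Layer cake with \<open>g\<close> the square of the strong maximal function.\<close>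

lemma carleson_embedding:
 fixes u :: "('n::finite => nat) => real"
 assumes "finite K" "!!n j. n \<in> K ==> n j <= L" "carleson L K w C" "!!n x. 0 <= w n x" "0 <= C"
 shows "(\<Sum>n\<in>K. \<Sum>x\<in>grid L. w n x * (mean_op L n u x)^2) <= C * (4 ^ CARD('n) * sq_norm L u)"
proof -
 have "(\<Sum>n\<in>K. \<Sum>x\<in>grid L. w n x * (mean_op L n u x)^2) <= C * (\<Sum>y\<in>grid L. (strong_max L u y)^2)"
 proof (rule carleson_layer_cake[where \<nu> = "%n. n" and K = K])
  fix n x y assume n: "n \<in> K" "x \<in> grid L" "y \<in> cell L n x"
  have "mean_op L n u x = mean_op L n u y" using n(3) by (rule mean_op_cell[symmetric])
  moreover have "\<bar>mean_op L n u y\<bar> <= strong_max L u y" using assms(2)[OF n(1)] by (rule strong_max_ge_abs)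
  ultimately show "(mean_op L n u x)^2 <= (strong_max L u y)^2"
   using abs_le_square_iff strong_max_nonneg[of L u y] by fastforce
 qed (use assms in auto)
 also have "... <= C * (4 ^ CARD('n) * sq_norm L u)"
  using sq_norm_strong_max[of L u] assms(5) by (intro mult_left_mono) (auto simp: sq_norm_def)
 finally show ?thesis .
qed

lemma mean_op_jensen:
 assumes "x \<in> grid L" "!!j. n j <= L" "!!y. y \<in> cell L n x ==> 0 < u y"
 shows "1 / (mean_op L n u x)^2 <= mean_op L n (%y. 1 / (u y)^2) x"
proof -
 define m where "m = mean_op L n u x"
 have m: "m > 0" unfolding m_def using assms by (rule mean_op_pos)
 have key: "(3 - 2 * t) <= 1 / t\<^sup>2" if "t > 0" for t :: real
 proof -
  have "0 <= (t - 1)^2 * (2 * t + 1)" using that by simp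
  also have "... = 1 - (3 - 2 * t) * t\<^sup>2" by (simp add: power2_eq_square algebra_simps)
  finally show ?thesis using that by (simp add: field_simps)
 qed
 have "mean_op L n (%y. 3 / m\<^sup>2 - (2 / m ^ 3) * u y) x <= mean_op L n (%y. 1 / (u y)^2) x"
 proof (rule mean_op_mono_cell)
  fix y assume y: "y \<in> cell L n x"
  have "(3 - 2 * (u y / m)) / m\<^sup>2 <= (1 / (u y / m)^2) / m\<^sup>2"
   using key[of "u y / m"] assms(3)[OF y] m by (intro divide_right_mono) auto
  also have "(1 / (u y / m)^2) / m\<^sup>2 = 1 / (u y)^2" using m by (simp add: power_divide)
  also have "(3 - 2 * (u y / m)) / m\<^sup>2 = 3 / m\<^sup>2 - (2 / m ^ 3) * u y"
   using m by (simp add: diff_divide_distrib power2_eq_square power3_eq_cube)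
  finally show "3 / m\<^sup>2 - (2 / m ^ 3) * u y <= 1 / (u y)^2" .
 qed
 moreover have "mean_op L n (%y. 3 / m\<^sup>2 - (2 / m ^ 3) * u y) x = 3 / m\<^sup>2 - (2 / m ^ 3) * m"
 proof -
  have c: "mean_op L n (%_. 3 / m\<^sup>2) x = 3 / m\<^sup>2" using assms(1,2) by (simp add: mean_op_const)
  show ?thesis using c m_def[symmetric] unfolding mean_op_def ker_op_diff ker_op_cmult by (simp only:)
 qed
 moreover have "3 / m\<^sup>2 - (2 / m ^ 3) * m = 1 / m\<^sup>2" using m by (simp add: field_simps power2_eq_square power3_eq_cube)
 ultimately show ?thesis by (simp add: m_def)
qed

text \<open>The pairing of product BMO with product \<open>H\<^sup>1\<close>, where \<open>S\<close> dominates the square function. Write the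
  summand as a product with the mean of \<open>sqrt S\<close>: the first factor is controlled by the Carleson embedding, the
  second by Jensen's inequality for \<open>1 / u\<^sup>2\<close>.\<close>

lemma carleson_duality:
 fixes S :: "('n::finite => nat) => real"
 assumes K: "finite K" "!!n j. n \<in> K ==> n j <= L"
  and carl: "carleson L K (%n x. (m n x)^2) (B\<^sup>2)" and B: "0 <= B"
  and m: "!!n x. 0 <= m n x" and c: "!!n x. 0 <= c n x"
  and cc: "!!n x y. n \<in> K ==> x \<in> grid L ==> y \<in> cell L n x ==> c n y = c n x"
  and S: "!!x. 0 <= S x" and cS: "!!x. x \<in> grid L ==> (\<Sum>n\<in>K. (c n x)^2) <= (S x)^2"
 shows "(\<Sum>n\<in>K. \<Sum>x\<in>grid L. m n x * c n x) <= 2 ^ CARD('n) * B * (\<Sum>x\<in>grid L. S x)"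
proof -
 define u where "u = (%x. sqrt (S x))"
 define E where "E = (%n x. mean_op L n u x)"
 define I where "I = (\<Sum>x\<in>grid L. S x)"
 have I: "0 <= I" unfolding I_def using S by (simp add: sum_nonneg)
 have cS1: "(c n x)^2 <= (S x)^2" if "n \<in> K" "x \<in> grid L" for n x
  using cS[OF that(2)] member_le_sum[of n K "%n. (c n x)^2"] K(1) that(1) by auto
 have pos: "0 < u y" if n: "n \<in> K" "x \<in> grid L" "c n x ~= 0" "y \<in> cell L n x" for n x y
 proof -
  have "y \<in> grid L" using n(4) cell_subset_grid by blast
  then have "(c n x)^2 <= (S y)^2" using cS1[OF n(1)] cc[OF n(1,2,4)] by metis
  moreover have "0 < (c n x)\<^sup>2" using n(3) by simp
  ultimately have "S y ~= 0" by auto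
  then show ?thesis using S[of y] by (simp add: u_def)
 qed
 have Epos: "0 < E n x" if n: "n \<in> K" "x \<in> grid L" "c n x ~= 0" for n x
  unfolding E_def using K(2)[OF n(1)] pos[OF n] by (intro mean_op_pos n(2)) auto
 have split: "m n x * c n x = (m n x * E n x) * (c n x / E n x)" if "n \<in> K" "x \<in> grid L" for n x
  using Epos[OF that] by (cases "c n x = 0") auto
 have T1: "(\<Sum>n\<in>K. \<Sum>x\<in>grid L. (m n x * E n x)^2) <= B\<^sup>2 * (4 ^ CARD('n) * I)"
 proof -
  have "sq_norm L u = I" unfolding sq_norm_def I_def u_def using S by simp
  then show ?thesis
   using carleson_embedding[where K = K and L = L and w = "%n x. (m n x)^2" and C = "B\<^sup>2" and u = u] K carl
   by (simp add: E_def power_mult_distrib)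
 qed
 have T2: "(\<Sum>n\<in>K. \<Sum>x\<in>grid L. (c n x / E n x)^2) <= I"
 proof -
  have "(\<Sum>x\<in>grid L. (c n x / E n x)^2) <= (\<Sum>x\<in>grid L. (c n x)^2 / S x)" if n: "n \<in> K" for n
  proof -
   have "(\<Sum>x\<in>grid L. (c n x / E n x)^2) <= (\<Sum>x\<in>grid L. (c n x)^2 * mean_op L n (%y. 1 / S y) x)"
   proof (rule sum_mono)
    fix x :: "'n => nat" assume x: "x \<in> grid L"
    show "(c n x / E n x)^2 <= (c n x)^2 * mean_op L n (%y. 1 / S y) x"
    proof (cases "c n x = 0")
     case False
     have "1 / (E n x)^2 <= mean_op L n (%y. 1 / (u y)^2) x"
      unfolding E_def using K(2)[OF n] pos[OF n x False] by (intro mean_op_jensen x) auto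
     also have "(%y. 1 / (u y)^2) = (%y. 1 / S y)" using S by (auto simp: u_def)
     finally show ?thesis using mult_left_mono[of "1 / (E n x)^2" _ "(c n x)^2"] by (simp add: power_divide)
    qed simp
   qed
   also have "... = (\<Sum>x\<in>grid L. mean_op L n (%x. (c n x)^2) x * (1 / S x))" by (rule mean_op_adjoint)
   also have "... = (\<Sum>x\<in>grid L. (c n x)^2 * (1 / S x))"
    using K(2)[OF n] cc[OF n] by (intro sum.cong refl arg_cong2[of _ _ _ _ "(*)"] mean_op_fix) auto
   finally show ?thesis by simp
  qed
  then have "(\<Sum>n\<in>K. \<Sum>x\<in>grid L. (c n x / E n x)^2) <= (\<Sum>n\<in>K. \<Sum>x\<in>grid L. (c n x)^2 / S x)"
   by (rule sum_mono)
  also have "... = (\<Sum>x\<in>grid L. (\<Sum>n\<in>K. (c n x)^2) / S x)"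
   by (subst sum.swap) (simp add: sum_divide_distrib)
  also have "... <= I" unfolding I_def
  proof (rule sum_mono)
   fix x :: "'n => nat" assume x: "x \<in> grid L"
   show "(\<Sum>n\<in>K. (c n x)^2) / S x <= S x"
   proof (cases "S x = 0")
    case False
    with S[of x] have "0 < S x" by simp
    then show ?thesis using cS[OF x] by (simp add: divide_le_eq power2_eq_square)
   qed simp
  qed
  finally show ?thesis .
 qed
 define \<Sigma> where "\<Sigma> = (\<Sum>n\<in>K. \<Sum>x\<in>grid L. m n x * c n x)"
 have "\<Sigma> = (\<Sum>p\<in>K \<times> grid L. (m (fst p) (snd p) * E (fst p) (snd p)) * (c (fst p) (snd p) / E (fst p) (snd p)))"
  unfolding \<Sigma>_def sum.cartesian_product case_prod_beta
 proof (rule sum.cong[OF refl])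
  fix p assume "p \<in> K \<times> (grid L :: ('n => nat) set)"
  then have "fst p \<in> K" "snd p \<in> grid L" by auto
  then show "m (fst p) (snd p) * c (fst p) (snd p) =
    (m (fst p) (snd p) * E (fst p) (snd p)) * (c (fst p) (snd p) / E (fst p) (snd p))" by (rule split)
 qed
 then have "\<Sigma>\<^sup>2 <= (\<Sum>p\<in>K \<times> grid L. (m (fst p) (snd p) * E (fst p) (snd p))^2) *
   (\<Sum>p\<in>K \<times> grid L. (c (fst p) (snd p) / E (fst p) (snd p))^2)"
  by (simp only: Cauchy_Schwarz_ineq_sum)
 also have "... = (\<Sum>n\<in>K. \<Sum>x\<in>grid L. (m n x * E n x)^2) * (\<Sum>n\<in>K. \<Sum>x\<in>grid L. (c n x / E n x)^2)"
  by (simp add: sum.cartesian_product case_prod_beta)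
 also have "... <= (B\<^sup>2 * (4 ^ CARD('n) * I)) * I"
  using T1 T2 I by (intro mult_mono) (auto intro!: sum_nonneg)
 also have "... = (2 ^ CARD('n) * B * I)^2"
 proof -
  have "(4::real) ^ CARD('n) = (2 ^ CARD('n))^2" by (simp add: power2_eq_square flip: power_mult_distrib)
  then show ?thesis by (simp add: power2_eq_square)
 qed
 finally have sq: "\<Sigma>\<^sup>2 <= (2 ^ CARD('n) * B * I)^2" .
 have "0 <= 2 ^ CARD('n) * B * I" using B I by simp
 with sq have "\<Sigma> <= 2 ^ CARD('n) * B * I" by (rule power2_le_imp_le)
 then show ?thesis by (simp add: \<Sigma>_def I_def)
qed

section \<open>Bessel's inequality for differences\<close>

lemma diff_ker_sym: "diff_ker L k s t = diff_ker L k t s"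
 by (simp add: diff_ker_def mean_ker_sym[of L k s t])

lemma diff_ker_comp:
 assumes "k < L" "l < L" "s < 2 ^ L"
 shows "(\<Sum>u<2 ^ L. diff_ker L k s u * diff_ker L l u t) = (if k = l then diff_ker L k s t else 0)"
proof (cases "k = l")
 case True
 have h: "haar_like L k (%u. diff_ker L k u t)" by (rule haar_like_diff_ker)
 have "(\<Sum>u<2 ^ L. diff_ker L k s u * diff_ker L k u t) =
  (\<Sum>u<2 ^ L. mean_ker L (Suc k) s u * diff_ker L k u t) - (\<Sum>u<2 ^ L. mean_ker L k s u * diff_ker L k u t)"
  unfolding diff_ker_eq[OF assms(1), of s] by (simp add: left_diff_distrib sum_subtractf)
 also have "... = diff_ker L k s t"
  using mean_of_haar_like[OF _ assms(1) h, of k s]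
   mean_of_cell_const[OF _ _ haar_like_cell_const[OF h lessI], of "Suc k" s] assms by simp
 finally show ?thesis using True by simp
next
 case False
 have "haar_like L k (%u. diff_ker L k s u)" using haar_like_diff_ker[of L k s] by (simp add: diff_ker_sym[of L k s])
 from sum_haar_like_orth[OF this haar_like_diff_ker False assms(1,2)] False show ?thesis by simp
qed

definition partial_diff :: "nat => 'n::finite set => ('n => nat) => (('n => nat) => real) => ('n => nat) => real" where
 "partial_diff L A q = ker_op L (%j. if j \<in> A then diff_ker L (q j) else mean_ker L L)"

definition partial_scales :: "nat => 'n::finite set => ('n => nat) set" where
 "partial_scales L A = {q. \<forall>j. if j \<in> A then q j < L else q j = 0}"

lemma finite_partial_scales [simp]: "finite (partial_scales L (A :: 'n::finite set))"
proof -
 have "partial_scales L A \<subseteq> scales (Suc L)"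
  unfolding partial_scales_def scales_def by (auto split: if_splits) (metis less_SucI zero_less_Suc)
 then show ?thesis by (rule finite_subset) simp
qed

lemma partial_diff_comp:
 assumes "q \<in> partial_scales L A" "q' \<in> partial_scales L A" "x \<in> grid L"
 shows "partial_diff L A q (partial_diff L A q' f) x = (if q = q' then partial_diff L A q f x else 0)"
proof -
 have q: "q j < L" "q' j < L" if "j \<in> A" for j
  using assms(1,2) that by (auto simp: partial_scales_def dest: spec[of _ j])
 have m: "(\<Sum>u<2 ^ L. mean_ker L L s u * mean_ker L L u t) = mean_ker L L s t" if "s < 2 ^ L" "t < 2 ^ L" for s t
  using mean_ker_comp[of L L L s t] that by simp
 show ?thesis
 proof (cases "q = q'")
  case True
  then show ?thesis unfolding partial_diff_def ker_op_ker_op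
   by (simp, intro ker_op_cong) (use q gridD[OF assms(3)] m in \<open>auto simp: diff_ker_comp\<close>)
 next
  case False
  then obtain j where j: "q j ~= q' j" by auto
  have jA: "j \<in> A"
  proof (rule ccontr)
   assume "j \<notin> A"
   then have "q j = 0" "q' j = 0" using assms(1,2) by (auto simp: partial_scales_def)
   with j show False by simp
  qed
  have "partial_diff L A q (partial_diff L A q' f) x = 0"
   unfolding partial_diff_def ker_op_ker_op
   by (rule ker_op_eq_0[of _ _ j]) (use q[OF jA] gridD[OF assms(3)] j jA in \<open>auto simp: diff_ker_comp\<close>)
  with False show ?thesis by simp
 qed
qed

lemma partial_diff_adjoint:
 "(\<Sum>x\<in>grid L. f x * partial_diff L A q g x) = (\<Sum>x\<in>grid L. partial_diff L A q f x * g x)"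
 unfolding partial_diff_def
proof (rule ker_op_adjoint)
 fix j s t
 show "(if j \<in> A then diff_ker L (q j) else mean_ker L L) s t = (if j \<in> A then diff_ker L (q j) else mean_ker L L) t s"
  using diff_ker_sym mean_ker_sym by auto
qed

text \<open>The differences in the coordinates of \<open>A\<close> are orthogonal projections with mutually orthogonal ranges.\<close>

lemma bessel:
 "(\<Sum>q\<in>partial_scales L A. sq_norm L (partial_diff L A q f)) <= sq_norm L f"
proof -
 define P where "P = (%q. partial_diff L A q f)"
 define s where "s = (%x. \<Sum>q\<in>partial_scales L A. P q x)"
 define T where "T = (\<Sum>q\<in>partial_scales L A. sq_norm L (P q))"
 have in_: "(\<Sum>x\<in>grid L. P q x * P q' x) = (if q = q' then \<Sum>x\<in>grid L. f x * P q x else 0)"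
  if "q \<in> partial_scales L A" "q' \<in> partial_scales L A" for q q'
 proof -
  have "(\<Sum>x\<in>grid L. P q x * P q' x) = (\<Sum>x\<in>grid L. f x * partial_diff L A q (P q') x)"
   unfolding P_def by (rule partial_diff_adjoint[symmetric])
  also have "... = (\<Sum>x\<in>grid L. if q = q' then f x * P q x else 0)"
   unfolding P_def by (intro sum.cong refl) (simp add: partial_diff_comp[OF that])
  finally show ?thesis by simp
 qed
 have T: "T = (\<Sum>x\<in>grid L. f x * s x)"
 proof -
  have "T = (\<Sum>q\<in>partial_scales L A. \<Sum>x\<in>grid L. f x * P q x)"
   unfolding T_def sq_norm_def power2_eq_square by (rule sum.cong[OF refl]) (use in_ in auto)
  then show ?thesis unfolding s_def sum_distrib_left by (subst (asm) sum.swap) simp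
 qed
 have "sq_norm L s = (\<Sum>q\<in>partial_scales L A. \<Sum>q'\<in>partial_scales L A. \<Sum>x\<in>grid L. P q x * P q' x)"
  unfolding sq_norm_def s_def power2_eq_square sum_product
  by (subst sum.swap, rule sum.cong[OF refl], rule sum.swap)
 also have "... = (\<Sum>q\<in>partial_scales L A. \<Sum>x\<in>grid L. f x * P q x)"
 proof (rule sum.cong[OF refl])
  fix q assume q: "q \<in> partial_scales L A"
  have "(\<Sum>q'\<in>partial_scales L A. \<Sum>x\<in>grid L. P q x * P q' x)
   = (\<Sum>q'\<in>partial_scales L A. if q = q' then \<Sum>x\<in>grid L. f x * P q x else 0)"
   by (rule sum.cong[OF refl]) (rule in_[OF q])
  then show "(\<Sum>q'\<in>partial_scales L A. \<Sum>x\<in>grid L. P q x * P q' x) = (\<Sum>x\<in>grid L. f x * P q x)"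
   using q by simp
 qed
 also have "... = T" unfolding T s_def sum_distrib_left by (rule sum.swap)
 finally have s: "sq_norm L s = T" .
 have "0 <= (\<Sum>x\<in>grid L. (f x - s x)^2)" by (simp add: sum_nonneg)
 also have "... = sq_norm L f + sq_norm L s - 2 * T"
  unfolding T sq_norm_def by (simp add: power2_diff sum.distrib sum_subtractf sum_distrib_left mult_ac)
 finally show ?thesis using s by (simp add: T_def P_def)
qed

section \<open>The four-linear estimate\<close>

text \<open>The three terms of the discrete product rule at scale \<open>k\<close>: the difference falls on \<open>f\<close>, on \<open>b\<close>, or on both.\<close>

datatype mode = Diff_Mean | Osc_Diff | Diff_Diff

lemma UNIV_mode: "(UNIV :: mode set) = {Diff_Mean, Osc_Diff, Diff_Diff}"
 using mode.exhaust by auto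

instance mode :: finite
 by standard (simp add: UNIV_mode)

text \<open>Outside \<open>Z\<close> nothing is telescoped: there \<open>f\<close> carries a Haar coefficient and \<open>b\<close> a mean at the scale of the
  rectangle, which is what \<open>Diff_Mean\<close> looks like up to a sign.\<close>

definition fker :: "nat => 'n set => ('n => mode) => ('n => nat) => 'n => nat => nat => real" where
 "fker L Z t k j = (if j \<notin> Z then coeff_ker L (k j)
  else if t j = Osc_Diff then osc_ker L (k j) else diff_ker L (k j))"

definition bker :: "nat => 'n set => ('n => mode) => ('n => nat) => 'n => nat => nat => real" where
 "bker L Z t k j = (if j \<notin> Z \<or> t j = Diff_Mean then mean_ker L (k j) else diff_ker L (k j))"

definition gker :: "nat => 'n set => ('n => mode) => ('n => nat) => 'n => nat => nat => nat => real" where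
 "gker L Z t k j s y z = fker L Z t k j s y * bker L Z t k j s z"

text \<open>The increments of \<open>osc_ker\<close> and \<open>mean_ker\<close> are both \<open>diff_ker\<close>.\<close>

lemma product_telescope:
 assumes "n <= L"
 shows "osc_ker L n s y * mean_ker L n s z =
  (\<Sum>k<n. diff_ker L k s y * mean_ker L k s z + osc_ker L k s y * diff_ker L k s z
    + diff_ker L k s y * diff_ker L k s z)"
 using assms
proof (induction n)
 case 0 then show ?case by (simp add: osc_ker_def)
next
 case (Suc n)
 have 1: "osc_ker L (Suc n) s y = osc_ker L n s y + diff_ker L n s y" by (simp add: osc_ker_def)
 have 2: "mean_ker L (Suc n) s z = mean_ker L n s z + diff_ker L n s z" using Suc.prems by (simp add: diff_ker_eq)
 show ?case using Suc unfolding 1 2 by (simp add: algebra_simps)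
qed

lemma product_expansion:
 assumes n: "n \<in> scales L"
 shows "ker_op L (%j. if j \<in> Z then osc_ker L (n j) else coeff_ker L (n j)) f x * mean_op L n b x =
  (\<Sum>t\<in>PiE UNIV (%j. if j \<in> Z then UNIV else {Diff_Mean}).
   \<Sum>k\<in>PiE UNIV (%j. if j \<in> Z then {..<n j} else {n j}). ker_op2 L (gker L Z t k) f b x)"
proof -
 define I where "I = (%j. if j \<in> Z then UNIV else {Diff_Mean})"
 define J where "J = (%j. if j \<in> Z then {..<n j} else {n j})"
 define g where "g = (%j m k. gker L Z (%_. m) (%_. k) j)"
 have "ker_op L (%j. if j \<in> Z then osc_ker L (n j) else coeff_ker L (n j)) f x * mean_op L n b x =
  ker_op2 L (%j s y z. \<Sum>m\<in>I j. \<Sum>k\<in>J j. g j m k s y z) f b x"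
  unfolding mean_op_def ker_op_mult
 proof (rule ker_op2_cong)
  fix j y z
  show "(if j \<in> Z then osc_ker L (n j) else coeff_ker L (n j)) (x j) y * mean_ker L (n j) (x j) z
   = (\<Sum>m\<in>I j. \<Sum>k\<in>J j. g j m k (x j) y z)"
  proof (cases "j \<in> Z")
   case True
   then show ?thesis using n product_telescope[of "n j" L "x j" y z]
    by (simp add: I_def J_def g_def gker_def fker_def bker_def UNIV_mode sum.distrib scales_def less_imp_le add_ac)
  next
   case False
   then show ?thesis by (simp add: I_def J_def g_def gker_def fker_def bker_def)
  qed
 qed
 also have "... = (\<Sum>t\<in>PiE UNIV I. ker_op2 L (%j s y z. \<Sum>k\<in>J j. g j (t j) k s y z) f b x)"
  by (rule ker_op2_sum_kernels[where I = I and \<gamma> = "%j m s y z. \<Sum>k\<in>J j. g j m k s y z"]) (auto simp: I_def)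
 also have "... = (\<Sum>t\<in>PiE UNIV I. \<Sum>k\<in>PiE UNIV J. ker_op2 L (%j s y z. g j (t j) (k j) s y z) f b x)"
  by (intro sum.cong refl ker_op2_sum_kernels) (auto simp: J_def)
 also have "... = (\<Sum>t\<in>PiE UNIV I. \<Sum>k\<in>PiE UNIV J. ker_op2 L (gker L Z t k) f b x)"
  by (intro sum.cong refl ker_op2_cong) (simp add: g_def gker_def fker_def bker_def)
 finally show ?thesis by (simp only: I_def J_def)
qed

lemma cell_const_osc_ker: "k <= L ==> k <= l ==> cell_const L l (%s. osc_ker L k s t)"
 unfolding osc_ker_eq by (intro cell_const_diff cell_const_mean_ker) auto

lemma cell_const_coeff_ker: "k <= l ==> cell_const L l (%s. coeff_ker L k s t)"
 unfolding coeff_ker_def by (intro cell_const_mult cell_const_mean_ker cell_const_const)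

lemma gker_haar_like:
 assumes "j \<in> Z" "t j ~= Diff_Diff" "k j < L"
 shows "haar_like L (k j) (%s. gker L Z t k j s y z)"
proof (cases "t j")
 case Diff_Mean
 then show ?thesis unfolding gker_def fker_def bker_def using assms
  by (simp add: haar_like_mult haar_like_diff_ker cell_const_mean_ker)
next
 case Osc_Diff
 have "haar_like L (k j) (%s. diff_ker L (k j) s z * osc_ker L (k j) s y)"
  using assms by (intro haar_like_mult haar_like_diff_ker cell_const_osc_ker) auto
 then show ?thesis unfolding gker_def fker_def bker_def using assms Osc_Diff by (simp add: mult.commute)
qed (use assms in simp)

lemma gker_cell_const:
 assumes "k j < L" "if j \<in> Z then k j < l else k j <= l"
 shows "cell_const L l (%s. gker L Z t k j s y z)"
proof (cases "j \<in> Z \<and> t j ~= Diff_Diff")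
 case True
 then show ?thesis using gker_haar_like[of j Z t k L y z] assms by (intro haar_like_cell_const[of L "k j"]) auto
next
 case False
 then show ?thesis
 proof (cases "j \<in> Z")
  case True
  then have t: "t j = Diff_Diff" using False by simp
  have "cell_const L l (%s. diff_ker L (k j) s y * diff_ker L (k j) s z)"
   using assms True by (intro cell_const_mult haar_like_cell_const[OF haar_like_diff_ker]) auto
  then show ?thesis unfolding gker_def fker_def bker_def using True t by simp
 next
  case False
  have "cell_const L l (%s. coeff_ker L (k j) s y * mean_ker L (k j) s z)"
   using assms False by (intro cell_const_mult cell_const_coeff_ker cell_const_mean_ker) auto
  then show ?thesis unfolding gker_def fker_def bker_def using False by simp
 qed
qed

lemma mean_op_bilinear:
 assumes k: "k \<in> scales L" and n: "n \<in> scales L" and x: "x \<in> grid L"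
  and C: "!!j. j \<in> Z ==> t j = Diff_Diff ==> k j < n j"
 shows "mean_op L (%j. if j \<in> Z then n j else L) (ker_op2 L (gker L Z t k) f b) x =
  (if \<forall>j\<in>Z. k j < n j then ker_op2 L (gker L Z t k) f b x else 0)"
proof (cases "\<forall>j\<in>Z. k j < n j")
 case True
 have "(\<Sum>u<2 ^ L. mean_ker L (if j \<in> Z then n j else L) (x j) u * gker L Z t k j u y z) = gker L Z t k j (x j) y z" for j y z
 proof (rule mean_of_cell_const[OF le_refl])
  show "(if j \<in> Z then n j else L) <= L" using scalesD[OF n, of j] by simp
  show "cell_const L (if j \<in> Z then n j else L) (%u. gker L Z t k j u y z)"
   using scalesD[OF k, of j] True by (intro gker_cell_const) auto
 qed (rule gridD[OF x])
 then show ?thesis using True unfolding mean_op_def ker_op_ker_op2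
  by (simp) (rule ker_op2_cong, simp)
next
 case False
 then obtain i where i: "i \<in> Z" "n i <= k i" by (meson not_le)
 have "(\<Sum>u<2 ^ L. mean_ker L (n i) (x i) u * gker L Z t k i u y z) = 0" for y z
  using i scalesD[OF k, of i] C[OF i(1)] by (intro mean_of_haar_like[of "n i" "k i"] gker_haar_like) auto
 then have "mean_op L (%j. if j \<in> Z then n j else L) (ker_op2 L (gker L Z t k) f b) x = 0"
  unfolding mean_op_def ker_op_ker_op2 using i by (intro ker_op2_eq_0[of _ _ i]) simp
 then show ?thesis unfolding if_not_P[OF False] .
qed

text \<open>If exactly one factor is differenced at scale \<open>k j\<close>, the product is Haar-like in coordinate \<open>j\<close>. If both are
  differenced it is constant on the cells instead, and orthogonality over \<open>k j\<close> is lost.\<close>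

lemma bilinear_orth:
 assumes k: "k \<in> scales L" "k' \<in> scales L" and j: "j \<in> Z" "t j ~= Diff_Diff" "k j ~= k' j"
 shows "(\<Sum>x\<in>grid L. ker_op2 L (gker L Z t k) f b x * ker_op2 L (gker L Z t k') f b x) = 0"
proof (rule ker_op2_orth[where i = j])
 fix y z y' z'
 show "(\<Sum>s<2 ^ L. gker L Z t k j s y z * gker L Z t k' j s y' z') = 0"
 proof (rule sum_haar_like_orth[where k = "k j" and l = "k' j"])
  show "haar_like L (k j) (%s. gker L Z t k j s y z)" "haar_like L (k' j) (%s. gker L Z t k' j s y' z')"
   using j(1,2) k[THEN scalesD] by (auto intro: gker_haar_like)
 qed (use j k[THEN scalesD] in auto)
qed

lemma sq_norm_orth_sum:
 assumes "finite I" "!!i i'. i \<in> I ==> i' \<in> I ==> i ~= i' ==> (\<Sum>x\<in>grid L. g i x * g i' x) = 0"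
 shows "sq_norm L (%x. \<Sum>i\<in>I. g i x) = (\<Sum>i\<in>I. sq_norm L (g i))"
proof -
 have "sq_norm L (%x. \<Sum>i\<in>I. g i x) = (\<Sum>i\<in>I. \<Sum>i'\<in>I. \<Sum>x\<in>grid L. g i x * g i' x)"
  unfolding sq_norm_def power2_eq_square sum_product
  by (subst sum.swap, rule sum.cong[OF refl], rule sum.swap)
 also have "... = (\<Sum>i\<in>I. sq_norm L (g i))"
 proof (rule sum.cong[OF refl])
  fix i assume i: "i \<in> I"
  have "(\<Sum>i'\<in>I. \<Sum>x\<in>grid L. g i x * g i' x) = (\<Sum>i'\<in>I. if i = i' then sq_norm L (g i) else 0)"
   by (rule sum.cong[OF refl]) (use assms(2)[OF i] in \<open>auto simp: sq_norm_def power2_eq_square\<close>)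
  then show "(\<Sum>i'\<in>I. \<Sum>x\<in>grid L. g i x * g i' x) = sq_norm L (g i)" using i assms(1) by simp
 qed
 finally show ?thesis .
qed

definition coeff_op :: "nat => ('n::finite => nat) => (('n => nat) => real) => ('n => nat) => real" where
 "coeff_op L n = ker_op L (%j. coeff_ker L (n j))"

lemma coeff_op_cell: "x \<in> grid L ==> y \<in> cell L n x ==> coeff_op L n f y = coeff_op L n f x"
proof -
 assume x: "x \<in> grid L" and y: "y \<in> cell L n x"
 have "coeff_ker L (n j) (y j) t = coeff_ker L (n j) (x j) t" for j t
  using cell_constD[OF cell_const_coeff_ker[OF le_refl, of L "n j" t], of "y j" "x j"] x y
  by (auto simp: cell_def grid_def same_cell_sym)
 then show ?thesis unfolding coeff_op_def by (intro ker_op_cong) simp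
qed

text \<open>One block of the expansion. With the scales in \<open>D\<close> frozen, the means of \<open>v\<close> run only over the remaining coordinates, so the layer cake
  applies to a family of scales indexed by those alone.\<close>

lemma frozen_embedding:
 fixes f b :: "('n::finite => nat) => real"
 assumes carl: "carleson L (scales L) (%n x. (coeff_op L n f x)^2) (F\<^sup>2)"
  and D: "D = {j \<in> Z. t j ~= Diff_Mean}" and B: "B = {j \<in> Z. t j = Osc_Diff}"
  and q: "q \<in> partial_scales L D"
  and l: "!!j. j \<in> B ==> l j < L"
 shows "(\<Sum>k\<in>{k \<in> scales L. (%j. if j \<in> D then k j else 0) = q}. \<Sum>x\<in>grid L.
   (coeff_op L (%j. if j \<in> B then l j else k j) f x)^2 *
   (mean_op L (%j. if j \<in> D then L else k j) v x)^2) <= F\<^sup>2 * (4 ^ CARD('n) * sq_norm L v)"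
proof -
 define K where "K = {k \<in> scales L. (%j. if j \<in> D then k j else 0) = q}"
 define \<nu> where "\<nu> = (%k j. if j \<in> B then l j else k j :: nat)"
 define kA where "kA = (%k j. if j \<in> D then L else k j)"
 define \<psi> where "\<psi> = (%k x. (mean_op L (kA k) v x)^2)"
 define nD where "nD = (%j. if j \<in> D then (if j \<in> B then l j else q j) else L)"
 define g where "g = mean_op L nD (%x. (strong_max L v x)^2)"
 have BD: "B \<subseteq> D" unfolding B D by auto
 have Kq: "k j = q j" if "k \<in> K" "j \<in> D" for k j using that by (auto simp: K_def)
 have Ks: "k j < L" if "k \<in> K" for k j using that by (auto simp: K_def scales_def)
 have qL: "q j < L" if "j \<in> D" for j using q that unfolding partial_scales_def by (auto dest: spec[of _ j])
 have \<nu>s: "\<nu> k j < L" if "k \<in> K" for k j using Ks[OF that] l by (simp add: \<nu>_def)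
 have nDL: "nD j <= L" for j using l[of j] qL[of j] BD by (auto simp: nD_def)
 have kAL: "kA k j <= L" if "k \<in> K" for k j using Ks[OF that, of j] by (simp add: kA_def)
 have \<nu>min: "\<nu> k = (%j. min (nD j) (kA k j))" if k: "k \<in> K" for k
 proof
  fix j
  show "\<nu> k j = min (nD j) (kA k j)"
   using Kq[OF k, of j] Ks[OF k, of j] l[of j] qL[of j] BD by (auto simp: \<nu>_def nD_def kA_def)
 qed
 have inj: "inj_on \<nu> K"
 proof (rule inj_onI)
  fix k k' assume k: "k \<in> K" "k' \<in> K" and e: "\<nu> k = \<nu> k'"
  show "k = k'"
  proof
   fix j show "k j = k' j"
    using Kq[OF k(1), of j] Kq[OF k(2), of j] fun_cong[OF e, of j] BD by (cases "j \<in> D") (auto simp: \<nu>_def split: if_splits)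
  qed
 qed
 have \<psi>fix: "mean_op L (kA k) (\<psi> k) y = \<psi> k y" if k: "k \<in> K" and y: "y \<in> grid L" for k y
  by (rule mean_op_fix[OF y]) (use kAL[OF k] in \<open>auto simp: \<psi>_def mean_op_cell\<close>)
 have \<psi>max: "\<psi> k y <= (strong_max L v y)^2" if k: "k \<in> K" for k y
  unfolding \<psi>_def using strong_max_ge_abs[of "kA k" L v y] kAL[OF k] strong_max_nonneg[of L v y]
  by (metis abs_le_square_iff abs_of_nonneg)
 have vg: "mean_op L (\<nu> k) (\<psi> k) x <= g y" if k: "k \<in> K" and x: "x \<in> grid L" and y: "y \<in> cell L (\<nu> k) x" for k x y
 proof -
  have yg: "y \<in> grid L" using y cell_subset_grid by blast
  have "mean_op L (\<nu> k) (\<psi> k) x = mean_op L (\<nu> k) (\<psi> k) y" using mean_op_cell[OF y] by simp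
  also have "... = mean_op L nD (mean_op L (kA k) (\<psi> k)) y"
   unfolding \<nu>min[OF k] by (rule mean_op_comp[OF yg nDL kAL[OF k], symmetric])
  also have "... = mean_op L nD (\<psi> k) y"
   unfolding mean_op_def[of L nD] by (rule ker_op_cong_fun) (rule \<psi>fix[OF k])
  also have "... <= g y" unfolding g_def by (rule mean_op_mono) (rule \<psi>max[OF k])
  finally show ?thesis .
 qed
 have "(\<Sum>k\<in>K. \<Sum>x\<in>grid L. (coeff_op L (\<nu> k) f x)^2 * \<psi> k x) =
  (\<Sum>k\<in>K. \<Sum>x\<in>grid L. (coeff_op L (\<nu> k) f x)^2 * mean_op L (\<nu> k) (\<psi> k) x)"
 proof (rule sum.cong[OF refl])
  fix k assume k: "k \<in> K"
  have "(\<Sum>x\<in>grid L. (coeff_op L (\<nu> k) f x)^2 * mean_op L (\<nu> k) (\<psi> k) x) =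
   (\<Sum>x\<in>grid L. mean_op L (\<nu> k) (%x. (coeff_op L (\<nu> k) f x)^2) x * \<psi> k x)"
   by (rule mean_op_adjoint)
  also have "... = (\<Sum>x\<in>grid L. (coeff_op L (\<nu> k) f x)^2 * \<psi> k x)"
  proof (intro sum.cong refl arg_cong2[of _ _ _ _ "(*)"])
   fix x :: "'n => nat" assume x: "x \<in> grid L"
   show "mean_op L (\<nu> k) (%x. (coeff_op L (\<nu> k) f x)^2) x = (coeff_op L (\<nu> k) f x)^2"
    by (rule mean_op_fix[OF x]) (use \<nu>s[OF k] coeff_op_cell[OF x] in \<open>auto simp: less_imp_le\<close>)
  qed
  finally show "(\<Sum>x\<in>grid L. (coeff_op L (\<nu> k) f x)^2 * \<psi> k x) =
   (\<Sum>x\<in>grid L. (coeff_op L (\<nu> k) f x)^2 * mean_op L (\<nu> k) (\<psi> k) x)" ..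
 qed
 also have "... <= F\<^sup>2 * (\<Sum>y\<in>grid L. g y)"
 proof (rule carleson_layer_cake[where \<nu> = \<nu> and I = K and K = "scales L" and w = "%n x. (coeff_op L n f x)^2"
    and v = "%k. mean_op L (\<nu> k) (\<psi> k)", OF _ inj _ _ carl])
  show "finite K" unfolding K_def by simp
  show "\<nu> ` K \<subseteq> scales L" using \<nu>s by (auto simp: scales_def)
  show "0 <= g y" for y unfolding g_def by (rule mean_op_nonneg) simp
 qed (use vg in auto)
 also have "(\<Sum>y\<in>grid L. g y) = sq_norm L (strong_max L v)"
  unfolding g_def sq_norm_def by (rule sum_mean_op) (rule nDL)
 also have "F\<^sup>2 * ... <= F\<^sup>2 * (4 ^ CARD('n) * sq_norm L v)"
  by (intro mult_left_mono sq_norm_strong_max) simp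
 finally show ?thesis by (simp only: K_def \<nu>_def kA_def \<psi>_def)
qed

text \<open>In the coordinates where only \<open>b\<close> is differenced, \<open>f\<close> enters through \<open>q j\<close> differences; Cauchy--Schwarz
  over them costs the factor \<open>q j\<close>, squared.\<close>

lemma sum_frozen_bilinear:
 fixes f b :: "('n::finite => nat) => real"
 assumes carl: "carleson L (scales L) (%n x. (coeff_op L n f x)^2) (F\<^sup>2)"
  and D: "D = {j \<in> Z. t j ~= Diff_Mean}" and B: "B = {j \<in> Z. t j = Osc_Diff}"
  and q: "q \<in> partial_scales L D"
 shows "(\<Sum>k\<in>{k \<in> scales L. (%j. if j \<in> D then k j else 0) = q}. sq_norm L (ker_op2 L (gker L Z t k) f b))
  <= (\<Prod>j\<in>B. real (q j))^2 * (F\<^sup>2 * (4 ^ CARD('n) * sq_norm L (partial_diff L D q b)))"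
proof -
 define K where "K = {k \<in> scales L. (%j. if j \<in> D then k j else 0) = q}"
 define v where "v = partial_diff L D q b"
 define \<Lambda> where "\<Lambda> = PiE UNIV (%j. if j \<in> B then {..<q j} else {0::nat})"
 define \<nu> where "\<nu> = (%l k j. if j \<in> B then l j else k j :: nat)"
 have BD: "B \<subseteq> D" unfolding B D by auto
 have Kq: "k j = q j" if "k \<in> K" "j \<in> D" for k j using that by (auto simp: K_def)
 have Ks: "k j < L" if "k \<in> K" for k j using that by (auto simp: K_def scales_def)
 have qL: "q j < L" if "j \<in> D" for j using q that unfolding partial_scales_def by (auto dest: spec[of _ j])
 have fin: "finite \<Lambda>" unfolding \<Lambda>_def by (intro finite_PiE) auto
 have cardL: "real (card \<Lambda>) = (\<Prod>j\<in>B. real (q j))"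
 proof -
  have "card \<Lambda> = (\<Prod>j\<in>UNIV. if j \<in> B then q j else 1)"
   unfolding \<Lambda>_def by (subst card_PiE) (auto intro: prod.cong)
  also have "... = (\<Prod>j\<in>B. q j)" by (simp add: prod.If_cases)
  finally show ?thesis by simp
 qed
 have bpart: "ker_op L (bker L Z t k) b x = mean_op L (%j. if j \<in> D then L else k j) v x"
  if k: "k \<in> K" and x: "x \<in> grid L" for k x
  unfolding v_def partial_diff_def mean_op_def ker_op_ker_op
 proof (rule ker_op_cong)
  fix j y assume y: "y < (2::nat) ^ L"
  show "bker L Z t k j (x j) y = (\<Sum>u<2 ^ L. mean_ker L (if j \<in> D then L else k j) (x j) u *
    (if j \<in> D then diff_ker L (q j) else mean_ker L L) u y)"
  proof (cases "j \<in> D")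
   case True
   have "(\<Sum>u<2 ^ L. mean_ker L L (x j) u * diff_ker L (q j) u y) = diff_ker L (q j) (x j) y"
    using qL[OF True] gridD[OF x] by (intro mean_of_cell_const[of L] haar_like_cell_const[OF haar_like_diff_ker]) auto
   then show ?thesis using True Kq[OF k True] by (simp add: bker_def D)
  next
   case False
   then have "bker L Z t k j = mean_ker L (k j)" by (auto simp: bker_def D)
   then show ?thesis using False mean_ker_comp[of "k j" L L "x j" y] Ks[OF k, of j] gridD[OF x] y by simp
  qed
 qed
 have fpart: "(ker_op L (fker L Z t k) f x)^2 <= card \<Lambda> * (\<Sum>l\<in>\<Lambda>. (coeff_op L (\<nu> l k) f x)^2)"
  if k: "k \<in> K" for k x
 proof -
  define \<kappa> where "\<kappa> = (%j l. if j \<in> B then diff_ker L l else if j \<in> Z then diff_ker L (k j) else coeff_ker L (k j))"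
  have "ker_op L (fker L Z t k) f x =
    ker_op L (%j s y. \<Sum>l\<in>(if j \<in> B then {..<q j} else {0}). \<kappa> j l s y) f x"
  proof (rule ker_op_cong)
   fix j y
   show "fker L Z t k j (x j) y = (\<Sum>l\<in>(if j \<in> B then {..<q j} else {0}). \<kappa> j l (x j) y)"
   proof (cases "j \<in> B")
    case True
    then show ?thesis using Kq[OF k, of j] BD by (auto simp: fker_def \<kappa>_def B osc_ker_def)
   next
    case False
    then show ?thesis by (auto simp: fker_def \<kappa>_def B)
   qed
  qed
  also have "... = (\<Sum>l\<in>\<Lambda>. ker_op L (%j. \<kappa> j (l j)) f x)"
   unfolding \<Lambda>_def by (rule ker_op_sum_kernels) auto
  finally have e: "ker_op L (fker L Z t k) f x = (\<Sum>l\<in>\<Lambda>. ker_op L (%j. \<kappa> j (l j)) f x)" .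
  have abs: "\<bar>ker_op L (%j. \<kappa> j (l j)) f x\<bar> = \<bar>coeff_op L (\<nu> l k) f x\<bar>" for l
   unfolding coeff_op_def
   by (rule ker_op_signs[where \<sigma> = "%j. if j \<in> Z then half_sign L (\<nu> l k j) (x j) else 1"])
    (auto simp: \<kappa>_def \<nu>_def B diff_ker_def coeff_ker_def)
  have "(ker_op L (fker L Z t k) f x)^2 <= (\<Sum>l\<in>\<Lambda>. (ker_op L (%j. \<kappa> j (l j)) f x)^2) * card \<Lambda>"
   unfolding e by (rule sum_squared_le_sum_of_squares)
  also have "(\<Sum>l\<in>\<Lambda>. (ker_op L (%j. \<kappa> j (l j)) f x)^2) = (\<Sum>l\<in>\<Lambda>. (coeff_op L (\<nu> l k) f x)^2)"
   using abs by (intro sum.cong refl) (metis power2_abs)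
  finally show ?thesis by (simp add: mult.commute)
 qed
 have "(\<Sum>k\<in>K. sq_norm L (ker_op2 L (gker L Z t k) f b)) =
  (\<Sum>k\<in>K. \<Sum>x\<in>grid L. (ker_op L (fker L Z t k) f x)^2 * (ker_op L (bker L Z t k) b x)^2)"
 proof -
  have "ker_op2 L (gker L Z t k) f b x = ker_op L (fker L Z t k) f x * ker_op L (bker L Z t k) b x" for k x
   unfolding ker_op_mult by (rule ker_op2_cong) (simp add: gker_def)
  then show ?thesis unfolding sq_norm_def by (simp add: power_mult_distrib)
 qed
 also have "... <= (\<Sum>k\<in>K. \<Sum>x\<in>grid L. (card \<Lambda> * (\<Sum>l\<in>\<Lambda>. (coeff_op L (\<nu> l k) f x)^2)) *
   (mean_op L (%j. if j \<in> D then L else k j) v x)^2)"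
  using fpart bpart by (intro sum_mono mult_mono) (auto intro!: mult_nonneg_nonneg sum_nonneg)
 also have "... = card \<Lambda> * (\<Sum>l\<in>\<Lambda>. \<Sum>k\<in>K. \<Sum>x\<in>grid L. (coeff_op L (\<nu> l k) f x)^2 *
   (mean_op L (%j. if j \<in> D then L else k j) v x)^2)"
 proof -
  have s: "(\<Sum>l\<in>\<Lambda>. \<Sum>k\<in>K. \<Sum>x\<in>grid L. h l k x) = (\<Sum>k\<in>K. \<Sum>x\<in>grid L. \<Sum>l\<in>\<Lambda>. h l k x)" for h :: "('n => nat) => ('n => nat) => ('n => nat) => real"
   by (subst sum.swap) (intro sum.cong refl sum.swap)
  show ?thesis unfolding s sum_distrib_left sum_distrib_right by (simp only: mult.assoc)
 qed
 also have "... <= card \<Lambda> * (\<Sum>l\<in>\<Lambda>. F\<^sup>2 * (4 ^ CARD('n) * sq_norm L v))"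
 proof (intro mult_left_mono sum_mono)
  fix l assume lL: "l \<in> \<Lambda>"
  have l: "l j < L" if j: "j \<in> B" for j
  proof -
   have "l j \<in> (if j \<in> B then {..<q j} else {0})" using lL unfolding \<Lambda>_def by (rule PiE_mem) simp
   then show ?thesis using j qL[of j] BD by auto
  qed
  show "(\<Sum>k\<in>K. \<Sum>x\<in>grid L. (coeff_op L (\<nu> l k) f x)^2 * (mean_op L (%j. if j \<in> D then L else k j) v x)^2)
    <= F\<^sup>2 * (4 ^ CARD('n) * sq_norm L v)"
   unfolding K_def \<nu>_def by (rule frozen_embedding[OF carl D B q l])
 qed simp
 also have "... = (\<Prod>j\<in>B. real (q j))^2 * (F\<^sup>2 * (4 ^ CARD('n) * sq_norm L v))"
  by (simp add: cardL power2_eq_square)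
 finally show ?thesis by (simp only: K_def v_def)
qed

section \<open>Dyadic blocks of scales and the Schur test\<close>

text \<open>Scales are grouped by the binary logarithm of \<open>k + 1\<close>, so that a block of level \<open>i\<close> has about \<open>2\<^sup>i\<close> members.\<close>

definition level :: "'n set => ('n => nat) => 'n => nat" where
 "level D k = (%j. if j \<in> D then floor_log (Suc (k j)) else 0)"

text \<open>Used both for the inverse measure of a rectangle of scale \<open>i\<close> and for the size of a block of level \<open>i\<close>.\<close>

definition weight :: "('n::finite => nat) => real" where
 "weight i = (\<Prod>j\<in>UNIV. 2 ^ i j)"

lemma weight_pos: "0 < weight i"
 by (simp add: weight_def prod_pos)

lemma weight_div: "weight i / weight r = (\<Prod>j\<in>UNIV. 2 ^ i j / 2 ^ r j)"
 by (simp add: weight_def prod_dividef)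

lemma geometric_up: "(\<Sum>r\<in>{a..M}. (2::real) ^ a / 2 ^ r) <= 2"
proof -
 have "(\<Sum>r\<in>{a..M}. (2::real) ^ a / 2 ^ r) = (\<Sum>r\<in>{a..M}. (1/2) ^ (r - a))"
  by (intro sum.cong) (auto simp: power_diff power_divide)
 also have "... <= (\<Sum>d\<in>{0..M}. (1/2) ^ d)"
 proof (rule sum_le_included[where i = "%d. d + a"])
  show "\<forall>r\<in>{a..M}. \<exists>d\<in>{0..M}. d + a = r \<and> (1 / 2 :: real) ^ (r - a) <= (1 / 2) ^ d"
  proof
   fix r assume "r \<in> {a..M}"
   then show "\<exists>d\<in>{0..M}. d + a = r \<and> (1 / 2 :: real) ^ (r - a) <= (1 / 2) ^ d"
    by (intro bexI[of _ "r - a"]) auto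
  qed
 qed auto
 also have "... <= (\<Sum>d. (1/2) ^ d)" by (intro sum_le_suminf) auto
 also have "... = (2::real)" by (simp add: suminf_geometric)
 finally show ?thesis .
qed

lemma geometric_down: "(\<Sum>i\<in>{..b}. (2::real) ^ i / 2 ^ b) <= 2"
proof -
 have "(\<Sum>i\<in>{..b}. (2::real) ^ i) = 2 ^ Suc b - 1" by (induction b) auto
 then show ?thesis by (simp add: divide_le_eq flip: sum_divide_distrib)
qed

lemma finite_bounded:
 fixes I :: "('n::finite => nat) set"
 assumes "finite I"
 obtains M where "!!i j. i \<in> I ==> i j <= M"
proof
 fix i j assume "i \<in> I"
 then show "i j <= (\<Sum>i\<in>I. \<Sum>j\<in>UNIV. i j)"
  using member_le_sum[of j UNIV i] member_le_sum[of i I "%i. \<Sum>j\<in>UNIV. i j"] assms by fastforce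
qed

text \<open>The matrix \<open>2\<^sup>i / 2\<^sup>r\<close> on \<open>i \<le> r\<close> has bounded row and column sums, and the multi-index version is a product.\<close>

lemma block_schur:
 fixes x y :: "('n::finite => nat) => real"
 assumes fin: "finite I" "finite R" and "!!i. 0 <= x i" "!!r. 0 <= y r"
 shows "(\<Sum>r\<in>R. \<Sum>i\<in>{i \<in> I. \<forall>j. i j <= r j}. weight i / weight r * (sqrt (x i) * sqrt (y r)))
  <= 2 ^ CARD('n) * (sqrt (\<Sum>i\<in>I. x i) * sqrt (\<Sum>r\<in>R. y r))"
proof -
 define S where "S = Sigma R (%r. {i \<in> I. \<forall>j. i j <= r j})"
 define w where "w = (%p :: ('n => nat) \<times> ('n => nat). weight (snd p) / weight (fst p))"
 have w0: "0 <= w p" for p unfolding w_def using weight_pos by (metis divide_nonneg_pos less_imp_le)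
 have finS: "finite S" unfolding S_def using fin by auto
 have row: "(\<Sum>i\<in>{i \<in> I. \<forall>j. i j <= r j}. weight i / weight r) <= 2 ^ CARD('n)" for r :: "'n => nat"
 proof -
  have "(\<Sum>i\<in>{i \<in> I. \<forall>j. i j <= r j}. weight i / weight r) <= (\<Sum>i\<in>PiE UNIV (%j. {..r j}). weight i / weight r)"
   using weight_pos by (intro sum_mono2) (auto intro!: finite_PiE divide_nonneg_pos simp: less_imp_le)
  also have "... = (\<Prod>j\<in>UNIV. \<Sum>i\<in>{..r j}. 2 ^ i / 2 ^ r j)"
   unfolding weight_div by (rule prod_sum_PiE[symmetric]) auto
  also have "... <= (\<Prod>j\<in>(UNIV::'n set). 2)"
   by (intro prod_mono conjI geometric_down sum_nonneg) auto
  finally show ?thesis by simp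
 qed
 obtain M where M: "!!r j. r \<in> R ==> r j <= M" using finite_bounded[OF fin(2)] by blast
 have col: "(\<Sum>r\<in>{r \<in> R. \<forall>j. i j <= r j}. weight i / weight r) <= 2 ^ CARD('n)" for i :: "'n => nat"
 proof -
  have "(\<Sum>r\<in>{r \<in> R. \<forall>j. i j <= r j}. weight i / weight r) <= (\<Sum>r\<in>PiE UNIV (%j. {i j..M}). weight i / weight r)"
   using weight_pos M by (intro sum_mono2) (auto intro!: finite_PiE divide_nonneg_pos simp: less_imp_le)
  also have "... = (\<Prod>j\<in>UNIV. \<Sum>r\<in>{i j..M}. 2 ^ i j / 2 ^ r)"
   unfolding weight_div by (rule prod_sum_PiE[symmetric]) auto
  also have "... <= (\<Prod>j\<in>(UNIV::'n set). 2)"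
   by (intro prod_mono conjI geometric_up sum_nonneg) auto
  finally show ?thesis by simp
 qed
 have X: "(\<Sum>p\<in>S. w p * x (snd p)) <= 2 ^ CARD('n) * (\<Sum>i\<in>I. x i)"
 proof -
  have "(\<Sum>p\<in>S. w p * x (snd p)) = (\<Sum>r\<in>R. \<Sum>i\<in>{i \<in> I. \<forall>j. i j <= r j}. weight i / weight r * x i)"
   unfolding S_def w_def using fin by (subst sum.Sigma) (auto simp: case_prod_beta)
  also have "... = (\<Sum>i\<in>I. \<Sum>r\<in>{r \<in> R. \<forall>j. i j <= r j}. weight i / weight r * x i)"
   by (rule sum.swap_restrict[OF fin(2,1)])
  also have "... = (\<Sum>i\<in>I. (\<Sum>r\<in>{r \<in> R. \<forall>j. i j <= r j}. weight i / weight r) * x i)"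
   by (simp add: sum_distrib_right)
  also have "... <= (\<Sum>i\<in>I. 2 ^ CARD('n) * x i)"
   by (intro sum_mono mult_right_mono col assms(3))
  finally show ?thesis by (simp add: sum_distrib_left)
 qed
 have Y: "(\<Sum>p\<in>S. w p * y (fst p)) <= 2 ^ CARD('n) * (\<Sum>r\<in>R. y r)"
 proof -
  have "(\<Sum>p\<in>S. w p * y (fst p)) = (\<Sum>r\<in>R. \<Sum>i\<in>{i \<in> I. \<forall>j. i j <= r j}. weight i / weight r * y r)"
   unfolding S_def w_def using fin by (subst sum.Sigma) (auto simp: case_prod_beta)
  also have "... = (\<Sum>r\<in>R. (\<Sum>i\<in>{i \<in> I. \<forall>j. i j <= r j}. weight i / weight r) * y r)"
   by (simp add: sum_distrib_right)
  also have "... <= (\<Sum>r\<in>R. 2 ^ CARD('n) * y r)"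
   by (intro sum_mono mult_right_mono row assms(4))
  finally show ?thesis by (simp add: sum_distrib_left)
 qed
 define T where "T = (\<Sum>p\<in>S. w p * (sqrt (x (snd p)) * sqrt (y (fst p))))"
 have "T = (\<Sum>p\<in>S. sqrt (w p * x (snd p)) * sqrt (w p * y (fst p)))"
  unfolding T_def using w0 by (intro sum.cong refl) (simp add: real_sqrt_mult)
 then have "T\<^sup>2 <= (\<Sum>p\<in>S. (sqrt (w p * x (snd p)))^2) * (\<Sum>p\<in>S. (sqrt (w p * y (fst p)))^2)"
  by (simp only: Cauchy_Schwarz_ineq_sum)
 also have "... = (\<Sum>p\<in>S. w p * x (snd p)) * (\<Sum>p\<in>S. w p * y (fst p))"
  using w0 assms(3,4) by simp
 also have "... <= (2 ^ CARD('n) * (\<Sum>i\<in>I. x i)) * (2 ^ CARD('n) * (\<Sum>r\<in>R. y r))"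
  using w0 assms(3,4) by (intro mult_mono X Y) (auto intro!: sum_nonneg mult_nonneg_nonneg)
 also have "... = (2 ^ CARD('n) * (sqrt (\<Sum>i\<in>I. x i) * sqrt (\<Sum>r\<in>R. y r)))^2"
 proof -
  have "(sqrt (\<Sum>i\<in>I. x i))^2 = (\<Sum>i\<in>I. x i)" "(sqrt (\<Sum>r\<in>R. y r))^2 = (\<Sum>r\<in>R. y r)"
   using assms(3,4) by (simp_all add: sum_nonneg)
  then show ?thesis unfolding power_mult_distrib by (simp only:) (simp add: power2_eq_square)
 qed
 finally have "T\<^sup>2 <= (2 ^ CARD('n) * (sqrt (\<Sum>i\<in>I. x i) * sqrt (\<Sum>r\<in>R. y r)))^2" .
 then have "T <= 2 ^ CARD('n) * (sqrt (\<Sum>i\<in>I. x i) * sqrt (\<Sum>r\<in>R. y r))"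
  by (rule power2_le_imp_le) (use assms(3,4) in \<open>auto intro!: mult_nonneg_nonneg sum_nonneg\<close>)
 moreover have "T = (\<Sum>r\<in>R. \<Sum>i\<in>{i \<in> I. \<forall>j. i j <= r j}. weight i / weight r * (sqrt (x i) * sqrt (y r)))"
  unfolding T_def S_def w_def using fin by (subst sum.Sigma) (auto simp: case_prod_beta)
 ultimately show ?thesis by simp
qed

lemma card_level_le: "card {c. floor_log (Suc c) = i} <= 2 ^ i" "finite {c. floor_log (Suc c) = i}"
proof -
 have sub: "{c. floor_log (Suc c) = i} \<subseteq> {2 ^ i - 1..<2 ^ i - 1 + 2 ^ i}"
 proof
  fix c assume "c \<in> {c. floor_log (Suc c) = i}"
  then have "2 ^ i <= Suc c" "Suc c < 2 * 2 ^ i"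
   using floor_log_exp2_le[of "Suc c"] floor_log_exp2_gt[of "Suc c"] by auto
  then show "c \<in> {2 ^ i - 1..<2 ^ i - 1 + 2 ^ i}" by auto
 qed
 show "finite {c. floor_log (Suc c) = i}" by (rule finite_subset[OF sub]) simp
 show "card {c. floor_log (Suc c) = i} <= 2 ^ i" using card_mono[OF _ sub] by simp
qed

lemma sum_sqrt_mult_le:
 fixes u v :: "'x => real"
 assumes "!!x. 0 <= u x" "!!x. 0 <= v x"
 shows "(\<Sum>x\<in>A. sqrt (u x) * sqrt (v x)) <= sqrt (\<Sum>x\<in>A. u x) * sqrt (\<Sum>x\<in>A. v x)"
 using L2_set_mult_ineq[of "%x. sqrt (u x)" "%x. sqrt (v x)" A] assms by (simp add: L2_set_def)

context
 fixes L :: nat and Z :: "'n::finite set" and t :: "'n => mode"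
  and m :: "('n => nat) => ('n => nat) => real" and f a b :: "('n => nat) => real" and B F :: real
begin

definition diffd :: "'n set" where "diffd = {j \<in> Z. t j ~= Diff_Mean}"

definition below :: "('n => nat) => ('n => nat) set" where
 "below n = PiE UNIV (%j. if j \<in> Z then {..<n j} else {n j})"

text \<open>The part of \<open>k\<close> in coordinates where the orthogonality of \<open>bilinear_orth\<close> is not available is kept, the rest is
  merged by summation.\<close>

definition fixed :: "('n => nat) => 'n => nat" where
 "fixed k = (%j. if j \<in> Z \<and> t j ~= Diff_Diff then 0 else k j)"

abbreviation "bil \<equiv> %k. ker_op2 L (gker L Z t k) f b"

definition block :: "('n => nat) => ('n => nat) set" where
 "block i = {k \<in> scales L. level diffd k = i}"

definition fibre_sum :: "('n => nat) => ('n => nat) => ('n => nat) => real" where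
 "fibre_sum i p x = (\<Sum>k\<in>{k \<in> block i. fixed k = p}. bil k x)"

definition block_term :: "('n => nat) => ('n => nat) => ('n => nat) => real" where
 "block_term i n x = (\<Sum>k\<in>{k \<in> below n. level diffd k = i}. bil k x)"

text \<open>The number of scales in a block in the coordinates without orthogonality, where Cauchy--Schwarz has to be used.\<close>

definition multiplicity_bound :: "('n => nat) => real" where
 "multiplicity_bound i = (\<Prod>j\<in>UNIV. if j \<in> Z \<and> t j = Diff_Diff then 2 ^ i j else 1)"

text \<open>The part of the form that depends on \<open>a\<close>; \<open>afroz\<close> is its version without averaging outside \<open>Z\<close>, so that the former
  is a mean of the latter and is controlled by a maximal function.\<close>

definition apart :: "('n => nat) => ('n => nat) => real" where
 "apart n = ker_op L (%j. if j \<in> Z then coeff_ker L (n j) else mean_ker L (n j)) a"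

definition afroz :: "('n => nat) => ('n => nat) => real" where
 "afroz z = ker_op L (%j. if j \<in> Z then coeff_ker L (z j) else mean_ker L L) a"

lemma finite_below [simp]: "finite (below n)"
 unfolding below_def by (intro finite_PiE) auto

lemma finite_block [simp]: "finite (block i)"
 by (simp add: block_def)

lemma belowD: "k \<in> below n ==> j \<in> Z ==> k j < n j" "k \<in> below n ==> j \<notin> Z ==> k j = n j"
 by (auto simp: below_def PiE_iff split: if_splits dest: spec[of _ j])

lemma below_le: "k \<in> below n ==> k j <= n j"
 using belowD[of k n j] by (cases "j \<in> Z") auto

lemma below_scales: "n \<in> scales L ==> k \<in> below n ==> k \<in> scales L"
 unfolding scales_def using below_le le_less_trans by blast

lemma belowI: "(!!j. j \<in> Z ==> k j < n j) ==> (!!j. j \<notin> Z ==> k j = n j) ==> k \<in> below n"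
 by (auto simp: below_def PiE_iff)

lemma multiplicity_bound_nonneg: "0 <= multiplicity_bound i"
 unfolding multiplicity_bound_def by (intro prod_nonneg) auto

text \<open>The sum over scales below \<open>n\<close> is a mean over the cell of \<open>n\<close> of the sum over the whole block, because finer
  Haar-like terms average to zero; hence the maximal function.\<close>

lemma block_term_sq:
 assumes n: "n \<in> scales L" and x: "x \<in> grid L"
 shows "(block_term i n x)^2 <= multiplicity_bound i *
  (\<Sum>p\<in>fixed ` {k \<in> below n. level diffd k = i}. (strong_max L (fibre_sum i p) x)^2)"
proof -
 define K where "K = {k \<in> below n. level diffd k = i}"
 define E where "E = (%j. if j \<in> Z then n j else L)"
 have finK: "finite K" by (simp add: K_def)
 have Kb: "k \<in> block i" if "k \<in> K" for k using that below_scales[OF n] by (auto simp: K_def block_def)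
 have inner: "(\<Sum>k\<in>{k \<in> K. fixed k = p}. bil k x) = mean_op L E (fibre_sum i p) x" if p: "p \<in> fixed ` K" for p
 proof -
  obtain k0 where k0: "k0 \<in> K" "p = fixed k0" using p by auto
  have k0n: "k0 \<in> below n" using k0 by (simp add: K_def)
  have off: "k j = n j" if k: "k \<in> block i" "fixed k = p" and j: "j \<notin> Z" for k j
  proof -
   have "fixed k j = fixed k0 j" using k k0 by simp
   then show ?thesis using j belowD(2)[OF k0n j] by (simp add: fixed_def)
  qed
  have dd: "k j < n j" if k: "k \<in> block i" "fixed k = p" and j: "j \<in> Z" "t j = Diff_Diff" for k j
  proof -
   have "fixed k j = fixed k0 j" using k k0 by simp
   then show ?thesis using j belowD(1)[OF k0n j(1)] by (simp add: fixed_def)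
  qed
  have "mean_op L E (fibre_sum i p) x = (\<Sum>k\<in>{k \<in> block i. fixed k = p}. mean_op L E (bil k) x)"
   unfolding fibre_sum_def[abs_def] mean_op_def by (rule ker_op_sum)
  also have "... = (\<Sum>k\<in>{k \<in> block i. fixed k = p}. if \<forall>j\<in>Z. k j < n j then bil k x else 0)"
   unfolding E_def
  proof (rule sum.cong[OF refl])
   fix k assume k: "k \<in> {k \<in> block i. fixed k = p}"
   show "mean_op L (%j. if j \<in> Z then n j else L) (bil k) x = (if \<forall>j\<in>Z. k j < n j then bil k x else 0)"
    by (rule mean_op_bilinear[OF _ n x]) (use k dd in \<open>auto simp: block_def\<close>)
  qed
  also have "... = (\<Sum>k\<in>{k \<in> {k \<in> block i. fixed k = p}. \<forall>j\<in>Z. k j < n j}. bil k x)"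
   by (rule sum.inter_filter[symmetric]) simp
  also have "{k \<in> {k \<in> block i. fixed k = p}. \<forall>j\<in>Z. k j < n j} = {k \<in> K. fixed k = p}"
   using Kb off by (auto simp: K_def block_def intro: belowI dest: belowD(1))
  finally show ?thesis by simp
 qed
 have "block_term i n x = (\<Sum>p\<in>fixed ` K. \<Sum>k\<in>{k \<in> K. fixed k = p}. bil k x)"
  unfolding block_term_def K_def[symmetric] by (rule sum.image_gen[OF finK])
 also have "... = (\<Sum>p\<in>fixed ` K. mean_op L E (fibre_sum i p) x)"
  by (rule sum.cong[OF refl]) (rule inner)
 finally have "(block_term i n x)^2 <= (\<Sum>p\<in>fixed ` K. (mean_op L E (fibre_sum i p) x)^2) * card (fixed ` K)"
  by (simp only: sum_squared_le_sum_of_squares)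
 also have "... <= (\<Sum>p\<in>fixed ` K. (strong_max L (fibre_sum i p) x)^2) * multiplicity_bound i"
 proof (intro mult_mono sum_mono)
  fix p
  have "\<bar>mean_op L E (fibre_sum i p) x\<bar> <= strong_max L (fibre_sum i p) x"
   by (rule strong_max_ge_abs) (use scalesD[OF n] in \<open>auto simp: E_def less_imp_le\<close>)
  then show "(mean_op L E (fibre_sum i p) x)^2 <= (strong_max L (fibre_sum i p) x)^2"
   using strong_max_nonneg[of L "fibre_sum i p" x] by (metis abs_le_square_iff abs_of_nonneg)
 next
  define P where "P = (%j. if j \<in> Z then (if t j = Diff_Diff then {c. floor_log (Suc c) = i j} else {0}) else {n j})"
  have finP: "finite (PiE UNIV P)" by (intro finite_PiE) (auto simp: P_def card_level_le)
  have "fixed ` K \<subseteq> PiE UNIV P"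
  proof (rule image_subsetI)
   fix k assume k: "k \<in> K"
   show "fixed k \<in> PiE UNIV P"
   proof (rule PiE_I)
    fix j
    have "level diffd k j = i j" using k by (auto simp: K_def)
    then show "fixed k j \<in> P j" using k belowD(2)[of k n j]
     by (auto simp: fixed_def P_def level_def diffd_def K_def)
   qed simp
  qed
  then have "card (fixed ` K) <= card (PiE UNIV P)" using finP by (rule card_mono[rotated])
  also have "card (PiE UNIV P) = (\<Prod>j\<in>UNIV. card (P j))" by (rule card_PiE) simp
  also have "... <= (\<Prod>j\<in>UNIV. if j \<in> Z \<and> t j = Diff_Diff then 2 ^ i j else 1)"
   by (intro prod_mono) (auto simp: P_def card_level_le)
  finally have "card (fixed ` K) <= (\<Prod>j\<in>UNIV. if j \<in> Z \<and> t j = Diff_Diff then 2 ^ i j else 1)" .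
  then have "real (card (fixed ` K)) <= real (\<Prod>j\<in>UNIV. if j \<in> Z \<and> t j = Diff_Diff then 2 ^ i j else 1)"
   by (simp only: of_nat_le_iff)
  also have "... = multiplicity_bound i" unfolding multiplicity_bound_def of_nat_prod by (rule prod.cong) auto
  finally show "real (card (fixed ` K)) <= multiplicity_bound i" .
 qed (auto intro!: sum_nonneg)
 finally show ?thesis by (simp only: K_def mult.commute)
qed

lemma apart_sq_le:
 assumes n: "n \<in> scales L" and x: "x \<in> grid L"
 shows "(apart n x)^2 <= (strong_max L (afroz (%j. if j \<in> Z then n j else 0)) x)^2"
proof -
 define z where "z = (%j. if j \<in> Z then n j else 0)"
 have "apart n x = mean_op L (%j. if j \<in> Z then L else n j) (afroz z) x"
  unfolding apart_def afroz_def mean_op_def ker_op_ker_op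
 proof (rule ker_op_cong)
  fix j y assume y: "y < (2::nat) ^ L"
  show "(if j \<in> Z then coeff_ker L (n j) else mean_ker L (n j)) (x j) y =
   (\<Sum>u<2 ^ L. mean_ker L (if j \<in> Z then L else n j) (x j) u *
    (if j \<in> Z then coeff_ker L (z j) else mean_ker L L) u y)"
  proof (cases "j \<in> Z")
   case True
   have "(\<Sum>u<2 ^ L. mean_ker L L (x j) u * coeff_ker L (n j) u y) = coeff_ker L (n j) (x j) y"
    using scalesD[OF n, of j] gridD[OF x] by (intro mean_of_cell_const[of L] cell_const_coeff_ker) auto
   then show ?thesis using True by (simp add: z_def)
  next
   case False
   then show ?thesis using mean_ker_comp[of "n j" L L "x j" y] scalesD[OF n, of j] gridD[OF x] y by simp
  qed
 qed
 also have "\<bar>...\<bar> <= strong_max L (afroz z) x"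
  by (rule strong_max_ge_abs) (use scalesD[OF n] in \<open>auto simp: less_imp_le\<close>)
 finally show ?thesis unfolding z_def using strong_max_nonneg by (metis abs_le_square_iff abs_of_nonneg)
qed

lemma apart_cell: "x \<in> grid L ==> y \<in> cell L n x ==> apart n y = apart n x"
 unfolding apart_def
proof (rule ker_op_cong)
 fix j s assume x: "x \<in> grid L" and y: "y \<in> cell L n x"
 have "cell_const L (n j) (%u. (if j \<in> Z then coeff_ker L (n j) else mean_ker L (n j)) u s)"
  by (auto intro: cell_const_coeff_ker cell_const_mean_ker)
 from cell_constD[OF this, of "y j" "x j"] x y
 show "(if j \<in> Z then coeff_ker L (n j) else mean_ker L (n j)) (y j) s
   = (if j \<in> Z then coeff_ker L (n j) else mean_ker L (n j)) (x j) s"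
  by (simp add: cell_def grid_def same_cell_sym)
qed

lemma block_term_cell:
 assumes n: "n \<in> scales L" and x: "x \<in> grid L" and y: "y \<in> cell L n x"
 shows "block_term i n y = block_term i n x"
 unfolding block_term_def
proof (intro sum.cong refl ker_op2_cong)
 fix k j s u assume k: "k \<in> {k \<in> below n. level diffd k = i}"
 have "cell_const L (n j) (%v. gker L Z t k j v s u)"
  using k below_scales[OF n, of k] belowD[of k n j] by (intro gker_cell_const) (auto simp: scales_def)
 from cell_constD[OF this, of "y j" "x j"] x y
 show "gker L Z t k j (y j) s u = gker L Z t k j (x j) s u"
  by (simp add: cell_def grid_def same_cell_sym)
qed

lemma sum_fibre_sums:
 "(\<Sum>p\<in>fixed ` block i. sq_norm L (fibre_sum i p)) = (\<Sum>k\<in>block i. sq_norm L (bil k))"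
proof -
 have "sq_norm L (fibre_sum i p) = (\<Sum>k\<in>{k \<in> block i. fixed k = p}. sq_norm L (bil k))" for p
  unfolding fibre_sum_def[abs_def]
 proof (rule sq_norm_orth_sum)
  fix k k' assume k: "k \<in> {k \<in> block i. fixed k = p}" "k' \<in> {k \<in> block i. fixed k = p}" "k ~= k'"
  then obtain j where j: "k j ~= k' j" by auto
  have "fixed k j = fixed k' j" using k by simp
  with j have "j \<in> Z" "t j ~= Diff_Diff" by (auto simp: fixed_def split: if_splits)
  then show "(\<Sum>x\<in>grid L. bil k x * bil k' x) = 0"
   using k j by (intro bilinear_orth) (auto simp: block_def)
 qed simp
 then show ?thesis using sum.image_gen[of "block i" "%k. sq_norm L (bil k)" fixed] by simp
qed

definition bmass :: "('n => nat) => real" where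
 "bmass i = (\<Sum>q\<in>{q \<in> partial_scales L diffd. level diffd q = i}. sq_norm L (partial_diff L diffd q b))"

definition amass :: "('n => nat) => real" where
 "amass r = (\<Sum>z\<in>{z \<in> partial_scales L Z. level Z z = r}. sq_norm L (afroz z))"

lemma bmass_nonneg: "0 <= bmass i" and amass_nonneg: "0 <= amass r"
 by (simp_all add: bmass_def amass_def sum_nonneg)

lemma sum_bmass: "finite I ==> (\<Sum>i\<in>I. bmass i) <= sq_norm L b"
proof -
 assume I: "finite I"
 have "(\<Sum>i\<in>I. bmass i) = (\<Sum>q\<in>{q \<in> partial_scales L diffd. level diffd q \<in> I}. sq_norm L (partial_diff L diffd q b))"
  unfolding bmass_def
  by (subst sum.group[of "{q \<in> partial_scales L diffd. level diffd q \<in> I}" I "level diffd", symmetric])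
   (use I in \<open>auto intro!: sum.cong\<close>)
 also have "... <= (\<Sum>q\<in>partial_scales L diffd. sq_norm L (partial_diff L diffd q b))"
  by (intro sum_mono2) auto
 also have "... <= sq_norm L b" by (rule bessel)
 finally show ?thesis .
qed

lemma sq_norm_afroz: "sq_norm L (afroz z) = sq_norm L (partial_diff L Z z a)"
 unfolding sq_norm_def
proof (intro sum.cong refl)
 fix x :: "'n => nat"
 have "\<bar>partial_diff L Z z a x\<bar> = \<bar>afroz z x\<bar>"
  unfolding partial_diff_def afroz_def
  by (rule ker_op_signs[where \<sigma> = "%j. if j \<in> Z then half_sign L (z j) (x j) else 1"])
   (auto simp: diff_ker_def coeff_ker_def)
 then show "(afroz z x)^2 = (partial_diff L Z z a x)^2" by (metis power2_abs)
qed

lemma sum_amass: "finite R ==> (\<Sum>r\<in>R. amass r) <= sq_norm L a"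
proof -
 assume R: "finite R"
 have "(\<Sum>r\<in>R. amass r) = (\<Sum>z\<in>{z \<in> partial_scales L Z. level Z z \<in> R}. sq_norm L (afroz z))"
  unfolding amass_def
  by (subst sum.group[of "{q \<in> partial_scales L Z. level Z q \<in> R}" R "level Z", symmetric])
   (use R in \<open>auto intro!: sum.cong\<close>)
 also have "... <= (\<Sum>z\<in>partial_scales L Z. sq_norm L (afroz z))"
  by (intro sum_mono2) auto
 also have "... <= sq_norm L a" unfolding sq_norm_afroz by (rule bessel)
 finally show ?thesis .
qed

text \<open>The growth of the oscillation kernel and the missing orthogonality together cost at most the square of the block
  size in each coordinate.\<close>

lemma block_mass:
 assumes carl: "carleson L (scales L) (%n x. (coeff_op L n f x)^2) (F\<^sup>2)"
 shows "multiplicity_bound i * (\<Sum>k\<in>block i. sq_norm L (bil k))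
  <= 16 ^ CARD('n) * (F\<^sup>2 * ((weight i)^2 * bmass i))"
proof -
 define Q where "Q = {q \<in> partial_scales L diffd. level diffd q = i}"
 define res where "res = (%k j. if j \<in> diffd then k j else 0 :: nat)"
 define Os where "Os = {j \<in> Z. t j = Osc_Diff}"
 have lev: "level diffd (res k) = level diffd k" for k by (auto simp: level_def res_def)
 have "(\<Sum>k\<in>block i. sq_norm L (bil k)) = (\<Sum>q\<in>res ` block i. \<Sum>k\<in>{k \<in> block i. res k = q}. sq_norm L (bil k))"
  by (rule sum.image_gen) simp
 also have "... <= (\<Sum>q\<in>Q. \<Sum>k\<in>{k \<in> block i. res k = q}. sq_norm L (bil k))"
 proof (rule sum_mono2)
  show "res ` block i \<subseteq> Q"
   using lev by (auto simp: Q_def block_def partial_scales_def scales_def res_def)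
 qed (auto simp: Q_def intro!: sum_nonneg)
 also have "... <= (\<Sum>q\<in>Q. (\<Prod>j\<in>Os. real (q j))^2 * (F\<^sup>2 * (4 ^ CARD('n) * sq_norm L (partial_diff L diffd q b))))"
 proof (rule sum_mono)
  fix q assume q: "q \<in> Q"
  have "(\<Sum>k\<in>{k \<in> block i. res k = q}. sq_norm L (bil k)) <= (\<Sum>k\<in>{k \<in> scales L. res k = q}. sq_norm L (bil k))"
   by (rule sum_mono2) (auto simp: block_def)
  also have "... <= (\<Prod>j\<in>Os. real (q j))^2 * (F\<^sup>2 * (4 ^ CARD('n) * sq_norm L (partial_diff L diffd q b)))"
   unfolding res_def using q by (intro sum_frozen_bilinear[OF carl diffd_def Os_def]) (simp add: Q_def)
  finally show "(\<Sum>k\<in>{k \<in> block i. res k = q}. sq_norm L (bil k))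
   <= (\<Prod>j\<in>Os. real (q j))^2 * (F\<^sup>2 * (4 ^ CARD('n) * sq_norm L (partial_diff L diffd q b)))" .
 qed
 also have "... <= (\<Sum>q\<in>Q. (\<Prod>j\<in>Os. 2 * 2 ^ i j)^2 * (F\<^sup>2 * (4 ^ CARD('n) * sq_norm L (partial_diff L diffd q b))))"
 proof (intro sum_mono mult_right_mono power_mono prod_mono conjI)
  fix q j assume q: "q \<in> Q" and j: "j \<in> Os"
  have "level diffd q j = i j" using q by (auto simp: Q_def)
  then have "floor_log (Suc (q j)) = i j" using j by (auto simp: level_def diffd_def Os_def)
  then have "q j <= 2 * 2 ^ i j" using floor_log_exp2_gt[of "Suc (q j)"] by simp
  then have "real (q j) <= real (2 * 2 ^ i j)" by (simp only: of_nat_le_iff)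
  then show "real (q j) <= 2 * 2 ^ i j" by simp
 qed (auto intro!: prod_nonneg mult_nonneg_nonneg)
 also have "... = (\<Prod>j\<in>Os. 2 * 2 ^ i j)^2 * (F\<^sup>2 * (4 ^ CARD('n) * bmass i))"
  by (simp add: bmass_def Q_def sum_distrib_left)
 finally have "multiplicity_bound i * (\<Sum>k\<in>block i. sq_norm L (bil k)) <=
   multiplicity_bound i * ((\<Prod>j\<in>Os. 2 * 2 ^ i j)^2 * (F\<^sup>2 * (4 ^ CARD('n) * bmass i)))"
  using multiplicity_bound_nonneg by (rule mult_left_mono)
 also have "... = (multiplicity_bound i * (\<Prod>j\<in>Os. 2 * 2 ^ i j)^2) * (F\<^sup>2 * (4 ^ CARD('n) * bmass i))"
  by simp
 also have "... <= (4 ^ CARD('n) * (weight i)^2) * (F\<^sup>2 * (4 ^ CARD('n) * bmass i))"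
 proof (rule mult_right_mono)
  have "(\<Prod>j\<in>Os. 2 * 2 ^ i j :: real) = (\<Prod>j\<in>UNIV. if j \<in> Os then 2 * 2 ^ i j else 1)"
   by (simp add: prod.If_cases)
  then have "multiplicity_bound i * (\<Prod>j\<in>Os. 2 * 2 ^ i j)^2 =
   (\<Prod>j\<in>UNIV. (if j \<in> Z \<and> t j = Diff_Diff then 2 ^ i j else 1) * (if j \<in> Os then 2 * 2 ^ i j else 1)^2)"
   by (simp only: multiplicity_bound_def prod.distrib prod_power_distrib)
  also have "... <= (\<Prod>j\<in>UNIV. 4 * (2 ^ i j)^2)"
  proof (rule prod_mono, intro conjI)
   fix j
   define u where "u = (2::real) ^ i j"
   have u: "1 <= u" by (simp add: u_def)
   then have "1 <= u\<^sup>2" "u <= u\<^sup>2" by (auto simp: power2_eq_square mult_ge1_I)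
   then show "(if j \<in> Z \<and> t j = Diff_Diff then 2 ^ i j else 1) * (if j \<in> Os then 2 * 2 ^ i j else 1)^2 <= 4 * ((2::real) ^ i j)^2"
    unfolding u_def[symmetric] using u by (auto simp: Os_def power_mult_distrib)
  qed auto
  also have "... = 4 ^ CARD('n) * (weight i)^2" by (simp add: weight_def prod.distrib prod_power_distrib)
  finally show "multiplicity_bound i * (\<Prod>j\<in>Os. 2 * 2 ^ i j)^2 <= 4 ^ CARD('n) * (weight i)^2" .
  show "0 <= F\<^sup>2 * (4 ^ CARD('n) * bmass i)" using bmass_nonneg by simp
 qed
 also have "... = 16 ^ CARD('n) * (F\<^sup>2 * ((weight i)^2 * bmass i))"
 proof -
  have "(16::real) ^ CARD('n) = 4 ^ CARD('n) * 4 ^ CARD('n)" by (simp flip: power_mult_distrib)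
  then show ?thesis by simp
 qed
 finally show ?thesis .
qed

text \<open>Duality with \<open>S\<close> the geometric combination of the square functions of the two factors; the Carleson constant
  of the symbol at level \<open>r\<close> gains \<open>1 / weight r\<close>, the block of level \<open>i\<close> loses \<open>weight i\<close>.\<close>

lemma block_pair_estimate:
 assumes carlf: "carleson L (scales L) (%n x. (coeff_op L n f x)^2) (F\<^sup>2)"
  and carlm: "carleson L {n \<in> scales L. level Z n = r} (%n x. (m n x)^2) ((B / weight r)^2)"
  and m: "!!n x. 0 <= m n x" and B: "0 <= B" and F: "0 <= F"
 shows "(\<Sum>n\<in>{n \<in> scales L. level Z n = r}. \<Sum>x\<in>grid L. m n x * (\<bar>block_term i n x\<bar> * \<bar>apart n x\<bar>))
  <= 32 ^ CARD('n) * (B * F) * (weight i / weight r * (sqrt (bmass i) * sqrt (amass r)))"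
proof -
 define N where "N = {n \<in> scales L. level Z n = r}"
 define Zr where "Zr = {z \<in> partial_scales L Z. level Z z = r}"
 define z where "z = (%n j. if j \<in> Z then n j else 0 :: nat)"
 define P where "P = (%n. fixed ` {k \<in> below n. level diffd k = i})"
 define h where "h = (%p x. (strong_max L (fibre_sum i p) x)^2)"
 define e where "e = (%z x. (strong_max L (afroz z) x)^2)"
 define u where "u = (%x. multiplicity_bound i * (\<Sum>p\<in>fixed ` block i. h p x))"
 define v where "v = (%x. \<Sum>z\<in>Zr. e z x)"
 have h0: "0 <= h p x" and e0: "0 <= e z' x" for p z' x by (auto simp: h_def e_def)
 have u0: "0 <= u x" and v0: "0 <= v x" for x
  unfolding u_def v_def using multiplicity_bound_nonneg h0 e0 by (auto intro!: mult_nonneg_nonneg sum_nonneg)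
 have finN: "finite N" by (simp add: N_def)
 have Pb: "P n \<subseteq> fixed ` block i" if "n \<in> N" for n
  using that below_scales[of n] by (auto simp: P_def N_def block_def)
 have finP: "finite (P n)" for n by (simp add: P_def)
 have key: "(\<Sum>n\<in>N. (\<bar>block_term i n x\<bar> * \<bar>apart n x\<bar>)^2) <= (sqrt (u x) * sqrt (v x))^2" if x: "x \<in> grid L" for x
 proof -
  have "(\<Sum>n\<in>N. (\<bar>block_term i n x\<bar> * \<bar>apart n x\<bar>)^2) <=
    (\<Sum>n\<in>N. (multiplicity_bound i * (\<Sum>p\<in>P n. h p x)) * e (z n) x)"
   unfolding power_mult_distrib power2_abs
  proof (intro sum_mono mult_mono)
   fix n assume "n \<in> N"
   then have n: "n \<in> scales L" by (simp add: N_def)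
   show "(block_term i n x)^2 <= multiplicity_bound i * (\<Sum>p\<in>P n. h p x)"
    unfolding P_def h_def by (rule block_term_sq[OF n x])
   show "(apart n x)^2 <= e (z n) x" unfolding e_def z_def by (rule apart_sq_le[OF n x])
  qed (use multiplicity_bound_nonneg h0 in \<open>auto intro!: mult_nonneg_nonneg sum_nonneg\<close>)
  also have "... = multiplicity_bound i * (\<Sum>n\<in>N. \<Sum>p\<in>P n. h p x * e (z n) x)"
   by (simp add: sum_distrib_left sum_distrib_right mult_ac)
  also have "(\<Sum>n\<in>N. \<Sum>p\<in>P n. h p x * e (z n) x) = (\<Sum>w\<in>Sigma N P. h (snd w) x * e (z (fst w)) x)"
   using finN finP by (simp add: sum.Sigma case_prod_beta)
  also have "... = (\<Sum>w\<in>(%w. (snd w, z (fst w))) ` Sigma N P. h (fst w) x * e (snd w) x)"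
  proof (subst sum.reindex)
   show "inj_on (%w. (snd w, z (fst w))) (Sigma N P)"
   proof (rule inj_onI)
    fix w w' assume w: "w \<in> Sigma N P" "w' \<in> Sigma N P" and eq: "(snd w, z (fst w)) = (snd w', z (fst w'))"
    have off: "snd w'' j = fst w'' j" if w'': "w'' \<in> Sigma N P" and j: "j \<notin> Z" for w'' j
    proof -
     obtain k where "k \<in> below (fst w'')" "snd w'' = fixed k" using w'' by (auto simp: P_def)
     then show ?thesis using j belowD(2)[of k "fst w''" j] by (simp add: fixed_def)
    qed
    have "fst w j = fst w' j" for j
    proof (cases "j \<in> Z")
     case True
     have "z (fst w) j = z (fst w') j" using eq by simp
     then show ?thesis using True by (simp add: z_def)
    next
     case False
     then show ?thesis using off[OF w(1), of j] off[OF w(2), of j] eq by simp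
    qed
    then show "w = w'" using eq by (auto simp: prod_eq_iff)
   qed
  qed simp
  also have "... <= (\<Sum>w\<in>fixed ` block i \<times> Zr. h (fst w) x * e (snd w) x)"
  proof (rule sum_mono2)
   have "z n \<in> Zr" if "n \<in> N" for n
    using that by (auto simp: N_def Zr_def z_def partial_scales_def scales_def level_def)
   then show "(%w. (snd w, z (fst w))) ` Sigma N P \<subseteq> fixed ` block i \<times> Zr"
    using Pb by (intro image_subsetI) (fastforce elim!: SigmaE)
  qed (auto simp: Zr_def h0 e0)
  also have "... = (\<Sum>p\<in>fixed ` block i. h p x) * v x"
   by (simp add: v_def sum_product sum.cartesian_product case_prod_beta)
  finally have "(\<Sum>n\<in>N. (\<bar>block_term i n x\<bar> * \<bar>apart n x\<bar>)^2) <= u x * v x"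
   using multiplicity_bound_nonneg by (simp add: u_def mult_left_mono mult.assoc)
  then show ?thesis using u0 v0 by (simp add: power_mult_distrib)
 qed
 have "(\<Sum>n\<in>N. \<Sum>x\<in>grid L. m n x * (\<bar>block_term i n x\<bar> * \<bar>apart n x\<bar>))
  <= 2 ^ CARD('n) * (B / weight r) * (\<Sum>x\<in>grid L. sqrt (u x) * sqrt (v x))"
 proof (rule carleson_duality[OF finN])
  show "n j <= L" if "n \<in> N" for n j using that by (simp add: N_def scales_def less_imp_le)
  show "carleson L N (%n x. (m n x)^2) ((B / weight r)^2)" unfolding N_def by (rule carlm)
  show "0 <= B / weight r" using B weight_pos[of r] by simp
  show "\<bar>block_term i n y\<bar> * \<bar>apart n y\<bar> = \<bar>block_term i n x\<bar> * \<bar>apart n x\<bar>"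
   if "n \<in> N" "x \<in> grid L" "y \<in> cell L n x" for n x y
   using block_term_cell[of n x y i] apart_cell[of x y n] that by (simp add: N_def)
 qed (use m u0 v0 key in auto)
 also have "... <= 2 ^ CARD('n) * (B / weight r) * (sqrt (\<Sum>x\<in>grid L. u x) * sqrt (\<Sum>x\<in>grid L. v x))"
  using B weight_pos[of r] by (intro mult_left_mono sum_sqrt_mult_le u0 v0) auto
 also have "... <= 2 ^ CARD('n) * (B / weight r) *
   (sqrt (64 ^ CARD('n) * (F\<^sup>2 * ((weight i)^2 * bmass i))) * sqrt (4 ^ CARD('n) * amass r))"
 proof (intro mult_left_mono mult_mono real_sqrt_le_mono)
  have "(\<Sum>x\<in>grid L. u x) = multiplicity_bound i * (\<Sum>p\<in>fixed ` block i. sq_norm L (strong_max L (fibre_sum i p)))"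
   unfolding u_def h_def sq_norm_def by (simp add: sum_distrib_left[symmetric]) (subst sum.swap, simp)
  also have "... <= multiplicity_bound i * (\<Sum>p\<in>fixed ` block i. 4 ^ CARD('n) * sq_norm L (fibre_sum i p))"
   using multiplicity_bound_nonneg by (intro mult_left_mono sum_mono sq_norm_strong_max)
  also have "... = 4 ^ CARD('n) * (multiplicity_bound i * (\<Sum>k\<in>block i. sq_norm L (bil k)))"
   by (simp add: sum_fibre_sums flip: sum_distrib_left)
  also have "... <= 4 ^ CARD('n) * (16 ^ CARD('n) * (F\<^sup>2 * ((weight i)^2 * bmass i)))"
   by (intro mult_left_mono block_mass[OF carlf]) simp
  also have "... = 64 ^ CARD('n) * (F\<^sup>2 * ((weight i)^2 * bmass i))"
  proof -
   have "(64::real) ^ CARD('n) = 4 ^ CARD('n) * 16 ^ CARD('n)" by (simp flip: power_mult_distrib)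
   then show ?thesis by simp
  qed
  finally show "(\<Sum>x\<in>grid L. u x) <= 64 ^ CARD('n) * (F\<^sup>2 * ((weight i)^2 * bmass i))" .
  have "(\<Sum>x\<in>grid L. v x) = (\<Sum>z\<in>Zr. sq_norm L (strong_max L (afroz z)))"
   unfolding v_def e_def sq_norm_def by (rule sum.swap)
  also have "... <= (\<Sum>z\<in>Zr. 4 ^ CARD('n) * sq_norm L (afroz z))"
   by (intro sum_mono sq_norm_strong_max)
  also have "... = 4 ^ CARD('n) * amass r" by (simp add: amass_def Zr_def sum_distrib_left)
  finally show "(\<Sum>x\<in>grid L. v x) <= 4 ^ CARD('n) * amass r" .
 qed (use B weight_pos[of r] bmass_nonneg amass_nonneg u0 v0 in \<open>auto intro!: sum_nonneg\<close>)
 also have "... = 32 ^ CARD('n) * (B * F) * (weight i / weight r * (sqrt (bmass i) * sqrt (amass r)))"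
 proof -
  have p: "sqrt ((64::real) ^ CARD('n)) = 8 ^ CARD('n)" "sqrt ((4::real) ^ CARD('n)) = 2 ^ CARD('n)"
   "(32::real) ^ CARD('n) = 2 ^ CARD('n) * (8 ^ CARD('n) * 2 ^ CARD('n))"
   using real_sqrt_abs[of "(8::real) ^ CARD('n)"] real_sqrt_abs[of "(2::real) ^ CARD('n)"]
   by (auto simp: power2_eq_square simp flip: power_mult_distrib)
  show ?thesis unfolding real_sqrt_mult p using F weight_pos[of i] by (simp add: mult_ac)
 qed
 finally show ?thesis by (simp only: N_def)
qed

text \<open>Only blocks with \<open>i \<le> r\<close> contribute, because the telescoped scales lie below \<open>n\<close>; the Schur test sums them.\<close>

lemma typed_estimate:
 assumes carlf: "carleson L (scales L) (%n x. (coeff_op L n f x)^2) (F\<^sup>2)"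
  and carlm: "!!r. carleson L {n \<in> scales L. level Z n = r} (%n x. (m n x)^2) ((B / weight r)^2)"
  and m: "!!n x. 0 <= m n x" and B: "0 <= B" and F: "0 <= F"
 shows "(\<Sum>n\<in>scales L. \<Sum>x\<in>grid L. m n x * (\<bar>\<Sum>k\<in>below n. bil k x\<bar> * \<bar>apart n x\<bar>))
  <= 64 ^ CARD('n) * (B * F) * (sqrt (sq_norm L b) * sqrt (sq_norm L a))"
proof -
 define I where "I = level diffd ` scales L"
 define R where "R = level Z ` scales L"
 have fin: "finite I" "finite R" by (auto simp: I_def R_def)
 have pt: "\<bar>\<Sum>k\<in>below n. bil k x\<bar> <= (\<Sum>i\<in>{i \<in> I. \<forall>j. i j <= level Z n j}. \<bar>block_term i n x\<bar>)"
  if n: "n \<in> scales L" for n x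
 proof -
  have "(\<Sum>k\<in>below n. bil k x) = (\<Sum>i\<in>level diffd ` below n. block_term i n x)"
   unfolding block_term_def by (rule sum.image_gen) simp
  then have "\<bar>\<Sum>k\<in>below n. bil k x\<bar> <= (\<Sum>i\<in>level diffd ` below n. \<bar>block_term i n x\<bar>)"
   by (simp only: sum_abs)
  also have "... <= (\<Sum>i\<in>{i \<in> I. \<forall>j. i j <= level Z n j}. \<bar>block_term i n x\<bar>)"
  proof (rule sum_mono2)
   show "level diffd ` below n \<subseteq> {i \<in> I. \<forall>j. i j <= level Z n j}"
   proof (rule image_subsetI)
    fix k assume k: "k \<in> below n"
    have "level diffd k j <= level Z n j" for j
     using below_le[OF k, of j] by (auto simp: level_def diffd_def intro: floor_log_le_iff)
    then show "level diffd k \<in> {i \<in> I. \<forall>j. i j <= level Z n j}"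
     using below_scales[OF n k] by (auto simp: I_def)
   qed
  qed (use fin in auto)
  finally show ?thesis .
 qed
 have "(\<Sum>n\<in>scales L. \<Sum>x\<in>grid L. m n x * (\<bar>\<Sum>k\<in>below n. bil k x\<bar> * \<bar>apart n x\<bar>)) <=
  (\<Sum>n\<in>scales L. \<Sum>x\<in>grid L. m n x * ((\<Sum>i\<in>{i \<in> I. \<forall>j. i j <= level Z n j}. \<bar>block_term i n x\<bar>) * \<bar>apart n x\<bar>))"
  by (intro sum_mono mult_left_mono mult_right_mono pt m) auto
 also have "... = (\<Sum>n\<in>scales L. \<Sum>i\<in>{i \<in> I. \<forall>j. i j <= level Z n j}. \<Sum>x\<in>grid L. m n x * (\<bar>block_term i n x\<bar> * \<bar>apart n x\<bar>))"
  by (simp only: sum_distrib_left sum_distrib_right sum.swap[of _ _ "grid L"])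
 also have "... = (\<Sum>r\<in>R. \<Sum>n\<in>{n \<in> scales L. level Z n = r}. \<Sum>i\<in>{i \<in> I. \<forall>j. i j <= level Z n j}. \<Sum>x\<in>grid L. m n x * (\<bar>block_term i n x\<bar> * \<bar>apart n x\<bar>))"
  unfolding R_def by (rule sum.image_gen) simp
 also have "... = (\<Sum>r\<in>R. \<Sum>i\<in>{i \<in> I. \<forall>j. i j <= r j}. \<Sum>n\<in>{n \<in> scales L. level Z n = r}. \<Sum>x\<in>grid L. m n x * (\<bar>block_term i n x\<bar> * \<bar>apart n x\<bar>))"
 proof (rule sum.cong[OF refl])
  fix r assume "r \<in> R"
  have "(\<Sum>n\<in>{n \<in> scales L. level Z n = r}. \<Sum>i\<in>{i \<in> I. \<forall>j. i j <= level Z n j}. \<Sum>x\<in>grid L. m n x * (\<bar>block_term i n x\<bar> * \<bar>apart n x\<bar>))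
   = (\<Sum>n\<in>{n \<in> scales L. level Z n = r}. \<Sum>i\<in>{i \<in> I. \<forall>j. i j <= r j}. \<Sum>x\<in>grid L. m n x * (\<bar>block_term i n x\<bar> * \<bar>apart n x\<bar>))"
   by (rule sum.cong[OF refl]) simp
  also have "... = (\<Sum>i\<in>{i \<in> I. \<forall>j. i j <= r j}. \<Sum>n\<in>{n \<in> scales L. level Z n = r}. \<Sum>x\<in>grid L. m n x * (\<bar>block_term i n x\<bar> * \<bar>apart n x\<bar>))"
   by (rule sum.swap)
  finally show "(\<Sum>n\<in>{n \<in> scales L. level Z n = r}. \<Sum>i\<in>{i \<in> I. \<forall>j. i j <= level Z n j}. \<Sum>x\<in>grid L. m n x * (\<bar>block_term i n x\<bar> * \<bar>apart n x\<bar>))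
   = (\<Sum>i\<in>{i \<in> I. \<forall>j. i j <= r j}. \<Sum>n\<in>{n \<in> scales L. level Z n = r}. \<Sum>x\<in>grid L. m n x * (\<bar>block_term i n x\<bar> * \<bar>apart n x\<bar>))" .
 qed
 also have "... <= (\<Sum>r\<in>R. \<Sum>i\<in>{i \<in> I. \<forall>j. i j <= r j}. 32 ^ CARD('n) * (B * F) * (weight i / weight r * (sqrt (bmass i) * sqrt (amass r))))"
  by (intro sum_mono block_pair_estimate[OF carlf carlm m B F])
 also have "... = 32 ^ CARD('n) * (B * F) * (\<Sum>r\<in>R. \<Sum>i\<in>{i \<in> I. \<forall>j. i j <= r j}. weight i / weight r * (sqrt (bmass i) * sqrt (amass r)))"
  by (simp only: sum_distrib_left)
 also have "... <= 32 ^ CARD('n) * (B * F) * (2 ^ CARD('n) * (sqrt (\<Sum>i\<in>I. bmass i) * sqrt (\<Sum>r\<in>R. amass r)))"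
  using B F by (intro mult_left_mono block_schur fin bmass_nonneg amass_nonneg) auto
 also have "... <= 32 ^ CARD('n) * (B * F) * (2 ^ CARD('n) * (sqrt (sq_norm L b) * sqrt (sq_norm L a)))"
  using B F sum_bmass[OF fin(1)] sum_amass[OF fin(2)] bmass_nonneg amass_nonneg
  by (intro mult_left_mono mult_mono real_sqrt_le_mono) (auto intro!: sum_nonneg)
 also have "... = 64 ^ CARD('n) * (B * F) * (sqrt (sq_norm L b) * sqrt (sq_norm L a))"
 proof -
  have "(64::real) ^ CARD('n) = 32 ^ CARD('n) * 2 ^ CARD('n)" by (simp flip: power_mult_distrib)
  then show ?thesis by (simp add: mult_ac)
 qed
 finally show ?thesis .
qed

end

text \<open>On the block of level \<open>r\<close> all scales in \<open>Z\<close> are at least \<open>2\<^sup>r - 1\<close>, so the logarithmic hypothesis on the symbol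
  becomes the gain \<open>1 / weight r\<close>. There are at most three modes per coordinate of \<open>Z\<close>, which turns \<open>64\<close> into \<open>192\<close>.\<close>

theorem four_linear_estimate:
 fixes f a b :: "('n::finite => nat) => real" and m :: "('n => nat) => ('n => nat) => real"
 assumes carlf: "carleson L (scales L) (%n x. (coeff_op L n f x)^2) (F\<^sup>2)"
  and carlm: "!!k. carleson L {n \<in> scales L. \<forall>j\<in>Z. k j <= n j} (%n x. (m n x)^2)
    (B\<^sup>2 / (\<Prod>j\<in>Z. (real (k j) + 1)^2))"
  and m: "!!n x. 0 <= m n x" and B: "0 <= B" and F: "0 <= F"
 shows "(\<Sum>n\<in>scales L. \<Sum>x\<in>grid L. m n x *
   (\<bar>ker_op L (%j. if j \<in> Z then osc_ker L (n j) else coeff_ker L (n j)) f x\<bar> * \<bar>mean_op L n b x\<bar> *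
   \<bar>ker_op L (%j. if j \<in> Z then coeff_ker L (n j) else mean_ker L (n j)) a x\<bar>))
  <= 192 ^ CARD('n) * (B * F) * (sqrt (sq_norm L b) * sqrt (sq_norm L a))"
proof -
 define T where "T = PiE UNIV (%j. if j \<in> Z then UNIV else {Diff_Mean})"
 define R where "R = 64 ^ CARD('n) * (B * F) * (sqrt (sq_norm L b) * sqrt (sq_norm L a))"
 have R: "0 <= R" unfolding R_def using B F by auto
 have finT: "finite T" unfolding T_def by (intro finite_PiE) auto
 have carlr: "carleson L {n \<in> scales L. level Z n = r} (%n x. (m n x)^2) ((B / weight r)^2)" for r
 proof (cases "\<forall>j. j \<notin> Z --> r j = 0")
  case True
  (* The smallest scale of level r: floor_log (Suc k) = r means 2 ^ r <= Suc k. *)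
  define k where "k = (%j. 2 ^ r j - 1 :: nat)"
  have "(\<Prod>j\<in>Z. (real (k j) + 1)^2) = (\<Prod>j\<in>Z. (2 ^ r j)^2)" by (simp add: k_def of_nat_diff)
  also have "... = (\<Prod>j\<in>UNIV. (2 ^ r j)^2)" by (rule prod.mono_neutral_left) (use True in auto)
  also have "... = (weight r)^2" by (simp add: weight_def prod_power_distrib)
  finally have e: "B\<^sup>2 / (\<Prod>j\<in>Z. (real (k j) + 1)^2) = (B / weight r)^2" by (simp add: power_divide)
  have sub: "{n \<in> scales L. level Z n = r} \<subseteq> {n \<in> scales L. \<forall>j\<in>Z. k j <= n j}"
  proof (intro subsetI CollectI conjI ballI)
   fix n j assume n: "n \<in> {n \<in> scales L. level Z n = r}" and j: "j \<in> Z"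
   then have "floor_log (Suc (n j)) = r j" by (auto simp: level_def)
   then have "2 ^ r j <= Suc (n j)" using floor_log_exp2_le[of "Suc (n j)"] by auto
   then show "k j <= n j" by (simp add: k_def)
  qed auto
  show ?thesis unfolding carleson_def
  proof (intro allI impI)
   fix W :: "('n => nat) set" assume om: "W \<subseteq> grid L"
   have "(\<Sum>n\<in>{n \<in> scales L. level Z n = r}. \<Sum>x\<in>{x \<in> grid L. cell L n x \<subseteq> W}. (m n x)^2)
    <= (\<Sum>n\<in>{n \<in> scales L. \<forall>j\<in>Z. k j <= n j}. \<Sum>x\<in>{x \<in> grid L. cell L n x \<subseteq> W}. (m n x)^2)"
    using sub by (intro sum_mono2) (auto intro!: sum_nonneg)
   also have "... <= (B / weight r)^2 * card W" using carlm[of k] om unfolding carleson_def e by blast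
   finally show "(\<Sum>n\<in>{n \<in> scales L. level Z n = r}. \<Sum>x\<in>{x \<in> grid L. cell L n x \<subseteq> W}. (m n x)^2)
     <= (B / weight r)^2 * card W" .
  qed
 next
  case False
  then have e: "{n \<in> scales L. level Z n = r} = {}" by (auto simp: level_def)
  show ?thesis unfolding carleson_def e by simp
 qed
 have "(\<Sum>n\<in>scales L. \<Sum>x\<in>grid L. m n x *
   (\<bar>ker_op L (%j. if j \<in> Z then osc_ker L (n j) else coeff_ker L (n j)) f x\<bar> * \<bar>mean_op L n b x\<bar> *
   \<bar>ker_op L (%j. if j \<in> Z then coeff_ker L (n j) else mean_ker L (n j)) a x\<bar>))
  <= (\<Sum>n\<in>scales L. \<Sum>x\<in>grid L. m n x *
   ((\<Sum>t\<in>T. \<bar>\<Sum>k\<in>below Z n. ker_op2 L (gker L Z t k) f b x\<bar>) * \<bar>apart L Z a n x\<bar>))"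
 proof (intro sum_mono mult_left_mono m)
  fix n x :: "'n => nat" assume n: "n \<in> scales L"
  have "\<bar>ker_op L (%j. if j \<in> Z then osc_ker L (n j) else coeff_ker L (n j)) f x\<bar> * \<bar>mean_op L n b x\<bar>
   = \<bar>\<Sum>t\<in>T. \<Sum>k\<in>below Z n. ker_op2 L (gker L Z t k) f b x\<bar>"
   unfolding abs_mult[symmetric] product_expansion[OF n] T_def below_def ..
  also have "... <= (\<Sum>t\<in>T. \<bar>\<Sum>k\<in>below Z n. ker_op2 L (gker L Z t k) f b x\<bar>)" by (rule sum_abs)
  finally show "\<bar>ker_op L (%j. if j \<in> Z then osc_ker L (n j) else coeff_ker L (n j)) f x\<bar> * \<bar>mean_op L n b x\<bar> *
   \<bar>ker_op L (%j. if j \<in> Z then coeff_ker L (n j) else mean_ker L (n j)) a x\<bar> <=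
   (\<Sum>t\<in>T. \<bar>\<Sum>k\<in>below Z n. ker_op2 L (gker L Z t k) f b x\<bar>) * \<bar>apart L Z a n x\<bar>"
   unfolding apart_def by (rule mult_right_mono) simp
 qed
 also have "... = (\<Sum>t\<in>T. \<Sum>n\<in>scales L. \<Sum>x\<in>grid L. m n x *
   (\<bar>\<Sum>k\<in>below Z n. ker_op2 L (gker L Z t k) f b x\<bar> * \<bar>apart L Z a n x\<bar>))"
  by (simp only: sum_distrib_left sum_distrib_right sum.swap[of _ T])
 also have "... <= (\<Sum>t\<in>T. R)"
  unfolding R_def by (intro sum_mono typed_estimate[OF carlf carlr m B F])
 also have "... <= 3 ^ CARD('n) * R"
 proof -
  have "card T <= 3 ^ CARD('n)"
  proof -
   have "card T = (\<Prod>j\<in>UNIV. card (if j \<in> Z then UNIV else {Diff_Mean}))"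
    unfolding T_def by (rule card_PiE) simp
   also have "... <= (\<Prod>j\<in>(UNIV::'n set). 3)" by (rule prod_mono) (auto simp: UNIV_mode)
   finally show ?thesis by simp
  qed
  then have "real (card T) <= real (3 ^ CARD('n))" by (simp only: of_nat_le_iff)
  then show ?thesis using R by (simp add: mult_right_mono)
 qed
 also have "... = 192 ^ CARD('n) * (B * F) * (sqrt (sq_norm L b) * sqrt (sq_norm L a))"
 proof -
  have "(192::real) ^ CARD('n) = 3 ^ CARD('n) * 64 ^ CARD('n)" by (simp flip: power_mult_distrib)
  then show ?thesis by (simp add: R_def)
 qed
 finally show ?thesis .
qed

section \<open>Localising the spectrum of a function with small support\<close>

lemma ker_op_diff_kernel:
 fixes \<kappa> :: "'n::finite => nat => nat => real"
 assumes "!!t. t < 2 ^ L ==> \<kappa> i (x i) t = \<alpha> (x i) t - \<beta> (x i) t"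
 shows "ker_op L \<kappa> f x = ker_op L (\<kappa>(i := \<alpha>)) f x - ker_op L (\<kappa>(i := \<beta>)) f x"
proof -
 have p: "(\<Prod>j\<in>UNIV. (\<kappa>(i := \<gamma>)) j (x j) (y j)) = \<gamma> (x i) (y i) * (\<Prod>j\<in>UNIV - {i}. \<kappa> j (x j) (y j))" for \<gamma> y
  by (subst prod.remove[of UNIV i]) (auto intro: prod.cong)
 have q: "(\<Prod>j\<in>UNIV. \<kappa> j (x j) (y j)) = \<kappa> i (x i) (y i) * (\<Prod>j\<in>UNIV - {i}. \<kappa> j (x j) (y j))" for y
  by (rule prod.remove) auto
 show ?thesis unfolding ker_op_def p q
  by (subst sum_subtractf[symmetric], rule sum.cong[OF refl]) (simp add: assms gridD algebra_simps)
qed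

lemma mean_op_cauchy_schwarz:
 "(mean_op L n (%y. g y * h y) x)^2 <= mean_op L n (%y. (g y)^2) x * mean_op L n (%y. (h y)^2) x"
proof -
 define w where "w = (%y. \<Prod>j\<in>UNIV. mean_ker L (n j) (x j) (y j))"
 have w: "0 <= w y" for y unfolding w_def by (intro prod_nonneg) auto
 have mw: "mean_op L n f x = (\<Sum>y\<in>grid L. w y * f y)" for f
  by (simp add: mean_op_def ker_op_def w_def)
 have "mean_op L n (%y. g y * h y) x = (\<Sum>y\<in>grid L. (sqrt (w y) * g y) * (sqrt (w y) * h y))"
  unfolding mw
 proof (rule sum.cong[OF refl])
  fix y :: "'a => nat"
  have "sqrt (w y) * sqrt (w y) = w y" using w[of y] by simp
  then show "w y * (g y * h y) = sqrt (w y) * g y * (sqrt (w y) * h y)" by (metis mult.assoc mult.left_commute)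
 qed
 then have "(mean_op L n (%y. g y * h y) x)^2 <=
   (\<Sum>y\<in>grid L. (sqrt (w y) * g y)^2) * (\<Sum>y\<in>grid L. (sqrt (w y) * h y)^2)"
  by (simp only: Cauchy_Schwarz_ineq_sum)
 also have "... = mean_op L n (%y. (g y)^2) x * mean_op L n (%y. (h y)^2) x"
  unfolding mw using w by (simp add: power_mult_distrib)
 finally show ?thesis .
qed

definition axis_scale :: "nat => 'n => nat => 'n => nat" where
 "axis_scale L j k = (%i. if i = j then k else L)"

lemma axis_scale_fun_upd: "(%_. L)(j := k) = axis_scale L j k"
 by (auto simp: axis_scale_def)

definition axis_diff :: "nat => 'n::finite => nat => (('n => nat) => real) => ('n => nat) => real" where
 "axis_diff L j k f x = mean_op L (axis_scale L j (Suc k)) f x - mean_op L (axis_scale L j k) f x"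

lemma axis_diff_ker:
 assumes "k < L"
 shows "axis_diff L j k f x = ker_op L (%i. if i = j then diff_ker L k else mean_ker L L) f x"
proof -
 have "ker_op L (%i. if i = j then diff_ker L k else mean_ker L L) f x =
  ker_op L ((%i. if i = j then diff_ker L k else mean_ker L L)(j := mean_ker L (Suc k))) f x -
  ker_op L ((%i. if i = j then diff_ker L k else mean_ker L L)(j := mean_ker L k)) f x"
  by (rule ker_op_diff_kernel) (simp add: diff_ker_eq assms)
 moreover have "(%i. if i = j then diff_ker L k else mean_ker L L)(j := mean_ker L l) = (%i. mean_ker L (axis_scale L j l i))" for l
  by (auto simp: axis_scale_def)
 ultimately show ?thesis by (simp add: axis_diff_def mean_op_def)
qed

lemma mean_op_refine_le:
 assumes "k < L" "!!y. y \<in> grid L ==> 0 <= f y"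
 shows "mean_op L (axis_scale L j (Suc k)) f x <= 2 * mean_op L (axis_scale L j k) f x"
 unfolding mean_op_def ker_op_def sum_distrib_left
proof (rule sum_mono)
 fix y :: "'a => nat" assume y: "y \<in> grid L"
 have le: "mean_ker L (Suc k) s t <= 2 * mean_ker L k s t" for s t
 proof -
  have "(2::real) ^ (L - k) = 2 * 2 ^ (L - Suc k)" using assms(1) by (metis Suc_diff_Suc power_Suc)
  then show ?thesis using same_cell_mono[of L "Suc k" s t k] by (auto simp: mean_ker_def field_simps)
 qed
 define P where "P = (\<Prod>i\<in>UNIV - {j}. mean_ker L L (x i) (y i))"
 have P: "0 <= P" unfolding P_def by (intro prod_nonneg) auto
 have r: "(\<Prod>i\<in>UNIV. mean_ker L (axis_scale L j l i) (x i) (y i)) = mean_ker L l (x j) (y j) * P" for l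
  unfolding P_def by (subst prod.remove[of UNIV j]) (auto simp: axis_scale_def intro: prod.cong)
 have "mean_ker L (Suc k) (x j) (y j) * (P * f y) <= 2 * mean_ker L k (x j) (y j) * (P * f y)"
  using le P assms(2)[OF y] by (intro mult_right_mono) auto
 then show "(\<Prod>i\<in>UNIV. mean_ker L (axis_scale L j (Suc k) i) (x i) (y i)) * f y
  <= 2 * ((\<Prod>i\<in>UNIV. mean_ker L (axis_scale L j k i) (x i) (y i)) * f y)"
  unfolding r by (simp add: mult_ac)
qed

lemma sum_cell_const_mean:
 assumes "!!i. n i <= L" "!!x y. x \<in> grid L ==> y \<in> cell L n x ==> u y = u x"
 shows "(\<Sum>x\<in>grid L. u x * mean_op L n f x) = (\<Sum>x\<in>grid L. u x * f x)"
 unfolding mean_op_adjoint using assms by (intro sum.cong refl arg_cong2[of _ _ _ _ "(*)"] mean_op_fix) auto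

text \<open>Energy of the martingale differences before the stopping time at which the density of \<open>E\<close> exceeds \<open>\<theta>\<close>. The
  stopped martingale is a mean of \<open>v\<close>, which lives on \<open>E\<close>; by Cauchy--Schwarz its square is at most the density
  of \<open>E\<close> times the mean of \<open>v\<^sup>2\<close>, and one refinement at most doubles the density.\<close>

lemma stopped_axis_energy:
 fixes v :: "('n::finite => nat) => real" and E :: "('n => nat) set" and \<theta> :: real and j :: 'n
 assumes \<theta>: "0 <= \<theta>" "\<theta> < 1" and E: "!!x. x \<in> grid L ==> v x ~= 0 ==> x \<in> E"
 defines "hit \<equiv> %k x. \<exists>l\<le>k. mean_op L (axis_scale L j l) (indicator E) x > \<theta>"
 shows "(\<Sum>k<L. \<Sum>x\<in>grid L. (if hit k x then 0 else (axis_diff L j k v x)^2)) <= 2 * \<theta> * sq_norm L v"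
proof -
 define e where "e = (%k. mean_op L (axis_scale L j k) v)"
 define u where "u = (%k x. if hit k x then 0 else 1 :: real)"
 have aL: "axis_scale L j k i <= L" if "k <= L" for k i using that by (simp add: axis_scale_def)
 have sub: "y \<in> cell L (axis_scale L j l) x" if "y \<in> cell L (axis_scale L j k) x" "l <= k" for k l x and y :: "'n => nat"
  using that unfolding cell_def axis_scale_def by (auto intro: same_cell_mono split: if_splits)
 have uc: "u k y = u k x" if "y \<in> cell L (axis_scale L j k) x" for k x y
 proof -
  have "mean_op L (axis_scale L j l) (indicator E) y = mean_op L (axis_scale L j l) (indicator E) x" if "l <= k" for l
   by (rule mean_op_cell) (rule sub[OF \<open>y \<in> cell L (axis_scale L j k) x\<close> that])
  then have "hit k y = hit k x" unfolding hit_def by auto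
  then show ?thesis by (simp add: u_def)
 qed
 have ec: "e k y = e k x" if "y \<in> cell L (axis_scale L j k) x" for k x y
  unfolding e_def by (rule mean_op_cell[OF that])
 have ee: "mean_op L (axis_scale L j k) (e (Suc k)) x = e k x" if "k < L" "x \<in> grid L" for k x
 proof -
  have "mean_op L (axis_scale L j k) (e (Suc k)) x = mean_op L (%i. min (axis_scale L j k i) (axis_scale L j (Suc k) i)) v x"
   unfolding e_def using that by (intro mean_op_comp) (auto simp: axis_scale_def)
  also have "(%i. min (axis_scale L j k i) (axis_scale L j (Suc k) i)) = axis_scale L j k" by (auto simp: axis_scale_def)
  finally show ?thesis by (simp only: e_def)
 qed
 have energy: "(\<Sum>x\<in>grid L. u k x * (axis_diff L j k v x)^2) = (\<Sum>x\<in>grid L. u k x * ((e (Suc k) x)^2 - (e k x)\<^sup>2))"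
  if k: "k < L" for k
 proof -
  have "(\<Sum>x\<in>grid L. (u k x * e k x) * e (Suc k) x) = (\<Sum>x\<in>grid L. (u k x * e k x) * mean_op L (axis_scale L j k) (e (Suc k)) x)"
   by (rule sum_cell_const_mean[symmetric]) (use uc ec k in \<open>auto simp: aL\<close>)
  also have "... = (\<Sum>x\<in>grid L. (u k x * e k x) * e k x)" using ee[OF k] by (intro sum.cong) auto
  finally have "(\<Sum>x\<in>grid L. u k x * (e k x * e (Suc k) x)) = (\<Sum>x\<in>grid L. u k x * (e k x)^2)"
   by (simp add: mult.assoc power2_eq_square)
  moreover have ad: "axis_diff L j k v x = e (Suc k) x - e k x" for x by (simp add: axis_diff_def e_def)
  have "(\<Sum>x\<in>grid L. u k x * (axis_diff L j k v x)^2) = (\<Sum>x\<in>grid L. u k x * (e (Suc k) x)^2)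
    + (\<Sum>x\<in>grid L. u k x * (e k x)^2) - 2 * (\<Sum>x\<in>grid L. u k x * (e k x * e (Suc k) x))"
   unfolding ad sum_distrib_left sum.distrib[symmetric] sum_subtractf[symmetric]
   by (rule sum.cong[OF refl]) (simp add: power2_diff algebra_simps)
  ultimately show ?thesis by (simp add: right_diff_distrib sum_subtractf)
 qed
 have ind: "(\<Sum>k<n. \<Sum>x\<in>grid L. u k x * (axis_diff L j k v x)^2) <=
  (\<Sum>x\<in>grid L. (1 - u n x) * (2 * \<theta> * (v x)^2) + u n x * (e n x)^2)" if "n <= L" for n
  using that
 proof (induction n)
  case 0
  show ?case using \<theta> by (auto intro!: sum_nonneg simp: u_def)
 next
  case (Suc n)
  then have n: "n < L" by simp
  define w where "w = (%x. u n x - u (Suc n) x)"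
  have w0: "w x = 0 \<or> w x = 1" for x
   unfolding w_def u_def hit_def by (auto intro: le_SucI)
  have wc: "w y = w x" if "y \<in> cell L (axis_scale L j (Suc n)) x" for x y
   using uc[OF that] uc[OF sub[OF that, of n]] by (simp add: w_def)
  have est: "w x * (e (Suc n) x)^2 <= w x * (2 * \<theta> * mean_op L (axis_scale L j (Suc n)) (%y. (v y)^2) x)"
   if x: "x \<in> grid L" for x
  proof (cases "w x = 0")
   case False
   have "u n x ~= 0" using False w0[of x] by (auto simp: w_def u_def split: if_splits)
   then have "\<not> hit n x" by (auto simp: u_def)
   then have "mean_op L (axis_scale L j n) (indicator E) x <= \<theta>" unfolding hit_def by (meson le_refl not_le)
   moreover have "mean_op L (axis_scale L j (Suc n)) (indicator E) x <= 2 * mean_op L (axis_scale L j n) (indicator E) x"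
    by (rule mean_op_refine_le[OF n]) simp
   ultimately have a: "mean_op L (axis_scale L j (Suc n)) (indicator E) x <= 2 * \<theta>" by simp
   have "e (Suc n) x = mean_op L (axis_scale L j (Suc n)) (%y. indicator E y * v y) x"
    unfolding e_def mean_op_def by (rule ker_op_cong_fun) (use E in \<open>auto simp: indicator_def\<close>)
   then have "(e (Suc n) x)^2 <= mean_op L (axis_scale L j (Suc n)) (%y. (indicator E y)^2) x *
    mean_op L (axis_scale L j (Suc n)) (%y. (v y)^2) x"
    by (simp only: mean_op_cauchy_schwarz)
   also have "(%y. (indicator E y)^2 :: real) = indicator E" by (auto simp: indicator_def)
   also have "mean_op L (axis_scale L j (Suc n)) (indicator E) x * mean_op L (axis_scale L j (Suc n)) (%y. (v y)^2) x
    <= 2 * \<theta> * mean_op L (axis_scale L j (Suc n)) (%y. (v y)^2) x"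
    by (rule mult_right_mono[OF a]) (rule mean_op_nonneg, simp)
   finally show ?thesis using w0[of x] False by simp
  qed simp
  have "(\<Sum>x\<in>grid L. w x * (e (Suc n) x)^2) <= (\<Sum>x\<in>grid L. w x * (2 * \<theta> * mean_op L (axis_scale L j (Suc n)) (%y. (v y)^2) x))"
   by (rule sum_mono) (rule est)
  also have "... = (2 * \<theta>) * (\<Sum>x\<in>grid L. w x * mean_op L (axis_scale L j (Suc n)) (%y. (v y)^2) x)"
   by (simp add: sum_distrib_left mult_ac)
  also have "(\<Sum>x\<in>grid L. w x * mean_op L (axis_scale L j (Suc n)) (%y. (v y)^2) x) = (\<Sum>x\<in>grid L. w x * (v x)^2)"
   by (rule sum_cell_const_mean) (use wc n in \<open>auto simp: aL\<close>)
  finally have step: "(\<Sum>x\<in>grid L. w x * (e (Suc n) x)^2) <= 2 * \<theta> * (\<Sum>x\<in>grid L. w x * (v x)^2)" .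
  have IH: "(\<Sum>k<n. \<Sum>x\<in>grid L. u k x * (axis_diff L j k v x)^2) <=
    (\<Sum>x\<in>grid L. (1 - u n x) * (2 * \<theta> * (v x)^2) + u n x * (e n x)^2)" using Suc by simp
  have "(\<Sum>k<Suc n. \<Sum>x\<in>grid L. u k x * (axis_diff L j k v x)^2) <=
   (\<Sum>x\<in>grid L. (1 - u n x) * (2 * \<theta> * (v x)^2) + u n x * (e n x)^2) + (\<Sum>x\<in>grid L. u n x * ((e (Suc n) x)^2 - (e n x)\<^sup>2))"
   using IH by (simp add: energy[OF n])
  also have "... = (\<Sum>x\<in>grid L. (1 - u (Suc n) x) * (2 * \<theta> * (v x)^2) + u (Suc n) x * (e (Suc n) x)^2)
   + ((\<Sum>x\<in>grid L. w x * (e (Suc n) x)^2) - 2 * \<theta> * (\<Sum>x\<in>grid L. w x * (v x)^2))"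
   unfolding sum_distrib_left sum.distrib[symmetric] sum_subtractf[symmetric] w_def
   by (rule sum.cong[OF refl]) (simp add: algebra_simps)
  also have "... <= (\<Sum>x\<in>grid L. (1 - u (Suc n) x) * (2 * \<theta> * (v x)^2) + u (Suc n) x * (e (Suc n) x)^2)"
   using step by simp
  finally show ?case .
 qed
 have top: "axis_scale L j L = (%_. L)" by (auto simp: axis_scale_def)
 have "(\<Sum>k<L. \<Sum>x\<in>grid L. (if hit k x then 0 else (axis_diff L j k v x)^2)) = (\<Sum>k<L. \<Sum>x\<in>grid L. u k x * (axis_diff L j k v x)^2)"
  by (intro sum.cong refl) (simp add: u_def)
 also have "... <= (\<Sum>x\<in>grid L. (1 - u L x) * (2 * \<theta> * (v x)^2) + u L x * (e L x)^2)" by (rule ind) simp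
 also have "... <= (\<Sum>x\<in>grid L. 2 * \<theta> * (v x)^2)"
 proof (rule sum_mono)
  fix x :: "'n => nat" assume x: "x \<in> grid L"
  show "(1 - u L x) * (2 * \<theta> * (v x)^2) + u L x * (e L x)^2 <= 2 * \<theta> * (v x)^2"
  proof (cases "v x = 0")
   case True
   then have "e L x = 0" unfolding e_def top using x by (simp add: mean_op_top)
   with True show ?thesis by simp
  next
   case False
   then have "mean_op L (axis_scale L j L) (indicator E) x = 1" unfolding top using x E by (simp add: mean_op_top)
   then have "hit L x" unfolding hit_def using \<theta> by auto
   then show ?thesis by (simp add: u_def)
  qed
 qed
 finally show ?thesis by (simp add: sq_norm_def sum_distrib_left)
qed

lemma axis_bessel:
 fixes f :: "('n::finite => nat) => real"
 shows "(\<Sum>k<L. sq_norm L (axis_diff L j k f)) <= sq_norm L f"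
proof -
 define \<iota> where "\<iota> = (%k i. if i = j then k else 0 :: nat)"
 have "(\<Sum>k<L. sq_norm L (axis_diff L j k f)) = (\<Sum>k<L. sq_norm L (partial_diff L {j} (\<iota> k) f))"
 proof (rule sum.cong[OF refl])
  fix k assume "k \<in> {..<L}"
  then have "axis_diff L j k f x = partial_diff L {j} (\<iota> k) f x" for x
   unfolding partial_diff_def by (subst axis_diff_ker) (auto simp: \<iota>_def intro!: ker_op_cong)
  then show "sq_norm L (axis_diff L j k f) = sq_norm L (partial_diff L {j} (\<iota> k) f)" by (simp add: sq_norm_def)
 qed
 also have "... = (\<Sum>q\<in>\<iota> ` {..<L}. sq_norm L (partial_diff L {j} q f))"
 proof (rule sum.reindex[symmetric, unfolded comp_def])
  show "inj_on \<iota> {..<L}" by (rule inj_onI) (metis \<iota>_def)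
 qed
 also have "... <= (\<Sum>q\<in>partial_scales L {j}. sq_norm L (partial_diff L {j} q f))"
  by (rule sum_mono2[OF finite_partial_scales]) (auto simp: partial_scales_def \<iota>_def)
 also have "... <= sq_norm L f" by (rule bessel)
 finally show ?thesis .
qed

lemma sum_mean_ker_top: "s < 2 ^ L ==> (\<Sum>u<2 ^ L. mean_ker L L s u * h u) = h s"
 "t < 2 ^ L ==> (\<Sum>u<2 ^ L. h u * mean_ker L L u t) = h t"
proof -
 have "mean_ker L L s u * h u = (if u = s then h u else 0)" "h u * mean_ker L L u t = (if u = t then h u else 0)" for u
  by (auto simp: mean_ker_top)
 then show "s < 2 ^ L ==> (\<Sum>u<2 ^ L. mean_ker L L s u * h u) = h s"
  "t < 2 ^ L ==> (\<Sum>u<2 ^ L. h u * mean_ker L L u t) = h t" by simp_all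
qed

lemma partial_diff_insert:
 assumes "j \<notin> S" "k j < L" "x \<in> grid L"
 shows "partial_diff L (insert j S) k f x = axis_diff L j (k j) (partial_diff L S (k(j := 0)) f) x"
 unfolding axis_diff_ker[OF assms(2)] partial_diff_def ker_op_ker_op
proof (rule ker_op_cong)
 fix i t assume t: "t < (2::nat) ^ L"
 have s: "x i < 2 ^ L" using assms(3) by (rule gridD)
 show "(if i \<in> insert j S then diff_ker L (k i) else mean_ker L L) (x i) t =
  (\<Sum>u<2 ^ L. (if i = j then diff_ker L (k j) else mean_ker L L) (x i) u *
    (if i \<in> S then diff_ker L ((k(j := 0)) i) else mean_ker L L) u t)"
  using assms(1) s t by (cases "i = j"; cases "i \<in> S") (auto simp: sum_mean_ker_top)
qed

lemma sum_partial_scales_insert: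
 fixes h :: "('n::finite => nat) => nat => real"
 assumes "j \<notin> S"
 shows "(\<Sum>k\<in>partial_scales L (insert j S). h (k(j := 0)) (k j)) = (\<Sum>k\<in>partial_scales L S. \<Sum>l<L. h k l)"
 unfolding sum.cartesian_product
proof (rule sum.reindex_bij_witness[where i = "%(k, l). k(j := l)" and j = "%k. (k(j := 0), k j)"])
 fix p assume p: "p \<in> partial_scales L S \<times> {..<L}"
 then have "fst p j = 0" using assms by (auto simp: partial_scales_def dest: spec[of _ j])
 then have "(fst p)(j := 0) = fst p" by (metis fun_upd_triv)
 then show "(%k. (k(j := 0), k j)) ((%(k, l). k(j := l)) p) = p" by (simp add: case_prod_beta)
 show "(%(k, l). k(j := l)) p \<in> partial_scales L (insert j S)" using p by (auto simp: partial_scales_def)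
qed (use assms in \<open>auto simp: partial_scales_def\<close>)

lemma sqrt_sum_sq_norm_triangle:
 "sqrt (\<Sum>k\<in>K. sq_norm L (%x. f k x + g k x)) <= sqrt (\<Sum>k\<in>K. sq_norm L (f k)) + sqrt (\<Sum>k\<in>K. sq_norm L (g k))"
 using L2_set_triangle_ineq[of "%p. f (fst p) (snd p)" "%p. g (fst p) (snd p)" "K \<times> grid L"]
 by (simp add: L2_set_def sq_norm_def sum.cartesian_product case_prod_beta)

text \<open>A function supported on \<open>W\<close> has almost all of its Haar spectrum on cells inside a slightly larger set. Induction
  over the coordinates: expand in one more coordinate, discard the differences taken where the density is still below
  \<open>\<theta>\<close> (little energy), and enlarge the set by the points where the one-dimensional maximal function of its indicator
  exceeds \<open>\<theta>\<close>.\<close>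

lemma spectral_localization:
 fixes A :: "('n::finite => nat) => real" and \<theta> :: real
 assumes \<theta>: "0 < \<theta>" "\<theta> < 1" and W: "W \<subseteq> grid L" and A: "!!x. x \<in> grid L ==> A x ~= 0 ==> x \<in> W"
 obtains W' where "W' \<subseteq> grid L" "card W' <= (4 / \<theta>\<^sup>2) ^ CARD('n) * card W"
  "(\<Sum>k\<in>scales L. \<Sum>x\<in>{x \<in> grid L. \<not> cell L k x \<subseteq> W'}. (coeff_op L k A x)^2)
   <= 2 * \<theta> * (real CARD('n))^2 * sq_norm L A"
proof -
 define cS where "cS = (%S (k :: 'n => nat) i. if i \<in> S then k i else L)"
 define good where "good = (%S W' (v :: ('n => nat) => ('n => nat) => real).
  W' \<subseteq> grid L \<and> card W' <= (4 / \<theta>\<^sup>2) ^ card S * card W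
  \<and> (\<forall>k\<in>partial_scales L S. \<forall>x\<in>grid L. v k x ~= 0 --> cell L (cS S k) x \<subseteq> W')
  \<and> sqrt (\<Sum>k\<in>partial_scales L S. sq_norm L (%x. partial_diff L S k A x - v k x)) <= card S * sqrt (2 * \<theta> * sq_norm L A)
  \<and> (\<Sum>k\<in>partial_scales L S. sq_norm L (v k)) <= sq_norm L A)"
 have "\<exists>W' v. good S W' v" if "finite S" for S :: "'n set"
  using that
 proof (induction S)
  case empty
  have ps: "partial_scales L {} = {%_ :: 'n. 0 :: nat}" by (auto simp: partial_scales_def)
  have pd: "partial_diff L {} k A x = A x" if "x \<in> grid L" for k :: "'n => nat" and x
   unfolding partial_diff_def by (rule ker_op_id[OF that]) (simp add: mean_ker_top)
  have c: "cell L (cS {} k) x = {x}" if "x \<in> grid L" for k x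
   using that by (auto simp: cell_def cS_def same_cell_top)
  have "sq_norm L (%x. partial_diff L {} (%_. 0) A x - A x) = 0"
   unfolding sq_norm_def by (rule sum.neutral) (simp add: pd)
  then have "good {} W (%_. A)"
   unfolding good_def ps using W A c by simp
  then show ?case by blast
 next
  case (insert j S)
  then obtain W1 v where g: "good S W1 v" by blast
  define N where "N = sq_norm L A"
  have N: "0 <= N" by (simp add: N_def)
  have g1: "W1 \<subseteq> grid L" and g2: "card W1 <= (4 / \<theta>\<^sup>2) ^ card S * card W"
   and g3: "!!k x. k \<in> partial_scales L S ==> x \<in> grid L ==> v k x ~= 0 ==> cell L (cS S k) x \<subseteq> W1"
   and g4: "sqrt (\<Sum>k\<in>partial_scales L S. sq_norm L (%x. partial_diff L S k A x - v k x)) <= card S * sqrt (2 * \<theta> * N)"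
   and g5: "(\<Sum>k\<in>partial_scales L S. sq_norm L (v k)) <= N"
   using g unfolding good_def N_def by auto
  define M where "M = (%E l. mean_op L (axis_scale L j l) (indicator E))"
  define W2 where "W2 = {x \<in> grid L. \<exists>l\<le>L. M W1 l x > \<theta>}"
  define E where "E = (%k. {x \<in> grid L. cell L (cS S k) x \<subseteq> W1})"
  define hit where "hit = (%k l x. \<exists>l'\<le>l. M (E k) l' x > \<theta>)"
  define v0 where "v0 = (%k l x. if hit k l x then axis_diff L j l (v k) x else 0)"
  define v1 where "v1 = (%k l x. if hit k l x then 0 else axis_diff L j l (v k) x)"
  define w where "w = (%k x. partial_diff L S k A x - v k x)"
  define v' where "v' = (%k. v0 (k(j := 0)) (k j))"
  have psj: "k(j := 0) \<in> partial_scales L S" "k j < L" if "k \<in> partial_scales L (insert j S)" for k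
   using that insert.hyps by (auto simp: partial_scales_def)
  have h1: "W2 \<subseteq> grid L" by (auto simp: W2_def)
  have h2: "card W2 <= (4 / \<theta>\<^sup>2) ^ card (insert j S) * card W"
  proof -
   define a where "a = axis_max L j (indicator W1) L"
   have "\<theta>\<^sup>2 * card W2 = (\<Sum>x\<in>W2. \<theta>\<^sup>2)" by simp
   also have "... <= (\<Sum>x\<in>W2. (a x)^2)"
   proof (rule sum_mono)
    fix x assume "x \<in> W2"
    then obtain l where l: "l <= L" "M W1 l x > \<theta>" by (auto simp: W2_def)
    have "M W1 l x <= a x" unfolding a_def M_def axis_scale_fun_upd[symmetric] by (rule axis_max_ge[OF l(1)])
    with l(2) show "\<theta>\<^sup>2 <= (a x)^2" using \<theta> by (intro power_mono) auto
   qed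
   also have "... <= sq_norm L a" unfolding sq_norm_def by (rule sum_mono2) (auto simp: W2_def)
   also have "... <= 4 * sq_norm L (indicator W1)" unfolding a_def by (rule sq_norm_axis_max)
   also have "sq_norm L (indicator W1) = card W1"
   proof -
    have "sq_norm L (indicator W1) = (\<Sum>x\<in>grid L. if x \<in> W1 then 1 else 0)"
     unfolding sq_norm_def by (intro sum.cong) (auto simp: indicator_def)
    also have "... = card (grid L \<inter> W1)" by (simp add: sum.If_cases)
    also have "grid L \<inter> W1 = W1" using g1 by blast
    finally show ?thesis .
   qed
   finally have "\<theta>\<^sup>2 * card W2 <= 4 * card W1" by simp
   then have "card W2 <= (4 / \<theta>\<^sup>2) * card W1" using \<theta> by (simp add: field_simps)
   also have "... <= (4 / \<theta>\<^sup>2) * ((4 / \<theta>\<^sup>2) ^ card S * card W)" by (rule mult_left_mono[OF g2]) simp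
   finally show ?thesis using insert.hyps by simp
  qed
  have h3: "cell L (cS (insert j S) k) x \<subseteq> W2"
   if k: "k \<in> partial_scales L (insert j S)" and x: "x \<in> grid L" and nz: "v' k x ~= 0" for k x
  proof
   fix y assume y: "y \<in> cell L (cS (insert j S) k) x"
   then have yg: "y \<in> grid L" using cell_subset_grid by blast
   define k0 where "k0 = k(j := 0)"
   have "hit k0 (k j) x" using nz by (auto simp: v'_def v0_def k0_def split: if_splits)
   then obtain l where l: "l <= k j" "M (E k0) l x > \<theta>" by (auto simp: hit_def)
   have lL: "l <= L" using l(1) psj(2)[OF k] by simp
   have cL: "cS S k0 i <= L" for i
    using psj(1)[OF k] by (auto simp: cS_def k0_def partial_scales_def less_imp_le split: if_splits)
   have inv: "mean_op L (cS S k0) (indicator (E k0)) z = indicator (E k0) z" if z: "z \<in> grid L" for z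
   proof (rule mean_op_fix[OF z cL])
    fix z' assume "z' \<in> cell L (cS S k0) z"
    then have "cell L (cS S k0) z' = cell L (cS S k0) z" "z' \<in> grid L" using cell_eq cell_subset_grid by blast+
    then show "indicator (E k0) z' = (indicator (E k0) z :: real)" using z by (simp add: E_def indicator_def)
   qed
   define c where "c = (%i. min (axis_scale L j l i) (cS S k0 i))"
   have M_eq: "M (E k0) l z = mean_op L c (indicator (E k0)) z" if z: "z \<in> grid L" for z
   proof -
    have "mean_op L c (indicator (E k0)) z = mean_op L (axis_scale L j l) (mean_op L (cS S k0) (indicator (E k0))) z"
     unfolding c_def by (rule mean_op_comp[symmetric, OF z]) (use cL lL in \<open>auto simp: axis_scale_def\<close>)
    also have "... = M (E k0) l z" unfolding M_def mean_op_def[of L "axis_scale L j l"]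
     by (rule ker_op_cong_fun) (rule inv)
    finally show ?thesis ..
   qed
   have "c i <= cS (insert j S) k i" for i
    using l(1) insert.hyps by (auto simp: c_def cS_def axis_scale_def k0_def)
   then have "y \<in> cell L c x" using y unfolding cell_def by (auto intro: same_cell_mono)
   then have "M (E k0) l y = M (E k0) l x" unfolding M_eq[OF x] M_eq[OF yg] by (rule mean_op_cell)
   moreover have "M (E k0) l y <= M W1 l y" unfolding M_def
   proof (rule mean_op_mono)
    fix z :: "'n => nat" assume z: "z \<in> grid L"
    show "indicator (E k0) z <= (indicator W1 z :: real)"
     using cell_refl[OF z, of "cS S k0"] by (auto simp: indicator_def E_def)
   qed
   ultimately have "M W1 l y > \<theta>" using l(2) by simp
   then show "y \<in> W2" using yg lL by (auto simp: W2_def)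
  qed
  have pdi: "partial_diff L (insert j S) k A x - v' k x = axis_diff L j (k j) (w (k(j := 0))) x + v1 (k(j := 0)) (k j) x"
   if k: "k \<in> partial_scales L (insert j S)" and x: "x \<in> grid L" for k x
  proof -
   have "axis_diff L j (k j) (w (k(j := 0))) x = axis_diff L j (k j) (partial_diff L S (k(j := 0)) A) x - axis_diff L j (k j) (v (k(j := 0))) x"
    unfolding w_def axis_diff_def mean_op_def by (simp add: ker_op_diff)
   then show ?thesis
    using partial_diff_insert[where k = k and f = A, OF insert.hyps(2) psj(2)[OF k] x] by (simp add: v'_def v0_def v1_def)
  qed
  have h4: "sqrt (\<Sum>k\<in>partial_scales L (insert j S). sq_norm L (%x. partial_diff L (insert j S) k A x - v' k x))
    <= card (insert j S) * sqrt (2 * \<theta> * N)"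
  proof -
   have "sqrt (\<Sum>k\<in>partial_scales L (insert j S). sq_norm L (%x. partial_diff L (insert j S) k A x - v' k x)) =
    sqrt (\<Sum>k\<in>partial_scales L (insert j S). sq_norm L (%x. axis_diff L j (k j) (w (k(j := 0))) x + v1 (k(j := 0)) (k j) x))"
    unfolding sq_norm_def using pdi by (intro arg_cong[where f = sqrt] sum.cong refl) simp
   also have "... <= sqrt (\<Sum>k\<in>partial_scales L (insert j S). sq_norm L (axis_diff L j (k j) (w (k(j := 0)))))
    + sqrt (\<Sum>k\<in>partial_scales L (insert j S). sq_norm L (v1 (k(j := 0)) (k j)))"
    by (rule sqrt_sum_sq_norm_triangle)
   also have "... = sqrt (\<Sum>k\<in>partial_scales L S. \<Sum>l<L. sq_norm L (axis_diff L j l (w k)))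
    + sqrt (\<Sum>k\<in>partial_scales L S. \<Sum>l<L. sq_norm L (v1 k l))"
    using sum_partial_scales_insert[OF insert.hyps(2), of "%k l. sq_norm L (axis_diff L j l (w k))" L]
     sum_partial_scales_insert[OF insert.hyps(2), of "%k l. sq_norm L (v1 k l)" L] by simp
   also have "... <= sqrt (\<Sum>k\<in>partial_scales L S. sq_norm L (w k)) + sqrt (\<Sum>k\<in>partial_scales L S. 2 * \<theta> * sq_norm L (v k))"
   proof (intro add_mono real_sqrt_le_mono sum_mono)
    fix k assume k: "k \<in> partial_scales L S"
    show "(\<Sum>l<L. sq_norm L (axis_diff L j l (w k))) <= sq_norm L (w k)" by (rule axis_bessel)
    have "(\<Sum>l<L. \<Sum>x\<in>grid L. (if hit k l x then 0 else (axis_diff L j l (v k) x)^2)) <= 2 * \<theta> * sq_norm L (v k)"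
     unfolding hit_def M_def
    proof (rule stopped_axis_energy)
     show "x \<in> E k" if "x \<in> grid L" "v k x ~= 0" for x using g3[OF k that] that by (simp add: E_def)
    qed (use \<theta> in auto)
    moreover have "(v1 k l x)^2 = (if hit k l x then 0 else (axis_diff L j l (v k) x)^2)" for l x
     by (simp add: v1_def)
    ultimately show "(\<Sum>l<L. sq_norm L (v1 k l)) <= 2 * \<theta> * sq_norm L (v k)" by (simp add: sq_norm_def)
   qed
   also have "... <= card S * sqrt (2 * \<theta> * N) + sqrt (2 * \<theta> * N)"
   proof (rule add_mono)
    show "sqrt (\<Sum>k\<in>partial_scales L S. sq_norm L (w k)) <= card S * sqrt (2 * \<theta> * N)"
     unfolding w_def by (rule g4)
    show "sqrt (\<Sum>k\<in>partial_scales L S. 2 * \<theta> * sq_norm L (v k)) <= sqrt (2 * \<theta> * N)"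
     using g5 \<theta> by (simp flip: sum_distrib_left)
   qed
   finally show ?thesis using insert.hyps by (simp add: algebra_simps)
  qed
  have h5: "(\<Sum>k\<in>partial_scales L (insert j S). sq_norm L (v' k)) <= N"
  proof -
   have "(\<Sum>k\<in>partial_scales L (insert j S). sq_norm L (v' k)) = (\<Sum>k\<in>partial_scales L S. \<Sum>l<L. sq_norm L (v0 k l))"
    unfolding v'_def by (rule sum_partial_scales_insert[OF insert.hyps(2), of "%k l. sq_norm L (v0 k l)"])
   also have "... <= (\<Sum>k\<in>partial_scales L S. \<Sum>l<L. sq_norm L (axis_diff L j l (v k)))"
    unfolding sq_norm_def by (intro sum_mono) (simp add: v0_def)
   also have "... <= (\<Sum>k\<in>partial_scales L S. sq_norm L (v k))" by (rule sum_mono) (rule axis_bessel)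
   finally show ?thesis using g5 by simp
  qed
  have "good (insert j S) W2 v'"
   unfolding good_def N_def[symmetric] using h1 h2 h3 h4 h5 by blast
  then show ?case by blast
 qed
 from this[of UNIV] obtain W' v where g: "good UNIV W' v" by auto
 have ps: "partial_scales L UNIV = (scales L :: ('n => nat) set)" by (auto simp: partial_scales_def scales_def)
 have cU: "cS UNIV k = k" for k by (simp add: cS_def)
 have g1: "W' \<subseteq> grid L" and g2: "card W' <= (4 / \<theta>\<^sup>2) ^ CARD('n) * card W"
  and g3: "!!k x. k \<in> scales L ==> x \<in> grid L ==> v k x ~= 0 ==> cell L k x \<subseteq> W'"
  and g4: "sqrt (\<Sum>k\<in>scales L. sq_norm L (%x. partial_diff L UNIV k A x - v k x)) <= CARD('n) * sqrt (2 * \<theta> * sq_norm L A)"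
  using g unfolding good_def ps cU by auto
 have "(\<Sum>k\<in>scales L. \<Sum>x\<in>{x \<in> grid L. \<not> cell L k x \<subseteq> W'}. (coeff_op L k A x)^2)
  <= (\<Sum>k\<in>scales L. sq_norm L (%x. partial_diff L UNIV k A x - v k x))"
 proof (rule sum_mono)
  fix k :: "'n => nat" assume k: "k \<in> scales L"
  have c: "\<bar>partial_diff L UNIV k A x\<bar> = \<bar>coeff_op L k A x\<bar>" for x
   unfolding partial_diff_def coeff_op_def
   by (rule ker_op_signs[where \<sigma> = "%j. half_sign L (k j) (x j)"]) (auto simp: diff_ker_def coeff_ker_def)
  have "(\<Sum>x\<in>{x \<in> grid L. \<not> cell L k x \<subseteq> W'}. (coeff_op L k A x)^2)
   = (\<Sum>x\<in>{x \<in> grid L. \<not> cell L k x \<subseteq> W'}. (partial_diff L UNIV k A x - v k x)^2)"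
  proof (rule sum.cong[OF refl])
   fix x assume "x \<in> {x \<in> grid L. \<not> cell L k x \<subseteq> W'}"
   then have "v k x = 0" using g3[OF k, of x] by auto
   then show "(coeff_op L k A x)^2 = (partial_diff L UNIV k A x - v k x)^2" using c[of x] by (metis diff_zero power2_abs)
  qed
  also have "... <= sq_norm L (%x. partial_diff L UNIV k A x - v k x)"
   unfolding sq_norm_def by (rule sum_mono2) auto
  finally show "(\<Sum>x\<in>{x \<in> grid L. \<not> cell L k x \<subseteq> W'}. (coeff_op L k A x)^2)
   <= sq_norm L (%x. partial_diff L UNIV k A x - v k x)" .
 qed
 also have "... <= (CARD('n) * sqrt (2 * \<theta> * sq_norm L A))^2"
  using sqrt_le_D[OF g4] by simp
 also have "... = 2 * \<theta> * (real CARD('n))^2 * sq_norm L A" using \<theta> by (simp add: power_mult_distrib mult_nonneg_nonneg)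
 finally show thesis using that g1 g2 by blast
qed

section \<open>Functions with mean zero in each variable and the localised test function\<close>

text \<open>The discrete counterpart of \<open>L2_0\<close>: integrating out any single variable gives zero.\<close>

definition mean_zero :: "nat => (('n::finite => nat) => real) => bool" where
 "mean_zero L f \<longleftrightarrow> (\<forall>\<kappa> i x. x \<in> grid L --> \<kappa> i = mean_ker L 0 --> ker_op L \<kappa> f x = 0)"

lemma mean_zeroD: "mean_zero L f ==> x \<in> grid L ==> \<kappa> i = mean_ker L 0 ==> ker_op L \<kappa> f x = 0"
 by (auto simp: mean_zero_def)

lemma osc_eq_mean:
 fixes S :: "'n::finite set"
 assumes f: "mean_zero L f" and x: "x \<in> grid L" and n: "!!j. n j <= L"
 shows "ker_op L (%j. if j \<in> S then osc_ker L (n j) else \<kappa> j) f x = ker_op L (%j. if j \<in> S then mean_ker L (n j) else \<kappa> j) f x"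
proof -
 have "finite S" by simp
 then have "ker_op L (%j. if j \<in> S then osc_ker L (n j) else \<kappa> j) f x = ker_op L (%j. if j \<in> S then mean_ker L (n j) else \<kappa> j) f x" for \<kappa>
 proof (induction S arbitrary: \<kappa>)
  case (insert i S)
  define \<mu> where "\<mu> = (%j. if j \<in> insert i S then osc_ker L (n j) else \<kappa> j)"
  have "ker_op L \<mu> f x = ker_op L (\<mu>(i := mean_ker L (n i))) f x - ker_op L (\<mu>(i := mean_ker L 0)) f x"
   by (rule ker_op_diff_kernel) (simp add: \<mu>_def osc_ker_eq n)
  also have "ker_op L (\<mu>(i := mean_ker L 0)) f x = 0" by (rule mean_zeroD[OF f x, where i = i]) simp
  also have "\<mu>(i := mean_ker L (n i)) = (%j. if j \<in> S then osc_ker L (n j) else (\<kappa>(i := mean_ker L (n i))) j)"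
   using insert.hyps by (auto simp: \<mu>_def)
  also have "ker_op L ... f x = ker_op L (%j. if j \<in> S then mean_ker L (n j) else (\<kappa>(i := mean_ker L (n i))) j) f x"
   by (rule insert.IH)
  also have "(%j. if j \<in> S then mean_ker L (n j) else (\<kappa>(i := mean_ker L (n i))) j) =
   (%j. if j \<in> insert i S then mean_ker L (n j) else \<kappa> j)"
   using insert.hyps by auto
  finally show ?case by (simp only: \<mu>_def diff_zero)
 qed simp
 then show ?thesis .
qed

definition scale_diff :: "nat => ('n::finite => nat) => (('n => nat) => real) => ('n => nat) => real" where
 "scale_diff L k = ker_op L (%j. diff_ker L (k j))"

definition sign_prod :: "nat => ('n::finite => nat) => ('n => nat) => real" where
 "sign_prod L k x = (\<Prod>j\<in>UNIV. half_sign L (k j) (x j))"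

lemma sign_prod_sq [simp]: "sign_prod L k x * sign_prod L k x = 1" "\<bar>sign_prod L k x\<bar> = 1"
 by (simp_all add: sign_prod_def abs_prod flip: prod.distrib)

lemma coeff_op_eq: "coeff_op L k f x = mean_op L k (%y. sign_prod L k y * f y) x"
 by (simp add: coeff_op_def mean_op_def ker_op_def coeff_ker_def sign_prod_def prod.distrib mult_ac)

lemma scale_diff_eq: "scale_diff L k f x = sign_prod L k x * coeff_op L k f x"
 by (simp add: scale_diff_def coeff_op_def ker_op_def coeff_ker_def diff_ker_def sign_prod_def
   prod.distrib sum_distrib_left mult_ac)

lemma scale_diff_partial: "scale_diff L k = partial_diff L UNIV k"
 by (simp add: scale_diff_def[abs_def] partial_diff_def[abs_def])

lemma partial_scales_UNIV: "partial_scales L UNIV = scales L"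
 by (auto simp: partial_scales_def scales_def)

lemma scale_diff_comp:
 "k \<in> scales L ==> l \<in> scales L ==> x \<in> grid L ==> scale_diff L k (scale_diff L l f) x = (if k = l then scale_diff L k f x else 0)"
 unfolding scale_diff_partial by (rule partial_diff_comp) (auto simp: partial_scales_UNIV)

lemma scale_diff_adjoint: "(\<Sum>x\<in>grid L. f x * scale_diff L k g x) = (\<Sum>x\<in>grid L. scale_diff L k f x * g x)"
 unfolding scale_diff_partial by (rule partial_diff_adjoint)

lemma scale_diff_sum: "scale_diff L k (%x. \<Sum>i\<in>I. f i x) x = (\<Sum>i\<in>I. scale_diff L k (f i) x)"
 unfolding scale_diff_def by (rule ker_op_sum)

lemma scales_PiE: "PiE UNIV (%_. {..<L}) = scales L"
 by (auto simp: scales_def)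

lemma sum_scale_diff:
 assumes "mean_zero L f" "x \<in> grid L"
 shows "(\<Sum>k\<in>scales L. scale_diff L k f x) = f x"
proof -
 have "(\<Sum>k\<in>scales L. scale_diff L k f x) = ker_op L (%j s t. \<Sum>l<L. diff_ker L l s t) f x"
  unfolding scale_diff_def scales_PiE[symmetric] by (rule ker_op_sum_kernels[symmetric]) simp
 also have "... = ker_op L (%j. if j \<in> UNIV then osc_ker L L else mean_ker L L) f x"
  by (rule ker_op_cong) (simp add: osc_ker_def)
 also have "... = ker_op L (%j. if j \<in> UNIV then mean_ker L L else mean_ker L L) f x"
  by (rule osc_eq_mean[OF assms, where n = "%_. L"]) simp
 also have "... = f x" by (rule ker_op_id[OF assms(2)]) (simp add: mean_ker_top)
 finally show ?thesis .
qed

lemma scale_diff_restrict: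
 assumes k: "k \<in> scales L" and x: "x \<in> grid L"
  and g: "!!x y. x \<in> grid L ==> y \<in> cell L k x ==> g y = g x"
 shows "scale_diff L k (%x. g x * scale_diff L k f x) x = g x * scale_diff L k f x"
proof -
 have "coeff_op L k (%x. g x * scale_diff L k f x) x = mean_op L k (%y. g y * coeff_op L k f y) x"
 proof -
  have "sign_prod L k y * (g y * (sign_prod L k y * coeff_op L k f y)) = g y * coeff_op L k f y" for y
   by (metis mult.assoc mult.left_commute mult_1 sign_prod_sq(1))
  then show ?thesis
   by (simp only: scale_diff_eq coeff_op_eq[of L k "%x. g x * (sign_prod L k x * coeff_op L k f x)"])
 qed
 also have "... = g x * coeff_op L k f x"
 proof (rule mean_op_fix[OF x])
  fix y assume "y \<in> cell L k x"
  then show "g y * coeff_op L k f y = g x * coeff_op L k f x" using g[OF x] coeff_op_cell[OF x] by metis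
 qed (use scalesD[OF k] in \<open>simp add: less_imp_le\<close>)
 finally show ?thesis by (simp add: scale_diff_eq mult_ac)
qed

definition spectral_part :: "nat => (('n::finite => nat) => ('n => nat) set => bool) => (('n => nat) => real) => ('n => nat) => real" where
 "spectral_part L P f x = (\<Sum>k\<in>scales L. (if P k (cell L k x) then 1 else 0) * scale_diff L k f x)"

lemma scale_diff_spectral_part:
 assumes l: "l \<in> scales L" and x: "x \<in> grid L"
 shows "scale_diff L l (spectral_part L P f) x = (if P l (cell L l x) then 1 else 0) * scale_diff L l f x"
proof -
 define h where "h = (%k x. (if P k (cell L k x) then 1 else 0) * scale_diff L k f x)"
 have hk: "scale_diff L k (h k) y = h k y" if "k \<in> scales L" "y \<in> grid L" for k y
  unfolding h_def using that by (rule scale_diff_restrict) (simp add: cell_eq)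
 have "scale_diff L l (spectral_part L P f) x = (\<Sum>k\<in>scales L. scale_diff L l (h k) x)"
  unfolding spectral_part_def[abs_def] h_def by (rule scale_diff_sum)
 also have "... = (\<Sum>k\<in>scales L. if l = k then h l x else 0)"
 proof (rule sum.cong[OF refl])
  fix k :: "'a => nat" assume k: "k \<in> scales L"
  have "scale_diff L l (h k) x = scale_diff L l (scale_diff L k (h k)) x"
   unfolding scale_diff_def[of L l] by (rule ker_op_cong_fun) (rule hk[OF k, symmetric])
  also have "... = (if l = k then h l x else 0)"
   using scale_diff_comp[OF l k x, of "h k"] hk[OF l x] by auto
  finally show "scale_diff L l (h k) x = (if l = k then h l x else 0)" .
 qed
 also have "... = h l x" using l by simp
 finally show ?thesis by (simp only: h_def)
qed

lemma sq_norm_spectral_part: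
 "sq_norm L (spectral_part L P f) = (\<Sum>k\<in>scales L. \<Sum>x\<in>{x \<in> grid L. P k (cell L k x)}. (coeff_op L k f x)^2)"
proof -
 define h where "h = (%k x. (if P k (cell L k x) then 1 else 0) * scale_diff L k f x)"
 have hk: "scale_diff L k (h k) y = h k y" if "k \<in> scales L" "y \<in> grid L" for k y
  unfolding h_def using that by (rule scale_diff_restrict) (simp add: cell_eq)
 have "sq_norm L (spectral_part L P f) = (\<Sum>k\<in>scales L. sq_norm L (h k))"
  unfolding spectral_part_def[abs_def] h_def[symmetric]
 proof (subst sq_norm_orth_sum[symmetric])
  fix k l :: "'a => nat" assume kl: "k \<in> scales L" "l \<in> scales L" "k ~= l"
  have "(\<Sum>x\<in>grid L. h k x * h l x) = (\<Sum>x\<in>grid L. h k x * scale_diff L l (h l) x)"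
   using hk[OF kl(2)] by simp
  also have "... = (\<Sum>x\<in>grid L. scale_diff L l (h k) x * h l x)" by (rule scale_diff_adjoint)
  also have "... = 0"
  proof (intro sum.neutral ballI)
   fix x :: "'a => nat" assume x: "x \<in> grid L"
   have "scale_diff L l (h k) x = scale_diff L l (scale_diff L k (h k)) x"
    unfolding scale_diff_def[of L l] by (rule ker_op_cong_fun) (rule hk[OF kl(1), symmetric])
   then show "scale_diff L l (h k) x * h l x = 0" using scale_diff_comp[OF kl(2,1) x] kl(3) by simp
  qed
  finally show "(\<Sum>x\<in>grid L. h k x * h l x) = 0" .
 qed (simp_all add: h_def)
 also have "... = (\<Sum>k\<in>scales L. \<Sum>x\<in>{x \<in> grid L. P k (cell L k x)}. (coeff_op L k f x)^2)"
 proof (rule sum.cong[OF refl])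
  fix k :: "'a => nat"
  have "(scale_diff L k f x)^2 = (coeff_op L k f x)^2" for x
   using sign_prod_sq(1)[of L k x] by (simp add: scale_diff_eq power_mult_distrib power2_eq_square)
  then have "sq_norm L (h k) = (\<Sum>x\<in>grid L. if P k (cell L k x) then (coeff_op L k f x)^2 else 0)"
   unfolding sq_norm_def h_def by (intro sum.cong refl) (simp add: power_mult_distrib)
  then show "sq_norm L (h k) = (\<Sum>x\<in>{x \<in> grid L. P k (cell L k x)}. (coeff_op L k f x)^2)"
   by (simp add: sum.inter_filter)
 qed
 finally show ?thesis .
qed

lemma mean_zero_spectral_part: "mean_zero L (spectral_part L P (f :: ('n::finite => nat) => real))"
 unfolding mean_zero_def
proof (intro allI impI)
 fix \<kappa> :: "'n => nat => nat => real" and i and x :: "'n => nat"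
 assume x: "x \<in> grid L" and i: "\<kappa> i = mean_ker L 0"
 define h where "h = (%k x. (if P k (cell L k x) then 1 else 0) * scale_diff L k f x)"
 have hk: "scale_diff L k (h k) y = h k y" if "k \<in> scales L" "y \<in> grid L" for k y
  unfolding h_def using that by (rule scale_diff_restrict) (simp add: cell_eq)
 have "ker_op L \<kappa> (spectral_part L P f) x = (\<Sum>k\<in>scales L. ker_op L \<kappa> (h k) x)"
  unfolding spectral_part_def[abs_def] h_def by (rule ker_op_sum)
 also have "... = 0"
 proof (intro sum.neutral ballI)
  fix k :: "'n => nat" assume k: "k \<in> scales L"
  have "ker_op L \<kappa> (h k) x = ker_op L \<kappa> (scale_diff L k (h k)) x"
   by (rule ker_op_cong_fun) (rule hk[OF k, symmetric])
  also have "... = 0" unfolding scale_diff_def ker_op_ker_op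
   by (rule ker_op_eq_0[of _ _ i]) (simp add: i mean_of_haar_like[OF _ scalesD[OF k] haar_like_diff_ker])
  finally show "ker_op L \<kappa> (h k) x = 0" .
 qed
 finally show "ker_op L \<kappa> (spectral_part L P f) x = 0" .
qed

text \<open>Translation by half the circle, which changes the sign of the coarsest Haar function.\<close>

definition half_flip :: "nat => nat => nat" where
 "half_flip L s = (if s < 2 ^ (L - Suc 0) then s + 2 ^ (L - Suc 0) else s - 2 ^ (L - Suc 0))"

lemma half_flip:
 assumes "0 < L" "s < 2 ^ L"
 shows "half_flip L s < 2 ^ L" "half_flip L (half_flip L s) = s" "half_sign L 0 (half_flip L s) = - half_sign L 0 s"
proof -
 define h where "h = (2::nat) ^ (L - Suc 0)"
 have e: "(2::nat) ^ L = 2 * h" unfolding h_def using assms(1) by (metis Suc_pred power_Suc)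
 have h: "0 < h" by (simp add: h_def)
 show 1: "half_flip L s < 2 ^ L" and "half_flip L (half_flip L s) = s"
  using assms(2) unfolding half_flip_def h_def[symmetric] e by auto
 have d: "half_sign L 0 r = (if r < h then - 1 else 1)" if "r < 2 * h" for r
 proof (cases "r < h")
  case False
  then have "r div h = 1" using that h by (metis Suc_1 add_cancel_left_right div_nat_eqI le_antisym linorder_not_less mult.commute mult.left_neutral mult_Suc_right One_nat_def)
  then show ?thesis using False by (simp add: half_sign_def h_def[symmetric])
 qed (simp add: half_sign_def h_def[symmetric])
 show "half_sign L 0 (half_flip L s) = - half_sign L 0 s"
  using d[of s] d[of "half_flip L s"] 1 assms(2) unfolding e half_flip_def h_def[symmetric] by auto
qed

lemma flip_odd_mean_zero:
 fixes A :: "('n::finite => nat) => real"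
 assumes L: "0 < L" and A: "!!x i. x \<in> grid L ==> A (x(i := half_flip L (x i))) = - A x"
 shows "mean_zero L A"
 unfolding mean_zero_def
proof (intro allI impI)
 fix \<kappa> :: "'n => nat => nat => real" and i and x :: "'n => nat"
 assume x: "x \<in> grid L" and i: "\<kappa> i = mean_ker L 0"
 define \<tau> where "\<tau> = (%y :: 'n => nat. y(i := half_flip L (y i)))"
 define g where "g = (%y. (\<Prod>j\<in>UNIV. \<kappa> j (x j) (y j)) * A y)"
 have \<tau>g: "\<tau> y \<in> grid L" if "y \<in> grid L" for y using that half_flip(1)[OF L] by (simp add: \<tau>_def grid_def)
 have \<tau>\<tau>: "\<tau> (\<tau> y) = y" if "y \<in> grid L" for y using half_flip(2)[OF L gridD[OF that]] by (simp add: \<tau>_def)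
 have "(\<Sum>y\<in>grid L. g y) = (\<Sum>y\<in>grid L. g (\<tau> y))"
  by (rule sum.reindex_bij_witness[where i = \<tau> and j = \<tau>]) (simp_all add: \<tau>g \<tau>\<tau>)
 also have "... = (\<Sum>y\<in>grid L. - g y)"
 proof (rule sum.cong[OF refl])
  fix y :: "'n => nat" assume y: "y \<in> grid L"
  have "(\<Prod>j\<in>UNIV. \<kappa> j (x j) (\<tau> y j)) = (\<Prod>j\<in>UNIV. \<kappa> j (x j) (y j))"
  proof (rule prod.cong[OF refl])
   fix j show "\<kappa> j (x j) (\<tau> y j) = \<kappa> j (x j) (y j)"
    using i gridD[OF x, of i] gridD[OF y, of i] half_flip(1)[OF L gridD[OF y, of i]]
    by (cases "j = i") (auto simp: \<tau>_def mean_ker_0)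
  qed
  then show "g (\<tau> y) = - g y" using A[OF y, of i] by (simp add: g_def \<tau>_def)
 qed
 finally have "(\<Sum>y\<in>grid L. g y) = 0" by (simp add: sum_negf)
 then show "ker_op L \<kappa> A x = 0" by (simp add: ker_op_def g_def)
qed

text \<open>Symmetrise \<open>W\<close> under half translations and multiply its indicator by the coarsest Haar sign in every variable:
  the result \<open>A\<close> has mean zero in each variable and means of modulus one on cells in \<open>W\<close> without full sides. Take for \<open>a\<close>
  the part of \<open>A\<close> with spectrum in the set given by \<open>spectral_localization\<close>. The rest has small norm, so its strong
  maximal function is below \<open>1/2\<close> off a set of at most half the size, and \<open>\<theta>\<close> is chosen for that.\<close>

lemma localized_test_function:
 fixes W :: "('n::finite => nat) set"
 assumes L: "0 < L" and W: "W \<subseteq> grid L"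
 defines "\<theta> \<equiv> 1 / (16 * (real CARD('n))^2 * 8 ^ CARD('n))"
 obtains W' W2 a where "W' \<subseteq> grid L" "W2 \<subseteq> grid L"
  "card W' <= (4 / \<theta>\<^sup>2) ^ CARD('n) * 2 ^ CARD('n) * card W" "card W2 <= card W / 2"
  "mean_zero L a" "sq_norm L a <= 2 ^ CARD('n) * card W"
  "!!k x. k \<in> scales L ==> x \<in> grid L ==> coeff_op L k a x ~= 0 ==> cell L k x \<subseteq> W'"
  "!!n x. n \<in> scales L ==> x \<in> grid L ==> (!!j. 0 < n j) ==> cell L n x \<subseteq> W ==> \<not> cell L n x \<subseteq> W2
   ==> 1 / 2 <= \<bar>mean_op L n a x\<bar>"
proof -
 (* The symmetrisation costs a factor 2 in measure for each variable. *)
 define Ws where "Ws = {x \<in> grid L. \<exists>y\<in>W. \<forall>j. y j = x j \<or> y j = half_flip L (x j)}"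
 define A where "A = (%x. if x \<in> Ws then sign_prod L (%_. 0) x else 0)"
 have N1: "1 <= real CARD('n)" by (simp add: Suc_leI)
 have e1: "1 <= (8::real) ^ CARD('n)" by simp
 have big: "1 < 16 * (real CARD('n))^2 * 8 ^ CARD('n)"
 proof -
  have "1 * 1 <= (real CARD('n))^2 * 8 ^ CARD('n)" using N1 e1 by (intro mult_mono) auto
  then show ?thesis by simp
 qed
 have \<theta>: "0 < \<theta>" "\<theta> < 1" unfolding \<theta>_def using big by auto
 have sW: "Ws \<subseteq> grid L" by (auto simp: Ws_def)
 have sub: "W \<subseteq> Ws" using W by (auto simp: Ws_def)
 have flip: "x(i := half_flip L (x i)) \<in> Ws \<longleftrightarrow> x \<in> Ws" if x: "x \<in> grid L" for x :: "'n => nat" and i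
 proof -
  define y where "y = x(i := half_flip L (x i))"
  have yg: "y \<in> grid L" using x half_flip(1)[OF L] by (simp add: y_def grid_def)
  have pt: "(u = y j \<or> u = half_flip L (y j)) \<longleftrightarrow> (u = x j \<or> u = half_flip L (x j))" for u j
   using half_flip(2)[OF L gridD[OF x, of i]] by (auto simp: y_def)
  show ?thesis unfolding y_def[symmetric] Ws_def using x yg by (simp add: pt)
 qed
 have A0: "mean_zero L A"
 proof (rule flip_odd_mean_zero[OF L])
  fix x :: "'n => nat" and i assume x: "x \<in> grid L"
  have "sign_prod L (%_. 0) (x(i := half_flip L (x i))) = - sign_prod L (%_. 0) x"
  proof -
   have "sign_prod L (%_. 0) y = half_sign L 0 (y i) * (\<Prod>j\<in>UNIV - {i}. half_sign L 0 (y j))" for y :: "'n => nat"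
    unfolding sign_prod_def by (rule prod.remove) auto
   then show ?thesis using half_flip(3)[OF L gridD[OF x, of i]] by simp
  qed
  then show "A (x(i := half_flip L (x i))) = - A x" using flip[OF x, of i] by (simp add: A_def)
 qed
 have cardS: "card Ws <= 2 ^ CARD('n) * card W"
 proof -
  define Q where "Q = (%y :: 'n => nat. PiE UNIV (%j. {y j, half_flip L (y j)}))"
  have finQ: "finite (Q y)" for y unfolding Q_def by (intro finite_PiE) auto
  have "Ws \<subseteq> (\<Union>y\<in>W. Q y)"
  proof
   fix x assume "x \<in> Ws"
   then obtain y where y: "y \<in> W" "\<forall>j. y j = x j \<or> y j = half_flip L (x j)" and xg: "x \<in> grid L" by (auto simp: Ws_def)
   have "x j = y j \<or> x j = half_flip L (y j)" for j using y(2) half_flip(2)[OF L gridD[OF xg, of j]] by metis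
   then show "x \<in> (\<Union>y\<in>W. Q y)" using y(1) by (auto simp: Q_def)
  qed
  then have "card Ws <= card (\<Union>y\<in>W. Q y)"
   using finQ finite_subset[OF W] by (intro card_mono finite_UN_I) auto
  also have "... <= (\<Sum>y\<in>W. card (Q y))" using finite_subset[OF W] by (intro card_UN_le) auto
  also have "... <= (\<Sum>y\<in>W. 2 ^ CARD('n))"
  proof (rule sum_mono)
   fix y
   have "card (Q y) = (\<Prod>j\<in>UNIV. card {y j, half_flip L (y j)})" unfolding Q_def by (rule card_PiE) simp
   also have "... <= (\<Prod>j\<in>(UNIV::'n set). 2)" by (rule prod_mono) (auto simp: card_insert_if)
   finally show "card (Q y) <= 2 ^ CARD('n)" by simp
  qed
  finally show ?thesis by (simp add: mult.commute)
 qed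
 then have cardS': "real (card Ws) <= 2 ^ CARD('n) * card W"
  by (metis (mono_tags) of_nat_le_iff of_nat_mult of_nat_power of_nat_numeral)
 have normA: "sq_norm L A = card Ws"
 proof -
  have "(A x)^2 = (if x \<in> Ws then 1 else 0)" for x by (simp add: A_def power2_eq_square)
  then have "sq_norm L A = (\<Sum>x\<in>grid L. if x \<in> Ws then 1 else 0)" by (simp add: sq_norm_def)
  also have "... = card (grid L \<inter> Ws)" by (simp add: sum.If_cases)
  also have "grid L \<inter> Ws = Ws" using sW by blast
  finally show ?thesis .
 qed
 obtain W' where o1: "W' \<subseteq> grid L" "card W' <= (4 / \<theta>\<^sup>2) ^ CARD('n) * card Ws"
  and o2: "(\<Sum>k\<in>scales L. \<Sum>x\<in>{x \<in> grid L. \<not> cell L k x \<subseteq> W'}. (coeff_op L k A x)^2)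
   <= 2 * \<theta> * (real CARD('n))^2 * sq_norm L A"
  by (rule spectral_localization[OF \<theta> sW, of A]) (auto simp: A_def split: if_splits)
 define a where "a = spectral_part L (%k R. R \<subseteq> W') A"
 define c where "c = spectral_part L (%k R. \<not> R \<subseteq> W') A"
 have ac: "a x + c x = A x" if "x \<in> grid L" for x
 proof -
  have one: "(if P then 1 else 0) + (if \<not> P then 1 else 0) = (1::real)" for P by simp
  show ?thesis
   unfolding a_def c_def spectral_part_def sum.distrib[symmetric] distrib_right[symmetric] one mult_1
   by (rule sum_scale_diff[OF A0 that])
 qed
 define W2 where "W2 = {x \<in> grid L. 1 / 2 < strong_max L c x}"
 have normc: "sq_norm L c <= 2 * \<theta> * (real CARD('n))^2 * sq_norm L A"
  unfolding c_def sq_norm_spectral_part by (rule o2)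
 have card2: "card W2 <= card W / 2"
 proof -
  have "card W2 * (1 / 4) = (\<Sum>x\<in>W2. (1 / 2)^2 :: real)" by (simp add: power2_eq_square)
  also have "... <= (\<Sum>x\<in>W2. (strong_max L c x)^2)" by (intro sum_mono power_mono) (auto simp: W2_def)
  also have "... <= sq_norm L (strong_max L c)" unfolding sq_norm_def by (rule sum_mono2) (auto simp: W2_def)
  also have "... <= 4 ^ CARD('n) * sq_norm L c" by (rule sq_norm_strong_max)
  also have "... <= 4 ^ CARD('n) * (2 * \<theta> * (real CARD('n))^2 * sq_norm L A)" by (rule mult_left_mono[OF normc]) simp
  also have "... <= 4 ^ CARD('n) * (2 * \<theta> * (real CARD('n))^2 * (2 ^ CARD('n) * card W))"
   unfolding normA using \<theta> cardS' by (intro mult_left_mono) auto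
  also have "... = (8 ^ CARD('n) * (real CARD('n))^2 * \<theta> * 2) * card W"
  proof -
   have "(8::real) ^ CARD('n) = 4 ^ CARD('n) * 2 ^ CARD('n)" by (simp flip: power_mult_distrib)
   then show ?thesis by (simp add: mult_ac)
  qed
  also have "8 ^ CARD('n) * (real CARD('n))^2 * \<theta> * 2 = 1 / 8" unfolding \<theta>_def using N1 by (simp add: field_simps)
  finally show ?thesis by simp
 qed
 have norma: "sq_norm L a <= 2 ^ CARD('n) * card W"
 proof -
  have "sq_norm L a <= (\<Sum>k\<in>scales L. sq_norm L (partial_diff L UNIV k A))"
   unfolding a_def sq_norm_spectral_part
  proof (rule sum_mono)
   fix k :: "'n => nat"
   have "(coeff_op L k A x)^2 = (partial_diff L UNIV k A x)^2" for x
    using sign_prod_sq(1)[of L k x]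
    by (simp add: scale_diff_partial[symmetric] scale_diff_eq power_mult_distrib power2_eq_square)
   then show "(\<Sum>x\<in>{x \<in> grid L. cell L k x \<subseteq> W'}. (coeff_op L k A x)^2) <= sq_norm L (partial_diff L UNIV k A)"
    unfolding sq_norm_def by (simp only:) (rule sum_mono2, auto)
  qed
  also have "... <= sq_norm L A" using bessel[of L UNIV A] by (simp add: partial_scales_UNIV)
  finally show ?thesis using cardS' by (simp add: normA)
 qed
 have supp: "cell L k x \<subseteq> W'" if k: "k \<in> scales L" and x: "x \<in> grid L" and nz: "coeff_op L k a x ~= 0" for k x
 proof (rule ccontr)
  assume "\<not> cell L k x \<subseteq> W'"
  then have "scale_diff L k a x = 0" unfolding a_def scale_diff_spectral_part[OF k x] by simp
  then show False using nz sign_prod_sq(2)[of L k x] by (auto simp: scale_diff_eq)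
 qed
 have low: "1 / 2 <= \<bar>mean_op L n a x\<bar>"
  if n: "n \<in> scales L" and x: "x \<in> grid L" and n0: "!!j. 0 < n j" and c1: "cell L n x \<subseteq> W" and c2: "\<not> cell L n x \<subseteq> W2" for n x
 proof -
  have nL: "n j <= L" for j using scalesD[OF n, of j] by simp
  have "mean_op L n A x = A x"
  proof (rule mean_op_fix[OF x nL])
   fix y assume y: "y \<in> cell L n x"
   have "sign_prod L (%_. 0) y = sign_prod L (%_. 0) x"
    unfolding sign_prod_def
   proof (rule prod.cong[OF refl])
    fix j
    have "same_cell L (Suc 0) (x j) (y j)"
     using y n0[of j] by (auto simp: cell_def intro: same_cell_mono)
    then show "half_sign L 0 (y j) = half_sign L 0 (x j)" by (rule half_sign_same_cell[symmetric])
   qed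
   moreover have "y \<in> Ws" "x \<in> Ws" using y c1 sub cell_refl[OF x] by blast+
   ultimately show "A y = A x" by (simp add: A_def)
  qed
  moreover have "x \<in> Ws" using c1 sub cell_refl[OF x] by blast
  ultimately have A1: "\<bar>mean_op L n A x\<bar> = 1" by (simp add: A_def)
  obtain y where y: "y \<in> cell L n x" "y \<notin> W2" using c2 by blast
  have "\<bar>mean_op L n c x\<bar> = \<bar>mean_op L n c y\<bar>" using mean_op_cell[OF y(1)] by simp
  also have "... <= strong_max L c y" by (rule strong_max_ge_abs[OF nL])
  also have "... <= 1 / 2" using y cell_subset_grid by (auto simp: W2_def)
  finally have c12: "\<bar>mean_op L n c x\<bar> <= 1 / 2" .
  have "mean_op L n A x = mean_op L n (%x. a x + c x) x"
   unfolding mean_op_def by (rule ker_op_cong_fun) (simp add: ac)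
  also have "... = mean_op L n a x + mean_op L n c x" unfolding mean_op_def by (rule ker_op_add)
  finally show ?thesis using A1 c12 by linarith
 qed
 have "card W' <= (4 / \<theta>\<^sup>2) ^ CARD('n) * (2 ^ CARD('n) * card W)"
  using o1(2) cardS' mult_left_mono[OF cardS', of "(4 / \<theta>\<^sup>2) ^ CARD('n)"] by simp
 then have card1: "card W' <= (4 / \<theta>\<^sup>2) ^ CARD('n) * 2 ^ CARD('n) * card W" by (simp add: mult.assoc)
 have "W2 \<subseteq> grid L" by (auto simp: W2_def)
 moreover have "mean_zero L a" unfolding a_def by (rule mean_zero_spectral_part)
 ultimately show thesis by (rule that[OF o1(1) _ card1 card2 _ norma supp low])
qed

section \<open>Dyadic rectangles and step functions on the torus\<close>

definition dint :: "nat => nat => real set" where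
 "dint n p = {real p / 2 ^ n ..< (real p + 1) / 2 ^ n}"

definition drect :: "('n => nat) => ('n => nat) => 'n => real set" where
 "drect n p = (%j. dint (n j) (p j))"

text \<open>The numerator of the left end point, for the interval of scale \<open>n j\<close> containing \<open>x j\<close>.\<close>

definition corner :: "nat => ('n => nat) => ('n => nat) => 'n => nat" where
 "corner L n x = (%j. x j div 2 ^ (L - n j))"

definition grid_rect :: "nat => ('n => nat) => ('n => nat) => 'n => real set" where
 "grid_rect L n x = drect n (corner L n x)"

definition cube :: "nat => ('n::finite => nat) => (real ^ 'n) set" where
 "cube L x = {z. \<forall>j. real (x j) / 2 ^ L <= z $ j \<and> z $ j < (real (x j) + 1) / 2 ^ L}"

lemma dint_lt: "real p / 2 ^ n < (real p + 1) / 2 ^ n"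
 by (simp add: divide_strict_right_mono)

lemma dint_Inf_Sup: "Inf (dint n p) = real p / 2 ^ n" "Sup (dint n p) = (real p + 1) / 2 ^ n"
 unfolding dint_def using dint_lt[of p n] by (simp_all add: cInf_atLeastLessThan cSup_atLeastLessThan)

lemma measure_dint: "measure lborel (dint n p) = 1 / 2 ^ n"
 unfolding dint_def using dint_lt[of p n] by (simp add: diff_divide_distrib[symmetric] less_imp_le)

lemma dint_inj:
 assumes "dint n p = dint m q" shows "n = m" "p = q"
proof -
 have "measure lborel (dint n p) = measure lborel (dint m q)" using assms by simp
 then show nm: "n = m" by (simp add: measure_dint)
 have "Inf (dint n p) = Inf (dint m q)" by (simp only: assms)
 then show "p = q" unfolding dint_Inf_Sup nm by simp
qed

lemma drect_inj: "drect n p = drect m q ==> n = m \<and> p = q"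
 unfolding drect_def fun_eq_iff using dint_inj by blast

lemma dyadic_intervals_eq: "dyadic_intervals = {dint n p | n p. p < 2 ^ n}"
 unfolding dyadic_intervals_def dint_def by auto

lemma dyadic_rects_eq: "dyadic_rects = {drect n p | n p :: 'n::finite => nat. \<forall>j. p j < 2 ^ n j}"
proof (intro set_eqI iffI)
 fix R :: "'n => real set" assume "R \<in> dyadic_rects"
 then have "\<forall>j. \<exists>n p. R j = dint n p \<and> p < 2 ^ n" by (auto simp: dyadic_rects_def dyadic_intervals_eq)
 then obtain n where "\<forall>j. \<exists>p. R j = dint (n j) p \<and> p < 2 ^ n j" by metis
 then obtain p where "\<forall>j. R j = dint (n j) (p j) \<and> p j < 2 ^ n j" by metis
 then show "R \<in> {drect n p | n p. \<forall>j. p j < 2 ^ n j}" by (auto simp: drect_def fun_eq_iff)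
qed (auto simp: dyadic_rects_def dyadic_intervals_eq drect_def)

lemma dint_iff:
 assumes "k <= L" "real s / 2 ^ L <= t" "t < (real s + 1) / 2 ^ L"
 shows "t \<in> dint k q \<longleftrightarrow> s div 2 ^ (L - k) = q"
proof -
 define D where "D = (2::nat) ^ (L - k)"
 have D: "0 < D" by (simp add: D_def)
 have LD: "(2::real) ^ L = real D * 2 ^ k" using assms(1) by (simp add: D_def flip: power_add)
 have ts: "real s <= t * (real D * 2 ^ k)" "t * (real D * 2 ^ k) < real s + 1"
  using assms(2,3) D unfolding LD by (simp_all add: field_simps)
 have "t \<in> dint k q \<longleftrightarrow> real q <= t * 2 ^ k \<and> t * 2 ^ k < real q + 1"
  unfolding dint_def by (simp add: field_simps)
 also have "... \<longleftrightarrow> real (q * D) <= t * (real D * 2 ^ k) \<and> t * (real D * 2 ^ k) < real ((q + 1) * D)"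
 proof -
  have "real q <= t * 2 ^ k \<longleftrightarrow> real q * real D <= (t * 2 ^ k) * real D"
   "t * 2 ^ k < real q + 1 \<longleftrightarrow> (t * 2 ^ k) * real D < (real q + 1) * real D"
   using D by simp_all
  moreover have "real (q * D) = real q * real D" "real ((q + 1) * D) = (real q + 1) * real D"
   "t * (real D * 2 ^ k) = (t * 2 ^ k) * real D" by (simp_all add: distrib_right)
  ultimately show ?thesis by (simp only:)
 qed
 also have "... \<longleftrightarrow> q * D <= s \<and> s < (q + 1) * D"
 proof
  assume "real (q * D) <= t * (real D * 2 ^ k) \<and> t * (real D * 2 ^ k) < real ((q + 1) * D)"
  then have "real (q * D) < real (s + 1)" "real s < real ((q + 1) * D)" using ts by auto
  then show "q * D <= s \<and> s < (q + 1) * D" by (simp only: of_nat_less_iff) simp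
 next
  assume a: "q * D <= s \<and> s < (q + 1) * D"
  then have "q * D <= s" "s + 1 <= (q + 1) * D" by (auto simp del: mult_Suc)
  then have "real (q * D) <= real s" "real (s + 1) <= real ((q + 1) * D)" by (simp_all only: of_nat_le_iff)
  moreover have "real (s + 1) = real s + 1" by simp
  ultimately show "real (q * D) <= t * (real D * 2 ^ k) \<and> t * (real D * 2 ^ k) < real ((q + 1) * D)"
   using ts by (intro conjI) linarith+
 qed
 also have "... \<longleftrightarrow> s div D = q"
 proof
  assume "q * D <= s \<and> s < (q + 1) * D"
  then show "s div D = q" by (intro div_nat_eqI) (simp_all add: mult.commute)
 next
  assume "s div D = q"
  then show "q * D <= s \<and> s < (q + 1) * D"
   using div_times_less_eq_dividend[of s D] dividend_less_times_div[OF D, of s] by (simp add: mult.commute)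
 qed
 finally show ?thesis by (simp only: D_def)
qed

lemma haar_dint:
 assumes k: "k < L" and t: "real s / 2 ^ L <= t" "t < (real s + 1) / 2 ^ L"
 shows "haar 0 (dint k (q div 2 ^ (L - k))) t = 2 ^ L / sqrt (2 ^ k) * coeff_ker L k q s"
  and "e ~= 0 ==> haar e (dint k (q div 2 ^ (L - k))) t = 2 ^ L * mean_ker L k q s"
proof -
 define p where "p = q div 2 ^ (L - k)"
 have kL: "k <= L" using k by simp
 have mem: "t \<in> dint k p \<longleftrightarrow> same_cell L k q s"
  using dint_iff[OF kL t, of p] by (auto simp: same_cell_def p_def)
 have LD: "(2::real) ^ L = 2 ^ (L - k) * 2 ^ k" using kL by (simp flip: power_add)
 show "e ~= 0 ==> haar e (dint k (q div 2 ^ (L - k))) t = 2 ^ L * mean_ker L k q s"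
  unfolding p_def[symmetric] haar_def using mem
  by (simp add: measure_dint mean_ker_def LD indicator_def)
 have right: "t \<in> right_half (dint k p) \<longleftrightarrow> same_cell L k q s \<and> odd (s div 2 ^ (L - Suc k))"
  and left: "t \<in> left_half (dint k p) \<longleftrightarrow> same_cell L k q s \<and> even (s div 2 ^ (L - Suc k))"
 proof -
  have Suc: "Suc k <= L" using k by simp
  have e: "(2::nat) ^ (L - k) = 2 ^ (L - Suc k) * 2" using k by (metis Suc_diff_Suc power_Suc2)
  have mid: "(Inf (dint k p) + Sup (dint k p)) / 2 = (2 * real p + 1) / 2 ^ Suc k"
   by (simp add: dint_Inf_Sup field_simps)
  have half: "dint (Suc k) (2 * p + 1) = {t \<in> dint k p. (2 * real p + 1) / 2 ^ Suc k <= t}"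
   "dint (Suc k) (2 * p) = {t \<in> dint k p. t < (2 * real p + 1) / 2 ^ Suc k}"
   by (auto simp: dint_def field_simps)
  have par: "a = 2 * p + 1 \<longleftrightarrow> a div 2 = p \<and> odd a" "a = 2 * p \<longleftrightarrow> a div 2 = p \<and> even a" for a
   by presburger+
  have dv: "s div 2 ^ (L - k) = (s div 2 ^ (L - Suc k)) div 2" unfolding e by (simp add: div_mult2_eq)
  have "t \<in> right_half (dint k p) \<longleftrightarrow> t \<in> dint (Suc k) (2 * p + 1)"
   unfolding right_half_def mid half by simp
  also have "... \<longleftrightarrow> s div 2 ^ (L - Suc k) = 2 * p + 1" by (rule dint_iff[OF Suc t])
  also have "... \<longleftrightarrow> s div 2 ^ (L - k) = p \<and> odd (s div 2 ^ (L - Suc k))" unfolding dv by (rule par)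
  finally show "t \<in> right_half (dint k p) \<longleftrightarrow> same_cell L k q s \<and> odd (s div 2 ^ (L - Suc k))"
   by (auto simp: same_cell_def p_def)
  have "t \<in> left_half (dint k p) \<longleftrightarrow> t \<in> dint (Suc k) (2 * p)"
   unfolding left_half_def mid half by simp
  also have "... \<longleftrightarrow> s div 2 ^ (L - Suc k) = 2 * p" by (rule dint_iff[OF Suc t])
  also have "... \<longleftrightarrow> s div 2 ^ (L - k) = p \<and> even (s div 2 ^ (L - Suc k))" unfolding dv by (rule par)
  finally show "t \<in> left_half (dint k p) \<longleftrightarrow> same_cell L k q s \<and> even (s div 2 ^ (L - Suc k))"
   by (auto simp: same_cell_def p_def)
 qed
 have sq: "sqrt (1 / 2 ^ k) = 1 / sqrt (2 ^ k)" by (simp add: real_sqrt_divide)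
 have "(2::real) ^ L / sqrt (2 ^ k) * (1 / 2 ^ (L - k)) = sqrt (2 ^ k)"
  unfolding LD by (simp add: real_div_sqrt)
 then show "haar 0 (dint k (q div 2 ^ (L - k))) t = 2 ^ L / sqrt (2 ^ k) * coeff_ker L k q s"
  unfolding p_def[symmetric] haar_def measure_dint sq using right left
  by (auto simp: coeff_ker_def mean_ker_def half_sign_def indicator_def mult.commute)
qed

definition haar_val :: "nat => ('n::finite => nat) => ('n => nat) => ('n => nat) => ('n => nat) => real" where
 "haar_val L e n x y = (\<Prod>j\<in>UNIV. if e j = 0 then 2 ^ L / sqrt (2 ^ n j) * coeff_ker L (n j) (x j) (y j)
   else 2 ^ L * mean_ker L (n j) (x j) (y j))"

lemma haar_rect_step:
 assumes "n \<in> scales L" "z \<in> cube L y"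
 shows "haar_rect e (grid_rect L n x) z = of_real (haar_val L e n x y)"
 unfolding haar_rect_def haar_val_def of_real_prod
proof (rule prod.cong[OF refl])
 fix j
 have "real (y j) / 2 ^ L <= z $ j" "z $ j < (real (y j) + 1) / 2 ^ L" using assms(2) by (auto simp: cube_def)
 from haar_dint[OF scalesD[OF assms(1), of j] this, where q = "x j"]
 show "complex_of_real (haar (e j) (grid_rect L n x j) (z $ j)) =
  of_real (if e j = 0 then 2 ^ L / sqrt (2 ^ n j) * coeff_ker L (n j) (x j) (y j) else 2 ^ L * mean_ker L (n j) (x j) (y j))"
  by (auto simp: grid_rect_def drect_def corner_def)
qed

lemma torus_set_cubes: "torus_set = (\<Union>x\<in>grid L. cube L x)"
proof (intro set_eqI iffI)
 fix z :: "real ^ 'n" assume z: "z \<in> torus_set"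
 define x where "x = (%j. nat \<lfloor>z $ j * 2 ^ L\<rfloor>)"
 have z0: "0 <= z $ j" "z $ j < 1" for j using z by (auto simp: torus_set_def)
 have r: "real (x j) <= z $ j * 2 ^ L" "z $ j * 2 ^ L < real (x j) + 1" for j
  using z0[of j] by (simp_all add: x_def)
 have "real (x j) < 2 ^ L" for j
 proof -
  have "z $ j * 2 ^ L < 1 * 2 ^ L" using z0[of j] by (intro mult_strict_right_mono) auto
  with r(1)[of j] show ?thesis by linarith
 qed
 then have "x \<in> grid L" by (simp add: grid_def)
 moreover have "z \<in> cube L x" using r by (simp add: cube_def field_simps)
 ultimately show "z \<in> (\<Union>x\<in>grid L. cube L x)" by blast
next
 fix z :: "real ^ 'n" assume "z \<in> (\<Union>x\<in>grid L. cube L x)"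
 then obtain x where x: "x \<in> grid L" "z \<in> cube L x" by blast
 have "0 <= z $ j \<and> z $ j < 1" for j
 proof -
  have "real (x j) / 2 ^ L <= z $ j" "z $ j < (real (x j) + 1) / 2 ^ L" using x(2) by (auto simp: cube_def)
  moreover have "(real (x j) + 1) / 2 ^ L <= 1"
  proof -
   have "Suc (x j) <= 2 ^ L" using gridD[OF x(1), of j] by simp
   then have "real (Suc (x j)) <= real (2 ^ L)" by (simp only: of_nat_le_iff)
   then show ?thesis by simp
  qed
  moreover have "0 <= real (x j) / 2 ^ L" by simp
  ultimately show ?thesis by linarith
 qed
 then show "z \<in> torus_set" by (simp add: torus_set_def)
qed

lemma cube_unique:
 assumes "z \<in> cube L x" "z \<in> cube L y" shows "x = y"
proof
 fix j
 have "z $ j \<in> dint L (x j)" using assms(1) by (simp add: cube_def dint_def)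
 moreover have "real (y j) / 2 ^ L <= z $ j" "z $ j < (real (y j) + 1) / 2 ^ L" using assms(2) by (auto simp: cube_def)
 ultimately show "x j = y j" using dint_iff[of L L "y j" "z $ j" "x j"] by simp
qed

lemma rect_cubes:
 assumes "!!j. n j <= L" "x \<in> grid L"
 shows "rect (grid_rect L n x) = (\<Union>y\<in>cell L n x. cube L y)"
proof -
 have iff: "z \<in> rect (grid_rect L n x) \<longleftrightarrow> y \<in> cell L n x" if z: "z \<in> cube L y" and y: "y \<in> grid L" for z y
 proof -
  have "z $ j \<in> grid_rect L n x j \<longleftrightarrow> same_cell L (n j) (x j) (y j)" for j
   using dint_iff[OF assms(1)[of j], of "y j" "z $ j" "corner L n x j"] z
   by (auto simp: grid_rect_def drect_def corner_def same_cell_def cube_def)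
  then show ?thesis using y by (simp add: rect_def cell_def)
 qed
 have "rect (grid_rect L n x) \<subseteq> torus_set"
 proof
  fix z assume z: "z \<in> rect (grid_rect L n x)"
  have "0 <= z $ j \<and> z $ j < 1" for j
  proof -
   have "z $ j \<in> dint (n j) (corner L n x j)" using z by (simp add: rect_def grid_rect_def drect_def)
   then have "real (corner L n x j) / 2 ^ n j <= z $ j" "z $ j < (real (corner L n x j) + 1) / 2 ^ n j"
    by (auto simp: dint_def)
   moreover have "(real (corner L n x j) + 1) / 2 ^ n j <= 1"
   proof -
    have "(2::nat) ^ L = 2 ^ (L - n j) * 2 ^ n j" using assms(1)[of j] by (simp flip: power_add)
    then have "corner L n x j < 2 ^ n j" using gridD[OF assms(2), of j]
     by (simp add: corner_def less_mult_imp_div_less mult.commute)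
    then have "real (Suc (corner L n x j)) <= real (2 ^ n j)" by (simp only: of_nat_le_iff Suc_leI)
    then show ?thesis by simp
   qed
   moreover have "0 <= real (corner L n x j) / 2 ^ n j" by simp
   ultimately show ?thesis by linarith
  qed
  then show "z \<in> torus_set" by (simp add: torus_set_def)
 qed
 note sub = this
 show ?thesis
 proof (intro equalityI subsetI)
  fix z assume z: "z \<in> rect (grid_rect L n x)"
  then have "z \<in> torus_set" using sub by (rule subsetD[rotated])
  then obtain y where y: "y \<in> grid L" "z \<in> cube L y" unfolding torus_set_cubes[of L] by (rule UN_E)
  then show "z \<in> (\<Union>y\<in>cell L n x. cube L y)" using iff[OF y(2,1)] z by (intro UN_I) simp_all
 next
  fix z assume "z \<in> (\<Union>y\<in>cell L n x. cube L y)"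
  then obtain y where y: "y \<in> cell L n x" "z \<in> cube L y" by (rule UN_E)
  have "y \<in> grid L" using y(1) cell_subset_grid by (rule subsetD[rotated])
  then show "z \<in> rect (grid_rect L n x)" using iff[OF y(2)] y(1) by simp
 qed
qed

lemma cube_box: "box (\<chi> j. real (x j) / 2 ^ L) (\<chi> j. (real (x j) + 1) / 2 ^ L) \<subseteq> cube L x"
 "cube L x \<subseteq> cbox (\<chi> j. real (x j) / 2 ^ L) (\<chi> j. (real (x j) + 1) / 2 ^ L)"
 by (auto simp: cube_def mem_box_cart less_imp_le)

lemma cube_lmeasurable: "cube L x \<in> lmeasurable"
 and measure_cube: "measure lebesgue (cube L (x :: 'n::finite => nat)) = 1 / 2 ^ (L * CARD('n))"
proof -
 define a where "a = (\<chi> j :: 'n. real (x j) / 2 ^ L)"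
 define b where "b = (\<chi> j :: 'n. (real (x j) + 1) / 2 ^ L)"
 have sub: "box a b \<subseteq> cube L x" "cube L x \<subseteq> cbox a b" unfolding a_def b_def by (rule cube_box)+
 have "negligible (cbox a b - box a b)" by (rule negligible_frontier_interval)
 then have neg: "negligible (cube L x - box a b)" by (rule negligible_subset) (use sub in auto)
 have e: "cube L x = box a b \<union> (cube L x - box a b)" using sub by auto
 have l1: "box a b \<in> lmeasurable" by simp
 have l2: "cube L x - box a b \<in> lmeasurable" using neg by (rule negligible_imp_measurable)
 show "cube L x \<in> lmeasurable" by (subst e) (rule fmeasurable.Un[OF l1 l2])
 have "measure lebesgue (cube L x) = measure lebesgue (box a b)"
  by (subst e, rule measure_Un_null_set) (use l1 neg in \<open>auto simp: negligible_iff_null_sets\<close>)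
 also have "... = measure lebesgue (cbox a b)" by (simp add: measure_lborel_cbox_eq measure_lborel_box_eq)
 also have "... = (\<Prod>i\<in>UNIV. b $ i - a $ i)"
 proof -
  have "a \<in> cbox a b" by (auto simp: mem_box_cart a_def b_def divide_right_mono)
  then have "cbox a b ~= {}" by blast
  then show ?thesis using content_cbox_cart[of a b] by simp
 qed
 also have "... = (\<Prod>i\<in>(UNIV :: 'n set). 1 / 2 ^ L)" by (rule prod.cong) (auto simp: a_def b_def diff_divide_distrib[symmetric])
 also have "... = 1 / 2 ^ (L * CARD('n))" by (simp add: power_divide power_mult)
 finally show "measure lebesgue (cube L x) = 1 / 2 ^ (L * CARD('n))" .
qed

definition cubes :: "nat => ('n::finite => nat) set => (real ^ 'n) set" where
 "cubes L W = (\<Union>x\<in>W. cube L x)"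

lemma cubes_lmeasurable: "W \<subseteq> grid L ==> cubes L W \<in> lmeasurable"
 and measure_cubes: "W \<subseteq> grid L ==> measure lebesgue (cubes L (W :: ('n::finite => nat) set)) = card W / 2 ^ (L * CARD('n))"
proof -
 assume om: "W \<subseteq> grid L"
 have fin: "finite W" by (rule finite_subset[OF om]) simp
 show "cubes L W \<in> lmeasurable" unfolding cubes_def by (rule fmeasurable.finite_UN[OF fin]) (rule cube_lmeasurable)
 have "measure lebesgue (cubes L W) = (\<Sum>x\<in>W. measure lebesgue (cube L x))"
  unfolding cubes_def
 proof (rule measure_finite_Union[OF fin])
  show "disjoint_family_on (cube L) W" unfolding disjoint_family_on_def using cube_unique by blast
 qed (use cube_lmeasurable fmeasurableD2 in \<open>auto\<close>)
 then show "measure lebesgue (cubes L W) = card W / 2 ^ (L * CARD('n))" by (simp add: measure_cube)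
qed

lemma torus_set_lmeasurable: "(torus_set :: (real ^ 'n::finite) set) \<in> lmeasurable"
 and measure_torus_set: "measure lebesgue (torus_set :: (real ^ 'n) set) = 1"
proof -
 have t: "(torus_set :: (real ^ 'n) set) = cubes 0 (grid 0)" unfolding cubes_def by (rule torus_set_cubes)
 show "(torus_set :: (real ^ 'n::finite) set) \<in> lmeasurable" unfolding t by (rule cubes_lmeasurable) simp
 show "measure lebesgue (torus_set :: (real ^ 'n) set) = 1" unfolding t
  by (subst measure_cubes) (simp_all add: card_grid)
qed

lemma finite_measure_torus: "finite_measure torus"
 by (rule finite_measure_lebesgue_on[OF torus_set_lmeasurable])

lemma sets_torusI: "A \<subseteq> torus_set ==> A \<in> sets lebesgue ==> A \<in> sets torus"
 by (simp add: sets_restrict_space_iff fmeasurableD[OF torus_set_lmeasurable])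

lemma measure_torus: "A \<subseteq> torus_set ==> measure torus A = measure lebesgue A"
 by (simp add: measure_restrict_space fmeasurableD[OF torus_set_lmeasurable])

lemma step_integral:
 fixes u :: "real ^ 'n::finite => 'b::{banach, second_countable_topology}" and U :: "('n => nat) => 'b"
 assumes u: "!!x z. x \<in> grid L ==> z \<in> cube L x ==> u z = U x"
 shows "integrable torus u" and "integral\<^sup>L torus u = (\<Sum>x\<in>grid L. U x) /\<^sub>R 2 ^ (L * CARD('n))"
proof -
 define v where "v = (%z. \<Sum>x\<in>grid L. indicator (cube L x) z *\<^sub>R U x)"
 have uv: "u z = v z" if z: "z \<in> torus_set" for z
 proof -
  obtain y where y: "y \<in> grid L" "z \<in> cube L y" using z torus_set_cubes[of L] by blast
  have "v z = (\<Sum>x\<in>grid L. if x = y then U y else 0)"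
   unfolding v_def by (rule sum.cong[OF refl]) (use y cube_unique in \<open>auto simp: indicator_def\<close>)
  then show ?thesis using y u by simp
 qed
 have sub: "cube L x \<subseteq> torus_set" if "x \<in> grid L" for x :: "'n => nat" using that torus_set_cubes[of L] by blast
 have sets: "cube L x \<in> sets torus" if "x \<in> grid L" for x :: "'n => nat"
  by (rule sets_torusI[OF sub[OF that] fmeasurableD[OF cube_lmeasurable]])
 have meas: "measure torus (cube L x) = 1 / 2 ^ (L * CARD('n))" if "x \<in> grid L" for x :: "'n => nat"
  using measure_torus[OF sub[OF that]] measure_cube[of L x] by simp
 have emeas: "emeasure torus (cube L x) < \<infinity>" for x :: "'n => nat"
  by (metis finite_measure.emeasure_finite finite_measure_torus infinity_ennreal_def less_top)
 have ii: "integrable torus (%z. indicat_real (cube L x) z *\<^sub>R U x)" if x: "x \<in> grid L" for x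
  by (intro integrable_scaleR_left integrable_real_indicator sets[OF x] emeas)
 have iv: "integrable torus v" unfolding v_def by (rule Bochner_Integration.integrable_sum) (rule ii)
 have "integrable torus u \<longleftrightarrow> integrable torus v"
  by (rule Bochner_Integration.integrable_cong) (simp_all add: uv)
 with iv show "integrable torus u" by simp
 have "integral\<^sup>L torus u = integral\<^sup>L torus v" by (rule Bochner_Integration.integral_cong) (use uv in auto)
 also have "... = (\<Sum>x\<in>grid L. integral\<^sup>L torus (%z. indicator (cube L x) z *\<^sub>R U x))"
  unfolding v_def by (rule Bochner_Integration.integral_sum) (rule ii)
 also have "... = (\<Sum>x\<in>grid L. (1 / 2 ^ (L * CARD('n))) *\<^sub>R U x)"
 proof (rule sum.cong[OF refl])
  fix x :: "'n => nat" assume x: "x \<in> grid L"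
  have "integral\<^sup>L torus (%z. indicator (cube L x) z *\<^sub>R U x) = measure torus (cube L x) *\<^sub>R U x"
   using sets[OF x] emeas[of x] Int_absorb2[OF sub[OF x]]
   by (subst integral_scaleR_left) (auto intro!: integrable_real_indicator simp: Int_commute)
  then show "integral\<^sup>L torus (%z. indicator (cube L x) z *\<^sub>R U x) = (1 / 2 ^ (L * CARD('n))) *\<^sub>R U x"
   using meas[OF x] by simp
 qed
 finally show "integral\<^sup>L torus u = (\<Sum>x\<in>grid L. U x) /\<^sub>R 2 ^ (L * CARD('n))"
  by (simp add: scaleR_sum_right inverse_eq_divide)
qed

text \<open>The normalisation that turns product kernels into Haar coefficients: each \<open>L\<^sup>2\<close>-normalised side contributes the
  square root of its length.\<close>

definition haar_unit :: "('n::finite => nat) => ('n => nat) => real" where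
 "haar_unit e n = (\<Prod>j\<in>UNIV. if e j = 0 then 1 / sqrt (2 ^ n j) else 1)"

lemma haar_unit_pos: "0 < haar_unit e n"
 unfolding haar_unit_def by (intro prod_pos) auto

lemma inner_step_haar:
 fixes u :: "real ^ 'n::finite => complex"
 assumes u: "!!y z. y \<in> grid L ==> z \<in> cube L y ==> u z = of_real (U y)" and n: "n \<in> scales L"
 shows "inner_torus u (haar_rect e (grid_rect L n x)) =
  of_real (haar_unit e n * ker_op L (%j. if e j = 0 then coeff_ker L (n j) else mean_ker L (n j)) U x)"
proof -
 have "inner_torus u (haar_rect e (grid_rect L n x)) =
  (\<Sum>y\<in>grid L. complex_of_real (U y * haar_val L e n x y)) /\<^sub>R 2 ^ (L * CARD('n))"
  unfolding inner_torus_def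
  by (rule step_integral(2)) (simp add: u haar_rect_step[OF n])
 also have "... = of_real ((\<Sum>y\<in>grid L. U y * haar_val L e n x y) / 2 ^ (L * CARD('n)))"
  by (simp add: scaleR_conv_of_real of_real_sum divide_inverse mult.commute)
 also have "(\<Sum>y\<in>grid L. U y * haar_val L e n x y) / 2 ^ (L * CARD('n)) =
  haar_unit e n * ker_op L (%j. if e j = 0 then coeff_ker L (n j) else mean_ker L (n j)) U x"
 proof -
  have "haar_val L e n x y = 2 ^ (L * CARD('n)) * (haar_unit e n *
   (\<Prod>j\<in>UNIV. (if e j = 0 then coeff_ker L (n j) else mean_ker L (n j)) (x j) (y j)))" for y
  proof -
   have "(2::real) ^ (L * CARD('n)) = (\<Prod>j\<in>(UNIV :: 'n set). 2 ^ L)" by (simp add: power_mult)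
   then show ?thesis unfolding haar_val_def haar_unit_def by (simp only: prod.distrib[symmetric]) (rule prod.cong, auto)
  qed
  then show ?thesis unfolding ker_op_def by (simp add: sum_distrib_left sum_divide_distrib mult_ac)
 qed
 finally show ?thesis .
qed

section \<open>Haar coefficients of functions on the torus and of functions on the grid\<close>

definition rects_below :: "nat => ('n::finite => real set) set" where
 "rects_below L = {drect n p | n p. n \<in> scales L \<and> (\<forall>j. p j < 2 ^ n j)}"

lemma corner_less:
 assumes "n \<in> scales L" "x \<in> grid L"
 shows "corner L n x j < 2 ^ n j"
proof -
 have "(2::nat) ^ L = 2 ^ (L - n j) * 2 ^ n j" using scalesD[OF assms(1), of j] by (simp flip: power_add)
 then show ?thesis using gridD[OF assms(2), of j] by (simp add: corner_def less_mult_imp_div_less mult.commute)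
qed

lemma grid_rect_below: "n \<in> scales L ==> x \<in> grid L ==> grid_rect L n x \<in> rects_below L"
 unfolding rects_below_def grid_rect_def using corner_less by blast

lemma rects_belowE:
 assumes "R \<in> rects_below L"
 obtains n x where "n \<in> scales L" "x \<in> grid L" "R = grid_rect L n x"
proof -
 obtain n p where np: "n \<in> scales L" "\<forall>j. p j < 2 ^ n j" "R = drect n p" using assms by (auto simp: rects_below_def)
 define x where "x = (%j. p j * 2 ^ (L - n j))"
 have "x j < 2 ^ L" for j
 proof -
  have "(2::nat) ^ L = 2 ^ n j * 2 ^ (L - n j)" using scalesD[OF np(1), of j] by (simp flip: power_add)
  then show ?thesis using np(2) by (simp add: x_def)
 qed
 moreover have "corner L n x = p" by (simp add: corner_def x_def fun_eq_iff)
 ultimately show thesis using that[of n x] np by (simp add: grid_rect_def grid_def)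
qed

lemma rects_below_eq: "rects_below L = (\<Union>n\<in>scales L. grid_rect L n ` grid L)"
 using grid_rect_below by (auto elim!: rects_belowE)

lemma finite_rects_below [simp]: "finite (rects_below L)"
 unfolding rects_below_eq by simp

lemma rects_below_dyadic: "rects_below L \<subseteq> dyadic_rects"
 unfolding rects_below_def dyadic_rects_eq by auto

lemma rects_below_mono: "L <= M ==> rects_below L \<subseteq> rects_below M"
 unfolding rects_below_def scales_def using less_le_trans by blast

lemma dyadic_rect_below:
 assumes "R \<in> (dyadic_rects :: ('n::finite => real set) set)"
 obtains L where "R \<in> rects_below L"
proof -
 obtain n p where np: "R = drect n p" "\<forall>j. p j < 2 ^ n j" using assms by (auto simp: dyadic_rects_eq)
 have "n j < Suc (\<Sum>i\<in>UNIV. n i)" for j using member_le_sum[of j UNIV n] by (simp add: less_Suc_eq_le)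
 then show thesis using np by (intro that[of "Suc (\<Sum>i\<in>UNIV. n i)"]) (auto simp: rects_below_def scales_def)
qed

lemma finite_dyadic_below:
 assumes "finite Q" "Q \<subseteq> (dyadic_rects :: ('n::finite => real set) set)"
 obtains L where "0 < L" "Q \<subseteq> rects_below L"
proof -
 have "\<exists>L>0. Q \<subseteq> rects_below L" using assms
 proof (induction Q)
  case (insert R Q)
  then obtain L where L: "0 < L" "Q \<subseteq> rects_below L" by auto
  obtain M where "R \<in> rects_below M" using insert.prems dyadic_rect_below by blast
  then have "insert R Q \<subseteq> rects_below (max L M)"
   using L rects_below_mono[of L "max L M"] rects_below_mono[of M "max L M"] by auto
  then show ?case using L by (intro exI[of _ "max L M"]) auto
 qed auto
 then show thesis using that by blast
qed

lemma grid_rect_eq_iff: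
 assumes "x \<in> grid L" "y \<in> grid L"
 shows "grid_rect L n x = grid_rect L n y \<longleftrightarrow> y \<in> cell L n x"
proof
 assume "grid_rect L n x = grid_rect L n y"
 then have "corner L n x = corner L n y" unfolding grid_rect_def using drect_inj by blast
 then show "y \<in> cell L n x" using assms by (auto simp: cell_def corner_def same_cell_def fun_eq_iff)
next
 assume "y \<in> cell L n x"
 then show "grid_rect L n x = grid_rect L n y" by (simp add: cell_def grid_rect_def corner_def same_cell_def)
qed

lemma card_cell:
 fixes x :: "'n::finite => nat"
 assumes "n \<in> scales L" "x \<in> grid L"
 shows "real (card (cell L n x)) = 2 ^ (L * CARD('n)) / weight n"
proof -
 have "cell L n x = PiE UNIV (%j. {t. t < 2 ^ L \<and> same_cell L (n j) (x j) t})"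
  by (auto simp: cell_def grid_def PiE_def)
 then have "card (cell L n x) = (\<Prod>j\<in>UNIV. card {t. t < 2 ^ L \<and> same_cell L (n j) (x j) t})"
  by (simp add: card_PiE)
 also have "... = (\<Prod>j\<in>UNIV. 2 ^ (L - n j))"
  using assms by (intro prod.cong refl card_same_cell) (auto simp: gridD scalesD less_imp_le)
 finally have "real (card (cell L n x)) = (\<Prod>j\<in>UNIV. 2 ^ (L - n j))" by simp
 also have "... = (\<Prod>j\<in>UNIV. 2 ^ L / 2 ^ n j)"
  using scalesD[OF assms(1)] by (intro prod.cong refl) (simp add: power_diff less_imp_le)
 also have "... = 2 ^ (L * CARD('n)) / weight n" by (simp add: prod_dividef weight_def power_mult)
 finally show ?thesis .
qed

lemma sum_rects_below:
 fixes h :: "('n::finite => real set) => real"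
 shows "(\<Sum>R\<in>rects_below L. h R) =
  (\<Sum>n\<in>scales L. \<Sum>x\<in>grid L. h (grid_rect L n x) * weight n) / 2 ^ (L * CARD('n))"
proof -
 have "(\<Sum>R\<in>rects_below L. h R) = (\<Sum>n\<in>scales L. \<Sum>R\<in>grid_rect L n ` grid L. h R)"
  unfolding rects_below_eq
 proof (rule sum.UNION_disjoint)
  show "\<forall>n\<in>scales L. \<forall>m\<in>scales L. n ~= m --> grid_rect L n ` (grid L :: ('n => nat) set) \<inter> grid_rect L m ` grid L = {}"
   unfolding grid_rect_def using drect_inj by blast
 qed auto
 also have "... = (\<Sum>n\<in>scales L. (\<Sum>x\<in>grid L. h (grid_rect L n x) * weight n) / 2 ^ (L * CARD('n)))"
 proof (rule sum.cong[OF refl])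
  fix n :: "'n => nat" assume n: "n \<in> scales L"
  have w: "weight n ~= 0" using weight_pos[of n] by simp
  have "(\<Sum>x\<in>grid L. h (grid_rect L n x) * weight n) =
   (\<Sum>R\<in>grid_rect L n ` grid L. \<Sum>x\<in>{x \<in> grid L. grid_rect L n x = R}. h (grid_rect L n x) * weight n)"
   by (rule sum.image_gen) simp
  also have "... = (\<Sum>R\<in>grid_rect L n ` grid L. h R * 2 ^ (L * CARD('n)))"
  proof (rule sum.cong[OF refl])
   fix R assume "R \<in> grid_rect L n ` (grid L :: ('n => nat) set)"
   then obtain y where y: "y \<in> grid L" "R = grid_rect L n y" by (elim imageE)
   have e: "{x \<in> grid L. grid_rect L n x = R} = cell L n y"
   proof (intro set_eqI iffI)
    fix x assume "x \<in> {x \<in> grid L. grid_rect L n x = R}"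
    then have x: "x \<in> grid L" "grid_rect L n y = grid_rect L n x" using y(2) by simp_all
    then show "x \<in> cell L n y" using grid_rect_eq_iff[OF y(1) x(1)] by simp
   next
    fix x assume c: "x \<in> cell L n y"
    then have x: "x \<in> grid L" using cell_subset_grid by (rule subsetD[rotated])
    then have "grid_rect L n y = grid_rect L n x" using grid_rect_eq_iff[OF y(1) x] c by simp
    then show "x \<in> {x \<in> grid L. grid_rect L n x = R}" using x y(2) by simp
   qed
   have "(\<Sum>x\<in>{x \<in> grid L. grid_rect L n x = R}. h (grid_rect L n x) * weight n) = (\<Sum>x\<in>cell L n y. h R * weight n)"
    unfolding e[symmetric] by (rule sum.cong) auto
   also have "... = h R * 2 ^ (L * CARD('n))" using card_cell[OF n y(1)] w by simp
   finally show "(\<Sum>x\<in>{x \<in> grid L. grid_rect L n x = R}. h (grid_rect L n x) * weight n) = h R * 2 ^ (L * CARD('n))" .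
  qed
  finally show "(\<Sum>R\<in>grid_rect L n ` grid L. h R) = (\<Sum>x\<in>grid L. h (grid_rect L n x) * weight n) / 2 ^ (L * CARD('n))"
   by (simp flip: sum_distrib_right)
 qed
 finally show ?thesis by (simp add: sum_divide_distrib)
qed

definition pair_ker :: "nat => ('n => nat) => ('n => nat) => 'n => nat => nat => real" where
 "pair_ker L e n j = (if e j = 0 then coeff_ker L (n j) else mean_ker L (n j))"

lemma ker_op_tensor:
 "ker_op L \<kappa> (%y. \<Prod>j\<in>UNIV. u j (y j)) x = (\<Prod>j\<in>UNIV. \<Sum>s<2 ^ L. \<kappa> j (x j) s * u j s)"
 unfolding ker_op_def prod.distrib[symmetric] by (rule sum_grid_prod[of "%j s. \<kappa> j (x j) s * u j s"])

lemma haar_like_coeff_ker: "haar_like L m (coeff_ker L m y)"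
proof -
 have "coeff_ker L m y = (%s. half_sign L m s * mean_ker L m y s)" by (auto simp: coeff_ker_def)
 then show ?thesis using haar_likeI[OF cell_const_mean_ker'[OF le_refl, of L m y]] by simp
qed

lemma sum_pair_coeff:
 assumes "n < L" "m < L" "x < 2 ^ L" "y < 2 ^ L"
 shows "(\<Sum>s<2 ^ L. (if e = 0 then coeff_ker L n else mean_ker L n) x s * coeff_ker L m y s) ~= 0
  ==> m <= n \<and> same_cell L m x y"
  and "(\<Sum>s<2 ^ L. coeff_ker L n x s * coeff_ker L m y s) = (if n = m \<and> same_cell L n x y then 1 / 2 ^ (L - n) else 0)"
proof -
 have same: "(\<Sum>s<2 ^ L. coeff_ker L n x s * coeff_ker L n y s) = mean_ker L n x y"
 proof -
  have "coeff_ker L n x s * coeff_ker L n y s = mean_ker L n x s * mean_ker L n s y" for s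
   using half_sign_sq(1)[of L n s] by (simp add: coeff_ker_def mean_ker_sym[of L n y] mult_ac)
  then show ?thesis using mean_ker_comp[of n L n x y] assms by simp
 qed
 have diff: "(\<Sum>s<2 ^ L. coeff_ker L n x s * coeff_ker L m y s) = 0" if "n ~= m"
  by (rule sum_haar_like_orth[OF haar_like_coeff_ker haar_like_coeff_ker that assms(1,2)])
 show "(\<Sum>s<2 ^ L. coeff_ker L n x s * coeff_ker L m y s) = (if n = m \<and> same_cell L n x y then 1 / 2 ^ (L - n) else 0)"
  using same diff by (cases "n = m") (auto simp: mean_ker_def)
 assume nz: "(\<Sum>s<2 ^ L. (if e = 0 then coeff_ker L n else mean_ker L n) x s * coeff_ker L m y s) ~= 0"
 show "m <= n \<and> same_cell L m x y"
 proof (cases "e = 0")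
  case True
  with nz diff have nm: "n = m" by auto
  with nz True same show ?thesis by (auto simp: mean_ker_def split: if_splits)
 next
  case False
  have "(\<Sum>s<2 ^ L. mean_ker L n x s * coeff_ker L m y s) = 0" if "n <= m"
   by (rule mean_of_haar_like[OF that assms(2) haar_like_coeff_ker])
  with nz False have mn: "m < n" by force
  obtain s where "mean_ker L n x s * coeff_ker L m y s ~= 0"
   using sum.not_neutral_contains_not_neutral[of "%s. mean_ker L n x s * coeff_ker L m y s" "{..<2 ^ L}"] nz False
   by auto
  then have "same_cell L n x s" "same_cell L m y s" by (auto simp: mean_ker_def coeff_ker_def split: if_splits)
  then have "same_cell L m x y" using mn same_cell_mono same_cell_sym same_cell_trans by (meson less_imp_le)
  with mn show ?thesis by simp
 qed
qed

definition haar_pair :: "('n::finite => nat) => ('n => real set) => ('n => real set) => real" where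
 "haar_pair e Q R = Re (inner_torus (haar_rect (%_. 0) Q) (haar_rect e R))"

definition haar_grid :: "nat => ('n::finite => real set) => ('n => nat) => real" where
 "haar_grid L Q y = Re (haar_rect (%_. 0) Q (\<chi> j. real (y j) / 2 ^ L))"

lemma corner_in_cube: "(\<chi> j. real (y j) / 2 ^ L) \<in> cube L y"
 by (auto simp: cube_def divide_strict_right_mono)

lemma haar_grid_eq: "m \<in> scales L ==> haar_grid L (grid_rect L m x) y = haar_val L (%_. 0) m x y"
 unfolding haar_grid_def haar_rect_step[OF _ corner_in_cube] by simp

lemma haar_rect_grid:
 assumes "Q \<in> rects_below L" "z \<in> cube L y"
 shows "haar_rect (%_. 0) Q z = of_real (haar_grid L Q y)"
 using assms by (elim rects_belowE) (simp add: haar_rect_step haar_grid_eq)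

lemma inner_haar_haar:
 assumes "Q \<in> rects_below L" "n \<in> scales L"
 shows "inner_torus (haar_rect (%_. 0) Q) (haar_rect e (grid_rect L n x)) =
  of_real (haar_unit e n * ker_op L (pair_ker L e n) (haar_grid L Q) x)"
 unfolding pair_ker_def[abs_def] by (rule inner_step_haar[OF haar_rect_grid[OF assms(1)] assms(2)])

lemma haar_pair_grid:
 assumes "Q \<in> rects_below L" "n \<in> scales L"
 shows "haar_pair e Q (grid_rect L n x) = haar_unit e n * ker_op L (pair_ker L e n) (haar_grid L Q) x"
 unfolding haar_pair_def inner_haar_haar[OF assms] by simp

lemma inner_haar_pair:
 assumes "Q \<in> dyadic_rects" "R \<in> dyadic_rects"
 shows "inner_torus (haar_rect (%_. 0) Q) (haar_rect e R) = of_real (haar_pair e Q R)"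
proof -
 obtain L where L: "{Q, R} \<subseteq> rects_below L" using finite_dyadic_below[of "{Q, R}"] assms by auto
 obtain n x where R: "n \<in> scales L" "R = grid_rect L n x" using L rects_belowE by (metis insert_subset)
 have "Q \<in> rects_below L" using L by simp
 from inner_haar_haar[OF this R(1), of e x] show ?thesis unfolding haar_pair_def R(2) by simp
qed

lemma ker_op_haar_grid:
 assumes "m \<in> scales L"
 shows "ker_op L \<kappa> (haar_grid L (grid_rect L m y)) x =
  (\<Prod>j\<in>UNIV. 2 ^ L / sqrt (2 ^ m j) * (\<Sum>s<2 ^ L. \<kappa> j (x j) s * coeff_ker L (m j) (y j) s))"
proof -
 have "ker_op L \<kappa> (haar_grid L (grid_rect L m y)) x =
  ker_op L \<kappa> (%w. \<Prod>j\<in>UNIV. 2 ^ L / sqrt (2 ^ m j) * coeff_ker L (m j) (y j) (w j)) x"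
  by (rule ker_op_cong_fun) (simp add: haar_grid_eq[OF assms] haar_val_def)
 also have "... = (\<Prod>j\<in>UNIV. \<Sum>s<2 ^ L. \<kappa> j (x j) s * (2 ^ L / sqrt (2 ^ m j) * coeff_ker L (m j) (y j) s))"
  by (rule ker_op_tensor[of L \<kappa> "%j s. 2 ^ L / sqrt (2 ^ m j) * coeff_ker L (m j) (y j) s"])
 finally show ?thesis by (simp add: sum_distrib_left mult_ac)
qed

lemma haar_pair_support:
 assumes "m \<in> scales L" "n \<in> scales L" "x \<in> grid L" "y \<in> grid L"
  and nz: "haar_pair e (grid_rect L m y) (grid_rect L n x) ~= 0"
 shows "m j <= n j" "cell L n x \<subseteq> cell L m y"
proof -
 have Q: "grid_rect L m y \<in> rects_below L" using assms by (intro grid_rect_below)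
 have "ker_op L (pair_ker L e n) (haar_grid L (grid_rect L m y)) x ~= 0"
  using nz unfolding haar_pair_grid[OF Q assms(2)] by auto
 then have "(\<Sum>s<2 ^ L. pair_ker L e n j (x j) s * coeff_ker L (m j) (y j) s) ~= 0" for j
  unfolding ker_op_haar_grid[OF assms(1)] by (auto simp: prod_zero_iff)
 then have key: "m j <= n j \<and> same_cell L (m j) (x j) (y j)" for j
  using sum_pair_coeff(1)[of "n j" L "m j" "x j" "y j" "e j"] scalesD[OF assms(1), of j] scalesD[OF assms(2), of j]
   gridD[OF assms(3), of j] gridD[OF assms(4), of j] by (auto simp: pair_ker_def)
 then show "m j <= n j" by simp
 show "cell L n x \<subseteq> cell L m y"
 proof
  fix z assume z: "z \<in> cell L n x"
  have "same_cell L (m j) (y j) (z j)" for j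
   using key[of j] z same_cell_mono[of L "n j" "x j" "z j" "m j"] same_cell_trans same_cell_sym unfolding cell_def by blast
  then show "z \<in> cell L m y" using z by (simp add: cell_def)
 qed
qed

lemma real_sqrt_prod: "finite A ==> sqrt (\<Prod>i\<in>A. f i) = (\<Prod>i\<in>A. sqrt (f i))"
 by (induction A rule: finite_induct) (simp_all add: real_sqrt_mult)

lemma haar_unit_0: "haar_unit (%_. 0) n = 1 / sqrt (weight n)"
 by (simp add: haar_unit_def weight_def prod_dividef real_sqrt_prod)

lemma haar_orthonormal:
 assumes "Q \<in> dyadic_rects" "R \<in> dyadic_rects"
 shows "haar_pair (%_. 0) Q R = (if Q = R then 1 else 0)"
proof -
 obtain L where L: "{Q, R} \<subseteq> rects_below L" using finite_dyadic_below[of "{Q, R}"] assms by auto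
 obtain n x where R: "n \<in> scales L" "x \<in> grid L" "R = grid_rect L n x" using L rects_belowE by (metis insert_subset)
 obtain m y where Q: "m \<in> scales L" "y \<in> grid L" "Q = grid_rect L m y" using L rects_belowE by (metis insert_subset)
 have QL: "Q \<in> rects_below L" using L by simp
 have s: "(\<Sum>s<2 ^ L. pair_ker L (%_. 0) n j (x j) s * coeff_ker L (m j) (y j) s) =
   (if n j = m j \<and> same_cell L (n j) (x j) (y j) then 1 / 2 ^ (L - n j) else 0)" for j
  using sum_pair_coeff(2)[of "n j" L "m j" "x j" "y j"] scalesD[OF Q(1), of j] scalesD[OF R(1), of j]
   gridD[OF Q(2), of j] gridD[OF R(2), of j] by (simp add: pair_ker_def)
 have e: "haar_pair (%_. 0) Q R = (\<Prod>j\<in>UNIV. 1 / sqrt (2 ^ n j) * (2 ^ L / sqrt (2 ^ m j) *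
  (if n j = m j \<and> same_cell L (n j) (x j) (y j) then 1 / 2 ^ (L - n j) else 0)))"
  unfolding R(3) haar_pair_grid[OF QL R(1)] unfolding Q(3) ker_op_haar_grid[OF Q(1)] s haar_unit_def prod.distrib by simp
 show ?thesis
 proof (cases "Q = R")
  case True
  then have nm: "n = m" unfolding Q(3) R(3) grid_rect_def using drect_inj by blast
  have "grid_rect L n x = grid_rect L n y" using True Q(3) R(3) nm by simp
  then have "y \<in> cell L n x" by (rule grid_rect_eq_iff[OF R(2) Q(2), THEN iffD1])
  then have sc: "same_cell L (n j) (x j) (y j)" for j by (simp add: cell_def)
  have "1 / sqrt (2 ^ n j) * (2 ^ L / sqrt (2 ^ n j) * (1 / 2 ^ (L - n j))) = (1::real)" for j
  proof -
   have "(2::real) ^ L = 2 ^ n j * 2 ^ (L - n j)" using scalesD[OF R(1), of j] by (simp flip: power_add)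
   then show ?thesis by simp
  qed
  then show ?thesis using True unfolding e nm[symmetric] by (simp add: sc)
 next
  case False
  have "\<exists>j. \<not> (n j = m j \<and> same_cell L (n j) (x j) (y j))"
  proof (rule ccontr)
   assume "\<nexists>j. \<not> (n j = m j \<and> same_cell L (n j) (x j) (y j))"
   then have "n = m" "y \<in> cell L n x" using Q(2) by (auto simp: cell_def)
   then have "grid_rect L n x = grid_rect L n y" by (intro grid_rect_eq_iff[OF R(2) Q(2), THEN iffD2])
   then show False using False Q(3) R(3) \<open>n = m\<close> by simp
  qed
  then have "haar_pair (%_. 0) Q R = 0" unfolding e by (auto simp: prod_zero_iff)
  with False show ?thesis by simp
 qed
qed

text \<open>A Haar function pairs to zero with everything that is constant on its support, so only scales not finer than
  those of \<open>R\<close> matter.\<close>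

lemma haar_pair_scale:
 assumes "Q \<in> dyadic_rects" "R \<in> rects_below L" "haar_pair e Q R ~= 0"
 shows "Q \<in> rects_below L"
proof -
 have "R \<in> dyadic_rects" using assms(2) rects_below_dyadic by blast
 then obtain M where M: "{Q, R} \<subseteq> rects_below M" using finite_dyadic_below[of "{Q, R}"] assms(1) by auto
 obtain n x where R: "n \<in> scales M" "x \<in> grid M" "R = grid_rect M n x" using M rects_belowE by (metis insert_subset)
 obtain m y where Q: "m \<in> scales M" "y \<in> grid M" "Q = grid_rect M m y" using M rects_belowE by (metis insert_subset)
 have le: "m j <= n j" for j using haar_pair_support(1)[OF Q(1) R(1,2) Q(2)] assms(3) Q(3) R(3) by simp
 obtain n' p' where "n' \<in> scales L" "R = drect n' p'" using assms(2) by (auto simp: rects_below_def)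
 then have "n \<in> scales L" using drect_inj R(3) unfolding grid_rect_def by metis
 then have "m \<in> scales L" using le unfolding scales_def by (auto intro: le_less_trans)
 then show ?thesis unfolding Q(3) grid_rect_def rects_below_def using corner_less[OF Q(1,2)] by blast
qed

definition haar_synth :: "nat => (('n::finite => real set) => real) => ('n => nat) => real" where
 "haar_synth L c y = (\<Sum>Q\<in>rects_below L. c Q * haar_grid L Q y)"

lemma haar_synth_pair:
 assumes "n \<in> scales L"
 shows "haar_unit e n * ker_op L (pair_ker L e n) (haar_synth L c) x =
  (\<Sum>Q\<in>rects_below L. c Q * haar_pair e Q (grid_rect L n x))"
 unfolding haar_synth_def[abs_def] ker_op_sum ker_op_cmult sum_distrib_left
 by (rule sum.cong[OF refl]) (simp add: haar_pair_grid[OF _ assms])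

lemma pair_ker_0: "ker_op L (pair_ker L (%_. 0) n) = coeff_op L n"
 by (simp add: pair_ker_def[abs_def] coeff_op_def)

lemma coeff_op_synth:
 assumes "n \<in> scales L" "x \<in> grid L"
 shows "coeff_op L n (haar_synth L c) x = sqrt (weight n) * c (grid_rect L n x)"
proof -
 have "(\<Sum>Q\<in>rects_below L. c Q * haar_pair (%_. 0) Q (grid_rect L n x)) =
  (\<Sum>Q\<in>rects_below L. if Q = grid_rect L n x then c Q else 0)"
 proof (rule sum.cong[OF refl])
  fix Q :: "'a => real set" assume "Q \<in> rects_below L"
  then have "Q \<in> dyadic_rects" "grid_rect L n x \<in> dyadic_rects"
   using rects_below_dyadic[of L] grid_rect_below[OF assms] by blast+
  then show "c Q * haar_pair (%_. 0) Q (grid_rect L n x) = (if Q = grid_rect L n x then c Q else 0)"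
   by (simp add: haar_orthonormal)
 qed
 also have "... = c (grid_rect L n x)" using grid_rect_below[OF assms] by simp
 finally have "haar_unit (%_. 0) n * coeff_op L n (haar_synth L c) x = c (grid_rect L n x)"
  unfolding pair_ker_0[symmetric] haar_synth_pair[OF assms(1)] .
 then show ?thesis using weight_pos[of n] by (simp add: haar_unit_0 field_simps)
qed

lemma mean_zero_synth: "mean_zero L (haar_synth L (c :: ('n::finite => real set) => real))"
 unfolding mean_zero_def
proof (intro allI impI)
 fix \<kappa> :: "'n => nat => nat => real" and i and x :: "'n => nat"
 assume x: "x \<in> grid L" and i: "\<kappa> i = mean_ker L 0"
 have "ker_op L \<kappa> (haar_grid L Q) x = 0" if "Q \<in> rects_below L" for Q
  using that
 proof (rule rects_belowE)
  fix m y assume m: "m \<in> scales L" and Q: "Q = grid_rect L m y"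
  have "(\<Sum>s<2 ^ L. \<kappa> i (x i) s * coeff_ker L (m i) (y i) s) = 0"
   unfolding i by (rule mean_of_haar_like[OF _ scalesD[OF m] haar_like_coeff_ker]) simp
  then show ?thesis unfolding Q ker_op_haar_grid[OF m] by (auto simp: prod_zero_iff)
 qed
 then show "ker_op L \<kappa> (haar_synth L c) x = 0"
  unfolding haar_synth_def[abs_def] ker_op_sum ker_op_cmult by simp
qed

lemma mean_zero_parseval:
 assumes "mean_zero L f"
 shows "sq_norm L f = (\<Sum>k\<in>scales L. \<Sum>x\<in>grid L. (coeff_op L k f x)^2)"
proof -
 have "sq_norm L f = sq_norm L (spectral_part L (%_ _. True) f)"
  unfolding sq_norm_def by (rule sum.cong[OF refl]) (simp add: spectral_part_def sum_scale_diff[OF assms])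
 then show ?thesis unfolding sq_norm_spectral_part by simp
qed

lemma sq_norm_synth:
 fixes c :: "('n::finite => real set) => real"
 shows "sq_norm L (haar_synth L c) = 2 ^ (L * CARD('n)) * (\<Sum>Q\<in>rects_below L. (c Q)^2)"
proof -
 have "sq_norm L (haar_synth L c) = (\<Sum>n\<in>scales L. \<Sum>x\<in>grid L. (c (grid_rect L n x))^2 * weight n)"
  unfolding mean_zero_parseval[OF mean_zero_synth]
  by (intro sum.cong refl) (simp add: coeff_op_synth power_mult_distrib less_imp_le[OF weight_pos])
 then show ?thesis unfolding sum_rects_below by simp
qed

lemma mean_zero_eqI:
 assumes "mean_zero L f" "mean_zero L g" "x \<in> grid L"
  and "!!k y. k \<in> scales L ==> y \<in> grid L ==> coeff_op L k f y = coeff_op L k g y"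
 shows "f x = g x"
proof -
 have "f x = (\<Sum>k\<in>scales L. scale_diff L k f x)" by (rule sum_scale_diff[OF assms(1,3), symmetric])
 also have "... = (\<Sum>k\<in>scales L. scale_diff L k g x)"
  by (rule sum.cong[OF refl]) (simp add: scale_diff_eq assms(3,4))
 also have "... = g x" by (rule sum_scale_diff[OF assms(2,3)])
 finally show ?thesis .
qed

text \<open>The Haar expansion on the grid is complete among functions with mean zero in each variable.\<close>

lemma mean_zero_synthesis:
 assumes "mean_zero L f"
 obtains c where "!!x. x \<in> grid L ==> haar_synth L c x = f x"
  "!!n x. n \<in> scales L ==> x \<in> grid L ==> c (grid_rect L n x) = haar_unit (%_. 0) n * coeff_op L n f x"
proof -
 define c where "c = (%R. let (n, x) = (SOME p. fst p \<in> scales L \<and> snd p \<in> grid L \<and> R = grid_rect L (fst p) (snd p))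
   in haar_unit (%_. 0) n * coeff_op L n f x)"
 have c: "c (grid_rect L n x) = haar_unit (%_. 0) n * coeff_op L n f x" if n: "n \<in> scales L" and x: "x \<in> grid L" for n x
 proof -
  define p where "p = (SOME p. fst p \<in> scales L \<and> snd p \<in> grid L \<and> grid_rect L n x = grid_rect L (fst p) (snd p))"
  have p: "fst p \<in> scales L \<and> snd p \<in> grid L \<and> grid_rect L n x = grid_rect L (fst p) (snd p)"
   unfolding p_def by (rule someI[of _ "(n, x)"]) (use n x in simp)
  then have "n = fst p" unfolding grid_rect_def using drect_inj by metis
  moreover have "snd p \<in> cell L n x" using p grid_rect_eq_iff[OF x] \<open>n = fst p\<close> by metis
  ultimately show ?thesis
   unfolding c_def p_def[symmetric] by (simp add: case_prod_beta coeff_op_cell[OF x])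
 qed
 show thesis
 proof (rule that[of c])
  fix x :: "'a => nat" assume x: "x \<in> grid L"
  show "haar_synth L c x = f x"
  proof (rule mean_zero_eqI[OF mean_zero_synth assms x])
   fix k y :: "'a => nat" assume "k \<in> scales L" "y \<in> grid L"
   then show "coeff_op L k (haar_synth L c) y = coeff_op L k f y"
    using weight_pos[of k] by (simp add: coeff_op_synth c haar_unit_0)
  qed
 qed (rule c)
qed

section \<open>Square integrable functions on the torus\<close>

text \<open>Step functions on the cubes of resolution \<open>2\<^sup>-\<^sup>L\<close>.\<close>

definition step_at :: "nat => (real ^ 'n::finite => complex) => bool" where
 "step_at L u \<longleftrightarrow> (\<exists>U. \<forall>x\<in>grid L. \<forall>z\<in>cube L x. u z = U x)"

lemma step_at_haar: "R \<in> rects_below L ==> step_at L (haar_rect e R)"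
 unfolding step_at_def by (elim rects_belowE) (auto simp: haar_rect_step)

lemma step_at_cmult: "step_at L u ==> step_at L (%z. c * u z)"
proof -
 assume "step_at L u"
 then obtain U where "\<forall>x\<in>grid L. \<forall>z\<in>cube L x. u z = U x" by (auto simp: step_at_def)
 then show ?thesis unfolding step_at_def by (intro exI[of _ "%x. c * U x"]) simp
qed

lemma step_at_diff: "step_at L u ==> step_at L v ==> step_at L (%z. u z - v z)"
proof -
 assume "step_at L u" "step_at L v"
 then obtain U V where "\<forall>x\<in>grid L. \<forall>z\<in>cube L x. u z = U x" "\<forall>x\<in>grid L. \<forall>z\<in>cube L x. v z = V x"
  by (auto simp: step_at_def)
 then show ?thesis unfolding step_at_def by (intro exI[of _ "%x. U x - V x"]) simp
qed

lemma step_at_sum: "(!!i. i \<in> I ==> step_at L (u i)) ==> step_at L (%z. \<Sum>i\<in>I. u i z)"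
proof -
 assume "!!i. i \<in> I ==> step_at L (u i)"
 then have "\<forall>i\<in>I. \<exists>U. \<forall>x\<in>grid L. \<forall>z\<in>cube L x. u i z = U x" by (auto simp: step_at_def)
 then obtain U where "\<forall>i\<in>I. \<forall>x\<in>grid L. \<forall>z\<in>cube L x. u i z = U i x" by metis
 then show ?thesis unfolding step_at_def by (intro exI[of _ "%x. \<Sum>i\<in>I. U i x"]) simp
qed

lemma step_at_integrable: "step_at L u ==> integrable torus u"
 unfolding step_at_def by (elim exE) (rule step_integral(1), blast)

lemma step_at_measurable: "step_at L u ==> u \<in> borel_measurable torus"
 using step_at_integrable by (rule borel_measurable_integrable)

lemma step_at_bounded:
 assumes "step_at L u"
 obtains M where "0 <= M" "!!z. z \<in> torus_set ==> cmod (u z) <= M"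
proof -
 obtain U where U: "\<forall>x\<in>grid L. \<forall>z\<in>cube L x. u z = U x" using assms by (auto simp: step_at_def)
 define M where "M = (\<Sum>x\<in>grid L. cmod (U x))"
 have "cmod (u z) <= M" if "z \<in> torus_set" for z
 proof -
  obtain x where x: "x \<in> grid L" "z \<in> cube L x" using \<open>z \<in> torus_set\<close> unfolding torus_set_cubes[of L] by (rule UN_E)
  then have "cmod (u z) = cmod (U x)" using U by simp
  also have "... <= M" unfolding M_def using x by (intro member_le_sum) auto
  finally show ?thesis .
 qed
 moreover have "0 <= M" by (simp add: M_def sum_nonneg)
 ultimately show thesis using that by blast
qed

lemma step_at_L2: "step_at L u ==> u \<in> L2"
proof -
 assume u: "step_at L u"
 then obtain U where "\<forall>x\<in>grid L. \<forall>z\<in>cube L x. u z = U x" by (auto simp: step_at_def)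
 then have "integrable torus (%z. (cmod (u z))^2)"
  by (intro step_integral(1)[where L = L and U = "%x. (cmod (U x))^2"]) simp
 then show ?thesis using step_at_measurable[OF u] by (simp add: L2_def)
qed

lemma integral_torus_const: "(LINT z|(torus :: (real ^ 'n::finite) measure). (c::real)) = c"
 using measure_torus[of "torus_set :: (real ^ 'n) set"] by (simp add: measure_torus_set)

lemma integrable_torus_const: "integrable torus (%z. c :: 'b::{banach, second_countable_topology})"
 by (rule finite_measure.integrable_const[OF finite_measure_torus])

lemma L2_integrable_norm:
 assumes "f \<in> L2"
 shows "integrable torus (%z. cmod (f z))" "(LINT z|torus. cmod (f z)) <= L2_norm_torus f"
proof -
 have f: "f \<in> borel_measurable torus" "integrable torus (%z. (cmod (f z))^2)" using assms by (auto simp: L2_def)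
 show i1: "integrable torus (%z. cmod (f z))"
 proof (rule Bochner_Integration.integrable_bound)
  show "integrable torus (%z. 1 + (cmod (f z))^2)"
   by (rule Bochner_Integration.integrable_add[OF integrable_torus_const f(2)])
  show "(%z. cmod (f z)) \<in> borel_measurable torus" using f(1) by measurable
  have "t <= 1 + t\<^sup>2" if "0 <= t" for t :: real
   using sum_squares_bound[of t 1] that by (simp add: power2_eq_square)
  then show "AE z in torus. norm (cmod (f z)) <= norm (1 + (cmod (f z))^2)" by simp
 qed
 define c where "c = (LINT z|torus. cmod (f z))"
 have "0 <= (LINT z|torus. (cmod (f z) - c)^2)" by simp
 also have "(LINT z|torus. (cmod (f z) - c)^2) = (LINT z|torus. (cmod (f z))^2 - 2 * c * cmod (f z) + c\<^sup>2)"
  by (simp add: power2_diff mult_ac algebra_simps)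
 also have "... = (LINT z|torus. (cmod (f z))^2) - 2 * c * c + c\<^sup>2"
  using i1 f(2) integrable_torus_const[of "c\<^sup>2"] integral_torus_const[of "c\<^sup>2"]
  by (subst Bochner_Integration.integral_add) (auto simp: c_def)
 finally have "c\<^sup>2 <= (LINT z|torus. (cmod (f z))^2)" by (simp add: power2_eq_square)
 then show "(LINT z|torus. cmod (f z)) <= L2_norm_torus f"
  unfolding L2_norm_torus_def c_def[symmetric] by (rule real_le_rsqrt)
qed

lemma inner_torus_bounded:
 assumes f: "f \<in> L2" and k: "k \<in> borel_measurable torus" and M: "0 <= M" "!!z. z \<in> torus_set ==> cmod (k z) <= M"
 shows "integrable torus (%z. f z * cnj (k z))" "cmod (inner_torus f k) <= M * L2_norm_torus f"
proof -
 have fm: "f \<in> borel_measurable torus" using f by (auto simp: L2_def)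
 have cm: "(%z. cnj (k z)) \<in> borel_measurable torus"
  by (rule measurable_compose[OF k borel_measurable_continuous_onI]) (intro continuous_intros)
 have le: "norm (f z * cnj (k z)) <= M * cmod (f z)" if "z \<in> torus_set" for z
  using mult_left_mono[OF M(2)[OF that], of "cmod (f z)"] by (simp add: norm_mult mult.commute)
 have iM: "integrable torus (%z. M * cmod (f z))" using L2_integrable_norm(1)[OF f] by simp
 show i: "integrable torus (%z. f z * cnj (k z))"
 proof (rule Bochner_Integration.integrable_bound[OF iM])
  show "(%z. f z * cnj (k z)) \<in> borel_measurable torus" using fm cm by measurable
  show "AE z in torus. norm (f z * cnj (k z)) <= norm (M * cmod (f z))"
   by (rule AE_I2) (use le M(1) in \<open>simp add: abs_mult\<close>)
 qed
 have "cmod (inner_torus f k) <= (LINT z|torus. norm (f z * cnj (k z)))"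
  unfolding inner_torus_def by (rule integral_norm_bound)
 also have "... <= (LINT z|torus. M * cmod (f z))"
  by (rule integral_mono[OF integrable_norm[OF i] iM]) (use le in simp)
 also have "... = M * (LINT z|torus. cmod (f z))" by simp
 also have "... <= M * L2_norm_torus f" by (rule mult_left_mono[OF L2_integrable_norm(2)[OF f] M(1)])
 finally show "cmod (inner_torus f k) <= M * L2_norm_torus f" .
qed

lemma L2_step_integrable:
 assumes "f \<in> L2" "step_at L k"
 shows "integrable torus (%z. f z * cnj (k z))"
 using step_at_bounded[OF assms(2)] inner_torus_bounded(1)[OF assms(1) step_at_measurable[OF assms(2)]] by metis

lemma norm_sq_add_le: "(cmod (a + b))^2 <= 2 * (cmod a)^2 + 2 * (cmod b)^2"
proof -
 have "(cmod (a + b))^2 <= (cmod a + cmod b)^2" by (intro power_mono norm_triangle_ineq) simp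
 also have "... <= 2 * (cmod a)^2 + 2 * (cmod b)^2"
  using sum_squares_bound[of "cmod a" "cmod b"] by (simp add: power2_sum)
 finally show ?thesis .
qed

lemma L2_add: "f \<in> L2 ==> g \<in> L2 ==> (%z. f z + g z) \<in> L2"
proof -
 assume "f \<in> L2" "g \<in> L2"
 then have f: "f \<in> borel_measurable torus" "integrable torus (%z. (cmod (f z))^2)"
  and g: "g \<in> borel_measurable torus" "integrable torus (%z. (cmod (g z))^2)" by (auto simp: L2_def)
 have "integrable torus (%z. (cmod (f z + g z))^2)"
 proof (rule Bochner_Integration.integrable_bound)
  show "integrable torus (%z. 2 * (cmod (f z))^2 + 2 * (cmod (g z))^2)" using f g by simp
  show "(%z. (cmod (f z + g z))^2) \<in> borel_measurable torus" using f g by measurable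
  show "AE z in torus. norm ((cmod (f z + g z))^2) <= norm (2 * (cmod (f z))^2 + 2 * (cmod (g z))^2)"
   by (rule AE_I2) (use norm_sq_add_le in simp)
 qed
 then show ?thesis using f(1) g(1) by (simp add: L2_def)
qed

lemma L2_cmult: "f \<in> L2 ==> (%z. c * f z) \<in> L2"
 by (auto simp: L2_def norm_mult power_mult_distrib)

lemma L2_diff: "f \<in> L2 ==> g \<in> L2 ==> (%z. f z - g z) \<in> L2"
 using L2_add[of f "%z. (- 1) * g z"] L2_cmult[of g "- 1"] by simp

lemma inner_torus_diff_left:
 "f \<in> L2 ==> g \<in> L2 ==> step_at L k ==> inner_torus (%z. f z - g z) k = inner_torus f k - inner_torus g k"
 unfolding inner_torus_def left_diff_distrib
 by (rule Bochner_Integration.integral_diff) (rule L2_step_integrable, assumption+)+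

lemma inner_torus_sum_left:
 assumes "!!i. i \<in> I ==> f i \<in> L2" "step_at L k"
 shows "inner_torus (%z. \<Sum>i\<in>I. c i * f i z) k = (\<Sum>i\<in>I. c i * inner_torus (f i) k)"
proof -
 have "inner_torus (%z. \<Sum>i\<in>I. c i * f i z) k = (LINT z|torus. (\<Sum>i\<in>I. c i * (f i z * cnj (k z))))"
  unfolding inner_torus_def sum_distrib_right by (simp only: mult.assoc)
 also have "... = (\<Sum>i\<in>I. LINT z|torus. c i * (f i z * cnj (k z)))"
  by (rule Bochner_Integration.integral_sum) (simp add: L2_step_integrable[OF assms(1) assms(2)])
 also have "... = (\<Sum>i\<in>I. c i * inner_torus (f i) k)" by (simp add: inner_torus_def)
 finally show ?thesis .
qed

lemma inner_torus_sum_right: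
 assumes "f \<in> L2" "!!i. i \<in> I ==> step_at L (k i)"
 shows "inner_torus f (%z. \<Sum>i\<in>I. c i * k i z) = (\<Sum>i\<in>I. cnj (c i) * inner_torus f (k i))"
proof -
 have "inner_torus f (%z. \<Sum>i\<in>I. c i * k i z) = (LINT z|torus. (\<Sum>i\<in>I. cnj (c i) * (f z * cnj (k i z))))"
  unfolding inner_torus_def by (simp add: sum_distrib_left mult_ac)
 also have "... = (\<Sum>i\<in>I. LINT z|torus. cnj (c i) * (f z * cnj (k i z)))"
  by (rule Bochner_Integration.integral_sum) (simp add: L2_step_integrable[OF assms(1) assms(2)])
 also have "... = (\<Sum>i\<in>I. cnj (c i) * inner_torus f (k i))" by (simp add: inner_torus_def)
 finally show ?thesis .
qed

lemma haar_rect_L2: "R \<in> dyadic_rects ==> haar_rect e R \<in> L2"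
 using dyadic_rect_below step_at_haar step_at_L2 by metis

lemma L2_0_L2: "f \<in> L2_0 ==> f \<in> L2"
 by (simp add: L2_0_def)

text \<open>\<open>L2_0\<close> is defined through approximation by finite Haar sums, so a bounded functional vanishing on the Haar
  functions vanishes on it.\<close>

lemma L2_0_orthogonal:
 assumes f: "f \<in> L2_0" and k: "step_at L k" and orth: "!!Q. Q \<in> dyadic_rects ==> inner_torus (haar_rect (%_. 0) Q) k = 0"
 shows "inner_torus f k = 0"
proof -
 obtain M where M: "0 <= M" "!!z. z \<in> torus_set ==> cmod (k z) <= M" using step_at_bounded[OF k] by metis
 have "cmod (inner_torus f k) <= e" if "e > 0" for e
 proof -
  have "e / (M + 1) > 0" using M(1) that by simp
  then obtain F c where F: "finite F" "F \<subseteq> dyadic_rects"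
   "L2_norm_torus (%x. f x - (\<Sum>R\<in>F. c R * haar_rect (%_. 0) R x)) < e / (M + 1)"
   using f unfolding L2_0_def by blast
  define s where "s = (%x. \<Sum>R\<in>F. c R * haar_rect (%_. 0) R x)"
  obtain L' where L': "F \<subseteq> rects_below L'" using finite_dyadic_below[OF F(1,2)] by metis
  have "step_at L' s" unfolding s_def by (intro step_at_sum step_at_cmult step_at_haar) (use L' in blast)
  then have s2: "s \<in> L2" by (rule step_at_L2)
  have "inner_torus s k = (\<Sum>R\<in>F. c R * inner_torus (haar_rect (%_. 0) R) k)"
   unfolding s_def by (rule inner_torus_sum_left[OF _ k]) (use F(2) haar_rect_L2 in blast)
  also have "... = 0" by (rule sum.neutral) (use F(2) orth in auto)
  finally have "inner_torus f k = inner_torus (%x. f x - s x) k"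
   using inner_torus_diff_left[OF L2_0_L2[OF f] s2 k] by simp
  then have "cmod (inner_torus f k) <= M * L2_norm_torus (%x. f x - s x)"
   using inner_torus_bounded(2)[OF L2_diff[OF L2_0_L2[OF f] s2] step_at_measurable[OF k] M] by simp
  also have "... <= M * (e / (M + 1))" using F(3) M(1) unfolding s_def by (intro mult_left_mono) auto
  also have "... <= e" using M(1) that by (simp add: field_simps)
  finally show ?thesis .
 qed
 then have "cmod (inner_torus f k) <= 0" by (rule field_le_epsilon) simp
 then show ?thesis by simp
qed

text \<open>For \<open>f\<close> in \<open>L2_0\<close> the pairings with the non-cancellative functions are finite sums of Haar coefficients: the
  difference of \<open>haar_rect e R\<close> and its projection to the Haar functions is orthogonal to all of \<open>L2_0\<close>.\<close>

lemma inner_haar_expansion: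
 assumes f: "f \<in> L2_0" and R: "R \<in> rects_below L"
 shows "inner_torus f (haar_rect e R) = (\<Sum>Q\<in>rects_below L. haar_coeff f Q * of_real (haar_pair e Q R))"
proof -
 define s where "s = (%z. \<Sum>Q\<in>rects_below L. complex_of_real (haar_pair e Q R) * haar_rect (%_. 0) Q z)"
 define k where "k = (%z. haar_rect e R z - s z)"
 have Rd: "R \<in> dyadic_rects" using R rects_below_dyadic by blast
 have hs: "step_at L (haar_rect e R)" using R by (rule step_at_haar)
 have ss: "step_at L s" unfolding s_def by (intro step_at_sum step_at_cmult step_at_haar)
 have ks: "step_at L k" unfolding k_def by (rule step_at_diff[OF hs ss])
 have inner_k: "inner_torus g k = inner_torus g (haar_rect e R) -
   (\<Sum>Q\<in>rects_below L. of_real (haar_pair e Q R) * inner_torus g (haar_rect (%_. 0) Q))" if g: "g \<in> L2" for g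
 proof -
  have "inner_torus g k = (LINT z|torus. g z * cnj (haar_rect e R z) - g z * cnj (s z))"
   unfolding inner_torus_def k_def by (simp add: right_diff_distrib)
  also have "... = inner_torus g (haar_rect e R) - inner_torus g s"
   unfolding inner_torus_def using L2_step_integrable[OF g hs] L2_step_integrable[OF g ss]
   by (rule Bochner_Integration.integral_diff)
  also have "inner_torus g s = (\<Sum>Q\<in>rects_below L. cnj (of_real (haar_pair e Q R)) * inner_torus g (haar_rect (%_. 0) Q))"
   unfolding s_def by (rule inner_torus_sum_right[OF g step_at_haar])
  finally show ?thesis by simp
 qed
 have "inner_torus f k = 0"
 proof (rule L2_0_orthogonal[OF f ks])
  fix Q :: "'a => real set" assume Q: "Q \<in> dyadic_rects"
  have "(\<Sum>Q'\<in>rects_below L. complex_of_real (haar_pair e Q' R) * inner_torus (haar_rect (%_. 0) Q) (haar_rect (%_. 0) Q'))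
   = (\<Sum>Q'\<in>rects_below L. if Q' = Q then of_real (haar_pair e Q R) else 0)"
  proof (rule sum.cong[OF refl])
   fix Q' :: "'a => real set" assume "Q' \<in> rects_below L"
   then have Q': "Q' \<in> dyadic_rects" using rects_below_dyadic by blast
   show "complex_of_real (haar_pair e Q' R) * inner_torus (haar_rect (%_. 0) Q) (haar_rect (%_. 0) Q')
    = (if Q' = Q then of_real (haar_pair e Q R) else 0)"
    using inner_haar_pair[OF Q Q', of "%_. 0"] haar_orthonormal[OF Q Q'] by auto
  qed
  also have "... = of_real (haar_pair e Q R)"
   using haar_pair_scale[OF Q R, of e] by auto
  finally show "inner_torus (haar_rect (%_. 0) Q) k = 0"
   unfolding inner_k[OF haar_rect_L2[OF Q]] inner_haar_pair[OF Q Rd] by simp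
 qed
 then show ?thesis unfolding inner_k[OF L2_0_L2[OF f]] haar_coeff_def by (simp add: mult.commute)
qed

lemma haar_sum_L2_0:
 fixes c :: "('n::finite => real set) => complex"
 assumes "finite F" "F \<subseteq> dyadic_rects"
 shows "(%z. \<Sum>R\<in>F. c R * haar_rect (%_. 0) R z) \<in> L2_0"
proof -
 obtain L where L: "F \<subseteq> rects_below L" using finite_dyadic_below[OF assms] by metis
 have "step_at L (%z. \<Sum>R\<in>F. c R * haar_rect (%_. 0) R z)"
  by (intro step_at_sum step_at_cmult step_at_haar) (use L in blast)
 then have l2: "(%z. \<Sum>R\<in>F. c R * haar_rect (%_. 0) R z) \<in> L2" by (rule step_at_L2)
 have z: "L2_norm_torus (%x :: real ^ 'n. 0) = 0" by (simp add: L2_norm_torus_def)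
 show ?thesis unfolding L2_0_def
 proof (intro CollectI conjI l2 allI impI)
  fix e :: real assume "0 < e"
  then show "\<exists>Fa ca. finite Fa \<and> Fa \<subseteq> dyadic_rects \<and> L2_norm_torus (%x. (\<Sum>R\<in>F. c R * haar_rect (%_. 0) R x) -
    (\<Sum>R\<in>Fa. ca R * haar_rect (%_. 0) R x)) < e"
   using assms z by (intro exI[of _ F] exI[of _ c]) simp
 qed
qed

lemma haar_coeff_sum:
 assumes "finite F" "F \<subseteq> dyadic_rects" "Q \<in> dyadic_rects"
 shows "haar_coeff (%z. \<Sum>R\<in>F. c R * haar_rect (%_. 0) R z) Q = (if Q \<in> F then c Q else 0)"
proof -
 obtain L where "Q \<in> rects_below L" using dyadic_rect_below[OF assms(3)] by metis
 then have "step_at L (haar_rect (%_. 0) Q)" by (rule step_at_haar)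
 then have "haar_coeff (%z. \<Sum>R\<in>F. c R * haar_rect (%_. 0) R z) Q =
  (\<Sum>R\<in>F. c R * inner_torus (haar_rect (%_. 0) R) (haar_rect (%_. 0) Q))"
  unfolding haar_coeff_def by (intro inner_torus_sum_left haar_rect_L2) (use assms(2) in blast)
 also have "... = (\<Sum>R\<in>F. if R = Q then c Q else 0)"
 proof (rule sum.cong[OF refl])
  fix R assume "R \<in> F"
  then have "R \<in> dyadic_rects" using assms(2) by blast
  then show "c R * inner_torus (haar_rect (%_. 0) R) (haar_rect (%_. 0) Q) = (if R = Q then c Q else 0)"
   using inner_haar_pair[OF _ assms(3), of R "%_. 0"] haar_orthonormal[OF _ assms(3), of R] by auto
 qed
 also have "... = (if Q \<in> F then c Q else 0)" using assms(1) by simp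
 finally show ?thesis .
qed

lemma integral_haar_sum_sq:
 assumes "finite F" "F \<subseteq> dyadic_rects"
 shows "(LINT z|torus. (cmod (\<Sum>R\<in>F. c R * haar_rect (%_. 0) R z))^2) = (\<Sum>R\<in>F. (cmod (c R))^2)"
proof -
 define s where "s = (%z. \<Sum>R\<in>F. c R * haar_rect (%_. 0) R z)"
 obtain L where L: "F \<subseteq> rects_below L" using finite_dyadic_below[OF assms] by metis
 have ss: "step_at L s" unfolding s_def by (intro step_at_sum step_at_cmult step_at_haar) (use L in blast)
 have "complex_of_real (LINT z|torus. (cmod (s z))^2) = (LINT z|torus. complex_of_real ((cmod (s z))^2))"
  by (rule integral_complex_of_real[symmetric])
 also have "... = inner_torus s s"
  unfolding inner_torus_def by (rule Bochner_Integration.integral_cong) (simp_all add: complex_norm_square del: of_real_power)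
 also have "... = (\<Sum>R\<in>F. cnj (c R) * inner_torus s (haar_rect (%_. 0) R))"
  by (subst (2) s_def) (rule inner_torus_sum_right[OF step_at_L2[OF ss] step_at_haar], use L in blast)
 also have "... = (\<Sum>R\<in>F. cnj (c R) * c R)"
 proof (rule sum.cong[OF refl])
  fix R assume R: "R \<in> F"
  then have "haar_coeff s R = c R" unfolding s_def using haar_coeff_sum[OF assms, of R c] assms(2) by auto
  then show "cnj (c R) * inner_torus s (haar_rect (%_. 0) R) = cnj (c R) * c R" by (simp add: haar_coeff_def)
 qed
 also have "... = complex_of_real (\<Sum>R\<in>F. (cmod (c R))^2)"
  unfolding of_real_sum by (rule sum.cong[OF refl]) (simp add: complex_norm_square mult.commute del: of_real_power)
 finally show ?thesis unfolding s_def by (simp only: of_real_eq_iff)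
qed

text \<open>The Riesz--Fischer theorem for the Haar system. Along resolutions \<open>l k\<close> whose tails decay like \<open>4\<^sup>-\<^sup>k\<close>, the increments \<open>d k\<close> of the partial sums satisfy
  \<open>\<Sum> 2\<^sup>k \<bar>d k\<bar>\<^sup>2 < \<infinity>\<close> almost everywhere. This gives pointwise convergence, and the same sum \<open>W\<close> dominates the tails in \<open>L\<^sup>2\<close>.\<close>

lemma haar_riesz_fischer:
 fixes \<gamma> :: "('n::finite => real set) => complex"
 assumes bd: "!!F. finite F ==> F \<subseteq> dyadic_rects ==> (\<Sum>R\<in>F. (cmod (\<gamma> R))^2) <= C"
 obtains g where "g \<in> L2_0" "!!Q. Q \<in> dyadic_rects ==> haar_coeff g Q = \<gamma> Q"
proof -
 define a where "a = (%L. \<Sum>R\<in>rects_below L. (cmod (\<gamma> R))^2)"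
 define S where "S = (%L z. \<Sum>R\<in>rects_below L. \<gamma> R * haar_rect (%_. 0) R z)"
 have am: "mono a" unfolding a_def by (intro monoI sum_mono2 rects_below_mono) auto
 have aC: "a L <= C" for L unfolding a_def by (rule bd) (simp_all add: rects_below_dyadic)
 have ab: "bdd_above (range a)" using aC by (intro bdd_aboveI2)
 define A where "A = (SUP L. a L)"
 have aA: "a L <= A" for L unfolding A_def by (rule cSUP_upper[OF UNIV_I ab])
 have "\<exists>L. A - 1 / 4 ^ k < a L" for k :: nat
 proof -
  have "A - 1 / 4 ^ k < A" by simp
  then show ?thesis unfolding A_def using less_cSUP_iff[OF UNIV_not_empty ab] by auto
 qed
 then obtain l0 where l0: "!!k. A - 1 / 4 ^ k < a (l0 k)" by metis
 define l where "l = (%k. \<Sum>i\<le>k. Suc (l0 i))"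
 have l_ge: "l0 k <= l k" for k unfolding l_def by (cases k) auto
 have l_mono: "l k <= l m" if "k <= m" for k m unfolding l_def using that by (intro sum_mono2) auto
 have l_k: "k <= l k" for k unfolding l_def by (induction k) auto
 have tail: "a M - a (l k) <= 1 / 4 ^ k" if "l k <= M" for k M
  using l0[of k] aA[of M] monoD[OF am l_ge[of k]] by linarith
 have S_diff: "(LINT z|torus. (cmod (S M z - S L z))^2) = a M - a L" if "L <= M" for L M
 proof -
  have sub: "rects_below L \<subseteq> (rects_below M :: ('n => real set) set)" by (rule rects_below_mono[OF that])
  have "S M z - S L z = (\<Sum>R\<in>rects_below M - rects_below L. \<gamma> R * haar_rect (%_. 0) R z)" for z
   unfolding S_def using sum.subset_diff[OF sub, of "%R. \<gamma> R * haar_rect (%_. 0) R z"] by simp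
  then have "(LINT z|torus. (cmod (S M z - S L z))^2) = (\<Sum>R\<in>rects_below M - rects_below L. (cmod (\<gamma> R))^2)"
   using integral_haar_sum_sq[of "rects_below M - rects_below L" \<gamma>] rects_below_dyadic[of M] by auto
  also have "... = a M - a L" unfolding a_def using sum.subset_diff[OF sub, of "%R. (cmod (\<gamma> R))^2"] by simp
  finally show ?thesis .
 qed
 have Sstep: "step_at L (S L)" for L unfolding S_def by (intro step_at_sum step_at_cmult step_at_haar)
 have S2: "S L \<in> L2" for L by (rule step_at_L2[OF Sstep])
 have Smeas [measurable]: "S L \<in> borel_measurable torus" for L by (rule step_at_measurable[OF Sstep])
 define d where "d = (%k z. S (l (Suc k)) z - S (l k) z)"
 define w where "w = (%k z. 2 ^ k * (cmod (d k z))^2)"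
 have w0: "0 <= w k z" for k z by (simp add: w_def)
 have dint: "integrable torus (%z. (cmod (d k z))^2)" for k
  using L2_diff[OF S2 S2, of "l (Suc k)" "l k"] by (simp add: L2_def d_def)
 have wint: "integrable torus (w k)" for k unfolding w_def using dint by simp
 have wle: "(LINT z|torus. w k z) <= (1 / 2) ^ k" for k
 proof -
  have "(LINT z|torus. w k z) = 2 ^ k * (a (l (Suc k)) - a (l k))"
   unfolding w_def d_def using S_diff[OF l_mono[of k "Suc k"]] by simp
  also have "... <= 2 ^ k * (1 / 4 ^ k)" by (intro mult_left_mono tail l_mono) auto
  also have "... = (1 / 2) ^ k"
  proof -
   have "(4::real) ^ k = 2 ^ k * 2 ^ k" by (simp flip: power_mult_distrib)
   then show ?thesis by (simp add: power_divide)
  qed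
  finally show ?thesis .
 qed
 have summ_int: "summable (%k. LINT z|torus. norm (w k z))"
 proof (rule summable_comparison_test')
  show "summable (%k. (1 / 2 :: real) ^ k)" by simp
  show "norm (LINT z|torus. norm (w k z)) <= (1 / 2) ^ k" if "0 <= k" for k
   using wle[of k] w0 by (simp add: abs_of_nonneg)
 qed
 have AE_summ: "AE z in torus. summable (%k. w k z)"
 proof -
  have meas: "(%z. ennreal (w k z)) \<in> borel_measurable torus" for k using wint[of k] by measurable
  have "(\<integral>\<^sup>+ z. (\<Sum>k. ennreal (w k z)) \<partial>torus) = (\<Sum>k. \<integral>\<^sup>+ z. ennreal (w k z) \<partial>torus)"
   by (rule nn_integral_suminf) (rule meas)
  also have "... = (\<Sum>k. ennreal (LINT z|torus. w k z))"
   by (intro suminf_cong nn_integral_eq_integral wint AE_I2 w0)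
  also have "... ~= \<infinity>"
   using summ_int w0 by (intro ennreal_suminf_neq_top[unfolded infinity_ennreal_def[symmetric]]) (auto simp: abs_of_nonneg)
  finally have "(\<integral>\<^sup>+ z. (\<Sum>k. ennreal (w k z)) \<partial>torus) ~= \<infinity>" .
  then have "AE z in torus. (\<Sum>k. ennreal (w k z)) ~= \<infinity>"
   by (intro nn_integral_PInf_AE borel_measurable_suminf_order meas)
  then show ?thesis by eventually_elim (use w0 in \<open>auto intro!: summable_suminf_not_top\<close>)
 qed
 define W where "W = (%z. \<Sum>k. w k z)"
 have Wint: "integrable torus W"
  unfolding W_def by (rule integrable_suminf[OF wint _ summ_int]) (use AE_summ w0 in \<open>simp add: abs_of_nonneg\<close>)
 (* On the null set of divergence lim has an arbitrary but measurable value. *)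
 define g where "g = (%z. lim (%m. S (l m) z))"
 have gmeas [measurable]: "g \<in> borel_measurable torus" unfolding g_def by measurable
 have key: "(cmod (g z - S (l n) z))^2 <= 4 * (1 / 2) ^ n * W z" if sm: "summable (%k. w k z)" for z n
 proof -
  have geo: "(\<Sum>k\<in>{n..<m}. (1 / 2 :: real) ^ k) <= 2 * (1 / 2) ^ n" for n m
  proof (cases "n <= m")
   case True
   then obtain j where "m = n + j" using le_Suc_ex by blast
   moreover have "(\<Sum>k\<in>{n..<n + j}. (1 / 2 :: real) ^ k) = 2 * (1 / 2) ^ n - 2 * (1 / 2) ^ (n + j)"
    by (induction j) simp_all
   ultimately have "(\<Sum>k\<in>{n..<m}. (1 / 2 :: real) ^ k) = 2 * (1 / 2) ^ n - 2 * (1 / 2) ^ m" by simp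
   then show ?thesis by simp
  qed simp
  have abs_sum: "(\<Sum>k\<in>{n..<m}. cmod (d k z))^2 <= 2 * (1 / 2) ^ n * W z" for n m
  proof -
   have "(\<Sum>k\<in>{n..<m}. cmod (d k z)) = (\<Sum>k\<in>{n..<m}. sqrt ((1 / 2) ^ k) * sqrt (w k z))"
    by (rule sum.cong[OF refl]) (simp add: w_def power_divide flip: real_sqrt_mult)
   then have "(\<Sum>k\<in>{n..<m}. cmod (d k z))^2 <= (\<Sum>k\<in>{n..<m}. (sqrt ((1 / 2) ^ k))^2) * (\<Sum>k\<in>{n..<m}. (sqrt (w k z))^2)"
    by (simp only: Cauchy_Schwarz_ineq_sum)
   also have "... = (\<Sum>k\<in>{n..<m}. (1 / 2) ^ k) * (\<Sum>k\<in>{n..<m}. w k z)" using w0 by simp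
   also have "... <= (2 * (1 / 2) ^ n) * W z"
    unfolding W_def by (intro mult_mono geo sum_le_suminf sm sum_nonneg w0) auto
   finally show ?thesis .
  qed
  have W0: "0 <= W z" unfolding W_def by (rule suminf_nonneg[OF sm w0])
  have "summable (%k. cmod (d k z))"
  proof (rule bounded_imp_summable)
   fix m
   have "(\<Sum>k\<in>{0..<Suc m}. cmod (d k z)) <= sqrt (2 * W z)" using abs_sum[of 0 "Suc m"] by (intro real_le_rsqrt) simp
   then show "(\<Sum>k\<le>m. cmod (d k z)) <= sqrt (2 * W z)" by (simp add: atLeast0LessThan lessThan_Suc_atMost)
  qed simp
  then have "summable (%k. d k z)" by (rule summable_norm_cancel)
  then have "convergent (%m. \<Sum>k<m. d k z)" by (simp add: summable_iff_convergent)
  then have conv: "convergent (%m. S (l 0) z + (\<Sum>k<m. d k z))" by (intro convergent_add convergent_const)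
  have Sd: "S (l m) z = S (l 0) z + (\<Sum>k<m. d k z)" for m
  proof (induction m)
   case (Suc m)
   have "S (l (Suc m)) z = S (l m) z + d m z" unfolding d_def by simp
   then show ?case unfolding Suc.IH by (simp only: sum.lessThan_Suc add.assoc)
  qed simp
  have Sf: "(%m. S (l m) z) = (%m. S (l 0) z + (\<Sum>k<m. d k z))" by (rule ext) (rule Sd)
  have "convergent (%m. S (l m) z)" by (subst Sf) (rule conv)
  then have lim: "(%m. S (l m) z) \<longlonglongrightarrow> g z" unfolding g_def by (rule convergent_LIMSEQ_iff[THEN iffD1])
  have "(%m. (cmod (S (l m) z - S (l n) z))^2) \<longlonglongrightarrow> (cmod (g z - S (l n) z))\<^sup>2"
   by (intro tendsto_intros lim)
  moreover have "(cmod (S (l m) z - S (l n) z))^2 <= 4 * (1 / 2) ^ n * W z" if "n <= m" for m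
  proof -
   have "S (l m) z - S (l n) z = (\<Sum>k\<in>{n..<m}. d k z)"
    using that
   proof (induction m rule: dec_induct)
    case (step m)
    have "S (l (Suc m)) z = S (l m) z + d m z" unfolding d_def by simp
    then have "S (l (Suc m)) z - S (l n) z = (S (l m) z - S (l n) z) + d m z" by (simp only: add_diff_eq diff_add_eq)
    then show ?case unfolding step.IH using step.hyps by (simp only: sum.atLeastLessThan_Suc)
   qed simp
   then have "cmod (S (l m) z - S (l n) z) <= (\<Sum>k\<in>{n..<m}. cmod (d k z))" by (simp add: norm_sum)
   then have "(cmod (S (l m) z - S (l n) z))^2 <= (\<Sum>k\<in>{n..<m}. cmod (d k z))^2" by (intro power_mono) auto
   also have "... <= 2 * (1 / 2) ^ n * W z" by (rule abs_sum)
   also have "... <= 4 * (1 / 2) ^ n * W z" using W0 by (intro mult_right_mono) auto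
   finally show ?thesis .
  qed
  ultimately show ?thesis by (intro tendsto_upperbound[OF _ _ sequentially_bot]) (auto intro: eventually_sequentiallyI)
 qed
 define B where "B = (LINT z|torus. W z)"
 have gs_int: "integrable torus (%z. (cmod (g z - S (l n) z))^2)" for n
 proof (rule Bochner_Integration.integrable_bound)
  show "integrable torus (%z. 4 * (1 / 2) ^ n * W z)" using Wint by simp
  show "(%z. (cmod (g z - S (l n) z))^2) \<in> borel_measurable torus" by measurable
  show "AE z in torus. norm ((cmod (g z - S (l n) z))^2) <= norm (4 * (1 / 2) ^ n * W z)"
   using AE_summ by eventually_elim (use key in \<open>force intro: order_trans[OF _ abs_ge_self]\<close>)
 qed
 have gs_norm: "L2_norm_torus (%z. g z - S (l n) z) <= sqrt (4 * (1 / 2) ^ n * B)" for n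
 proof -
  have "(LINT z|torus. (cmod (g z - S (l n) z))^2) <= (LINT z|torus. 4 * (1 / 2) ^ n * W z)"
  proof (rule integral_mono_AE[OF gs_int])
   show "integrable torus (%z. 4 * (1 / 2) ^ n * W z)" using Wint by simp
   show "AE z in torus. (cmod (g z - S (l n) z))^2 <= 4 * (1 / 2) ^ n * W z"
    using AE_summ by eventually_elim (rule key)
  qed
  then show ?thesis unfolding L2_norm_torus_def B_def by (intro real_sqrt_le_mono) simp
 qed
 have gs2: "(%z. g z - S (l n) z) \<in> L2" for n using gs_int[of n] by (simp add: L2_def)
 have g2: "g \<in> L2" using L2_add[OF gs2[of 0] S2[of "l 0"]] by simp
 have lim0: "(%n. sqrt (4 * (1 / 2) ^ n * B)) \<longlonglongrightarrow> 0"
 proof -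
  have "(%n. (1 / 2 :: real) ^ n) \<longlonglongrightarrow> 0" by (rule LIMSEQ_realpow_zero) auto
  then have "(%n. sqrt (4 * (1 / 2) ^ n * B)) \<longlonglongrightarrow> sqrt (4 * 0 * B)"
   by (intro tendsto_real_sqrt tendsto_mult tendsto_const)
  then show ?thesis by simp
 qed
 have g0: "g \<in> L2_0"
  unfolding L2_0_def
 proof (intro CollectI conjI g2 allI impI)
  fix e :: real assume "0 < e"
  have "\<forall>\<^sub>F n in sequentially. sqrt (4 * (1 / 2) ^ n * B) < e" by (rule order_tendstoD(2)[OF lim0 \<open>0 < e\<close>])
  then obtain n where "\<forall>m\<ge>n. sqrt (4 * (1 / 2) ^ m * B) < e" unfolding eventually_sequentially by (rule exE)
  then have "sqrt (4 * (1 / 2) ^ n * B) < e" by (rule allE[of _ n]) simp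
  then have "L2_norm_torus (%z. g z - S (l n) z) < e" using gs_norm[of n] by simp
  then show "\<exists>F c. finite F \<and> F \<subseteq> dyadic_rects \<and> L2_norm_torus (%x. g x - (\<Sum>R\<in>F. c R * haar_rect (%_. 0) R x)) < e"
   unfolding S_def by (intro exI[of _ "rects_below (l n)"] exI[of _ \<gamma>]) (simp add: rects_below_dyadic)
 qed
 have "haar_coeff g Q = \<gamma> Q" if Q: "Q \<in> dyadic_rects" for Q
 proof -
  obtain L where L: "Q \<in> rects_below L" using dyadic_rect_below[OF Q] by metis
  have st: "step_at L (haar_rect (%_. 0) Q)" using L by (rule step_at_haar)
  obtain M where M: "0 <= M" "!!z. z \<in> torus_set ==> cmod (haar_rect (%_. 0) Q z) <= M"
   using step_at_bounded[OF st] by metis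
  have "cmod (haar_coeff g Q - \<gamma> Q) <= M * sqrt (4 * (1 / 2) ^ n * B)" if n: "L <= n" for n
  proof -
   have "Q \<in> rects_below (l n)" using L rects_below_mono[of L "l n"] n l_k[of n] by auto
   then have "haar_coeff (S (l n)) Q = \<gamma> Q" unfolding S_def by (subst haar_coeff_sum) (auto simp: rects_below_dyadic Q)
   then have "haar_coeff g Q - \<gamma> Q = inner_torus (%z. g z - S (l n) z) (haar_rect (%_. 0) Q)"
    unfolding haar_coeff_def using inner_torus_diff_left[OF g2 S2 st, of "l n"] by simp
   then have "cmod (haar_coeff g Q - \<gamma> Q) <= M * L2_norm_torus (%z. g z - S (l n) z)"
    using inner_torus_bounded(2)[OF gs2 step_at_measurable[OF st] M] by simp
   also have "... <= M * sqrt (4 * (1 / 2) ^ n * B)" by (rule mult_left_mono[OF gs_norm M(1)])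
   finally show ?thesis .
  qed
  moreover have "(%n. M * sqrt (4 * (1 / 2) ^ n * B)) \<longlonglongrightarrow> M * 0" by (intro tendsto_intros lim0)
  ultimately have "cmod (haar_coeff g Q - \<gamma> Q) <= M * 0"
   by (intro tendsto_lowerbound[OF _ _ sequentially_bot]) (auto intro: eventually_sequentiallyI)
  then show ?thesis by simp
 qed
 with g0 show thesis by (rule that)
qed

section \<open>Carleson averages over open sets and over unions of grid cells\<close>

lemma frac_torus: "x \<in> torus_set ==> (\<chi> j. frac (x $ j)) = x"
 by (simp add: vec_eq_iff torus_set_def frac_eq)

lemma torus_open_lmeasurable:
 assumes "torus_open W"
 shows "W \<in> lmeasurable"
proof -
 define P where "P = {x. (\<chi> j. frac (x $ j)) \<in> W}"
 have op: "open P" and sub: "W \<subseteq> torus_set" using assms by (simp_all add: torus_open_def P_def)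
 have "W = torus_set \<inter> P" using sub by (auto simp: P_def frac_torus subset_iff)
 moreover have "P \<in> sets lebesgue" using op by simp
 ultimately show ?thesis using fmeasurable_Int_fmeasurable[OF torus_set_lmeasurable] by metis
qed

text \<open>A point of \<open>torus_set\<close> may lie on its boundary, but an open set meeting the closure of the open cube meets the
  open cube.\<close>

lemma torus_open_measure_pos:
 fixes W :: "(real ^ 'n::finite) set"
 assumes "torus_open W" "W ~= {}"
 shows "0 < measure lebesgue W"
proof -
 define P where "P = {x. (\<chi> j. frac (x $ j)) \<in> W}"
 define Q where "Q = box (0 :: real ^ 'n) 1"
 have op: "open P" and sub: "W \<subseteq> torus_set" using assms by (simp_all add: torus_open_def P_def)
 have Qt: "Q \<subseteq> torus_set" by (auto simp: Q_def torus_set_def mem_box_cart less_imp_le)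
 have "(\<chi> j. 1 / 2) \<in> Q" by (simp add: Q_def mem_box_cart)
 then have ne: "Q ~= {}" by blast
 have cl: "torus_set \<subseteq> closure Q"
  using closure_box[OF ne[unfolded Q_def]] by (auto simp: Q_def torus_set_def mem_box_cart less_imp_le)
 have "W \<subseteq> P" using sub by (auto simp: P_def frac_torus subset_iff)
 then have "P \<inter> closure Q ~= {}" using assms(2) sub cl by blast
 then have ne2: "P \<inter> Q ~= {}" using open_Int_closure_eq_empty[OF op, of Q] by simp
 have "P \<inter> Q \<subseteq> W" using Qt by (auto simp: P_def frac_torus subset_iff)
 moreover have "\<not> negligible (P \<inter> Q)" by (rule open_not_negligible[OF open_Int[OF op open_box] ne2[unfolded Q_def], folded Q_def])
 ultimately have "\<not> negligible W" using negligible_subset by blast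
 then have "measure lebesgue W ~= 0" using negligible_iff_measure torus_open_lmeasurable[OF assms(1)] by blast
 then show ?thesis using measure_nonneg[of lebesgue W] by linarith
qed

text \<open>Inclusion up to null sets, as in the definition of the Carleson average.\<close>

definition rects_in :: "(real ^ 'n::finite) set => ('n => real set) set" where
 "rects_in W = {R \<in> dyadic_rects. ae_subset (rect R) W}"

lemma ennreal_le_divideI:
 assumes "ennreal l * A <= ennreal C" "0 < l" "0 <= C"
 shows "A <= ennreal (C / l)"
proof -
 have "ennreal (1 / l) * (ennreal l * A) = A"
  using assms(2) by (simp add: mult.assoc[symmetric] ennreal_mult[symmetric])
 moreover have "ennreal (1 / l) * (ennreal l * A) <= ennreal (1 / l) * ennreal C" by (rule mult_left_mono[OF assms(1)]) simp
 moreover have "ennreal (1 / l) * ennreal C = ennreal (C / l)" using assms by (simp add: ennreal_mult[symmetric])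
 ultimately show ?thesis by simp
qed

lemma carleson_avg_le_iff:
 assumes "torus_open W" "W ~= {}" "0 <= C"
 shows "carleson_avg b W <= ennreal C \<longleftrightarrow>
  (\<forall>F. finite F --> F \<subseteq> rects_in W --> (\<Sum>R\<in>F. (cmod (haar_coeff b R))^2) <= C * measure lebesgue W)"
proof -
 define \<mu> where "\<mu> = measure lebesgue W"
 define S where "S = (\<Sum>\<^sub>\<infinity>R\<in>rects_in W. ennreal ((cmod (haar_coeff b R))^2))"
 have \<mu>: "0 < \<mu>" unfolding \<mu>_def by (rule torus_open_measure_pos[OF assms(1,2)])
 have em: "emeasure lebesgue W = ennreal \<mu>"
  unfolding \<mu>_def using torus_open_lmeasurable[OF assms(1)] by (simp add: emeasure_eq_measure2)
 have "carleson_avg b W = S / ennreal \<mu>" by (simp add: carleson_avg_def em S_def rects_in_def)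
 also have "S / ennreal \<mu> <= ennreal C \<longleftrightarrow> S <= ennreal C * ennreal \<mu>"
 proof
  assume "S / ennreal \<mu> <= ennreal C"
  then have "S / ennreal \<mu> * ennreal \<mu> <= ennreal C * ennreal \<mu>" by (rule mult_right_mono) simp
  then show "S <= ennreal C * ennreal \<mu>" using \<mu> by (simp add: ennreal_divide_times ennreal_times_divide[symmetric] ennreal_divide_self mult_divide_eq_ennreal)
 next
  assume "S <= ennreal C * ennreal \<mu>"
  then show "S / ennreal \<mu> <= ennreal C" using \<mu> by (intro divide_le_posI_ennreal) (auto simp: mult.commute)
 qed
 also have "... \<longleftrightarrow> (\<forall>F. finite F --> F \<subseteq> rects_in W --> (\<Sum>R\<in>F. ennreal ((cmod (haar_coeff b R))^2)) <= ennreal (C * \<mu>))"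
  unfolding S_def nonneg_infsum_complete[OF zero_le] SUP_le_iff using \<mu> assms(3) by (auto simp: ennreal_mult)
 also have "... \<longleftrightarrow> (\<forall>F. finite F --> F \<subseteq> rects_in W --> (\<Sum>R\<in>F. (cmod (haar_coeff b R))^2) <= C * \<mu>)"
  using \<mu> assms(3) by (simp add: sum_ennreal ennreal_le_iff)
 finally show ?thesis by (simp add: \<mu>_def)
qed

lemma BMO_L2_0: "b \<in> BMO ==> b \<in> L2_0"
 by (simp add: BMO_def)

lemma bmo_norm_nonneg: "0 <= bmo_norm b"
 by (simp add: bmo_norm_def)

lemma BMO_sum_le:
 assumes "b \<in> BMO" "torus_open W" "W ~= {}" "finite F" "F \<subseteq> rects_in W"
 shows "(\<Sum>R\<in>F. (cmod (haar_coeff b R))^2) <= (bmo_norm b)^2 * measure lebesgue W"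
proof -
 have "bmo_norm_sq b = ennreal ((bmo_norm b)^2)"
  using assms(1) by (simp add: BMO_def bmo_norm_def)
 moreover have "carleson_avg b W <= bmo_norm_sq b" unfolding bmo_norm_sq_def by (rule SUP_upper) (simp add: assms)
 ultimately have "carleson_avg b W <= ennreal ((bmo_norm b)^2)" by simp
 then show ?thesis using carleson_avg_le_iff[OF assms(2,3), of "(bmo_norm b)^2" b] assms(4,5) by simp
qed

lemma BMO_I:
 assumes b: "b \<in> L2_0" and K: "0 <= K"
  and le: "!!W F. torus_open W ==> W ~= {} ==> finite F ==> F \<subseteq> rects_in W ==>
   (\<Sum>R\<in>F. (cmod (haar_coeff b R))^2) <= K\<^sup>2 * measure lebesgue W"
 shows "b \<in> BMO" "bmo_norm b <= K"
proof -
 have *: "bmo_norm_sq b <= ennreal (K\<^sup>2)"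
  unfolding bmo_norm_sq_def by (rule SUP_least) (use le in \<open>simp add: carleson_avg_le_iff\<close>)
 then have "bmo_norm_sq b < \<infinity>" by (simp add: le_less_trans)
 then show "b \<in> BMO" using b by (simp add: BMO_def)
 have "enn2real (bmo_norm_sq b) <= K\<^sup>2" using * by (rule enn2real_leI[rotated]) simp
 then show "bmo_norm b <= K" unfolding bmo_norm_def using K by (simp add: real_le_lsqrt)
qed

text \<open>Open representatives of grid sets, needed because the norms are suprema over open sets.\<close>

definition open_cubes :: "nat => ('n::finite => nat) set => (real ^ 'n) set" where
 "open_cubes L W = (\<Union>x\<in>W. box (\<chi> j. real (x j) / 2 ^ L) (\<chi> j. (real (x j) + 1) / 2 ^ L))"

lemma open_frac_interval:
 assumes "0 <= a" "b <= 1"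
 shows "open {t :: real. a < frac t \<and> frac t < b}"
proof -
 have "{t. a < frac t \<and> frac t < b} = (\<Union>k :: int. {of_int k + a <..< of_int k + b})"
 proof (intro set_eqI iffI)
  fix t assume "t \<in> {t. a < frac t \<and> frac t < b}"
  then have "t \<in> {of_int \<lfloor>t\<rfloor> + a <..< of_int \<lfloor>t\<rfloor> + b}" by (auto simp: frac_def)
  then show "t \<in> (\<Union>k :: int. {of_int k + a <..< of_int k + b})" by blast
 next
  fix t assume "t \<in> (\<Union>k :: int. {of_int k + a <..< of_int k + b})"
  then obtain k :: int where k: "of_int k + a < t" "t < of_int k + b" by auto
  then have "\<lfloor>t\<rfloor> = k" using assms by (intro floor_unique) auto
  then show "t \<in> {t. a < frac t \<and> frac t < b}" using k by (auto simp: frac_def)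
 qed
 then show ?thesis by (simp add: open_UN)
qed

lemma torus_open_cubes:
 assumes "W \<subseteq> grid L"
 shows "torus_open (open_cubes L (W :: ('n::finite => nat) set))"
 unfolding torus_open_def
proof
 have "open_cubes L W \<subseteq> (\<Union>x\<in>grid L. cube L x)" unfolding open_cubes_def using assms cube_box(1) by blast
 then show "open_cubes L W \<subseteq> torus_set" unfolding torus_set_cubes[of L] .
 have "{z :: real ^ 'n. (\<chi> j. frac (z $ j)) \<in> open_cubes L W} =
  (\<Union>x\<in>W. \<Inter>j\<in>UNIV. (%z. z $ j) -` {t. real (x j) / 2 ^ L < frac t \<and> frac t < (real (x j) + 1) / 2 ^ L})"
  by (auto simp: open_cubes_def mem_box_cart)
 moreover have "open ((%z :: real ^ 'n. z $ j) -` {t. real (x j) / 2 ^ L < frac t \<and> frac t < (real (x j) + 1) / 2 ^ L})"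
  if "x \<in> W" for x j
 proof (rule open_vimage[OF open_frac_interval])
  have "x j < 2 ^ L" using that assms gridD by blast
  then have "real (x j) + 1 <= 2 ^ L" by (metis Suc_leI of_nat_Suc of_nat_le_iff of_nat_numeral of_nat_power add.commute)
  then show "(real (x j) + 1) / 2 ^ L <= 1" by simp
  show "continuous_on UNIV (%z :: real ^ 'n. z $ j)" by (intro continuous_intros)
 qed simp
 ultimately show "open {z :: real ^ 'n. (\<chi> j. frac (z $ j)) \<in> open_cubes L W}"
  by (simp add: open_UN open_INT)
qed

lemma cubes_diff_negligible:
 assumes "W \<subseteq> grid L"
 shows "negligible (cubes L W - open_cubes L (W :: ('n::finite => nat) set))"
proof -
 have "negligible (\<Union>x\<in>W. cbox (\<chi> j. real (x j) / 2 ^ L) (\<chi> j. (real (x j) + 1) / 2 ^ L)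
   - box (\<chi> j. real (x j) / 2 ^ L) (\<chi> j. (real (x j) + 1) / 2 ^ L))"
  using finite_subset[OF assms finite_grid] by (intro negligible_Union) (auto intro: negligible_frontier_interval)
 then show ?thesis
  by (rule negligible_subset) (use cube_box(2) in \<open>fastforce simp: cubes_def open_cubes_def\<close>)
qed

lemma open_cubes_subset: "open_cubes L W \<subseteq> cubes L W"
 unfolding open_cubes_def cubes_def using cube_box(1) by blast

lemma measure_open_cubes:
 assumes "W \<subseteq> grid L"
 shows "measure lebesgue (open_cubes L (W :: ('n::finite => nat) set)) = card W / 2 ^ (L * CARD('n))"
proof -
 have "measure lebesgue (cubes L W) = measure lebesgue (open_cubes L W)"
  by (rule measure_negligible_symdiff[OF cubes_lmeasurable[OF assms], symmetric])
   (use cubes_diff_negligible[OF assms] open_cubes_subset[of L W] in \<open>simp add: Diff_eq_empty_iff[THEN iffD2]\<close>)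
 then show ?thesis using measure_cubes[OF assms] by simp
qed

lemma rects_in_open_cubes:
 assumes "W \<subseteq> grid L" "n \<in> scales L" "x \<in> grid L" "cell L n x \<subseteq> W"
 shows "grid_rect L n x \<in> rects_in (open_cubes L W)"
proof -
 have n: "n j <= L" for j using scalesD[OF assms(2), of j] by simp
 have "rect (grid_rect L n x) \<subseteq> cubes L W"
  unfolding rect_cubes[OF n assms(3)] cubes_def using assms(4) by blast
 then have "negligible (rect (grid_rect L n x) - open_cubes L W)"
  by (intro negligible_subset[OF cubes_diff_negligible[OF assms(1)]]) blast
 then show ?thesis using grid_rect_below[OF assms(2,3)] rects_below_dyadic
  by (auto simp: rects_in_def ae_subset_def negligible_iff_null_sets)
qed

lemma open_cubes_ne:
 assumes "W \<subseteq> grid L" "W ~= {}"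
 shows "open_cubes L W ~= {}"
proof
 assume "open_cubes L W = {}"
 then have "real (card W) / 2 ^ (L * CARD('a)) = 0" using measure_open_cubes[OF assms(1)] by simp
 then show False using assms finite_subset[OF assms(1) finite_grid] by auto
qed

definition shadow :: "nat => ('n::finite => real set) set => ('n => nat) set" where
 "shadow L F = {y \<in> grid L. \<exists>n\<in>scales L. grid_rect L n y \<in> F}"

lemma shadow_grid: "shadow L F \<subseteq> grid L"
 by (auto simp: shadow_def)

lemma cell_shadow:
 assumes "n \<in> scales L" "x \<in> grid L" "grid_rect L n x \<in> F"
 shows "cell L n x \<subseteq> shadow L F"
proof
 fix y assume y: "y \<in> cell L n x"
 then have yg: "y \<in> grid L" by (simp add: cell_def)
 have e: "grid_rect L n y = grid_rect L n x" by (intro grid_rect_eq_iff[OF assms(2) yg, THEN iffD2, symmetric] y)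
 show "y \<in> shadow L F" using assms(1,3) yg unfolding shadow_def mem_Collect_eq e[symmetric] by blast
qed

lemma shadow_measure_1: "card (shadow L (F :: ('n::finite => real set) set)) / 2 ^ (L * CARD('n)) <= 1"
proof -
 have "card (shadow L F) <= card (grid L :: ('n => nat) set)" by (rule card_mono[OF finite_grid shadow_grid])
 then have "real (card (shadow L F)) <= 2 ^ (L * CARD('n))" unfolding card_grid by (metis of_nat_le_iff of_nat_numeral of_nat_power)
 then show ?thesis by simp
qed

text \<open>Passing from an open set to the union of finitely many rectangles almost contained in it does not increase the
  measure; this reduces open sets to grid sets.\<close>

lemma shadow_measure:
 fixes F :: "('n::finite => real set) set"
 assumes F: "finite F" "F \<subseteq> rects_in W" and W: "W \<in> lmeasurable"
 shows "card (shadow L F) / 2 ^ (L * CARD('n)) <= measure lebesgue W"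
proof -
 define E where "E = (\<Union>R\<in>F. rect R - W)"
 have E: "E \<in> null_sets lebesgue" unfolding E_def
  using F by (intro null_sets.finite_UN) (auto simp: rects_in_def ae_subset_def)
 have sub: "cubes L (shadow L F) \<subseteq> W \<union> E"
 proof
  fix z assume "z \<in> cubes L (shadow L F)"
  then obtain y where y: "y \<in> shadow L F" "z \<in> cube L y" by (auto simp: cubes_def)
  then obtain n where n: "n \<in> scales L" "y \<in> grid L" "grid_rect L n y \<in> F" by (auto simp: shadow_def)
  have nL: "n j <= L" for j using scalesD[OF n(1), of j] by simp
  have "z \<in> rect (grid_rect L n y)" unfolding rect_cubes[OF nL n(2)] using y(2) n(2) by (auto simp: cell_def same_cell_def)
  then show "z \<in> W \<union> E" using n(3) by (auto simp: E_def)
 qed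
 have fm: "W \<union> E \<in> lmeasurable"
  using W E by (intro fmeasurable.Un) (auto simp: fmeasurable_def null_sets_def)
 have "measure lebesgue (cubes L (shadow L F)) <= measure lebesgue (W \<union> E)"
  by (rule measure_mono_fmeasurable[OF sub fmeasurableD[OF cubes_lmeasurable[OF shadow_grid]] fm])
 also have "... = measure lebesgue W" by (rule measure_Un_null_set[OF fmeasurableD[OF W] E])
 finally show ?thesis by (simp add: measure_cubes[OF shadow_grid])
qed

lemma grid_carleson_of_open:
 fixes c :: "('n::finite => real set) => complex"
 assumes W: "W \<subseteq> grid L"
  and le: "W ~= {} ==> (!!F. finite F ==> F \<subseteq> rects_in (open_cubes L W) ==>
   (\<Sum>R\<in>F. (cmod (c R))^2) <= D * measure lebesgue (open_cubes L W))"
 shows "(\<Sum>n\<in>scales L. \<Sum>x\<in>{x \<in> grid L. cell L n x \<subseteq> W}. weight n * (cmod (c (grid_rect L n x)))^2) <= D * card W"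
proof (cases "W = {}")
 case True
 have "\<not> cell L n x \<subseteq> W" if "x \<in> grid L" for n x using that True by (auto simp: cell_def same_cell_def)
 then have none: "{x \<in> grid L. cell L n x \<subseteq> W} = {}" for n by blast
 show ?thesis unfolding none using True by simp
next
 case False
 define F where "F = rects_below L \<inter> rects_in (open_cubes L W)"
 define h where "h = (%R. if R \<in> F then (cmod (c R))^2 else 0)"
 have w: "0 < weight n" for n :: "'n => nat" by (rule weight_pos)
 have "(\<Sum>n\<in>scales L. \<Sum>x\<in>{x \<in> grid L. cell L n x \<subseteq> W}. weight n * (cmod (c (grid_rect L n x)))^2)
  <= (\<Sum>n\<in>scales L. \<Sum>x\<in>grid L. h (grid_rect L n x) * weight n)"
 proof (rule sum_mono)
  fix n :: "'n => nat" assume n: "n \<in> scales L"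
  have "(\<Sum>x\<in>{x \<in> grid L. cell L n x \<subseteq> W}. weight n * (cmod (c (grid_rect L n x)))^2)
   = (\<Sum>x\<in>{x \<in> grid L. cell L n x \<subseteq> W}. h (grid_rect L n x) * weight n)"
  proof (rule sum.cong[OF refl])
   fix x assume "x \<in> {x \<in> grid L. cell L n x \<subseteq> W}"
   then have "grid_rect L n x \<in> F" unfolding F_def using rects_in_open_cubes[OF W n] grid_rect_below[OF n] by auto
   then show "weight n * (cmod (c (grid_rect L n x)))^2 = h (grid_rect L n x) * weight n" by (simp add: h_def)
  qed
  also have "... <= (\<Sum>x\<in>grid L. h (grid_rect L n x) * weight n)"
   by (rule sum_mono2) (use less_imp_le[OF w[of n]] in \<open>auto simp: h_def\<close>)
  finally show "(\<Sum>x\<in>{x \<in> grid L. cell L n x \<subseteq> W}. weight n * (cmod (c (grid_rect L n x)))^2)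
   <= (\<Sum>x\<in>grid L. h (grid_rect L n x) * weight n)" .
 qed
 also have "... = 2 ^ (L * CARD('n)) * (\<Sum>R\<in>rects_below L. h R)" unfolding sum_rects_below by simp
 also have "(\<Sum>R\<in>rects_below L. h R) = (\<Sum>R\<in>F. (cmod (c R))^2)"
  unfolding h_def F_def by (subst sum.inter_restrict[OF finite_rects_below, symmetric]) (auto simp: Int_def intro: sum.cong)
 also have "2 ^ (L * CARD('n)) * (\<Sum>R\<in>F. (cmod (c R))^2) <= 2 ^ (L * CARD('n)) * (D * measure lebesgue (open_cubes L W))"
  by (rule mult_left_mono[OF le[OF False]]) (auto simp: F_def)
 also have "... = D * card W" by (simp add: measure_open_cubes[OF W])
 finally show ?thesis .
qed

lemma open_sum_of_grid_carleson:
 fixes c :: "('n::finite => real set) => complex"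
 assumes D: "0 <= D" and carl: "!!L. carleson L (scales L) (%n x. weight n * (cmod (c (grid_rect L n x)))^2) D"
  and W: "W \<in> lmeasurable" and F: "finite F" "F \<subseteq> rects_in W"
 shows "(\<Sum>R\<in>F. (cmod (c R))^2) <= D * measure lebesgue W"
proof -
 have Fd: "F \<subseteq> dyadic_rects" using F(2) by (auto simp: rects_in_def)
 obtain L where L: "F \<subseteq> rects_below L" using finite_dyadic_below[OF F(1) Fd] by metis
 define h where "h = (%R. if R \<in> F then (cmod (c R))^2 else 0)"
 have w: "0 < weight n" for n :: "'n => nat" by (rule weight_pos)
 have "(\<Sum>R\<in>F. (cmod (c R))^2) = (\<Sum>R\<in>rects_below L. h R)"
  unfolding h_def by (subst sum.inter_restrict[OF finite_rects_below, symmetric]) (use L in \<open>auto intro!: sum.cong\<close>)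
 also have "... = (\<Sum>n\<in>scales L. \<Sum>x\<in>grid L. h (grid_rect L n x) * weight n) / 2 ^ (L * CARD('n))" by (rule sum_rects_below)
 also have "... <= (\<Sum>n\<in>scales L. \<Sum>x\<in>{x \<in> grid L. cell L n x \<subseteq> shadow L F}. weight n * (cmod (c (grid_rect L n x)))^2) / 2 ^ (L * CARD('n))"
 proof (intro divide_right_mono sum_mono)
  fix n :: "'n => nat" assume n: "n \<in> scales L"
  have "(\<Sum>x\<in>grid L. h (grid_rect L n x) * weight n) = (\<Sum>x\<in>{x \<in> grid L. cell L n x \<subseteq> shadow L F}. h (grid_rect L n x) * weight n)"
   by (rule sum.mono_neutral_right) (use cell_shadow[OF n] in \<open>auto simp: h_def\<close>)
  also have "... <= (\<Sum>x\<in>{x \<in> grid L. cell L n x \<subseteq> shadow L F}. weight n * (cmod (c (grid_rect L n x)))^2)"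
   by (rule sum_mono) (use less_imp_le[OF w[of n]] in \<open>auto simp: h_def\<close>)
  finally show "(\<Sum>x\<in>grid L. h (grid_rect L n x) * weight n) <= (\<Sum>x\<in>{x \<in> grid L. cell L n x \<subseteq> shadow L F}. weight n * (cmod (c (grid_rect L n x)))^2)" .
 qed simp
 also have "... <= D * card (shadow L F) / 2 ^ (L * CARD('n))"
  by (rule divide_right_mono) (use carl[of L] shadow_grid in \<open>auto simp: carleson_def\<close>)
 also have "... = D * (card (shadow L F) / 2 ^ (L * CARD('n)))" by simp
 also have "... <= D * measure lebesgue W" by (rule mult_left_mono[OF shadow_measure[OF F W] D])
 finally show ?thesis .
qed

lemma BMO_carleson:
 assumes "b \<in> BMO"
 shows "carleson L (scales L) (%n x. weight n * (cmod (haar_coeff b (grid_rect L n x)))^2) ((bmo_norm b)^2)"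
 unfolding carleson_def
 by (intro allI impI grid_carleson_of_open BMO_sum_le assms torus_open_cubes open_cubes_ne)

lemma cell_antimono: "(!!j. k j <= n j) ==> cell L n x \<subseteq> cell L k x"
 unfolding cell_def using same_cell_mono by blast

text \<open>Uses \<open>ln 2 \<ge> 1/2\<close>, so each logarithm is at least half of \<open>k j + 1\<close>; the coordinates outside \<open>Z\<close> contribute
  \<open>ln 4 \<ge> 1\<close>.\<close>

lemma log_weight_grid:
 fixes \<beta> k :: "'n::finite => nat"
 shows "(\<Prod>j\<in>{j. \<beta> j = 0}. (real (k j) + 1)^2) / 4 ^ CARD('n) <= log_weight \<beta> (grid_rect L (%j. if \<beta> j = 0 then k j else 0) x)"
proof -
 have ln2: "1 / 2 <= ln (2::real)" using ln2_ge_two_thirds by simp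
 have ln4: "ln (4 * 2 ^ i) = (real i + 2) * ln 2" for i :: nat
 proof -
  have "(4::real) * 2 ^ i = 2 ^ (i + 2)" by (simp add: power_add)
  then show ?thesis by (simp only: ln_realpow) simp
 qed
 have one: "(if \<beta> j = 0 then (real (k j) + 1)^2 / 4 else 1) <=
  (ln (4 / measure lborel (if \<beta> j = 0 then grid_rect L (%j. if \<beta> j = 0 then k j else 0) x j else {0..<1})))^2" for j
 proof (cases "\<beta> j = 0")
  case True
  have "(real (k j) + 1) / 2 <= (real (k j) + 2) * ln 2"
   using mult_mono[of "real (k j) + 1" "real (k j) + 2" "1 / 2" "ln 2"] ln2 by simp
  then have "((real (k j) + 1) / 2)^2 <= ((real (k j) + 2) * ln 2)^2" by (intro power_mono) auto
  then show ?thesis using True by (simp add: grid_rect_def drect_def measure_dint ln4 power_divide)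
 next
  case False
  have "1 <= ln (4::real)" using ln4[of 0] ln2 by simp
  then have "1 <= (ln (4::real))^2" by (rule one_le_power)
  then show ?thesis using False by simp
 qed
 have "(\<Prod>j\<in>{j. \<beta> j = 0}. (real (k j) + 1)^2) / 4 ^ CARD('n) <= (\<Prod>j\<in>{j. \<beta> j = 0}. (real (k j) + 1)^2) / 4 ^ card {j. \<beta> j = 0}"
  by (intro divide_left_mono power_increasing card_mono prod_nonneg) auto
 also have "... = (\<Prod>j\<in>{j. \<beta> j = 0}. (real (k j) + 1)^2 / 4)" by (simp add: prod_dividef)
 also have "... = (\<Prod>j\<in>UNIV. if \<beta> j = 0 then (real (k j) + 1)^2 / 4 else 1)" by (simp add: prod.If_cases)
 also have "... <= log_weight \<beta> (grid_rect L (%j. if \<beta> j = 0 then k j else 0) x)"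
  unfolding log_weight_def by (rule prod_mono) (use one in auto)
 finally show ?thesis .
qed

text \<open>The common form of the hypotheses of the three upper bounds: in the coordinates with \<open>\<beta>\<^sub>j = 0\<close> the Carleson
  constant decays with the scale, in the others it does not.\<close>

definition symbol_carleson :: "('n::finite => nat) => (('n => real set) => complex) => real => bool" where
 "symbol_carleson \<beta> c B \<longleftrightarrow> (\<forall>L k. carleson L {n \<in> scales L. \<forall>j\<in>{j. \<beta> j = 0}. k j <= n j}
  (%n x. weight n * (cmod (c (grid_rect L n x)))^2) (B\<^sup>2 / (\<Prod>j\<in>{j. \<beta> j = 0}. (real (k j) + 1)^2)))"

lemma BMO_symbol_carleson:
 assumes "\<phi> \<in> BMO" "!!j. \<beta> j ~= 0"
 shows "symbol_carleson \<beta> (haar_coeff \<phi>) (bmo_norm \<phi>)"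
proof -
 have none: "{j. \<beta> j = 0} = {}" using assms(2) by simp
 show ?thesis using BMO_carleson[OF assms(1)] unfolding symbol_carleson_def none by simp
qed

text \<open>A grid set is cut into its intersections with the rectangles of scale \<open>k\<close> (scale zero outside \<open>Z\<close>); the LMO
  condition applies to each piece, and every rectangle of finer scale lies in one of them.\<close>

lemma LMO_symbol_carleson:
 fixes \<phi> :: "real ^ 'n::finite => complex" and \<beta> :: "'n => nat"
 assumes C: "0 <= C" and lmo: "lmo_bound \<beta> \<phi> C"
 shows "symbol_carleson \<beta> (haar_coeff \<phi>) (2 ^ CARD('n) * sqrt C)"
 unfolding symbol_carleson_def
proof (intro allI)
 fix L :: nat and k :: "'n => nat"
 define P where "P = (\<Prod>j\<in>{j. \<beta> j = 0}. (real (k j) + 1)^2)"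
 define K where "K = {n \<in> scales L. \<forall>j\<in>{j. \<beta> j = 0}. k j <= n j}"
 (* The scale of the rectangles that cut the grid set; full sides where no logarithm is available. *)
 define kz where "kz = (%j. if \<beta> j = 0 then k j else 0)"
 define w where "w = (%n x. weight n * (cmod (haar_coeff \<phi> (grid_rect L n x)))^2)"
 define D where "D = 4 ^ CARD('n) * C / P"
 have P: "0 < P" unfolding P_def by (intro prod_pos) auto
 have w0: "0 <= w n x" for n x unfolding w_def using weight_pos[of n] by simp
 have D: "0 <= D" using P C by (simp add: D_def)
 have "(\<Sum>n\<in>K. \<Sum>x\<in>{x \<in> grid L. cell L n x \<subseteq> W}. w n x) <= D * card W" if W: "W \<subseteq> grid L" for W
 proof (cases "K = {}")
  case True
  then show ?thesis using D by simp
 next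
  case False
  then obtain n0 where "n0 \<in> K" by blast
  then have kz: "kz \<in> scales L" by (auto simp: K_def kz_def scales_def intro: le_less_trans)
  have kzL: "kz j <= L" for j using scalesD[OF kz, of j] by simp
  have kzn: "kz j <= n j" if "n \<in> K" for n j using that by (auto simp: K_def kz_def)
  have piece: "(\<Sum>n\<in>K. \<Sum>x\<in>{x \<in> grid L. cell L kz x = A \<and> cell L n x \<subseteq> W}. w n x) <= D * card {x \<in> W. cell L kz x = A}"
   if A: "A \<in> cell L kz ` grid L" for A
  proof -
   obtain x0 where x0: "x0 \<in> grid L" "A = cell L kz x0" using A by blast
   define WA where "WA = {x \<in> W. cell L kz x = A}"
   define R where "R = grid_rect L kz x0"
   have WA: "WA \<subseteq> grid L" using W by (auto simp: WA_def)
   have Rd: "R \<in> dyadic_rects" unfolding R_def using grid_rect_below[OF kz x0(1)] rects_below_dyadic by blast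
   have lw: "P / 4 ^ CARD('n) <= log_weight \<beta> R" unfolding P_def R_def kz_def by (rule log_weight_grid)
   have lwp: "0 < log_weight \<beta> R" using lw P by (smt (verit) divide_pos_pos zero_less_power)
   have sub: "WA \<subseteq> cell L kz x0"
   proof
    fix x assume x: "x \<in> WA"
    then have "x \<in> cell L kz x" using WA by (auto simp: cell_def same_cell_def)
    then show "x \<in> cell L kz x0" using x x0(2) by (simp add: WA_def)
   qed
   have "open_cubes L WA \<subseteq> rect R"
    unfolding R_def rect_cubes[OF kzL x0(1)] using open_cubes_subset[of L WA] sub by (auto simp: cubes_def)
   then have ae: "ae_subset (open_cubes L WA) (rect R)" by (simp add: ae_subset_def Diff_eq_empty_iff[THEN iffD2])
   have "(\<Sum>n\<in>K. \<Sum>x\<in>{x \<in> grid L. cell L kz x = A \<and> cell L n x \<subseteq> W}. w n x)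
    <= (\<Sum>n\<in>K. \<Sum>x\<in>{x \<in> grid L. cell L n x \<subseteq> WA}. w n x)"
   proof (intro sum_mono sum_mono2)
    fix n assume n: "n \<in> K"
    show "{x \<in> grid L. cell L kz x = A \<and> cell L n x \<subseteq> W} \<subseteq> {x \<in> grid L. cell L n x \<subseteq> WA}"
    proof safe
     fix x y assume x: "x \<in> grid L" "A = cell L kz x" "cell L n x \<subseteq> W" and y: "y \<in> cell L n x"
     have "y \<in> cell L kz x" using y cell_antimono[where k = kz and n = n and L = L and x = x, OF kzn[OF n]] by blast
     then have "cell L kz y = cell L kz x" by (rule cell_eq)
     then show "y \<in> WA" using x y by (auto simp: WA_def)
    qed
   qed (auto simp: w0)
   also have "... <= (\<Sum>n\<in>scales L. \<Sum>x\<in>{x \<in> grid L. cell L n x \<subseteq> WA}. w n x)"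
    by (rule sum_mono2) (auto simp: K_def w0 intro: sum_nonneg)
   also have "... <= (C / log_weight \<beta> R) * card WA"
    unfolding w_def
   proof (rule grid_carleson_of_open[OF WA])
    fix F assume ne: "WA ~= {}" and F: "finite F" "F \<subseteq> rects_in (open_cubes L WA)"
    have ope: "torus_open (open_cubes L WA)" "open_cubes L WA ~= {}" by (rule torus_open_cubes[OF WA], rule open_cubes_ne[OF WA ne])
    have "ennreal (log_weight \<beta> R) * carleson_avg \<phi> (open_cubes L WA) <= ennreal C"
     using lmo Rd ope ae by (simp add: lmo_bound_def)
    then have "carleson_avg \<phi> (open_cubes L WA) <= ennreal (C / log_weight \<beta> R)"
     using lwp C by (rule ennreal_le_divideI)
    then show "(\<Sum>R\<in>F. (cmod (haar_coeff \<phi> R))^2) <= C / log_weight \<beta> R * measure lebesgue (open_cubes L WA)"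
     using carleson_avg_le_iff[OF ope, of "C / log_weight \<beta> R" \<phi>] lwp C F by simp
   qed
   also have "... <= D * card WA"
   proof (rule mult_right_mono)
    have "C / log_weight \<beta> R <= C / (P / 4 ^ CARD('n))" by (rule divide_left_mono[OF lw C]) (use lwp P in simp)
    then show "C / log_weight \<beta> R <= D" by (simp add: D_def mult.commute)
   qed simp
   finally show ?thesis unfolding WA_def .
  qed
  have "(\<Sum>n\<in>K. \<Sum>x\<in>{x \<in> grid L. cell L n x \<subseteq> W}. w n x)
   = (\<Sum>n\<in>K. \<Sum>A\<in>cell L kz ` grid L. \<Sum>x\<in>{x \<in> grid L. cell L kz x = A \<and> cell L n x \<subseteq> W}. w n x)"
  proof (rule sum.cong[OF refl])
   fix n assume "n \<in> K"
   have "(\<Sum>x\<in>{x \<in> grid L. cell L n x \<subseteq> W}. w n x) = (\<Sum>A\<in>cell L kz ` grid L. \<Sum>x\<in>{x \<in> {x \<in> grid L. cell L n x \<subseteq> W}. cell L kz x = A}. w n x)"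
    by (rule sum.group[symmetric]) auto
   also have "... = (\<Sum>A\<in>cell L kz ` grid L. \<Sum>x\<in>{x \<in> grid L. cell L kz x = A \<and> cell L n x \<subseteq> W}. w n x)"
    by (intro sum.cong refl) auto
   finally show "(\<Sum>x\<in>{x \<in> grid L. cell L n x \<subseteq> W}. w n x) = (\<Sum>A\<in>cell L kz ` grid L. \<Sum>x\<in>{x \<in> grid L. cell L kz x = A \<and> cell L n x \<subseteq> W}. w n x)" .
  qed
  also have "... = (\<Sum>A\<in>cell L kz ` grid L. \<Sum>n\<in>K. \<Sum>x\<in>{x \<in> grid L. cell L kz x = A \<and> cell L n x \<subseteq> W}. w n x)" by (rule sum.swap)
  also have "... <= (\<Sum>A\<in>cell L kz ` grid L. D * card {x \<in> W. cell L kz x = A})" by (rule sum_mono) (rule piece)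
  also have "... = D * (\<Sum>A\<in>cell L kz ` grid L. \<Sum>x\<in>{x \<in> W. cell L kz x = A}. 1)" by (simp add: sum_distrib_left)
  also have "(\<Sum>A\<in>cell L kz ` grid L. \<Sum>x\<in>{x \<in> W. cell L kz x = A}. 1) = (\<Sum>x\<in>W. 1 :: real)"
   by (rule sum.group[OF finite_subset[OF W finite_grid]]) (use W in auto)
  finally show ?thesis by simp
 qed
 moreover have "D = (2 ^ CARD('n) * sqrt C)^2 / P"
  using C by (simp add: D_def power_mult_distrib flip: power_mult) (simp add: mult.commute[of _ 2] power_mult)
 ultimately show "carleson L {n \<in> scales L. \<forall>j\<in>{j. \<beta> j = 0}. k j <= n j}
  (%n x. weight n * (cmod (haar_coeff \<phi> (grid_rect L n x)))^2)
  ((2 ^ CARD('n) * sqrt C)^2 / (\<Prod>j\<in>{j. \<beta> j = 0}. (real (k j) + 1)^2))"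
  unfolding carleson_def K_def[symmetric] P_def[symmetric] w_def by simp
qed

section \<open>The upper bound\<close>

lemma sum_rects_below_mono_grid:
 fixes h :: "('n::finite => real set) => real"
 assumes "!!n x. n \<in> scales L ==> x \<in> grid L ==> h (grid_rect L n x) * weight n <= u n x"
 shows "(\<Sum>R\<in>rects_below L. h R) <= (\<Sum>n\<in>scales L. \<Sum>x\<in>grid L. u n x) / 2 ^ (L * CARD('n))"
 unfolding sum_rects_below by (intro divide_right_mono sum_mono assms) auto

lemma haar_unit_mult:
 fixes \<beta> n :: "'n::finite => nat"
 assumes "!!j. \<beta> j \<in> {0, 1}"
 shows "haar_unit (%j. 1 - \<beta> j) n * haar_unit \<beta> n = 1 / sqrt (weight n)"
proof -
 have "haar_unit (%j. 1 - \<beta> j) n * haar_unit \<beta> n = haar_unit (%_. 0) n"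
  unfolding haar_unit_def prod.distrib[symmetric]
 proof (rule prod.cong[OF refl])
  fix j
  have "\<beta> j = 0 \<or> \<beta> j = 1" using assms[of j] by blast
  then show "(if 1 - \<beta> j = 0 then 1 / sqrt (2 ^ n j) else 1) * (if \<beta> j = 0 then 1 / sqrt (2 ^ n j) else 1)
   = (if (0::nat) = 0 then 1 / sqrt (2 ^ n j) else 1)" by auto
 qed
 then show ?thesis by (simp add: haar_unit_0)
qed

text \<open>The indicator \<open>b\<close> of the shadow has mean one over every rectangle that contributes, so it can be inserted for free.
  Since \<open>f\<close> has mean zero in each variable, its means equal its oscillations.\<close>

lemma real_form_estimate:
 fixes \<beta> :: "'n::finite => nat" and fc \<alpha> :: "('n => real set) => real" and c :: "('n => real set) => complex"
 assumes \<beta>: "!!j. \<beta> j \<in> {0, 1}" and c: "symbol_carleson \<beta> c B" and B: "0 <= B" and F: "0 <= F"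
  and fc: "carleson L (scales L) (%n x. weight n * (fc (grid_rect L n x))^2) (F\<^sup>2)"
  and \<alpha>: "!!Q. Q \<notin> Q0 ==> \<alpha> Q = 0"
 shows "(\<Sum>R\<in>rects_below L. cmod (c R) * \<bar>\<Sum>Q\<in>rects_below L. fc Q * haar_pair (%j. 1 - \<beta> j) Q R\<bar> *
   \<bar>\<Sum>Q\<in>rects_below L. \<alpha> Q * haar_pair \<beta> Q R\<bar>)
  <= 192 ^ CARD('n) * (B * F) * (sqrt (card (shadow L Q0) / 2 ^ (L * CARD('n))) * sqrt (\<Sum>Q\<in>rects_below L. (\<alpha> Q)^2))"
proof -
 define Z where "Z = {j. \<beta> j = 0}"
 define f where "f = haar_synth L fc"
 define a where "a = haar_synth L \<alpha>"
 define b where "b = (%y. if y \<in> shadow L Q0 then 1 else (0::real))"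
 define m where "m = (%n x. sqrt (weight n) * cmod (c (grid_rect L n x)))"
 define u where "u = (%n x. m n x *
   (\<bar>ker_op L (%j. if j \<in> Z then osc_ker L (n j) else coeff_ker L (n j)) f x\<bar> * \<bar>mean_op L n b x\<bar> *
   \<bar>ker_op L (%j. if j \<in> Z then coeff_ker L (n j) else mean_ker L (n j)) a x\<bar>))"
 have w: "0 < weight n" for n :: "'n => nat" by (rule weight_pos)
 have m2: "(m n x)^2 = weight n * (cmod (c (grid_rect L n x)))^2" for n x
  unfolding m_def using w[of n] by (simp add: power_mult_distrib)
 have m0: "0 <= m n x" for n x unfolding m_def using w[of n] by simp
 have carlm: "carleson L {n \<in> scales L. \<forall>j\<in>Z. k j <= n j} (%n x. (m n x)^2) (B\<^sup>2 / (\<Prod>j\<in>Z. (real (k j) + 1)^2))" for k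
  using c unfolding symbol_carleson_def m2 Z_def by blast
 have carlf: "carleson L (scales L) (%n x. (coeff_op L n f x)^2) (F\<^sup>2)"
  unfolding carleson_def
 proof (intro allI impI)
  fix W :: "('n => nat) set" assume "W \<subseteq> grid L"
  have "(\<Sum>n\<in>scales L. \<Sum>x\<in>{x \<in> grid L. cell L n x \<subseteq> W}. (coeff_op L n f x)^2)
   = (\<Sum>n\<in>scales L. \<Sum>x\<in>{x \<in> grid L. cell L n x \<subseteq> W}. weight n * (fc (grid_rect L n x))^2)"
   by (intro sum.cong refl) (use w in \<open>simp add: f_def coeff_op_synth power_mult_distrib less_imp_le\<close>)
  also have "... <= F\<^sup>2 * card W" using fc \<open>W \<subseteq> grid L\<close> by (simp add: carleson_def)
  finally show "(\<Sum>n\<in>scales L. \<Sum>x\<in>{x \<in> grid L. cell L n x \<subseteq> W}. (coeff_op L n f x)^2) <= F\<^sup>2 * card W" .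
 qed
 have tm: "(cmod (c (grid_rect L n x)) * \<bar>\<Sum>Q\<in>rects_below L. fc Q * haar_pair (%j. 1 - \<beta> j) Q (grid_rect L n x)\<bar> *
   \<bar>\<Sum>Q\<in>rects_below L. \<alpha> Q * haar_pair \<beta> Q (grid_rect L n x)\<bar>) * weight n <= u n x"
  if n: "n \<in> scales L" and x: "x \<in> grid L" for n x
 proof (cases "(\<Sum>Q\<in>rects_below L. \<alpha> Q * haar_pair \<beta> Q (grid_rect L n x)) = 0")
  case True
  have "0 <= u n x" unfolding u_def using m0 by (intro mult_nonneg_nonneg) auto
  then show ?thesis unfolding True by simp
 next
  case False
  then obtain Q where Q: "Q \<in> rects_below L" "\<alpha> Q * haar_pair \<beta> Q (grid_rect L n x) ~= 0" by (meson sum.neutral)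
  then have QQ: "Q \<in> Q0" using \<alpha>[of Q] by auto
  obtain q y where qy: "q \<in> scales L" "y \<in> grid L" "Q = grid_rect L q y" using Q(1) rects_belowE by metis
  have "cell L n x \<subseteq> cell L q y" using haar_pair_support(2)[OF qy(1) n x qy(2), of \<beta>] Q(2) qy(3) by auto
  also have "... \<subseteq> shadow L Q0" using cell_shadow[OF qy(1,2)] QQ qy(3) by simp
  finally have sub: "cell L n x \<subseteq> shadow L Q0" .
  have nL: "n j <= L" for j using scalesD[OF n, of j] by simp
have xs: "x \<in> shadow L Q0" using sub cell_refl[OF x, of n] by blast
  have "mean_op L n b x = b x" by (rule mean_op_fix[OF x nL]) (use sub xs in \<open>auto simp: b_def\<close>)
  then have b1: "mean_op L n b x = 1" using xs by (simp add: b_def)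
  have k1: "ker_op L (pair_ker L (%j. 1 - \<beta> j) n) f x = ker_op L (%j. if j \<in> Z then osc_ker L (n j) else coeff_ker L (n j)) f x"
  proof -
   have "pair_ker L (%j. 1 - \<beta> j) n = (%j. if j \<in> Z then mean_ker L (n j) else coeff_ker L (n j))"
   proof
    fix j
    have "\<beta> j = 0 \<or> \<beta> j = 1" using \<beta>[of j] by blast
    then show "pair_ker L (%j. 1 - \<beta> j) n j = (if j \<in> Z then mean_ker L (n j) else coeff_ker L (n j))"
     by (auto simp: pair_ker_def Z_def)
   qed
   then show ?thesis
    using osc_eq_mean[where S = Z and n = n and \<kappa> = "%j. coeff_ker L (n j)", OF mean_zero_synth[of L fc] x nL] by (simp add: f_def)
  qed
  have k2: "pair_ker L \<beta> n = (%j. if j \<in> Z then coeff_ker L (n j) else mean_ker L (n j))"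
   by (auto simp: pair_ker_def Z_def)
  have "sqrt (weight n) * (haar_unit (%j. 1 - \<beta> j) n * haar_unit \<beta> n) = 1"
   unfolding haar_unit_mult[OF \<beta>] using w[of n] by simp
  moreover have "weight n = sqrt (weight n) * sqrt (weight n)" using w[of n] by simp
  ultimately have wu: "haar_unit (%j. 1 - \<beta> j) n * haar_unit \<beta> n * weight n = sqrt (weight n)" by (metis mult.assoc mult.commute mult_1)
  show ?thesis
   unfolding haar_synth_pair[OF n, symmetric] u_def b1 k1[symmetric] k2[symmetric] m_def f_def[symmetric] a_def[symmetric] abs_mult
    wu[symmetric]
   by (simp add: abs_of_pos[OF haar_unit_pos] mult_ac)
 qed
 have "(\<Sum>R\<in>rects_below L. cmod (c R) * \<bar>\<Sum>Q\<in>rects_below L. fc Q * haar_pair (%j. 1 - \<beta> j) Q R\<bar> *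
   \<bar>\<Sum>Q\<in>rects_below L. \<alpha> Q * haar_pair \<beta> Q R\<bar>) <= (\<Sum>n\<in>scales L. \<Sum>x\<in>grid L. u n x) / 2 ^ (L * CARD('n))"
  by (rule sum_rects_below_mono_grid) (rule tm)
 also have "... <= 192 ^ CARD('n) * (B * F) * (sqrt (sq_norm L b) * sqrt (sq_norm L a)) / 2 ^ (L * CARD('n))"
  unfolding u_def by (intro divide_right_mono four_linear_estimate[OF carlf carlm m0 B F]) auto
 also have "sq_norm L b = card (shadow L Q0)"
 proof -
  have "sq_norm L b = (\<Sum>y\<in>grid L. if y \<in> shadow L Q0 then 1 else 0)"
   unfolding sq_norm_def b_def by (intro sum.cong) auto
  also have "... = (\<Sum>y\<in>grid L \<inter> shadow L Q0. 1)" by (rule sum.inter_restrict[symmetric]) simp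
  also have "grid L \<inter> shadow L Q0 = shadow L Q0" using shadow_grid by blast
  finally show ?thesis by simp
 qed
 also have "sqrt (sq_norm L a) = sqrt (2 ^ (L * CARD('n))) * sqrt (\<Sum>Q\<in>rects_below L. (\<alpha> Q)^2)"
  unfolding a_def sq_norm_synth by (rule real_sqrt_mult)
 also have "192 ^ CARD('n) * (B * F) * (sqrt (card (shadow L Q0)) * (sqrt (2 ^ (L * CARD('n))) * sqrt (\<Sum>Q\<in>rects_below L. (\<alpha> Q)^2))) / 2 ^ (L * CARD('n))
  = 192 ^ CARD('n) * (B * F) * (sqrt (card (shadow L Q0) / 2 ^ (L * CARD('n))) * sqrt (\<Sum>Q\<in>rects_below L. (\<alpha> Q)^2))"
 proof -
  define s where "s = sqrt (2 ^ (L * CARD('n)))"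
  have s: "0 < s" "2 ^ (L * CARD('n)) = s * s" by (simp_all add: s_def)
  show ?thesis unfolding real_sqrt_divide s_def[symmetric] unfolding s(2) using s(1) by (simp add: field_simps)
 qed
 finally show ?thesis .
qed

text \<open>Splitting into real and imaginary parts gives the complex form of the estimate.\<close>

lemma form_estimate:
 fixes \<beta> :: "'n::finite => nat" and \<alpha> c :: "('n => real set) => complex"
 assumes \<beta>: "!!j. \<beta> j \<in> {0, 1}" and c: "symbol_carleson \<beta> c B" and B: "0 <= B" and f: "f \<in> BMO"
  and Q0: "finite Q0" "Q0 \<subseteq> dyadic_rects" and R0: "finite R0" "R0 \<subseteq> dyadic_rects"
  and \<mu>: "!!L. card (shadow L Q0) / 2 ^ (L * CARD('n)) <= \<mu>"
 shows "(\<Sum>R\<in>R0. cmod (c R * inner_torus f (haar_rect (%j. 1 - \<beta> j) R)) * cmod (\<Sum>Q\<in>Q0. \<alpha> Q * of_real (haar_pair \<beta> Q R)))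
  <= 4 * 192 ^ CARD('n) * B * bmo_norm f * (sqrt \<mu> * sqrt (\<Sum>Q\<in>Q0. (cmod (\<alpha> Q))^2))"
proof -
 define F where "F = bmo_norm f"
 have F: "0 <= F" by (simp add: F_def bmo_norm_nonneg)
 have "finite (Q0 \<union> R0)" "Q0 \<union> R0 \<subseteq> dyadic_rects" using Q0 R0 by auto
 then obtain L where "0 < L" and L: "Q0 \<union> R0 \<subseteq> rects_below L" by (rule finite_dyadic_below)
 define \<alpha>' where "\<alpha>' = (%Q. if Q \<in> Q0 then \<alpha> Q else 0)"
 define X where "X = (%p R. \<bar>\<Sum>Q\<in>rects_below L. p (haar_coeff f Q) * haar_pair (%j. 1 - \<beta> j) Q R\<bar>)"
 define Y where "Y = (%p R. \<bar>\<Sum>Q\<in>rects_below L. p (\<alpha>' Q) * haar_pair \<beta> Q R\<bar>)"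
 define E where "E = 192 ^ CARD('n) * (B * F) * (sqrt \<mu> * sqrt (\<Sum>Q\<in>Q0. (cmod (\<alpha> Q))^2))"
 have E: "(\<Sum>R\<in>rects_below L. cmod (c R) * X p R * Y q R) <= E"
  if p: "!!z. \<bar>p z\<bar> <= cmod z" and q: "!!z. \<bar>q z\<bar> <= cmod z" for p q
 proof -
  have p2: "(p z)^2 <= (cmod z)^2" and q2: "(q z)^2 <= (cmod z)^2" for z
   using p[of z] q[of z] by (simp_all add: abs_le_square_iff[symmetric])
  have q0: "q 0 = 0" using q[of 0] by simp
  have carl: "carleson L (scales L) (%n x. weight n * (p (haar_coeff f (grid_rect L n x)))^2) (F\<^sup>2)"
   unfolding carleson_def
  proof (intro allI impI)
   fix W :: "('n => nat) set" assume W: "W \<subseteq> grid L"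
   have "(\<Sum>n\<in>scales L. \<Sum>x\<in>{x \<in> grid L. cell L n x \<subseteq> W}. weight n * (p (haar_coeff f (grid_rect L n x)))^2)
    <= (\<Sum>n\<in>scales L. \<Sum>x\<in>{x \<in> grid L. cell L n x \<subseteq> W}. weight n * (cmod (haar_coeff f (grid_rect L n x)))^2)"
    by (intro sum_mono mult_left_mono p2 less_imp_le[OF weight_pos])
   also have "... <= F\<^sup>2 * card W" using BMO_carleson[OF f, of L] W by (simp add: carleson_def F_def)
   finally show "(\<Sum>n\<in>scales L. \<Sum>x\<in>{x \<in> grid L. cell L n x \<subseteq> W}. weight n * (p (haar_coeff f (grid_rect L n x)))^2) <= F\<^sup>2 * card W" .
  qed
  have "(\<Sum>R\<in>rects_below L. cmod (c R) * X p R * Y q R)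
   <= 192 ^ CARD('n) * (B * F) * (sqrt (card (shadow L Q0) / 2 ^ (L * CARD('n))) * sqrt (\<Sum>Q\<in>rects_below L. (q (\<alpha>' Q))^2))"
   unfolding X_def Y_def by (rule real_form_estimate[OF \<beta> c B F carl]) (simp add: \<alpha>'_def q0)
  also have "... <= E"
   unfolding E_def
  proof (intro mult_left_mono mult_mono real_sqrt_le_mono \<mu>)
   have "(\<Sum>Q\<in>rects_below L. (q (\<alpha>' Q))^2) <= (\<Sum>Q\<in>rects_below L. (cmod (\<alpha>' Q))^2)" by (intro sum_mono q2)
   also have "... = (\<Sum>Q\<in>Q0. (cmod (\<alpha>' Q))^2)" by (rule sum.mono_neutral_right) (use L in \<open>auto simp: \<alpha>'_def\<close>)
   also have "... = (\<Sum>Q\<in>Q0. (cmod (\<alpha> Q))^2)" by (simp add: \<alpha>'_def)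
   finally show "(\<Sum>Q\<in>rects_below L. (q (\<alpha>' Q))^2) <= (\<Sum>Q\<in>Q0. (cmod (\<alpha> Q))^2)" .
   have "0 <= card (shadow L Q0) / 2 ^ (L * CARD('n))" by simp
   then have "0 <= \<mu>" using \<mu>[of L] by linarith
   then show "0 <= sqrt \<mu>" by simp
  qed (use B F in \<open>auto intro: sum_nonneg\<close>)
  finally show ?thesis .
 qed
 have X0: "0 <= X p R" and Y0: "0 <= Y p R" for p R by (simp_all add: X_def Y_def)
 have cX: "cmod (inner_torus f (haar_rect (%j. 1 - \<beta> j) R)) <= X Re R + X Im R" if "R \<in> rects_below L" for R
  unfolding inner_haar_expansion[OF BMO_L2_0[OF f] that] X_def by (rule order_trans[OF cmod_le]) simp
 have cY: "cmod (\<Sum>Q\<in>Q0. \<alpha> Q * of_real (haar_pair \<beta> Q R)) <= Y Re R + Y Im R" for R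
 proof -
  have "(\<Sum>Q\<in>Q0. \<alpha> Q * of_real (haar_pair \<beta> Q R)) = (\<Sum>Q\<in>rects_below L. \<alpha>' Q * of_real (haar_pair \<beta> Q R))"
   by (rule sum.mono_neutral_cong_left) (use L in \<open>auto simp: \<alpha>'_def\<close>)
  then show ?thesis unfolding Y_def by (simp only:) (rule order_trans[OF cmod_le], simp)
 qed
 have "(\<Sum>R\<in>R0. cmod (c R * inner_torus f (haar_rect (%j. 1 - \<beta> j) R)) * cmod (\<Sum>Q\<in>Q0. \<alpha> Q * of_real (haar_pair \<beta> Q R)))
  <= (\<Sum>R\<in>rects_below L. cmod (c R * inner_torus f (haar_rect (%j. 1 - \<beta> j) R)) * cmod (\<Sum>Q\<in>Q0. \<alpha> Q * of_real (haar_pair \<beta> Q R)))"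
  by (rule sum_mono2) (use L in auto)
 also have "... <= (\<Sum>R\<in>rects_below L. cmod (c R) * X Re R * Y Re R + cmod (c R) * X Re R * Y Im R
   + cmod (c R) * X Im R * Y Re R + cmod (c R) * X Im R * Y Im R)"
 proof (rule sum_mono)
  fix R :: "'n => real set" assume R: "R \<in> rects_below L"
  have "cmod (c R * inner_torus f (haar_rect (%j. 1 - \<beta> j) R)) * cmod (\<Sum>Q\<in>Q0. \<alpha> Q * of_real (haar_pair \<beta> Q R))
   <= (cmod (c R) * (X Re R + X Im R)) * (Y Re R + Y Im R)"
   unfolding norm_mult by (intro mult_mono mult_left_mono cX[OF R] cY) (use X0 in auto)
  then show "cmod (c R * inner_torus f (haar_rect (%j. 1 - \<beta> j) R)) * cmod (\<Sum>Q\<in>Q0. \<alpha> Q * of_real (haar_pair \<beta> Q R))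
   <= cmod (c R) * X Re R * Y Re R + cmod (c R) * X Re R * Y Im R + cmod (c R) * X Im R * Y Re R + cmod (c R) * X Im R * Y Im R"
   by (simp add: algebra_simps)
 qed
 also have "... <= E + E + E + E"
  unfolding sum.distrib by (intro add_mono E) (simp_all add: abs_Re_le_cmod abs_Im_le_cmod)
 also have "... = 4 * 192 ^ CARD('n) * B * bmo_norm f * (sqrt \<mu> * sqrt (\<Sum>Q\<in>Q0. (cmod (\<alpha> Q))^2))" by (simp add: E_def F_def)
 finally show ?thesis .
qed

lemma inner_torus_cnj: "inner_torus g f = cnj (inner_torus f g)"
 unfolding inner_torus_def by (subst Bochner_Integration.integral_cnj[symmetric]) (simp add: mult.commute)

lemma has_sum_finite_sum:
 fixes u :: "'b => 'a => complex"
 assumes "finite I" "!!i. i \<in> I ==> (u i has_sum s i) A"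
 shows "((%x. \<Sum>i\<in>I. u i x) has_sum (\<Sum>i\<in>I. s i)) A"
 using assms by (induction I rule: finite_induct) (simp_all add: has_sum_add)

lemma has_sum_norm_le:
 fixes u :: "'a => complex"
 assumes s: "(u has_sum s) A" and le: "!!F. finite F ==> F \<subseteq> A ==> cmod (sum u F) <= C"
 shows "cmod s <= C"
proof (rule tendsto_upperbound)
 show "((%F. cmod (sum u F)) \<longlongrightarrow> cmod s) (finite_subsets_at_top A)" using s unfolding has_sum_def by (rule tendsto_norm)
 show "\<forall>\<^sub>F F in finite_subsets_at_top A. cmod (sum u F) <= C" by (rule eventually_finite_subsets_at_top_weakI) (rule le)
qed simp

text \<open>Testing with a single \<open>Q\<close> gives absolute convergence of the series for its coefficient \<open>\<gamma> Q\<close>; testing with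
  \<open>\<alpha> = cnj \<circ> \<gamma>\<close> gives the BMO bound for \<open>\<gamma>\<close>, which is then realised by Riesz--Fischer.\<close>

theorem paraproduct_upper:
 fixes \<beta> :: "'n::finite => nat"
 assumes \<beta>: "!!j. \<beta> j \<in> {0, 1}" and c: "symbol_carleson \<beta> (haar_coeff \<phi>) B" and B: "0 <= B"
 shows "paraproduct_bound \<beta> \<phi> (4 * 192 ^ CARD('n) * B)"
 unfolding paraproduct_bound_def
proof
 fix f :: "real ^ 'n => complex" assume f: "f \<in> BMO"
 define K where "K = 4 * 192 ^ CARD('n) * B * bmo_norm f"
 have K: "0 <= K" unfolding K_def using B bmo_norm_nonneg[of f] by simp
 define t where "t = (%R. haar_coeff \<phi> R * inner_torus f (haar_rect (%j. 1 - \<beta> j) R))"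
 have form: "(\<Sum>R\<in>R0. cmod (t R) * cmod (\<Sum>Q\<in>Q0. \<alpha> Q * of_real (haar_pair \<beta> Q R))) <= K * (sqrt \<mu> * sqrt (\<Sum>Q\<in>Q0. (cmod (\<alpha> Q))^2))"
  if "finite Q0" "Q0 \<subseteq> dyadic_rects" "finite R0" "R0 \<subseteq> dyadic_rects" "!!L. card (shadow L Q0) / 2 ^ (L * CARD('n)) <= \<mu>" for Q0 R0 \<alpha> \<mu>
  unfolding t_def K_def by (rule form_estimate[OF \<beta> c B f that])
 have summ: "(%R. t R * of_real (haar_pair \<beta> Q R)) summable_on dyadic_rects" if Q: "Q \<in> dyadic_rects" for Q
 proof (rule abs_summable_summable, unfold abs_summable_iff_bdd_above, rule bdd_aboveI2)
  fix R0 :: "('n => real set) set" assume "R0 \<in> {F. F \<subseteq> dyadic_rects \<and> finite F}"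
  then show "(\<Sum>R\<in>R0. norm (t R * of_real (haar_pair \<beta> Q R))) <= K * (sqrt 1 * sqrt (\<Sum>Q\<in>{Q}. (cmod 1)^2))"
   using form[of "{Q}" R0 1 "%_. 1", OF _ _ _ _ shadow_measure_1] Q by (simp add: norm_mult)
 qed
 define \<gamma> where "\<gamma> = (%Q. \<Sum>\<^sub>\<infinity>R\<in>dyadic_rects. t R * of_real (haar_pair \<beta> Q R))"
 have hs: "((%R. t R * of_real (haar_pair \<beta> Q R)) has_sum \<gamma> Q) dyadic_rects" if "Q \<in> dyadic_rects" for Q
  unfolding \<gamma>_def by (rule has_sum_infsum[OF summ[OF that]])
 have \<gamma>: "(\<Sum>Q\<in>Q0. (cmod (\<gamma> Q))^2) <= K\<^sup>2 * \<mu>"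
  if Q0: "finite Q0" "Q0 \<subseteq> dyadic_rects" and \<mu>: "!!L. card (shadow L Q0) / 2 ^ (L * CARD('n)) <= \<mu>" for Q0 \<mu>
 proof -
  define s where "s = (\<Sum>Q\<in>Q0. (cmod (\<gamma> Q))^2)"
  have s0: "0 <= s" by (simp add: s_def sum_nonneg)
  have \<mu>0: "0 <= \<mu>" using \<mu>[of 0] by (smt (verit) divide_nonneg_nonneg of_nat_0_le_iff zero_le_power)
  have "((%R. \<Sum>Q\<in>Q0. cnj (\<gamma> Q) * (t R * of_real (haar_pair \<beta> Q R))) has_sum (\<Sum>Q\<in>Q0. cnj (\<gamma> Q) * \<gamma> Q)) dyadic_rects"
   using Q0(1) by (rule has_sum_finite_sum) (use Q0(2) hs has_sum_cmult_right in blast)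
  moreover have "cmod (\<Sum>R\<in>R0. \<Sum>Q\<in>Q0. cnj (\<gamma> Q) * (t R * of_real (haar_pair \<beta> Q R))) <= K * (sqrt \<mu> * sqrt s)"
   if R0: "finite R0" "R0 \<subseteq> dyadic_rects" for R0
  proof -
   have "cmod (\<Sum>R\<in>R0. \<Sum>Q\<in>Q0. cnj (\<gamma> Q) * (t R * of_real (haar_pair \<beta> Q R)))
    <= (\<Sum>R\<in>R0. cmod (\<Sum>Q\<in>Q0. cnj (\<gamma> Q) * (t R * of_real (haar_pair \<beta> Q R))))" by (rule norm_sum)
   also have "... = (\<Sum>R\<in>R0. cmod (t R) * cmod (\<Sum>Q\<in>Q0. cnj (\<gamma> Q) * of_real (haar_pair \<beta> Q R)))"
    unfolding norm_mult[symmetric] sum_distrib_left by (simp add: mult_ac)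
   also have "... <= K * (sqrt \<mu> * sqrt (\<Sum>Q\<in>Q0. (cmod (cnj (\<gamma> Q)))^2))" by (rule form[OF Q0 R0 \<mu>])
   finally show ?thesis by (simp add: s_def)
  qed
  ultimately have "cmod (\<Sum>Q\<in>Q0. cnj (\<gamma> Q) * \<gamma> Q) <= K * (sqrt \<mu> * sqrt s)" by (rule has_sum_norm_le)
  moreover have "(\<Sum>Q\<in>Q0. cnj (\<gamma> Q) * \<gamma> Q) = complex_of_real s"
   unfolding s_def of_real_sum by (rule sum.cong[OF refl]) (simp add: complex_norm_square mult.commute del: of_real_power)
  ultimately have le: "s <= K * (sqrt \<mu> * sqrt s)" using s0 by simp
  show ?thesis
  proof (cases "s = 0")
   case False
   then have "0 < sqrt s" using s0 by simp
   moreover have "sqrt s * sqrt s <= (K * sqrt \<mu>) * sqrt s" using le s0 by (simp add: mult_ac)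
   ultimately have "sqrt s <= K * sqrt \<mu>" by (rule mult_right_le_imp_le[rotated])
   then have "(sqrt s)^2 <= (K * sqrt \<mu>)^2" using s0 by (intro power_mono) auto
   then show ?thesis using s0 \<mu>0 by (simp add: s_def power_mult_distrib)
  qed (use K \<mu>0 in \<open>simp add: s_def\<close>)
 qed
 have "(\<Sum>Q\<in>Q0. (cmod (\<gamma> Q))^2) <= K\<^sup>2 * 1" if "finite Q0" "Q0 \<subseteq> dyadic_rects" for Q0
  by (rule \<gamma>[OF that shadow_measure_1])
 then obtain g where g: "g \<in> L2_0" "!!Q. Q \<in> dyadic_rects ==> haar_coeff g Q = \<gamma> Q" using haar_riesz_fischer by blast
 have gle: "(\<Sum>R\<in>F. (cmod (haar_coeff g R))^2) <= K\<^sup>2 * measure lebesgue W"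
  if W: "torus_open W" "W ~= {}" and F: "finite F" "F \<subseteq> rects_in W" for W F
 proof -
  have Fd: "F \<subseteq> dyadic_rects" using F(2) by (auto simp: rects_in_def)
  have "(\<Sum>R\<in>F. (cmod (haar_coeff g R))^2) = (\<Sum>R\<in>F. (cmod (\<gamma> R))^2)" by (intro sum.cong refl) (use g(2) Fd in auto)
  also have "... <= K\<^sup>2 * measure lebesgue W"
   by (rule \<gamma>[OF F(1) Fd shadow_measure[OF F torus_open_lmeasurable[OF W(1)]]])
  finally show ?thesis .
 qed
 show "\<exists>g\<in>BMO. paraproduct \<beta> \<phi> f g \<and> bmo_norm g <= 4 * 192 ^ CARD('n) * B * bmo_norm f"
 proof (intro bexI conjI)
  show "g \<in> BMO" by (rule BMO_I(1)[OF g(1) K gle])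
  show "bmo_norm g <= 4 * 192 ^ CARD('n) * B * bmo_norm f" using BMO_I(2)[OF g(1) K gle] by (simp add: K_def)
  show "paraproduct \<beta> \<phi> f g" unfolding paraproduct_def
  proof (intro conjI g(1) ballI)
   fix Q :: "'n => real set" assume Q: "Q \<in> dyadic_rects"
   have "((%R. haar_coeff \<phi> R * inner_torus f (haar_rect (%j. 1 - \<beta> j) R) * inner_torus (haar_rect \<beta> R) (haar_rect (%_. 0) Q))
     has_sum haar_coeff g Q) dyadic_rects \<longleftrightarrow> ((%R. t R * of_real (haar_pair \<beta> Q R)) has_sum \<gamma> Q) dyadic_rects"
    unfolding g(2)[OF Q]
    by (rule has_sum_cong) (simp add: t_def inner_torus_cnj[of "haar_rect \<beta> _"] inner_haar_pair[OF Q])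
   then show "((%R. haar_coeff \<phi> R * inner_torus f (haar_rect (%j. 1 - \<beta> j) R) * inner_torus (haar_rect \<beta> R) (haar_rect (%_. 0) Q))
     has_sum haar_coeff g Q) dyadic_rects" using hs[OF Q] by simp
  qed
 qed
qed

section \<open>Haar coefficients of paraproducts of finite Haar sums\<close>

lemma has_sum_finite_support:
 fixes u :: "'a => complex"
 assumes "(u has_sum s) A" "finite G" "G \<subseteq> A" "!!R. R \<in> A ==> R \<notin> G ==> u R = 0"
 shows "s = sum u G"
proof -
 have "(u has_sum s) A \<longleftrightarrow> (u has_sum s) G" by (rule has_sum_cong_neutral) (use assms in auto)
 then have "(u has_sum s) G" using assms(1) by simp
 moreover have "(u has_sum sum u G) G" by (rule has_sum_finite[OF assms(2)])
 ultimately show ?thesis by (rule has_sum_unique)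
qed

lemma has_sum_single_support:
 fixes u :: "'a => complex"
 assumes "(u has_sum s) A" "Q \<in> A" "!!R. R \<in> A ==> R ~= Q ==> u R = 0"
 shows "s = u Q"
 using has_sum_finite_support[OF assms(1), of "{Q}"] assms(2,3) by simp

lemma paraproduct_0_coeff:
 assumes "paraproduct (%_. 0) \<phi> f g" "Q \<in> dyadic_rects"
 shows "haar_coeff g Q = haar_coeff \<phi> Q * inner_torus f (haar_rect (%_. 1) Q)"
proof -
 have "((%R. haar_coeff \<phi> R * inner_torus f (haar_rect (%_. 1) R) * inner_torus (haar_rect (%_. 0) R) (haar_rect (%_. 0) Q))
  has_sum haar_coeff g Q) dyadic_rects"
  using assms by (simp add: paraproduct_def)
 then have "haar_coeff g Q = haar_coeff \<phi> Q * inner_torus f (haar_rect (%_. 1) Q) * inner_torus (haar_rect (%_. 0) Q) (haar_rect (%_. 0) Q)"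
  using assms(2) by (rule has_sum_single_support) (simp add: inner_haar_pair haar_orthonormal assms(2))
 then show ?thesis by (simp add: inner_haar_pair haar_orthonormal assms(2))
qed

lemma paraproduct_1_coeff:
 assumes "paraproduct (%_. 1) \<phi> f g" "Q \<in> dyadic_rects" "finite G" "G \<subseteq> dyadic_rects"
  and "!!R. R \<in> dyadic_rects ==> R \<notin> G ==> haar_coeff f R = 0"
 shows "haar_coeff g Q = (\<Sum>R\<in>G. haar_coeff \<phi> R * haar_coeff f R * of_real (haar_pair (%_. 1) Q R))"
proof -
 have "((%R. haar_coeff \<phi> R * haar_coeff f R * inner_torus (haar_rect (%_. 1) R) (haar_rect (%_. 0) Q))
  has_sum haar_coeff g Q) dyadic_rects"
  using assms(1,2) by (simp add: paraproduct_def haar_coeff_def)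
 then have "haar_coeff g Q = (\<Sum>R\<in>G. haar_coeff \<phi> R * haar_coeff f R * inner_torus (haar_rect (%_. 1) R) (haar_rect (%_. 0) Q))"
  by (rule has_sum_finite_support[OF _ assms(3,4)]) (simp add: assms(5))
 also have "... = (\<Sum>R\<in>G. haar_coeff \<phi> R * haar_coeff f R * of_real (haar_pair (%_. 1) Q R))"
 proof (rule sum.cong[OF refl])
  fix R assume "R \<in> G"
  then have "R \<in> dyadic_rects" using assms(4) by blast
  then show "haar_coeff \<phi> R * haar_coeff f R * inner_torus (haar_rect (%_. 1) R) (haar_rect (%_. 0) Q)
   = haar_coeff \<phi> R * haar_coeff f R * of_real (haar_pair (%_. 1) Q R)"
   unfolding inner_torus_cnj[of "haar_rect (%_. 1) R" "haar_rect (%_. 0) Q"] inner_haar_pair[OF assms(2) \<open>R \<in> dyadic_rects\<close>]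
   by (simp only: complex_cnj_complex_of_real)
 qed
 finally show ?thesis .
qed

lemma grid_rect_full_side:
 assumes "n \<in> scales L" "x \<in> grid L" "n j = 0"
 shows "grid_rect L n x j = {0..<1}"
 using corner_less[OF assms(1,2), of j] assms(3) by (simp add: grid_rect_def drect_def dint_def)

lemma no_full_side_coeff:
 assumes "no_full_side \<phi>" "n \<in> scales L" "x \<in> grid L" "n j = 0"
 shows "haar_coeff \<phi> (grid_rect L n x) = 0"
 using assms(1) grid_rect_full_side[OF assms(2-4)] grid_rect_below[OF assms(2,3)] rects_below_dyadic
 unfolding no_full_side_def by blast

section \<open>Necessity of the logarithmic condition\<close>

text \<open>The one-dimensional factor of the mean of a Haar function over a smaller interval.\<close>

lemma sum_mean_coeff_ker:
 assumes "m < q" "q < L" "x < 2 ^ L" "y < 2 ^ L" "same_cell L m x y"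
 shows "(\<Sum>s<2 ^ L. mean_ker L q y s * coeff_ker L m x s) = half_sign L m y / 2 ^ (L - m)"
proof -
 have "mean_ker L q y s * coeff_ker L m x s = half_sign L m y / 2 ^ (L - m) * mean_ker L q y s" for s
 proof (cases "same_cell L q y s")
  case True
  then have "same_cell L (Suc m) y s" using assms(1) by (intro same_cell_mono[of L q y s "Suc m"]) auto
  then have "half_sign L m y = half_sign L m s" "same_cell L m y s" by (auto intro: half_sign_same_cell same_cell_mono)
  then show ?thesis using same_cell_trans[OF assms(5)] by (simp add: coeff_ker_def mean_ker_def)
 qed (simp add: mean_ker_def)
 then have "(\<Sum>s<2 ^ L. mean_ker L q y s * coeff_ker L m x s) = half_sign L m y / 2 ^ (L - m) * (\<Sum>s<2 ^ L. mean_ker L q y s)"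
  by (simp add: sum_distrib_left)
 then show ?thesis using sum_mean_ker[of q L y] assms(2,4) by simp
qed

lemma mean_pair_ancestor:
 fixes m q :: "'n::finite => nat"
 assumes m: "m \<in> scales L" and q: "q \<in> scales L" and x: "x \<in> grid L" and y: "y \<in> grid L"
  and lt: "!!j. m j < q j" and sc: "!!j. same_cell L (m j) (x j) (y j)"
 shows "haar_pair (%_. 1) (grid_rect L m x) (grid_rect L q y) = (\<Prod>j\<in>UNIV. sqrt (2 ^ m j) * half_sign L (m j) (y j))"
proof -
 have "haar_pair (%_. 1) (grid_rect L m x) (grid_rect L q y) =
  (\<Prod>j\<in>UNIV. 2 ^ L / sqrt (2 ^ m j) * (\<Sum>s<2 ^ L. mean_ker L (q j) (y j) s * coeff_ker L (m j) (x j) s))"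
  unfolding haar_pair_grid[OF grid_rect_below[OF m x] q] ker_op_haar_grid[OF m]
  by (simp add: pair_ker_def haar_unit_def)
 also have "... = (\<Prod>j\<in>UNIV. sqrt (2 ^ m j) * half_sign L (m j) (y j))"
 proof (rule prod.cong[OF refl])
  fix j
  have "(2::real) ^ L = 2 ^ m j * 2 ^ (L - m j)" using scalesD[OF m, of j] by (simp flip: power_add)
  then have "2 ^ L / sqrt (2 ^ m j) / 2 ^ (L - m j) = 2 ^ m j / sqrt (2 ^ m j)" by simp
  also have "... = sqrt (2 ^ m j)" by (rule real_div_sqrt) simp
  finally show "2 ^ L / sqrt (2 ^ m j) * (\<Sum>s<2 ^ L. mean_ker L (q j) (y j) s * coeff_ker L (m j) (x j) s)
   = sqrt (2 ^ m j) * half_sign L (m j) (y j)"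
   using sum_mean_coeff_ker[OF lt scalesD[OF q] gridD[OF x] gridD[OF y] sc, of j] by (simp add: field_simps)
 qed
 finally show ?thesis .
qed

text \<open>The scales of the proper ancestors in each coordinate. A full side has no proper ancestor; it is kept itself, so that
  the product of Haar functions is defined.\<close>

definition chain_scales :: "('n::finite => nat) => ('n => nat) set" where
 "chain_scales n = PiE UNIV (%j. {..<max (n j) 1})"

lemma finite_chain_scales [simp]: "finite (chain_scales n)"
 unfolding chain_scales_def by (intro finite_PiE) auto

lemma card_chain_scales: "card (chain_scales n) = (\<Prod>j\<in>UNIV. max (n j) 1)"
 by (simp add: chain_scales_def card_PiE)

lemma chain_scales_lt: "m \<in> chain_scales n ==> m j < max (n j) 1"
 unfolding chain_scales_def by (auto dest: PiE_mem)

lemma chain_scales_scales: "n \<in> scales L ==> m \<in> chain_scales n ==> m \<in> scales L"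
proof -
 assume n: "n \<in> scales L" and m: "m \<in> chain_scales n"
 have "m j < L" for j using chain_scales_lt[OF m, of j] scalesD[OF n, of j] by (auto simp: max_def split: if_splits)
 then show ?thesis by (simp add: scales_def)
qed

text \<open>The signs make all terms positive at \<open>x\<close>; the size is the square root of the measure of the ancestor.\<close>

definition chain_coeff :: "nat => ('n::finite => nat) => ('n => nat) => real" where
 "chain_coeff L x m = (\<Prod>j\<in>UNIV. half_sign L (m j) (x j) / sqrt (2 ^ m j))"

definition chain_fun :: "nat => ('n::finite => nat) => ('n => nat) => real ^ 'n => complex" where
 "chain_fun L n x z = (\<Sum>m\<in>chain_scales n. of_real (chain_coeff L x m) * haar_rect (%_. 0) (grid_rect L m x) z)"

lemma chain_fun_sum:
 assumes "n \<in> scales L" "x \<in> grid L"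
 shows "\<exists>c. (\<forall>z. chain_fun L n x z = (\<Sum>R\<in>(%m. grid_rect L m x) ` chain_scales n. c R * haar_rect (%_. 0) R z)) \<and>
  (\<forall>m\<in>chain_scales n. c (grid_rect L m x) = of_real (chain_coeff L x m))"
proof -
 have inj: "inj_on (%m. grid_rect L m x) (chain_scales n)"
  unfolding grid_rect_def by (rule inj_onI) (use drect_inj in blast)
 define c where "c = (%R. complex_of_real (chain_coeff L x (the_inv_into (chain_scales n) (%m. grid_rect L m x) R)))"
 have c: "c (grid_rect L m x) = of_real (chain_coeff L x m)" if "m \<in> chain_scales n" for m
  unfolding c_def using the_inv_into_f_f[OF inj that] by simp
 show ?thesis
  by (rule exI[of _ c]) (simp add: chain_fun_def sum.reindex[OF inj] c)
qed

text \<open>Every term has mean of modulus one with the same sign, so the mean counts the ancestors. Over a full side the sign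
  is that of the coarsest Haar function, which is constant on the half containing \<open>q\<close>'s side.\<close>

lemma mean_chain_fun:
 fixes n q :: "'n::finite => nat"
 assumes n: "n \<in> scales L" and q: "q \<in> scales L" and x: "x \<in> grid L" and y: "y \<in> cell L n x"
  and nq: "!!j. n j <= q j" and q0: "!!j. 0 < q j"
 shows "cmod (inner_torus (chain_fun L n x) (haar_rect (%_. 1) (grid_rect L q y))) = (\<Prod>j\<in>UNIV. real (max (n j) 1))"
proof -
 have yg: "y \<in> grid L" using y cell_subset_grid by blast
 have Qd: "grid_rect L q y \<in> dyadic_rects" using grid_rect_below[OF q yg] rects_below_dyadic by blast
 define \<sigma> where "\<sigma> = (\<Prod>j\<in>UNIV. if n j = 0 then half_sign L 0 (x j) * half_sign L 0 (y j) else 1)"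
 have \<sigma>: "\<bar>\<sigma>\<bar> = 1" unfolding \<sigma>_def abs_prod by (rule prod.neutral) (auto simp: abs_mult)
 have step: "step_at L (haar_rect (%_. 1) (grid_rect L q y))" by (rule step_at_haar[OF grid_rect_below[OF q yg]])
 have "inner_torus (chain_fun L n x) (haar_rect (%_. 1) (grid_rect L q y)) =
  (\<Sum>m\<in>chain_scales n. of_real (chain_coeff L x m) * inner_torus (haar_rect (%_. 0) (grid_rect L m x)) (haar_rect (%_. 1) (grid_rect L q y)))"
  unfolding chain_fun_def[abs_def]
  by (rule inner_torus_sum_left[OF step_at_L2[OF step_at_haar] step]) (rule grid_rect_below[OF chain_scales_scales[OF n] x])
 also have "... = (\<Sum>m\<in>chain_scales n. complex_of_real \<sigma>)"
 proof (rule sum.cong[OF refl])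
  fix m assume m: "m \<in> chain_scales n"
  have ms: "m \<in> scales L" by (rule chain_scales_scales[OF n m])
  have Rd: "grid_rect L m x \<in> dyadic_rects" using grid_rect_below[OF ms x] rects_below_dyadic by blast
  have lt: "m j < q j" for j using chain_scales_lt[OF m, of j] nq[of j] q0[of j] by (auto simp: max_def split: if_splits)
  have scn: "same_cell L (n j) (x j) (y j)" for j using y by (simp add: cell_def)
  have sc: "same_cell L (m j) (x j) (y j)" for j
  proof (cases "n j = 0")
   case True
   then show ?thesis using chain_scales_lt[OF m, of j] scn[of j] by simp
  next
   case False
   then show ?thesis using chain_scales_lt[OF m, of j] by (intro same_cell_mono[OF scn]) (simp add: max_def split: if_splits)
  qed
  have "chain_coeff L x m * haar_pair (%_. 1) (grid_rect L m x) (grid_rect L q y) = \<sigma>"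
   unfolding mean_pair_ancestor[OF ms q x yg lt sc] chain_coeff_def prod.distrib[symmetric] \<sigma>_def
  proof (rule prod.cong[OF refl])
   fix j
   show "half_sign L (m j) (x j) / sqrt (2 ^ m j) * (sqrt (2 ^ m j) * half_sign L (m j) (y j))
    = (if n j = 0 then half_sign L 0 (x j) * half_sign L 0 (y j) else 1)"
   proof (cases "n j = 0")
    case True
    then show ?thesis using chain_scales_lt[OF m, of j] by simp
   next
    case False
    then have "Suc (m j) <= n j" using chain_scales_lt[OF m, of j] by (simp add: max_def split: if_splits)
    then have "half_sign L (m j) (x j) = half_sign L (m j) (y j)" by (intro half_sign_same_cell same_cell_mono[OF scn])
    then show ?thesis using False by simp
   qed
  qed
  then show "of_real (chain_coeff L x m) * inner_torus (haar_rect (%_. 0) (grid_rect L m x)) (haar_rect (%_. 1) (grid_rect L q y))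
   = complex_of_real \<sigma>"
   unfolding inner_haar_pair[OF Rd Qd] by (simp flip: of_real_mult)
 qed
 finally have e: "inner_torus (chain_fun L n x) (haar_rect (%_. 1) (grid_rect L q y)) = (\<Sum>m\<in>chain_scales n. complex_of_real \<sigma>)" .
 have "cmod (inner_torus (chain_fun L n x) (haar_rect (%_. 1) (grid_rect L q y))) = real (card (chain_scales n))"
  unfolding e using \<sigma> by (simp add: norm_mult)
 then show ?thesis unfolding card_chain_scales of_nat_prod .
qed

lemma card_flipped_cell:
 assumes "m < L" "x < 2 ^ L"
 shows "card {t. t < 2 ^ L \<and> same_cell L m x t \<and> half_sign L m t ~= half_sign L m x} = 2 ^ (L - Suc m)"
proof -
 define A where "A = {t. t < 2 ^ L \<and> same_cell L m x t \<and> half_sign L m t ~= half_sign L m x}"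
 have fin: "finite {t. t < (2::nat) ^ L \<and> P t}" for P by simp
 have "{t. t < 2 ^ L \<and> same_cell L m x t} = A \<union> {t. t < 2 ^ L \<and> same_cell L (Suc m) x t}"
  using same_cell_Suc[OF assms(1), of x] same_cell_mono[of L "Suc m" x _ m] by (auto simp: A_def)
 moreover have "A \<inter> {t. t < 2 ^ L \<and> same_cell L (Suc m) x t} = {}"
  using half_sign_same_cell by (fastforce simp: A_def)
 ultimately have "card {t. t < 2 ^ L \<and> same_cell L m x t} = card A + card {t. t < 2 ^ L \<and> same_cell L (Suc m) x t}"
  by (simp add: card_Un_disjoint A_def)
 then have "2 ^ (L - m) = card A + 2 ^ (L - Suc m)" using card_same_cell[of m L x] card_same_cell[of "Suc m" L x] assms by simp
 moreover have "(2::nat) ^ (L - m) = 2 * 2 ^ (L - Suc m)" using assms(1) by (metis Suc_diff_Suc power_Suc)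
 ultimately show ?thesis by (simp add: A_def)
qed

text \<open>The part of an ancestor on the other side of every midpoint: a fixed proportion of it, and different ancestors have
  disjoint such parts.\<close>

definition flipped_cell :: "nat => ('n::finite => nat) => ('n => nat) => ('n => nat) set" where
 "flipped_cell L m x = {y \<in> cell L m x. \<forall>j. half_sign L (m j) (y j) ~= half_sign L (m j) (x j)}"

lemma card_flipped:
 fixes m :: "'n::finite => nat"
 assumes "m \<in> scales L" "x \<in> grid L"
 shows "real (card (flipped_cell L m x)) * 2 ^ CARD('n) = 2 ^ (L * CARD('n)) / weight m"
proof -
 have "flipped_cell L m x = PiE UNIV (%j. {t. t < 2 ^ L \<and> same_cell L (m j) (x j) t \<and> half_sign L (m j) t ~= half_sign L (m j) (x j)})"
  by (auto simp: flipped_cell_def cell_def grid_def PiE_def)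
 then have "card (flipped_cell L m x) = (\<Prod>j\<in>UNIV. 2 ^ (L - Suc (m j)))"
  using card_flipped_cell[OF scalesD[OF assms(1)] gridD[OF assms(2)]] by (simp add: card_PiE)
 then have "real (card (flipped_cell L m x)) * 2 ^ CARD('n) = (\<Prod>j\<in>UNIV. 2 ^ (L - Suc (m j))) * (\<Prod>j\<in>(UNIV :: 'n set). 2)" by simp
 also have "... = (\<Prod>j\<in>UNIV. 2 ^ L / 2 ^ m j)"
  unfolding prod.distrib[symmetric]
 proof (rule prod.cong[OF refl])
  fix j
  have "(2::real) ^ L = 2 ^ m j * (2 ^ (L - Suc (m j)) * 2)" using scalesD[OF assms(1), of j]
   by (metis Suc_diff_Suc le_add_diff_inverse less_imp_le power_Suc2 power_add)
  then show "(2::real) ^ (L - Suc (m j)) * 2 = 2 ^ L / 2 ^ m j" by simp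
 qed
 also have "... = 2 ^ (L * CARD('n)) / weight m" by (simp add: prod_dividef weight_def power_mult)
 finally show ?thesis .
qed

lemma flipped_disjoint:
 fixes m m' :: "'n::finite => nat"
 assumes "m ~= m'"
 shows "flipped_cell L m x \<inter> flipped_cell L m' x = {}"
proof -
 have *: "flipped_cell L m x \<inter> flipped_cell L m' x = {}" if "m j < m' j" for m m' :: "'n => nat" and j
 proof -
  have False if "y \<in> flipped_cell L m x" "y \<in> flipped_cell L m' x" for y
  proof -
   have "same_cell L (m' j) (x j) (y j)" using that(2) by (simp add: flipped_cell_def cell_def)
   then have "same_cell L (Suc (m j)) (x j) (y j)" by (rule same_cell_mono) (use \<open>m j < m' j\<close> in simp)
   then have "half_sign L (m j) (x j) = half_sign L (m j) (y j)" by (rule half_sign_same_cell)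
   moreover have "half_sign L (m j) (y j) ~= half_sign L (m j) (x j)" using that(1) by (simp add: flipped_cell_def)
   ultimately show False by simp
  qed
  then show ?thesis by blast
 qed
 obtain j where "m j ~= m' j" using assms by (auto simp: fun_eq_iff)
 then consider "m j < m' j" | "m' j < m j" by linarith
 then show ?thesis using * by cases blast+
qed

lemma chain_fun_BMO:
 fixes n :: "'n::finite => nat"
 assumes n: "n \<in> scales L" and x: "x \<in> grid L"
 shows "chain_fun L n x \<in> BMO" "bmo_norm (chain_fun L n x) <= sqrt (2 ^ CARD('n))"
proof -
 define A where "A = (%m. grid_rect L m x) ` chain_scales n"
 obtain c where c0: "\<forall>z. chain_fun L n x z = (\<Sum>R\<in>A. c R * haar_rect (%_. 0) R z)"
  and cc0: "\<forall>m\<in>chain_scales n. c (grid_rect L m x) = of_real (chain_coeff L x m)"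
  using chain_fun_sum[OF n x, folded A_def] by blast
 have c: "chain_fun L n x z = (\<Sum>R\<in>A. c R * haar_rect (%_. 0) R z)" for z using c0 by (rule spec)
 have cc: "c (grid_rect L m x) = of_real (chain_coeff L x m)" if "m \<in> chain_scales n" for m using cc0 that by (rule bspec)
 have fin: "finite A" by (simp add: A_def)
 have Ab: "A \<subseteq> rects_below L" unfolding A_def using grid_rect_below[OF chain_scales_scales[OF n] x] by blast
 have Ad: "A \<subseteq> dyadic_rects" using Ab rects_below_dyadic by blast
 have fe: "chain_fun L n x = (%z. \<Sum>R\<in>A. c R * haar_rect (%_. 0) R z)" using c by (rule ext)
 have coeff: "haar_coeff (chain_fun L n x) R = (if R \<in> A then c R else 0)" if "R \<in> dyadic_rects" for R
  unfolding fe by (rule haar_coeff_sum[OF fin Ad that])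
 have l2: "chain_fun L n x \<in> L2_0" unfolding fe by (rule haar_sum_L2_0[OF fin Ad])
 have sq: "(cmod (c (grid_rect L m x)))^2 = 1 / weight m" if "m \<in> chain_scales n" for m
 proof -
  have "(chain_coeff L x m)^2 = (\<Prod>j\<in>UNIV. 1 / 2 ^ m j)"
   unfolding chain_coeff_def prod_power_distrib by (simp add: power_divide)
  then show ?thesis unfolding cc[OF that] by (simp add: weight_def prod_dividef)
 qed
 have le: "(\<Sum>R\<in>F. (cmod (haar_coeff (chain_fun L n x) R))^2) <= (sqrt (2 ^ CARD('n)))^2 * measure lebesgue W"
  if W: "torus_open W" and F: "finite F" "F \<subseteq> rects_in W" for W F
 proof -
  define M where "M = {m \<in> chain_scales n. grid_rect L m x \<in> F}"
  have finM: "finite M" by (simp add: M_def)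
  have inj: "inj_on (%m. grid_rect L m x) M" unfolding grid_rect_def by (rule inj_onI) (use drect_inj in blast)
  have Fd: "F \<subseteq> dyadic_rects" using F(2) by (auto simp: rects_in_def)
  have "(\<Sum>R\<in>F. (cmod (haar_coeff (chain_fun L n x) R))^2) = (\<Sum>R\<in>(%m. grid_rect L m x) ` M. (cmod (c R))^2)"
  proof (rule sum.mono_neutral_cong_right[OF F(1)])
   show "\<forall>R\<in>F - (%m. grid_rect L m x) ` M. (cmod (haar_coeff (chain_fun L n x) R))^2 = 0"
   proof
    fix R assume R: "R \<in> F - (%m. grid_rect L m x) ` M"
    then have "R \<notin> A" by (auto simp: A_def M_def)
    then show "(cmod (haar_coeff (chain_fun L n x) R))^2 = 0" using coeff[of R] R Fd by auto
   qed
   show "(cmod (haar_coeff (chain_fun L n x) R))^2 = (cmod (c R))^2" if "R \<in> (%m. grid_rect L m x) ` M" for R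
   proof -
    have "R \<in> A" using that by (auto simp: A_def M_def)
    then show ?thesis using coeff[of R] Ad by auto
   qed
  qed (auto simp: M_def)
  also have "... = (\<Sum>m\<in>M. 1 / weight m)"
   unfolding sum.reindex[OF inj] by (rule sum.cong[OF refl]) (simp add: sq M_def)
  also have "... = (\<Sum>m\<in>M. real (card (flipped_cell L m x)) * 2 ^ CARD('n) / 2 ^ (L * CARD('n)))"
  proof (rule sum.cong[OF refl])
   fix m assume "m \<in> M"
   then have "m \<in> scales L" using chain_scales_scales[OF n] by (simp add: M_def)
   from card_flipped[OF this x] show "1 / weight m = real (card (flipped_cell L m x)) * 2 ^ CARD('n) / 2 ^ (L * CARD('n))" by simp
  qed
  also have "... = 2 ^ CARD('n) * (real (\<Sum>m\<in>M. card (flipped_cell L m x)) / 2 ^ (L * CARD('n)))"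
   by (simp add: sum_divide_distrib sum_distrib_left mult.commute)
  also have "(\<Sum>m\<in>M. card (flipped_cell L m x)) = card (\<Union>m\<in>M. flipped_cell L m x)"
  proof (rule card_UN_disjoint[symmetric, OF finM])
   show "\<forall>m\<in>M. finite (flipped_cell L m x)"
    using finite_subset[OF _ finite_grid] by (auto simp: flipped_cell_def cell_def)
   show "\<forall>m\<in>M. \<forall>m'\<in>M. m ~= m' --> flipped_cell L m x \<inter> flipped_cell L m' x = {}" using flipped_disjoint by blast
  qed
  also have "real (card (\<Union>m\<in>M. flipped_cell L m x)) / 2 ^ (L * CARD('n)) <= card (shadow L F) / 2 ^ (L * CARD('n))"
  proof (intro divide_right_mono of_nat_mono card_mono finite_subset[OF shadow_grid finite_grid] UN_least)
   fix m assume m: "m \<in> M"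
   then have "m \<in> scales L" using chain_scales_scales[OF n] by (simp add: M_def)
   then have "cell L m x \<subseteq> shadow L F" by (rule cell_shadow[OF _ x]) (use m in \<open>simp add: M_def\<close>)
   then show "flipped_cell L m x \<subseteq> shadow L F" by (auto simp: flipped_cell_def)
  qed simp
  also have "... <= measure lebesgue W" by (rule shadow_measure[OF F torus_open_lmeasurable[OF W]])
  finally show ?thesis by simp
 qed
 show "chain_fun L n x \<in> BMO" by (rule BMO_I(1)[OF l2 _ le]) auto
 show "bmo_norm (chain_fun L n x) <= sqrt (2 ^ CARD('n))" by (rule BMO_I(2)[OF l2 _ le]) auto
qed

lemma cell_subset_scale:
 fixes n q :: "'n::finite => nat"
 assumes "q \<in> scales L" "n \<in> scales L" "y \<in> grid L" "x \<in> grid L" "cell L q y \<subseteq> cell L n x"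
 shows "n j <= q j"
proof -
 have sub: "{t. t < 2 ^ L \<and> same_cell L (q j) (y j) t} \<subseteq> {t. t < 2 ^ L \<and> same_cell L (n j) (x j) t}"
 proof safe
  fix t assume t: "t < 2 ^ L" "same_cell L (q j) (y j) t"
  then have "y(j := t) \<in> cell L q y" using assms(3) by (auto simp: cell_def grid_def)
  then have "y(j := t) \<in> cell L n x" using assms(5) by blast
  then have "same_cell L (n j) (x j) ((y(j := t)) j)" unfolding cell_def by blast
  then show "same_cell L (n j) (x j) t" by simp
 qed
 have "card {t. t < 2 ^ L \<and> same_cell L (q j) (y j) t} <= card {t. t < 2 ^ L \<and> same_cell L (n j) (x j) t}"
  by (rule card_mono[OF _ sub]) simp
 then have "(2::nat) ^ (L - q j) <= 2 ^ (L - n j)"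
  using card_same_cell[of "q j" L "y j"] card_same_cell[of "n j" L "x j"] scalesD[OF assms(1), of j] scalesD[OF assms(2), of j]
   gridD[OF assms(3), of j] gridD[OF assms(4), of j] by simp
 then have "L - q j <= L - n j" by simp
 then show ?thesis using scalesD[OF assms(1), of j] scalesD[OF assms(2), of j] by linarith
qed

text \<open>Almost inclusion of dyadic rectangles is inclusion, since cells have positive measure.\<close>

lemma ae_subset_cells:
 fixes n q :: "'n::finite => nat"
 assumes q: "q \<in> scales L" and n: "n \<in> scales L" and y: "y \<in> grid L" and x: "x \<in> grid L"
  and sub: "ae_subset (rect (grid_rect L q y)) (rect (grid_rect L n x))"
 shows "cell L q y \<subseteq> cell L n x"
proof -
 define F where "F = {grid_rect L q y, grid_rect L n x}"
 have nL: "n j <= L" for j using scalesD[OF n, of j] by simp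
 have cg: "cell L n x \<subseteq> grid L" by (rule cell_subset_grid)
 have re: "rect (grid_rect L n x) = cubes L (cell L n x)" unfolding cubes_def by (rule rect_cubes[OF nL x])
 have "F \<subseteq> rects_in (rect (grid_rect L n x))"
  using sub grid_rect_below[OF q y] grid_rect_below[OF n x] rects_below_dyadic by (auto simp: F_def rects_in_def ae_subset_def)
 moreover have "rect (grid_rect L n x) \<in> lmeasurable" unfolding re by (rule cubes_lmeasurable[OF cg])
 ultimately have "card (shadow L F) / 2 ^ (L * CARD('n)) <= measure lebesgue (rect (grid_rect L n x))"
  by (intro shadow_measure) (simp_all add: F_def)
 then have "card (shadow L F) <= card (cell L n x)" unfolding re measure_cubes[OF cg] by (simp add: divide_le_cancel)
 moreover have "cell L n x \<subseteq> shadow L F" by (rule cell_shadow[OF n x]) (simp add: F_def)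
 ultimately have "cell L n x = shadow L F" by (intro card_seteq finite_subset[OF shadow_grid finite_grid])
 moreover have "cell L q y \<subseteq> shadow L F" by (rule cell_shadow[OF q y]) (simp add: F_def)
 ultimately show ?thesis by simp
qed

lemma ae_subset_trans:
 assumes "ae_subset A B" "ae_subset B C"
 shows "ae_subset A C"
proof -
 have "negligible (A - B \<union> (B - C))" using assms(1,2) unfolding ae_subset_def negligible_iff_null_sets[symmetric] by (rule negligible_Un)
 then have "negligible (A - C)" by (rule negligible_subset) blast
 then show ?thesis by (simp add: ae_subset_def negligible_iff_null_sets)
qed

text \<open>On rectangles in \<open>R\<close> without full sides the coefficients of \<open>\<Pi>\<^sub>\<phi> f\<close> are those of \<open>\<phi>\<close> times the number of ancestors,
  a product in which each factor is at least a third of the corresponding logarithm.\<close>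

theorem paraproduct_0_lower:
 fixes \<phi> :: "real ^ 'n::finite => complex"
 assumes nf: "no_full_side \<phi>" and K: "0 <= K" and bd: "paraproduct_bound (%_. 0) \<phi> K"
 shows "lmo_bound (%_. 0) \<phi> (18 ^ CARD('n) * K\<^sup>2)"
 unfolding lmo_bound_def
proof (intro ballI allI impI)
 fix R :: "'n => real set" and W :: "(real ^ 'n) set"
 assume R: "R \<in> dyadic_rects" and "torus_open W \<and> W ~= {} \<and> ae_subset W (rect R)"
 then have W: "torus_open W" "W ~= {}" and ae: "ae_subset W (rect R)" by auto
 define P where "P = (%n :: 'n => nat. \<Prod>j\<in>UNIV. real (max (n j) 1))"
 have P: "0 < P n" for n unfolding P_def by (intro prod_pos) auto
 obtain nR pR where Rn: "R = drect nR pR" using R by (auto simp: dyadic_rects_eq)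
 define D where "D = 2 ^ CARD('n) * K\<^sup>2 / (P nR)^2"
 have D: "0 <= D" by (simp add: D_def)
 have key: "(\<Sum>Q\<in>F. (cmod (haar_coeff \<phi> Q))^2) <= D * measure lebesgue W" if F: "finite F" "F \<subseteq> rects_in W" for F
 proof -
  have Fd: "F \<subseteq> dyadic_rects" using F(2) by (auto simp: rects_in_def)
  have "finite (insert R F)" "insert R F \<subseteq> dyadic_rects" using F(1) Fd R by auto
  then obtain L where "0 < L" and L: "insert R F \<subseteq> rects_below L" by (rule finite_dyadic_below)
  then have "R \<in> rects_below L" by blast
  then obtain n x where n: "n \<in> scales L" and x: "x \<in> grid L" and Rx: "R = grid_rect L n x" by (rule rects_belowE)
  have "drect nR pR = drect n (corner L n x)" unfolding Rn[symmetric] Rx grid_rect_def by (rule refl)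
  then have nR: "nR = n" using drect_inj by blast
  define f where "f = chain_fun L n x"
  have f: "f \<in> BMO" "bmo_norm f <= sqrt (2 ^ CARD('n))" unfolding f_def by (rule chain_fun_BMO[OF n x])+
  obtain g where g: "g \<in> BMO" "paraproduct (%_. 0) \<phi> f g" "bmo_norm g <= K * bmo_norm f"
   using bd f(1) unfolding paraproduct_bound_def by blast
  have term_le: "(P n)^2 * (cmod (haar_coeff \<phi> Q))^2 <= (cmod (haar_coeff g Q))^2" if Q: "Q \<in> F" for Q
  proof -
   have Qd: "Q \<in> dyadic_rects" and Qb: "Q \<in> rects_below L" using Q Fd L by auto
   obtain q y where q: "q \<in> scales L" and y: "y \<in> grid L" and Qy: "Q = grid_rect L q y" using Qb by (rule rects_belowE)
   show ?thesis
   proof (cases "\<exists>j. q j = 0")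
    case True
    then have "haar_coeff \<phi> Q = 0" using no_full_side_coeff[OF nf q y] Qy by blast
    then show ?thesis by simp
   next
    case False
    then have q0: "0 < q j" for j by simp
    have "ae_subset (rect Q) W" using F(2) Q by (auto simp: rects_in_def)
    then have "ae_subset (rect Q) (rect R)" using ae by (rule ae_subset_trans)
    then have sub: "cell L q y \<subseteq> cell L n x" unfolding Qy Rx by (rule ae_subset_cells[OF q n y x])
    have "cmod (inner_torus f (haar_rect (%_. 1) Q)) = P n"
     unfolding f_def Qy P_def
     by (rule mean_chain_fun[OF n q x _ cell_subset_scale[OF q n y x sub] q0]) (use sub cell_refl[OF y, of q] in blast)
    then show ?thesis unfolding paraproduct_0_coeff[OF g(2) Qd] by (simp add: norm_mult power_mult_distrib mult.commute)
   qed
  qed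
  have "(P n)^2 * (\<Sum>Q\<in>F. (cmod (haar_coeff \<phi> Q))^2) <= (\<Sum>Q\<in>F. (cmod (haar_coeff g Q))^2)"
   unfolding sum_distrib_left by (rule sum_mono) (rule term_le)
  also have "... <= (bmo_norm g)^2 * measure lebesgue W" by (rule BMO_sum_le[OF g(1) W F])
  also have "... <= (K * sqrt (2 ^ CARD('n)))^2 * measure lebesgue W"
   by (intro mult_right_mono power_mono order_trans[OF g(3)] mult_left_mono f(2) K bmo_norm_nonneg) simp
  also have "... = (P n)^2 * (D * measure lebesgue W)"
   using P[of n] by (simp add: D_def nR power_mult_distrib)
  finally show ?thesis by (rule mult_left_le_imp_le) (use P[of n] in simp)
 qed
 have avg: "carleson_avg \<phi> W <= ennreal D" unfolding carleson_avg_le_iff[OF W D] using key by blast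
 have lw: "log_weight (%_. 0) R <= 9 ^ CARD('n) * (P nR)^2"
 proof -
  have one: "(ln (4 / measure lborel (R j)))^2 <= 9 * (real (max (nR j) 1))^2" for j
  proof -
   have l2: "ln (2::real) <= 1" using ln_add_one_self_le_self[of 1] by simp
   have "ln (4 / (1 / 2 ^ nR j)) = ln ((2::real) ^ (nR j + 2))" by (simp add: power_add)
   also have "... = real (nR j + 2) * ln 2" by (rule ln_realpow)
   finally have e: "ln (4 / measure lborel (R j)) = (real (nR j) + 2) * ln 2"
    unfolding Rn drect_def measure_dint by simp
   have "(real (nR j) + 2) * ln 2 <= (real (nR j) + 2) * 1" using l2 by (intro mult_left_mono) auto
   also have "... <= 3 * real (max (nR j) 1)" by (simp add: max_def)
   finally have "((real (nR j) + 2) * ln 2)^2 <= (3 * real (max (nR j) 1))^2" by (intro power_mono) auto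
   then show ?thesis unfolding e by (simp add: power_mult_distrib)
  qed
  have "log_weight (%_. 0) R <= (\<Prod>j\<in>UNIV. 9 * (real (max (nR j) 1))^2)"
   unfolding log_weight_def by (rule prod_mono) (use one in simp)
  also have "... = 9 ^ CARD('n) * (P nR)^2" by (simp add: P_def prod.distrib prod_power_distrib)
  finally show ?thesis .
 qed
 have lw0: "0 <= log_weight (%_. 0) R" unfolding log_weight_def by (intro prod_nonneg) auto
 have "ennreal (log_weight (%_. 0) R) * carleson_avg \<phi> W <= ennreal (log_weight (%_. 0) R) * ennreal D"
  by (rule mult_left_mono[OF avg]) simp
 also have "... = ennreal (log_weight (%_. 0) R * D)" using lw0 D by (simp add: ennreal_mult)
 also have "... <= ennreal (18 ^ CARD('n) * K\<^sup>2)"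
 proof (rule ennreal_leI)
  have "log_weight (%_. 0) R * D <= 9 ^ CARD('n) * (P nR)^2 * D" by (rule mult_right_mono[OF lw D])
  also have "... = (9 ^ CARD('n) * 2 ^ CARD('n)) * K\<^sup>2" using P[of nR] by (simp add: D_def)
  also have "... = 18 ^ CARD('n) * K\<^sup>2" by (simp flip: power_mult_distrib)
  finally show "log_weight (%_. 0) R * D <= 18 ^ CARD('n) * K\<^sup>2" .
 qed
 finally show "ennreal (log_weight (%_. 0) R) * carleson_avg \<phi> W <= ennreal (18 ^ CARD('n) * K\<^sup>2)" .
qed

section \<open>Necessity of the product BMO condition\<close>

definition rects_inside :: "nat => ('n::finite => nat) set => ('n => real set) set" where
 "rects_inside L W = {grid_rect L n x | n x. n \<in> scales L \<and> x \<in> grid L \<and> cell L n x \<subseteq> W}"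

lemma rects_inside_below: "rects_inside L W \<subseteq> rects_below L"
 unfolding rects_inside_def using grid_rect_below by blast

lemma finite_rects_inside [simp]: "finite (rects_inside L W)"
 by (rule finite_subset[OF rects_inside_below]) simp

lemma grid_rect_inside_iff:
 assumes "n \<in> scales L" "x \<in> grid L"
 shows "grid_rect L n x \<in> rects_inside L W \<longleftrightarrow> cell L n x \<subseteq> W"
proof
 assume "grid_rect L n x \<in> rects_inside L W"
 then obtain m y where m: "grid_rect L n x = grid_rect L m y" "m \<in> scales L" "y \<in> grid L" "cell L m y \<subseteq> W"
  by (auto simp: rects_inside_def)
 then have "n = m" unfolding grid_rect_def using drect_inj by blast
 then have "y \<in> cell L n x" using m grid_rect_eq_iff[OF assms(2) m(3), of n] by simp
 then have "cell L n y = cell L n x" by (rule cell_eq)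
 then show "cell L n x \<subseteq> W" using m(4) \<open>n = m\<close> by simp
qed (use assms in \<open>auto simp: rects_inside_def\<close>)

lemma sum_rects_inside:
 fixes h :: "('n::finite => real set) => real"
 shows "2 ^ (L * CARD('n)) * (\<Sum>R\<in>rects_inside L W. h R) =
  (\<Sum>n\<in>scales L. \<Sum>x\<in>{x \<in> grid L. cell L n x \<subseteq> W}. weight n * h (grid_rect L n x))"
proof -
 have "(\<Sum>R\<in>rects_inside L W. h R) = (\<Sum>R\<in>rects_below L. if R \<in> rects_inside L W then h R else 0)"
  by (rule sum.mono_neutral_cong_left) (use rects_inside_below in auto)
 also have "... = (\<Sum>n\<in>scales L. \<Sum>x\<in>grid L. (if grid_rect L n x \<in> rects_inside L W then h (grid_rect L n x) else 0) * weight n) / 2 ^ (L * CARD('n))"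
  by (rule sum_rects_below)
 also have "(\<Sum>n\<in>scales L. \<Sum>x\<in>grid L. (if grid_rect L n x \<in> rects_inside L W then h (grid_rect L n x) else 0) * weight n)
  = (\<Sum>n\<in>scales L. \<Sum>x\<in>{x \<in> grid L. cell L n x \<subseteq> W}. weight n * h (grid_rect L n x))"
 proof (rule sum.cong[OF refl])
  fix n :: "'n => nat" assume n: "n \<in> scales L"
  have "(\<Sum>x\<in>{x \<in> grid L. cell L n x \<subseteq> W}. weight n * h (grid_rect L n x))
   = (\<Sum>x\<in>grid L. if cell L n x \<subseteq> W then weight n * h (grid_rect L n x) else 0)"
   by (rule sum.inter_filter) simp
  also have "... = (\<Sum>x\<in>grid L. (if grid_rect L n x \<in> rects_inside L W then h (grid_rect L n x) else 0) * weight n)"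
   by (rule sum.cong[OF refl]) (simp add: grid_rect_inside_iff[OF n])
  finally show "(\<Sum>x\<in>grid L. (if grid_rect L n x \<in> rects_inside L W then h (grid_rect L n x) else 0) * weight n)
   = (\<Sum>x\<in>{x \<in> grid L. cell L n x \<subseteq> W}. weight n * h (grid_rect L n x))" by simp
 qed
 finally show ?thesis by simp
qed

lemma rects_inside_shadow: "F \<subseteq> rects_below L ==> F \<subseteq> rects_inside L (shadow L F)"
proof
 fix R assume F: "F \<subseteq> rects_below L" and R: "R \<in> F"
 then have "R \<in> rects_below L" by blast
 then obtain n x where n: "n \<in> scales L" and x: "x \<in> grid L" and Rx: "R = grid_rect L n x" by (rule rects_belowE)
 show "R \<in> rects_inside L (shadow L F)" unfolding Rx grid_rect_inside_iff[OF n x] by (rule cell_shadow[OF n x]) (use R Rx in simp)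
qed

lemma finite_haar_sum_BMO:
 fixes c :: "('n::finite => real set) => complex"
 assumes G: "G \<subseteq> rects_below L" and D: "0 <= D"
  and le: "!!W. W \<subseteq> grid L ==> (\<Sum>R\<in>rects_inside L W. if R \<in> G then (cmod (c R))^2 else 0) <= D * (card W / 2 ^ (L * CARD('n)))"
 defines "f \<equiv> %z. \<Sum>R\<in>G. c R * haar_rect (%_. 0) R z"
 shows "f \<in> BMO" "bmo_norm f <= sqrt D" "!!R. R \<in> dyadic_rects ==> haar_coeff f R = (if R \<in> G then c R else 0)"
proof -
 have fin: "finite G" by (rule finite_subset[OF G]) simp
 have Gd: "G \<subseteq> dyadic_rects" using G rects_below_dyadic by blast
 show co: "haar_coeff f R = (if R \<in> G then c R else 0)" if "R \<in> dyadic_rects" for R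
  unfolding f_def by (rule haar_coeff_sum[OF fin Gd that])
 have l2: "f \<in> L2_0" unfolding f_def by (rule haar_sum_L2_0[OF fin Gd])
 have key: "(\<Sum>R\<in>F. (cmod (haar_coeff f R))^2) <= (sqrt D)^2 * measure lebesgue W"
  if W: "torus_open W" and F: "finite F" "F \<subseteq> rects_in W" for W F
 proof -
  define F' where "F' = F \<inter> G"
  have F': "finite F'" "F' \<subseteq> rects_in W" "F' \<subseteq> rects_below L" using F G by (auto simp: F'_def)
  have Fd: "F \<subseteq> dyadic_rects" using F(2) by (auto simp: rects_in_def)
  have "(\<Sum>R\<in>F. (cmod (haar_coeff f R))^2) = (\<Sum>R\<in>F'. if R \<in> G then (cmod (c R))^2 else 0)"
  proof (rule sum.mono_neutral_cong_right[OF F(1)])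
   show "\<forall>R\<in>F - F'. (cmod (haar_coeff f R))^2 = 0"
   proof
    fix R assume "R \<in> F - F'"
    then have "R \<in> dyadic_rects" "R \<notin> G" using Fd by (auto simp: F'_def)
    then show "(cmod (haar_coeff f R))^2 = 0" using co by simp
   qed
   show "(cmod (haar_coeff f R))^2 = (if R \<in> G then (cmod (c R))^2 else 0)" if "R \<in> F'" for R
   proof -
    have "R \<in> dyadic_rects" "R \<in> G" using that Fd by (auto simp: F'_def)
    then show ?thesis using co by simp
   qed
  qed (simp add: F'_def)
  also have "... <= (\<Sum>R\<in>rects_inside L (shadow L F'). if R \<in> G then (cmod (c R))^2 else 0)"
   by (rule sum_mono2[OF finite_rects_inside rects_inside_shadow[OF F'(3)]]) simp
  also have "... <= D * (card (shadow L F') / 2 ^ (L * CARD('n)))" by (rule le[OF shadow_grid])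
  also have "... <= D * measure lebesgue W"
   by (rule mult_left_mono[OF shadow_measure[OF F'(1,2) torus_open_lmeasurable[OF W]] D])
  finally show ?thesis using D by simp
 qed
 show "f \<in> BMO" by (rule BMO_I(1)[OF l2 _ key]) (use D in auto)
 show "bmo_norm f <= sqrt D" by (rule BMO_I(2)[OF l2 _ key]) (use D in auto)
qed

lemma BMO_rects_inside:
 fixes g :: "real ^ 'n::finite => complex"
 assumes "g \<in> BMO" "W \<subseteq> grid L"
 shows "(\<Sum>R\<in>rects_inside L W. (cmod (haar_coeff g R))^2) <= (bmo_norm g)^2 * (card W / 2 ^ (L * CARD('n)))"
proof -
 have "2 ^ (L * CARD('n)) * (\<Sum>R\<in>rects_inside L W. (cmod (haar_coeff g R))^2) <= (bmo_norm g)^2 * card W"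
  unfolding sum_rects_inside using BMO_carleson[OF assms(1), of L] assms(2) by (simp add: carleson_def)
 then show ?thesis by (simp add: field_simps)
qed

text \<open>The value of \<open>(4 / \<theta>)\<^sup>N\<close> for the \<open>\<theta>\<close> of \<open>localized_test_function\<close>.\<close>

definition lower_const :: "nat => real" where
 "lower_const N = (64 * (real N)^2 * 8 ^ N) ^ N"

text \<open>
 One step of the bootstrap: the part of the Carleson sum over \<open>W\<close> that the test function sees is
 controlled by duality, and what it misses lies in a set of half the size.
\<close>

lemma good_sum_estimate:
 fixes \<phi> :: "real ^ 'n::finite => complex"
 assumes nf: "no_full_side \<phi>" and K: "0 <= K" and bd: "paraproduct_bound (%_. 1) \<phi> K"
  and L: "0 < L" and W: "W \<subseteq> grid L" and D: "0 <= D"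
  and le: "!!W. W \<subseteq> grid L ==> (\<Sum>R\<in>rects_inside L W. (cmod (haar_coeff \<phi> R))^2) <= D * (card W / 2 ^ (L * CARD('n)))"
 shows "(\<Sum>R\<in>rects_inside L W. (cmod (haar_coeff \<phi> R))^2) <=
  (2 * lower_const CARD('n) * (K * sqrt D) + D / 2) * (card W / 2 ^ (L * CARD('n)))"
proof -
 define \<theta> where "\<theta> = 1 / (16 * (real CARD('n))^2 * 8 ^ CARD('n))"
 have \<theta>: "0 < \<theta>" by (simp add: \<theta>_def)
 have "4 / \<theta> = 64 * (real CARD('n))^2 * 8 ^ CARD('n)" by (simp add: \<theta>_def)
 then have lc: "lower_const CARD('n) = (4 / \<theta>) ^ CARD('n)" by (simp only: lower_const_def)
 obtain W' W2 a where W': "W' \<subseteq> grid L" and W2: "W2 \<subseteq> grid L"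
  and card': "card W' <= (4 / \<theta>\<^sup>2) ^ CARD('n) * 2 ^ CARD('n) * card W" and card2: "card W2 <= card W / 2"
  and a0: "mean_zero L a" and asq: "sq_norm L a <= 2 ^ CARD('n) * card W"
  and asupp: "!!k x. k \<in> scales L ==> x \<in> grid L ==> coeff_op L k a x ~= 0 ==> cell L k x \<subseteq> W'"
  and amean: "!!n x. n \<in> scales L ==> x \<in> grid L ==> (!!j. 0 < n j) ==> cell L n x \<subseteq> W ==> \<not> cell L n x \<subseteq> W2
   ==> 1 / 2 <= \<bar>mean_op L n a x\<bar>"
  using localized_test_function[OF L W] unfolding \<theta>_def by blast
 obtain c where ca: "!!x. x \<in> grid L ==> haar_synth L c x = a x"
  and cc: "!!n x. n \<in> scales L ==> x \<in> grid L ==> c (grid_rect L n x) = haar_unit (%_. 0) n * coeff_op L n a x"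
  using mean_zero_synthesis[OF a0] by blast
 define V where "V = (2::real) ^ (L * CARD('n))"
 have V: "0 < V" by (simp add: V_def)
 define \<mu> where "\<mu> = card W / V"
 have \<mu>: "0 <= \<mu>" using V by (simp add: \<mu>_def)
 have csq: "(\<Sum>Q\<in>rects_below L. (c Q)^2) <= 2 ^ CARD('n) * \<mu>"
 proof -
  have "sq_norm L (haar_synth L c) = sq_norm L a" unfolding sq_norm_def by (rule sum.cong[OF refl]) (simp add: ca)
  then have "V * (\<Sum>Q\<in>rects_below L. (c Q)^2) <= 2 ^ CARD('n) * card W" using asq by (simp add: sq_norm_synth V_def)
  then show ?thesis using V by (simp add: \<mu>_def field_simps)
 qed
 define M where "M = (%R. \<Sum>Q\<in>rects_below L. c Q * haar_pair (%_. 1) Q R)"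
 have M: "M (grid_rect L n x) = mean_op L n a x" if n: "n \<in> scales L" and x: "x \<in> grid L" for n x
 proof -
  have "M (grid_rect L n x) = haar_unit (%_. 1) n * ker_op L (pair_ker L (%_. 1) n) (haar_synth L c) x"
   unfolding M_def by (rule haar_synth_pair[OF n, symmetric])
  also have "... = mean_op L n (haar_synth L c) x" by (simp add: haar_unit_def pair_ker_def[abs_def] mean_op_def)
  also have "... = mean_op L n a x" unfolding mean_op_def by (rule ker_op_cong_fun) (rule ca)
  finally show ?thesis .
 qed
 (* The rectangles seen by the test function. Those with a full side drop out as their coefficients vanish. *)
 define G where "G = {R \<in> rects_inside L W. \<not> R \<in> rects_inside L W2 \<and> haar_coeff \<phi> R ~= 0}"
 have finG: "finite G" by (simp add: G_def)
 have Gb: "G \<subseteq> rects_below L" unfolding G_def using rects_inside_below by blast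
 have Gd: "G \<subseteq> dyadic_rects" using Gb rects_below_dyadic by blast
 have MG: "1 / 2 <= \<bar>M R\<bar>" if R: "R \<in> G" for R
 proof -
  have "R \<in> rects_below L" using R Gb by blast
  then obtain n x where n: "n \<in> scales L" and x: "x \<in> grid L" and Rx: "R = grid_rect L n x" by (rule rects_belowE)
  have sub: "cell L n x \<subseteq> W" "\<not> cell L n x \<subseteq> W2"
   using R grid_rect_inside_iff[OF n x] by (auto simp: G_def Rx)
  have "0 < n j" for j
  proof (rule ccontr)
   assume "\<not> 0 < n j"
   then have "haar_coeff \<phi> R = 0" unfolding Rx by (intro no_full_side_coeff[OF nf n x, of j]) simp
   then show False using R by (simp add: G_def)
  qed
  then show ?thesis unfolding Rx M[OF n x] by (rule amean[OF n x _ sub])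
 qed
 (* The signs make every term of the pairing of a with the image of f nonnegative. *)
 define \<gamma> where "\<gamma> = (%R. cnj (haar_coeff \<phi> R) * of_real (sgn (M R)))"
 have \<gamma>n: "(cmod (\<gamma> R))^2 <= (cmod (haar_coeff \<phi> R))^2" for R
  by (intro power_mono) (auto simp: \<gamma>_def norm_mult abs_sgn_eq)
 define f where "f = (%z. \<Sum>R\<in>G. \<gamma> R * haar_rect (%_. 0) R z)"
 have fle: "(\<Sum>R\<in>rects_inside L W. if R \<in> G then (cmod (\<gamma> R))^2 else 0) <= D * (card W / 2 ^ (L * CARD('n)))"
  if "W \<subseteq> grid L" for W
  by (rule order_trans[OF sum_mono le[OF that]]) (use \<gamma>n in auto)
 note fB = finite_haar_sum_BMO[OF Gb D fle, folded f_def]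
 obtain g where g: "g \<in> BMO" "paraproduct (%_. 1) \<phi> f g" "bmo_norm g <= K * bmo_norm f"
  using bd fB(1) unfolding paraproduct_bound_def by blast
 have gn: "bmo_norm g <= K * sqrt D" by (rule order_trans[OF g(3) mult_left_mono[OF fB(2) K]])
 define S where "S = (\<Sum>R\<in>G. (cmod (haar_coeff \<phi> R))^2)"
 have gco: "haar_coeff g Q = (\<Sum>R\<in>G. of_real ((cmod (haar_coeff \<phi> R))^2 * sgn (M R) * haar_pair (%_. 1) Q R))" if Q: "Q \<in> dyadic_rects" for Q
 proof -
  have "haar_coeff g Q = (\<Sum>R\<in>G. haar_coeff \<phi> R * haar_coeff f R * of_real (haar_pair (%_. 1) Q R))"
   by (rule paraproduct_1_coeff[OF g(2) Q finG Gd]) (simp add: fB(3))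
  also have "... = (\<Sum>R\<in>G. of_real ((cmod (haar_coeff \<phi> R))^2 * sgn (M R) * haar_pair (%_. 1) Q R))"
  proof (rule sum.cong[OF refl])
   fix R assume R: "R \<in> G"
   then have "haar_coeff f R = \<gamma> R" using fB(3)[of R] Gd by auto
   moreover have "haar_coeff \<phi> R * cnj (haar_coeff \<phi> R) = of_real ((cmod (haar_coeff \<phi> R))^2)" by (rule complex_norm_square[symmetric])
   ultimately show "haar_coeff \<phi> R * haar_coeff f R * of_real (haar_pair (%_. 1) Q R)
    = of_real ((cmod (haar_coeff \<phi> R))^2 * sgn (M R) * haar_pair (%_. 1) Q R)"
    by (simp add: \<gamma>_def mult.assoc[symmetric] del: of_real_power)
  qed
  finally show ?thesis .
 qed
 have "S / 2 <= (\<Sum>R\<in>G. (cmod (haar_coeff \<phi> R))^2 * \<bar>M R\<bar>)"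
  unfolding S_def sum_divide_distrib
 proof (rule sum_mono)
  fix R assume "R \<in> G"
  from mult_left_mono[OF MG[OF this], of "(cmod (haar_coeff \<phi> R))^2"]
  show "(cmod (haar_coeff \<phi> R))^2 / 2 <= (cmod (haar_coeff \<phi> R))^2 * \<bar>M R\<bar>" by simp
 qed
 also have "... = (\<Sum>R\<in>G. \<Sum>Q\<in>rects_below L. c Q * ((cmod (haar_coeff \<phi> R))^2 * sgn (M R) * haar_pair (%_. 1) Q R))"
 proof (rule sum.cong[OF refl])
  fix R
  have "(\<Sum>Q\<in>rects_below L. c Q * ((cmod (haar_coeff \<phi> R))^2 * sgn (M R) * haar_pair (%_. 1) Q R)) = (cmod (haar_coeff \<phi> R))^2 * sgn (M R) * M R"
   unfolding M_def sum_distrib_left by (simp only: mult_ac)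
  then show "(cmod (haar_coeff \<phi> R))^2 * \<bar>M R\<bar> = (\<Sum>Q\<in>rects_below L. c Q * ((cmod (haar_coeff \<phi> R))^2 * sgn (M R) * haar_pair (%_. 1) Q R))"
   by (simp add: abs_sgn mult.assoc mult.commute[of "M R"])
 qed
 also have "... = (\<Sum>Q\<in>rects_below L. c Q * (\<Sum>R\<in>G. (cmod (haar_coeff \<phi> R))^2 * sgn (M R) * haar_pair (%_. 1) Q R))"
  unfolding sum_distrib_left by (rule sum.swap)
 also have "... <= (\<Sum>Q\<in>rects_inside L W'. \<bar>c Q\<bar> * cmod (haar_coeff g Q))"
 proof -
  have "(\<Sum>Q\<in>rects_below L. c Q * (\<Sum>R\<in>G. (cmod (haar_coeff \<phi> R))^2 * sgn (M R) * haar_pair (%_. 1) Q R))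
   = (\<Sum>Q\<in>rects_inside L W'. c Q * (\<Sum>R\<in>G. (cmod (haar_coeff \<phi> R))^2 * sgn (M R) * haar_pair (%_. 1) Q R))"
  proof (rule sum.mono_neutral_right[OF finite_rects_below rects_inside_below], rule ballI)
   fix Q assume Q: "Q \<in> rects_below L - rects_inside L W'"
   then have "Q \<in> rects_below L" by blast
   then obtain n x where n: "n \<in> scales L" and x: "x \<in> grid L" and Qx: "Q = grid_rect L n x" by (rule rects_belowE)
   have "\<not> cell L n x \<subseteq> W'" using Q grid_rect_inside_iff[OF n x] by (simp add: Qx)
   then have "coeff_op L n a x = 0" using asupp[OF n x] by blast
   then have "c Q = 0" by (simp add: Qx cc[OF n x])
   then show "c Q * (\<Sum>R\<in>G. (cmod (haar_coeff \<phi> R))^2 * sgn (M R) * haar_pair (%_. 1) Q R) = 0" by simp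
  qed
  also have "... <= (\<Sum>Q\<in>rects_inside L W'. \<bar>c Q\<bar> * cmod (haar_coeff g Q))"
  proof (rule sum_mono)
   fix Q assume "Q \<in> rects_inside L W'"
   then have Q: "Q \<in> dyadic_rects" using rects_inside_below rects_below_dyadic by blast
   have "cmod (haar_coeff g Q) = \<bar>\<Sum>R\<in>G. (cmod (haar_coeff \<phi> R))^2 * sgn (M R) * haar_pair (%_. 1) Q R\<bar>"
    unfolding gco[OF Q] of_real_sum[symmetric] by (rule norm_of_real)
   then show "c Q * (\<Sum>R\<in>G. (cmod (haar_coeff \<phi> R))^2 * sgn (M R) * haar_pair (%_. 1) Q R) <= \<bar>c Q\<bar> * cmod (haar_coeff g Q)"
    by (simp only: abs_mult[symmetric] abs_ge_self)
  qed
  finally show ?thesis .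
 qed
 also have "... <= sqrt (\<Sum>Q\<in>rects_inside L W'. \<bar>c Q\<bar>\<^sup>2) * sqrt (\<Sum>Q\<in>rects_inside L W'. (cmod (haar_coeff g Q))^2)"
  unfolding real_sqrt_mult[symmetric] by (rule real_le_rsqrt[OF Cauchy_Schwarz_ineq_sum])
 also have "... <= sqrt (2 ^ CARD('n) * \<mu>) * sqrt ((K * sqrt D)^2 * ((4 / \<theta>\<^sup>2) ^ CARD('n) * 2 ^ CARD('n) * \<mu>))"
 proof (intro mult_mono real_sqrt_le_mono)
  have "(\<Sum>Q\<in>rects_inside L W'. \<bar>c Q\<bar>\<^sup>2) <= (\<Sum>Q\<in>rects_below L. (c Q)^2)"
   unfolding power2_abs by (rule sum_mono2[OF finite_rects_below rects_inside_below]) simp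
  then show "(\<Sum>Q\<in>rects_inside L W'. \<bar>c Q\<bar>\<^sup>2) <= 2 ^ CARD('n) * \<mu>" using csq by linarith
  have "(\<Sum>Q\<in>rects_inside L W'. (cmod (haar_coeff g Q))^2) <= (bmo_norm g)^2 * (card W' / V)"
   unfolding V_def by (rule BMO_rects_inside[OF g(1) W'])
  also have "... <= (K * sqrt D)^2 * ((4 / \<theta>\<^sup>2) ^ CARD('n) * 2 ^ CARD('n) * \<mu>)"
  proof (rule mult_mono)
   show "(bmo_norm g)^2 <= (K * sqrt D)^2" by (intro power_mono gn bmo_norm_nonneg)
   show "card W' / V <= (4 / \<theta>\<^sup>2) ^ CARD('n) * 2 ^ CARD('n) * \<mu>"
    using divide_right_mono[OF card', of V] V by (simp add: \<mu>_def)
  qed (use V in auto)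
  finally show "(\<Sum>Q\<in>rects_inside L W'. (cmod (haar_coeff g Q))^2) <= (K * sqrt D)^2 * ((4 / \<theta>\<^sup>2) ^ CARD('n) * 2 ^ CARD('n) * \<mu>)" .
 qed (use \<mu> in \<open>auto intro: sum_nonneg\<close>)
 also have "... = sqrt (((4 / \<theta>) ^ CARD('n) * (K * sqrt D) * \<mu>)^2)"
 proof -
  have "(4 / \<theta>\<^sup>2) ^ CARD('n) * 2 ^ CARD('n) * 2 ^ CARD('n) = ((4 / \<theta>) ^ CARD('n))^2"
  proof -
   have "(4 / \<theta>\<^sup>2) ^ CARD('n) * 2 ^ CARD('n) * 2 ^ CARD('n) = (4 / \<theta>\<^sup>2 * 2 * 2) ^ CARD('n)" by (simp only: power_mult_distrib)
   also have "4 / \<theta>\<^sup>2 * 2 * 2 = (4 / \<theta>)^2" by (simp add: power_divide)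
   finally show ?thesis by (simp only: power_mult[symmetric] mult.commute)
  qed
  then have "2 ^ CARD('n) * \<mu> * ((K * sqrt D)^2 * ((4 / \<theta>\<^sup>2) ^ CARD('n) * 2 ^ CARD('n) * \<mu>)) = ((4 / \<theta>) ^ CARD('n) * (K * sqrt D) * \<mu>)^2"
   by (simp only: power2_eq_square mult_ac)
  then show ?thesis unfolding real_sqrt_mult[symmetric] by (simp only:)
 qed
 also have "... = lower_const CARD('n) * (K * sqrt D) * \<mu>"
  unfolding lc using \<theta> K D \<mu> by simp
 finally have S: "S <= 2 * lower_const CARD('n) * (K * sqrt D) * \<mu>" by simp
 have "(\<Sum>R\<in>rects_inside L W. (cmod (haar_coeff \<phi> R))^2) <= (\<Sum>R\<in>G \<union> rects_inside L W2. (cmod (haar_coeff \<phi> R))^2)"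
 proof -
  have "(\<Sum>R\<in>rects_inside L W. (cmod (haar_coeff \<phi> R))^2) = (\<Sum>R\<in>{R \<in> rects_inside L W. haar_coeff \<phi> R ~= 0}. (cmod (haar_coeff \<phi> R))^2)"
   by (rule sum.mono_neutral_right) auto
  also have "... <= (\<Sum>R\<in>G \<union> rects_inside L W2. (cmod (haar_coeff \<phi> R))^2)"
   by (rule sum_mono2) (auto simp: G_def)
  finally show ?thesis .
 qed
 also have "... <= S + (\<Sum>R\<in>rects_inside L W2. (cmod (haar_coeff \<phi> R))^2)"
  unfolding S_def sum_Un[OF finG finite_rects_inside] by (simp add: sum_nonneg)
 also have "(\<Sum>R\<in>rects_inside L W2. (cmod (haar_coeff \<phi> R))^2) <= D * (\<mu> / 2)"
 proof (rule order_trans[OF le[OF W2] mult_left_mono[OF _ D]])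
  show "card W2 / 2 ^ (L * CARD('n)) <= \<mu> / 2" using divide_right_mono[OF card2, of V] V by (simp add: \<mu>_def V_def)
 qed
 finally have "(\<Sum>R\<in>rects_inside L W. (cmod (haar_coeff \<phi> R))^2) <= S + D * (\<mu> / 2)" by simp
 also have "... <= 2 * lower_const CARD('n) * (K * sqrt D) * \<mu> + D * (\<mu> / 2)" using S by simp
 also have "... = (2 * lower_const CARD('n) * (K * sqrt D) + D / 2) * \<mu>" by (simp add: algebra_simps)
 finally show ?thesis by (simp add: \<mu>_def V_def)
qed

text \<open>At each resolution let \<open>D\<close> be the largest Carleson ratio. The preceding estimate at a maximiser gives
  \<open>D \<le> 2 H K \<surd>D + D / 2\<close>, hence a bound for \<open>D\<close> independent of the resolution.\<close>

theorem paraproduct_1_lower: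
 fixes \<phi> :: "real ^ 'n::finite => complex"
 assumes \<phi>: "\<phi> \<in> L2_0" and nf: "no_full_side \<phi>" and K: "0 <= K" and bd: "paraproduct_bound (%_. 1) \<phi> K"
 shows "\<phi> \<in> BMO" "bmo_norm \<phi> <= 4 * lower_const CARD('n) * K"
proof -
 define H where "H = lower_const CARD('n)"
 have H: "0 <= H" by (simp add: H_def lower_const_def)
 have carl: "carleson L (scales L) (%n x. weight n * (cmod (haar_coeff \<phi> (grid_rect L n x)))^2) ((4 * H * K)^2)" for L
 proof (cases "L = 0")
  case True
  then have "scales L = ({} :: ('n => nat) set)" by (auto simp: scales_def)
  then show ?thesis by (simp add: carleson_def)
 next
  case False
  then have L: "0 < L" by simp
  define V where "V = (2::real) ^ (L * CARD('n))"
  have V: "0 < V" by (simp add: V_def)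
  define s where "s = (%W. \<Sum>R\<in>rects_inside L W. (cmod (haar_coeff \<phi> R))^2)"
  have s0: "0 <= s W" for W by (simp add: s_def sum_nonneg)
  define T where "T = {W :: ('n => nat) set. W \<subseteq> grid L \<and> W ~= {}}"
  define r where "r = (%W. s W / (card W / V))"
  define D where "D = Max (r ` T)"
  have finT: "finite T" unfolding T_def by (rule finite_subset[of _ "Pow (grid L)"]) auto
  have neT: "T ~= {}" 
  proof -
   have "(%_. 0) \<in> (grid L :: ('n => nat) set)" by (simp add: grid_def)
   then have "grid L \<in> T" by (auto simp: T_def)
   then show ?thesis by blast
  qed
  have cpos: "0 < real (card W)" if "W \<in> T" for W
   using that finite_subset[OF _ finite_grid] by (auto simp: T_def card_gt_0_iff)
  have rD: "r W <= D" if "W \<in> T" for W unfolding D_def using finT that by (intro Max_ge) auto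
  have r0: "0 <= r W" for W unfolding r_def using s0 V by simp
  have D: "0 <= D" using neT rD r0 order_trans by blast
  have le: "s W <= D * (card W / V)" if W: "W \<subseteq> grid L" for W
  proof (cases "W = {}")
   case True
   have "rects_inside L W = {}" unfolding rects_inside_def True using cell_refl by blast
   then show ?thesis using True by (simp add: s_def)
  next
   case False
   then have T: "W \<in> T" using W by (simp add: T_def)
   from rD[OF T] show ?thesis unfolding r_def using cpos[OF T] V by (simp add: pos_divide_le_eq pos_le_divide_eq)
  qed
  have "D \<in> r ` T" unfolding D_def using finT neT by (intro Max_in) auto
  then obtain W where WT: "W \<in> T" and DW: "D = r W" by blast
  have Wg: "W \<subseteq> grid L" using WT by (simp add: T_def)
  have pos: "0 < card W / V" using cpos[OF WT] V by simp
  have "s W <= (2 * H * (K * sqrt D) + D / 2) * (card W / V)"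
   unfolding s_def V_def H_def
   by (rule good_sum_estimate[OF nf K bd L Wg D]) (rule le[unfolded s_def V_def])
  moreover define x where "x = real (card W) / V"
  moreover have x: "0 < x" using pos by (simp add: x_def)
  moreover have "D * x = s W" unfolding DW r_def x_def[symmetric] using x by simp
  ultimately have "D * x <= (2 * H * (K * sqrt D) + D / 2) * x" by simp
  then have "D <= 2 * H * (K * sqrt D) + D / 2" using x by (rule mult_right_le_imp_le)
  then have "sqrt D * sqrt D <= (4 * H * K) * sqrt D" using D by (simp add: algebra_simps)
  then have "D <= (4 * H * K)^2"
  proof (cases "D = 0")
   case False
   then have "0 < sqrt D" using D by simp
   then have "sqrt D <= 4 * H * K" using \<open>sqrt D * sqrt D <= (4 * H * K) * sqrt D\<close> by (rule mult_right_le_imp_le[rotated])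
   then have "(sqrt D)^2 <= (4 * H * K)^2" using D by (intro power_mono) auto
   then show ?thesis using D by simp
  qed simp
  show ?thesis unfolding carleson_def
  proof (intro allI impI)
   fix W :: "('n => nat) set" assume W: "W \<subseteq> grid L"
   have "V * s W <= V * (D * (card W / V))" using le[OF W] V by (intro mult_left_mono) auto
   also have "... = D * card W" using V by simp
   also have "... <= (4 * H * K)^2 * card W" using \<open>D <= (4 * H * K)^2\<close> by (rule mult_right_mono) simp
   finally show "(\<Sum>n\<in>scales L. \<Sum>x\<in>{x \<in> grid L. cell L n x \<subseteq> W}. weight n * (cmod (haar_coeff \<phi> (grid_rect L n x)))^2)
    <= (4 * H * K)^2 * card W"
    unfolding V_def s_def sum_rects_inside .
  qed
 qed
 have key: "(\<Sum>R\<in>F. (cmod (haar_coeff \<phi> R))^2) <= (4 * H * K)^2 * measure lebesgue W"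
  if "torus_open W" "W ~= {}" "finite F" "F \<subseteq> rects_in W" for W F
  by (rule open_sum_of_grid_carleson[OF _ carl torus_open_lmeasurable[OF that(1)] that(3,4)]) simp
 have HK: "0 <= 4 * H * K" using H K by simp
 show "\<phi> \<in> BMO" by (rule BMO_I(1)[OF \<phi> HK key])
 show "bmo_norm \<phi> <= 4 * lower_const CARD('n) * K" using BMO_I(2)[OF \<phi> HK key] by (simp add: H_def)
qed

section \<open>Comparison of the norms\<close>

lemma paraproduct_norm_le: "paraproduct_bound \<beta> \<phi> K ==> 0 <= K ==> paraproduct_norm \<beta> \<phi> <= K"
 unfolding paraproduct_norm_def by (rule cInf_lower) (auto intro: bdd_belowI[of _ 0])

lemma paraproduct_norm_ge:
 assumes "paraproduct_bounded \<beta> \<phi>" "!!K. 0 <= K ==> paraproduct_bound \<beta> \<phi> K ==> t <= A * K" "0 < A"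
 shows "t <= A * paraproduct_norm \<beta> \<phi>"
proof -
 have "t / A <= paraproduct_norm \<beta> \<phi>"
  unfolding paraproduct_norm_def
  by (rule cInf_greatest) (use assms in \<open>auto simp: paraproduct_bounded_def pos_divide_le_eq mult.commute\<close>)
 then show ?thesis using assms(3) by (simp add: pos_divide_le_eq mult.commute)
qed

lemma lmo_norm_le:
 assumes "0 <= C" "lmo_bound \<beta> \<phi> C"
 shows "lmo_norm \<beta> \<phi> <= sqrt C"
 unfolding lmo_norm_def
proof (rule real_sqrt_le_mono, rule field_le_epsilon)
 fix e :: real assume e: "0 < e"
 have "lmo_bound \<beta> \<phi> (C + e)"
  using assms(2) e unfolding lmo_bound_def by (meson ennreal_leI less_add_same_cancel1 less_imp_le order_trans)
 then show "Inf {C. C > 0 \<and> lmo_bound \<beta> \<phi> C} <= C + e"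
  using assms(1) e by (intro cInf_lower) (auto intro: bdd_belowI[of _ 0])
qed

lemma paraproduct_norm_le_lmo:
 fixes \<beta> :: "'n::finite => nat"
 assumes "!!j. \<beta> j \<in> {0, 1}" and \<phi>: "\<phi> \<in> LMO \<beta>"
 shows "paraproduct_bounded \<beta> \<phi>" "paraproduct_norm \<beta> \<phi> <= 4 * 384 ^ CARD('n) * lmo_norm \<beta> \<phi>"
proof -
 define A where "A = 4 * (384::real) ^ CARD('n)"
 have A: "0 < A" by (simp add: A_def)
 have bound: "paraproduct_bound \<beta> \<phi> (A * sqrt C)" if "0 < C" "lmo_bound \<beta> \<phi> C" for C
 proof -
  have "paraproduct_bound \<beta> \<phi> (4 * 192 ^ CARD('n) * (2 ^ CARD('n) * sqrt C))"
   by (rule paraproduct_upper[OF assms(1) LMO_symbol_carleson]) (use that in auto)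
  moreover have "4 * 192 ^ CARD('n) * (2 ^ CARD('n) * sqrt C) = A * sqrt C"
   unfolding A_def using power_mult_distrib[of "192::real" 2 "CARD('n)"] by simp
  ultimately show ?thesis by simp
 qed
 obtain C0 where C0: "0 < C0" "lmo_bound \<beta> \<phi> C0" using \<phi> by (auto simp: LMO_def)
 then show "paraproduct_bounded \<beta> \<phi>" unfolding paraproduct_bounded_def
  using bound[OF C0] A by (intro exI[of _ "A * sqrt C0"]) simp
 define p where "p = paraproduct_norm \<beta> \<phi>"
 have p0: "0 <= p" unfolding p_def paraproduct_norm_def
  by (rule cInf_greatest) (use bound[OF C0] A C0 in \<open>auto intro!: exI[of _ "A * sqrt C0"]\<close>)
 have "(p / A)^2 <= Inf {C. C > 0 \<and> lmo_bound \<beta> \<phi> C}"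
 proof (rule cInf_greatest)
  fix C assume C: "C \<in> {C. C > 0 \<and> lmo_bound \<beta> \<phi> C}"
  then have "p <= A * sqrt C" unfolding p_def using bound[of C] A by (intro paraproduct_norm_le) auto
  then have "p / A <= sqrt C" using A by (simp add: pos_divide_le_eq mult.commute)
  then have "(p / A)^2 <= (sqrt C)^2" using p0 A by (intro power_mono) auto
  then show "(p / A)^2 <= C" using C by simp
 qed (use C0 in auto)
 then have "p / A <= lmo_norm \<beta> \<phi>" unfolding lmo_norm_def by (rule real_le_rsqrt)
 then show "paraproduct_norm \<beta> \<phi> <= 4 * 384 ^ CARD('n) * lmo_norm \<beta> \<phi>"
  using A by (simp add: p_def[symmetric] A_def[symmetric] pos_divide_le_eq mult.commute)
qed

lemma paraproduct_norm_le_bmo: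
 fixes \<phi> :: "real ^ 'n::finite => complex"
 assumes \<phi>: "\<phi> \<in> BMO"
 shows "paraproduct_bounded (%_. 1) \<phi>" "paraproduct_norm (%_. 1) \<phi> <= 4 * 192 ^ CARD('n) * bmo_norm \<phi>"
proof -
 have "paraproduct_bound (%_. 1) \<phi> (4 * 192 ^ CARD('n) * bmo_norm \<phi>)"
  by (rule paraproduct_upper[OF _ BMO_symbol_carleson[OF \<phi>] bmo_norm_nonneg]) auto
 moreover have "0 <= 4 * 192 ^ CARD('n) * bmo_norm \<phi>" using bmo_norm_nonneg[of \<phi>] by simp
 ultimately show "paraproduct_bounded (%_. 1) \<phi>" "paraproduct_norm (%_. 1) \<phi> <= 4 * 192 ^ CARD('n) * bmo_norm \<phi>"
  unfolding paraproduct_bounded_def by (blast, intro paraproduct_norm_le)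
qed

lemma lmo_of_paraproduct:
 fixes \<phi> :: "real ^ 'n::finite => complex"
 assumes \<phi>: "\<phi> \<in> L2_0" and nf: "no_full_side \<phi>" and bd: "paraproduct_bounded (%_. 0) \<phi>"
 shows "\<phi> \<in> LMO (%_. 0)" "lmo_norm (%_. 0) \<phi> <= 18 ^ CARD('n) * paraproduct_norm (%_. 0) \<phi>"
proof -
 obtain K where K: "0 <= K" "paraproduct_bound (%_. 0) \<phi> K" using bd by (auto simp: paraproduct_bounded_def)
 have "lmo_bound (%_. 0) \<phi> (18 ^ CARD('n) * K\<^sup>2)" by (rule paraproduct_0_lower[OF nf K])
 then have "lmo_bound (%_. 0) \<phi> (18 ^ CARD('n) * K\<^sup>2 + 1)"
  unfolding lmo_bound_def by (meson ennreal_leI less_add_one less_imp_le order_trans)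
 moreover have "0 < 18 ^ CARD('n) * K\<^sup>2 + 1" by (smt (verit) zero_le_mult_iff zero_le_power zero_le_power2)
 ultimately show "\<phi> \<in> LMO (%_. 0)" using L2_0_L2[OF \<phi>] unfolding LMO_def by blast
 show "lmo_norm (%_. 0) \<phi> <= 18 ^ CARD('n) * paraproduct_norm (%_. 0) \<phi>"
 proof (rule paraproduct_norm_ge[OF bd])
  fix K :: real assume K: "0 <= K" "paraproduct_bound (%_. 0) \<phi> K"
  have "lmo_norm (%_. 0) \<phi> <= sqrt (18 ^ CARD('n) * K\<^sup>2)" by (rule lmo_norm_le[OF _ paraproduct_0_lower[OF nf K]]) simp
  also have "... = sqrt (18 ^ CARD('n)) * K" using K(1) by (simp add: real_sqrt_mult)
  also have "... <= 18 ^ CARD('n) * K"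
   by (rule mult_right_mono[OF _ K(1)]) (rule real_le_lsqrt, simp_all add: power2_eq_square)
  finally show "lmo_norm (%_. 0) \<phi> <= 18 ^ CARD('n) * K" .
 qed simp
qed

lemma bmo_of_paraproduct:
 fixes \<phi> :: "real ^ 'n::finite => complex"
 assumes \<phi>: "\<phi> \<in> L2_0" and nf: "no_full_side \<phi>" and bd: "paraproduct_bounded (%_. 1) \<phi>"
 shows "\<phi> \<in> BMO" "bmo_norm \<phi> <= 4 * lower_const CARD('n) * paraproduct_norm (%_. 1) \<phi>"
proof -
 show "\<phi> \<in> BMO" using bd paraproduct_1_lower(1)[OF \<phi> nf] by (auto simp: paraproduct_bounded_def)
 show "bmo_norm \<phi> <= 4 * lower_const CARD('n) * paraproduct_norm (%_. 1) \<phi>"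
  by (rule paraproduct_norm_ge[OF bd paraproduct_1_lower(2)[OF \<phi> nf]]) (simp_all add: lower_const_def)
qed

lemma mult_const_mono: "(t::real) <= A * s ==> A <= C ==> 0 <= s ==> t <= C * s"
 using mult_right_mono order_trans by blast

lemma lmo_norm_nonneg: "\<phi> \<in> LMO \<beta> ==> 0 <= lmo_norm \<beta> \<phi>"
 unfolding lmo_norm_def LMO_def by (auto intro!: real_sqrt_ge_zero cInf_greatest)

lemma paraproduct_norm_nonneg: "paraproduct_bounded \<beta> \<phi> ==> 0 <= paraproduct_norm \<beta> \<phi>"
 unfolding paraproduct_norm_def paraproduct_bounded_def by (auto intro!: cInf_greatest)

theorem theorem4p2:
  shows "\<exists>C>0. \<forall>\<phi> \<in> (L2_0 :: (real ^ 'n::finite \<Rightarrow> complex) set).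
    \<comment> \<open>(1)\<close>
    (\<phi> \<in> LMO (\<lambda>_. 0) \<longrightarrow>
       paraproduct_bounded (\<lambda>_. 0) \<phi> \<and>
       paraproduct_norm (\<lambda>_. 0) \<phi> \<le> C * lmo_norm (\<lambda>_. 0) \<phi>) \<and>
    (no_full_side \<phi> \<longrightarrow>
       (paraproduct_bounded (\<lambda>_. 0) \<phi> \<longleftrightarrow> \<phi> \<in> LMO (\<lambda>_. 0)) \<and>
       (paraproduct_bounded (\<lambda>_. 0) \<phi> \<longrightarrow>
          paraproduct_norm (\<lambda>_. 0) \<phi> \<le> C * lmo_norm (\<lambda>_. 0) \<phi> \<and>
          lmo_norm (\<lambda>_. 0) \<phi> \<le> C * paraproduct_norm (\<lambda>_. 0) \<phi>)) \<and>
    \<comment> \<open>(2)\<close>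
    (\<phi> \<in> BMO \<longrightarrow>
       paraproduct_bounded (\<lambda>_. 1) \<phi> \<and>
       paraproduct_norm (\<lambda>_. 1) \<phi> \<le> C * bmo_norm \<phi>) \<and>
    (no_full_side \<phi> \<longrightarrow>
       (paraproduct_bounded (\<lambda>_. 1) \<phi> \<longleftrightarrow> \<phi> \<in> BMO) \<and>
       (paraproduct_bounded (\<lambda>_. 1) \<phi> \<longrightarrow>
          paraproduct_norm (\<lambda>_. 1) \<phi> \<le> C * bmo_norm \<phi> \<and>
          bmo_norm \<phi> \<le> C * paraproduct_norm (\<lambda>_. 1) \<phi>)) \<and>
    \<comment> \<open>(3)\<close>
    (\<forall>\<beta>. (\<forall>j. \<beta> j \<in> {0, 1}) \<and> \<beta> \<noteq> (\<lambda>_. 0) \<and> \<beta> \<noteq> (\<lambda>_. 1) \<longrightarrow> \<phi> \<in> LMO \<beta> \<longrightarrow>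
       paraproduct_bounded \<beta> \<phi> \<and> paraproduct_norm \<beta> \<phi> \<le> C * lmo_norm \<beta> \<phi>)"
proof -
 define A1 where "A1 = 4 * (384::real) ^ CARD('n)"
 define A2 where "A2 = 4 * (192::real) ^ CARD('n)"
 define A3 where "A3 = (18::real) ^ CARD('n)"
 define A4 where "A4 = 4 * lower_const CARD('n)"
 define C where "C = A1 + A2 + A3 + A4"
 have pos: "0 < A1" "0 < A2" "0 < A3" "0 < A4"
  by (simp_all add: A1_def A2_def A3_def A4_def lower_const_def)
 then have C: "0 < C" "A1 <= C" "A2 <= C" "A3 <= C" "A4 <= C" by (simp_all add: C_def)
 have up: "paraproduct_bounded \<beta> \<phi> \<and> paraproduct_norm \<beta> \<phi> <= C * lmo_norm \<beta> \<phi>"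
  if "!!j. \<beta> j \<in> {0, 1}" "\<phi> \<in> LMO \<beta>" for \<beta> :: "'n => nat" and \<phi>
  using paraproduct_norm_le_lmo[OF that] mult_const_mono[OF _ C(2) lmo_norm_nonneg[OF that(2)]] by (simp add: A1_def)
 have up0: "paraproduct_bounded (%_. 0) \<phi> \<and> paraproduct_norm (%_. 0) \<phi> <= C * lmo_norm (%_. 0) \<phi>"
  if "\<phi> \<in> LMO (%_. 0)" for \<phi> :: "real ^ 'n => complex"
  by (rule up[OF _ that]) simp
 have up1: "paraproduct_bounded (%_. 1) \<phi> \<and> paraproduct_norm (%_. 1) \<phi> <= C * bmo_norm \<phi>"
  if "\<phi> \<in> BMO" for \<phi> :: "real ^ 'n => complex"
  using paraproduct_norm_le_bmo[OF that] mult_const_mono[OF _ C(3) bmo_norm_nonneg] unfolding A2_def by blast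
 have low0: "\<phi> \<in> LMO (%_. 0) \<and> lmo_norm (%_. 0) \<phi> <= C * paraproduct_norm (%_. 0) \<phi>"
  if "\<phi> \<in> L2_0" "no_full_side \<phi>" "paraproduct_bounded (%_. 0) \<phi>" for \<phi> :: "real ^ 'n => complex"
  using lmo_of_paraproduct[OF that] mult_const_mono[OF _ C(4) paraproduct_norm_nonneg[OF that(3)]] unfolding A3_def by blast
 have low1: "\<phi> \<in> BMO \<and> bmo_norm \<phi> <= C * paraproduct_norm (%_. 1) \<phi>"
  if "\<phi> \<in> L2_0" "no_full_side \<phi>" "paraproduct_bounded (%_. 1) \<phi>" for \<phi> :: "real ^ 'n => complex"
  using bmo_of_paraproduct[OF that] mult_const_mono[OF _ C(5) paraproduct_norm_nonneg[OF that(3)]] unfolding A4_def by blast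
 show ?thesis
  by (rule exI[of _ C], intro conjI C(1) ballI impI allI iffI; (elim conjE)?) (use up up0 up1 low0 low1 in blast)+
qed

end
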